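(* For every $\epsilon>0$ there exists a sequence $\delta_m\to 0$ (as $m\to\infty$) such that the following holds. If for some positive integers $k,n$ an $(\alpha,\beta;k,n)$-map exists with $\alpha\ge\epsilon$ and $\beta\ge\epsilon$, then $$ k R_{Sam}(\alpha) + k\delta_k \le n R_{LP2}(\beta) + n\delta_n $$ and $$ k\left(1-h\left(\tfrac{\alpha}{2}\right)\right) + k\delta_k \le n\left(1-h\left(\tfrac{\beta}{2}\right)\right) + n\delta_n. $$
   Context: For $z\in\mathbb{F}_2^m$, $|z|$ denotes the Hamming weight (number of nonzero coordinates). A map $f:\mathbb{F}_2^k\to\mathbb{F}_2^n$ is an $(\alpha,\beta;k,n)$-map if $\alpha k$ and $\beta n$ are integers and for all $x,x'\in\mathbb{F}_2^k$ either $|f(x)-f(x')|>\beta n$ or $|x-x'|\le \alpha k$. $h(x)=-x\log_2 x-(1-x)\log_2(1-x)$ is the binary entropy function. $R_{LP1}(\delta)=h(1/2-\sqrt{\delta(1-\delta)})$. $R_{LP2}(\delta)=0$ for $\delta\ge 1/2$, and for $\delta<1/2$, $R_{LP2}(\delta)=\min(1-h(a)+h(b))$, the minimum over all $0\le b\le a\le 1/2$ satisfying $2\frac{a(1-a)-b(1-b)}{1+2\sqrt{b(1-b)}}\le\delta$. $R_{Sam}(\alpha)=\frac12\max\left(1-h(\alpha)+R_{LP1}(\alpha),\ h(1-2\sqrt{\alpha(1-\alpha)})\right)$ for $\alpha<1/2$ and $R_{Sam}(\alpha)=0$ otherwise.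
   Formalization: The error terms kδ_k and nδ_n use two separate null sequences (with one common sequence the bounds fail, e.g. for a (1/2,2/3;2,3)-map), and α≤1 is assumed (for α>1 the map condition is void and the second bound fails). *)

theory Defs
  imports Complex_Main "HOL-Library.Z2" "Jordan_Normal_Form.Matrix"
begin

text \<open>The space $\mathbb{F}_2^m$ is \<open>carrier_vec m :: bit vec set\<close>, so that \<open>m\<close> can be quantified
  inside a formula.\<close>

definition hamming_weight :: "bit vec \<Rightarrow> nat" where
  "hamming_weight z = card {i. i < dim_vec z \<and> z $ i \<noteq> 0}"

definition alpha_beta_map ::
  "real \<Rightarrow> real \<Rightarrow> nat \<Rightarrow> nat \<Rightarrow> (bit vec \<Rightarrow> bit vec) \<Rightarrow> bool" where
  "alpha_beta_map \<alpha> \<beta> k n f \<longleftrightarrow>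
     f \<in> carrier_vec k \<rightarrow> carrier_vec n \<and>
     \<alpha> * real k \<in> \<int> \<and> \<beta> * real n \<in> \<int> \<and>
     (\<forall>x \<in> carrier_vec k. \<forall>x' \<in> carrier_vec k.
        real (hamming_weight (f x - f x')) > \<beta> * real n \<or>
        real (hamming_weight (x - x')) \<le> \<alpha> * real k)"

text \<open>Since \<open>log 2 0 = 0\<close>, this gives \<open>0\<close> at \<open>0\<close> and \<open>1\<close>, the usual continuous extension.\<close>

definition bin_entropy :: "real \<Rightarrow> real" where
  "bin_entropy x = - x * log 2 x - (1 - x) * log 2 (1 - x)"

definition R_LP1 :: "real \<Rightarrow> real" where
  "R_LP1 \<delta> = bin_entropy (1/2 - sqrt (\<delta> * (1 - \<delta>)))"

text \<open>For \<open>\<delta> \<ge> 0\<close> the infimum below is a minimum: the objective is continuous, and the feasible set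
  is compact and contains all pairs \<open>a = b\<close>.\<close>

definition R_LP2 :: "real \<Rightarrow> real" where
  "R_LP2 \<delta> =
     (if \<delta> \<ge> 1/2 then 0
      else Inf {1 - bin_entropy a + bin_entropy b | a b.
             0 \<le> b \<and> b \<le> a \<and> a \<le> 1/2 \<and>
             2 * ((a * (1 - a) - b * (1 - b)) / (1 + 2 * sqrt (b * (1 - b)))) \<le> \<delta>})"

definition R_Sam :: "real \<Rightarrow> real" where
  "R_Sam \<alpha> =
     (if \<alpha> < 1/2
      then 1/2 * max (1 - bin_entropy \<alpha> + R_LP1 \<alpha>)
                     (bin_entropy (1 - 2 * sqrt (\<alpha> * (1 - \<alpha>))))
      else 0)"

text \<open>
  Two conventions for the bounds on these maps.

  \<^item> The error terms \<open>k \<delta>\<^sub>k\<close> and \<open>n \<delta>\<^sub>n\<close> stand for \<open>o(k)\<close> and \<open>o(n)\<close> and get separate null sequences.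
    With a single sequence \<open>\<delta>\<close> on both sides the bounds fail for every \<open>\<epsilon> \<le> 1/2\<close>: the zero maps with
    \<open>\<alpha> = \<beta> = 1\<close> force \<open>k * \<delta> k = n * \<delta> n\<close> for all \<open>k, n > 0\<close>, so the error terms cancel. But a
    $(1/2, 2/3; 2, 3)$-map exists (antipodal pairs to antipodal pairs), whereas
    \<open>2 * (1 - bin_entropy (1/4)) > 3 * (1 - bin_entropy (1/3))\<close>, that is, $3^9 > 2^{14}$.

  \<^item> \<open>\<alpha>\<close> is a relative distance, so \<open>\<alpha> \<le> 1\<close>. For \<open>\<alpha> > 1\<close> the condition on the map is void and the
    second bound fails (\<open>\<alpha> = 3/2\<close>, \<open>\<beta> = 1\<close>, \<open>k = n\<close>).
\<close>

end

theory Submission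
  imports Defs "HOL-Analysis.L2_Norm" "HOL-Analysis.Function_Topology"
    "HOL-Analysis.Harmonic_Numbers" "HOL-Real_Asymp.Real_Asymp" "HOL-Computational_Algebra.Polynomial"
begin

text \<open>
  Call a kernel \<open>K\<close> on $\mathbb{F}_2^n$ good if \<open>K - J\<close> is positive semidefinite, \<open>J\<close> being the all-ones
  kernel, and \<open>K\<close> is nonpositive at distances above \<open>\<beta> n\<close>. An $(\alpha,\beta;k,n)$-map pulls good kernels back
  to kernels on $\mathbb{F}_2^k$ that are nonpositive at distances above \<open>\<alpha> k\<close>. Pairing the pullback with a feasible
  solution of Delsarte's linear program for distance above \<open>\<alpha> k\<close> shows that the value of this solution is at most
  the largest diagonal entry of \<open>K\<close>. The first bound follows from three constructions.

  \<^item> For \<open>R_LP2\<close>, restrict to the vectors of weight \<open>w \<approx> a n\<close> and take \<open>(t - \<tau>) F(t)\<^sup>2\<close> as a function of the size \<open>t\<close> of the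
    intersection, where \<open>F\<close> is a positive combination of Hahn polynomials of degree close to \<open>b n\<close> such that
    \<open>(t - \<tau>) F\<close> is one as well. Then average over all translates.

  \<^item> For the first term of \<open>R_Sam\<close>, give equal weight to all distances above \<open>\<alpha> k\<close> and additional weight to a
    single even one, as in Samorodnitsky's work.

  \<^item> For the second term of \<open>R_Sam\<close>, use a positive quadrature formula for the binomial distribution whose
    nodes are the even integers between \<open>\<alpha> k\<close> and \<open>(1 - \<alpha>) k\<close>.

  For the second bound, the preimage of a translate of the sphere of radius \<open>\<beta> n / 2\<close> has diameter at most
  \<open>\<alpha> k\<close>. A rank argument bounds its size by twice that of a ball of radius \<open>\<alpha> k / 2\<close>; then average over
  all translates.
\<close>

section \<open>Krawtchouk polynomials\<close>

text \<open>The null sequences may not depend on \<alpha> and \<beta>, so every estimate below is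
  uniform in the parameters. The main obstacle is the quadrature. By duality it exists once every
  polynomial of degree at most \<open>2 * m\<close> that is nonnegative on the nodes has nonnegative
  binomial mean. The extreme such polynomials have all their zeros at nodes, and their signs force
  the zeros into adjacent pairs \<open>t\<close>, \<open>t + 2\<close>, possibly together with both
  end nodes. So the mean of \<open>f(s) * f(s + 2)\<close> has to be estimated. Parseval turns it
  into a form dominated by its leading part as long as the degree stays below about
  \<open>n / 8\<close>. That is enough: whenever a larger degree would be called for, the first term
  of \<open>R_Sam\<close> is the larger one. The nodes are even because then the transform of the
  weights is symmetric in the degree, so exactness in the low degrees also controls the high ones.
  The constraint in \<open>R_LP2\<close> is the upper spectral edge of the Jacobi matrix of the Hahn
  polynomials, written as a distance.\<close>

definition sd :: "'a set \<Rightarrow> 'a set \<Rightarrow> 'a set" where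
  "sd x y = (x - y) \<union> (y - x)"

text \<open>The character of the cube indexed by \<open>u\<close>, with vectors replaced by their
  supports.\<close>

definition chi :: "'a set \<Rightarrow> 'a set \<Rightarrow> real" where
  "chi u x = (\<Prod>i\<in>u. if i \<in> x then -1 else 1)"

text \<open>The Krawtchouk polynomial of degree \<open>s\<close> at \<open>x\<close>. The generating
  function serves as the definition because the three-term recurrence and the passage from
  \<open>n\<close> to \<open>n + 1\<close> are read off from it.\<close>

definition kraw :: "nat \<Rightarrow> nat \<Rightarrow> nat \<Rightarrow> real" where
  "kraw n s x = coeff ([:1, -1:] ^ x * [:1, 1:] ^ (n - x)) s"

definition level :: "nat \<Rightarrow> nat \<Rightarrow> nat set set" where
  "level n s = {y \<in> Pow {..<n}. card y = s}"

lemma sd_simps [simp]: "sd x {} = x" "sd {} x = x" "sd x x = {}" "sd x (sd x y) = y"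
    "sd (sd x y) y = x"
  by (auto simp: sd_def)

lemma sd_commute: "sd x y = sd y x"
  by (auto simp: sd_def)

lemma sd_sd_cancel: "sd (sd x u) (sd y u) = sd x y"
  by (auto simp: sd_def)

lemma sd_eq_empty_iff [simp]: "sd x y = {} \<longleftrightarrow> x = y"
  by (auto simp: sd_def)

lemma sd_in_Pow [simp]: "x \<in> Pow A \<Longrightarrow> y \<in> Pow A \<Longrightarrow> sd x y \<in> Pow A"
  by (auto simp: sd_def)

lemma bij_betw_sd: "u \<in> Pow A \<Longrightarrow> bij_betw (\<lambda>x. sd x u) (Pow A) (Pow A)"
  by (rule bij_betw_byWitness[where f' = "\<lambda>x. sd x u"]) (auto simp: sd_def)

lemma sum_sd: "u \<in> Pow A \<Longrightarrow> (\<Sum>x\<in>Pow A. f (sd x u)) = (\<Sum>x\<in>Pow A. f x)"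
  by (rule sum.reindex_bij_betw[OF bij_betw_sd])

lemma card_level: "card (level n s) = n choose s"
  unfolding level_def using n_subsets[of "{..<n}" s] by simp

lemma finite_level [simp]: "finite (level n s)"
  by (simp add: level_def)

lemma chi_sd: "chi u (sd x y) = chi u x * chi u y"
  unfolding chi_def prod.distrib[symmetric] by (rule prod.cong) (auto simp: sd_def)

lemma chi_empty [simp]: "chi {} x = 1" "chi u {} = 1"
  by (auto simp: chi_def)

lemma chi_commute:
  assumes "finite u" "finite x"
  shows "chi u x = chi x u"
proof -
  have "chi u x = (\<Prod>i\<in>u \<inter> x. -1)" if "finite u" for u x :: "'a set"
    unfolding chi_def using that by (subst prod.inter_restrict) (auto intro: prod.cong)
  from this[of u x] this[of x u] show ?thesis using assms by (simp add: Int_commute)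
qed

lemma sum_Pow_prod:
  fixes f :: "'a \<Rightarrow> 'b::comm_semiring_1"
  assumes "finite A"
  shows "(\<Sum>u\<in>Pow A. \<Prod>i\<in>u. f i) = (\<Prod>i\<in>A. f i + 1)"
  using prod_add[OF assms, of f "\<lambda>_. 1"] by simp

lemma sum_chi:
  assumes "z \<in> Pow {..<n::nat}"
  shows "(\<Sum>u\<in>Pow {..<n}. chi u z) = (if z = {} then 2 ^ n else 0)"
proof -
  have "(\<Sum>u\<in>Pow {..<n}. chi u z) = (\<Prod>i<n. (if i \<in> z then -1 else 1) + (1::real))"
    unfolding chi_def by (rule sum_Pow_prod) simp
  also have "\<dots> = (if z = {} then 2 ^ n else 0)"
    using assms by (auto simp: prod_zero_iff)
  finally show ?thesis .
qed

text \<open>If \<open>y\<close> is weighted by a formal variable z to the power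
  \<open>card y\<close>, the character sum over all \<open>y\<close> factors over the coordinates: 1
  - z for the elements of \<open>u\<close> and 1 + z for the others.\<close>

lemma kraw_eq_sum_chi:
  assumes "u \<in> Pow {..<n}"
  shows "kraw n s (card u) = (\<Sum>y\<in>level n s. chi u y)"
proof -
  have fu: "finite u" using assms finite_subset by auto
  have fin: "finite y" if "y \<in> Pow {..<n}" for y using that finite_subset by auto
  let ?f = "\<lambda>i. if i \<in> u then monom (-1) 1 else monom 1 1 :: real poly"
  have m: "(\<Prod>i\<in>y. ?f i) = monom (chi y u) (card y)" if "finite y" for y
    using that unfolding chi_def by induction (auto simp: mult_monom)
  have "(\<Sum>y\<in>Pow {..<n}. monom (chi u y) (card y)) = (\<Sum>y\<in>Pow {..<n}. \<Prod>i\<in>y. ?f i)"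
    using fin m chi_commute[OF fu] by (intro sum.cong) auto
  also have "\<dots> = (\<Prod>i<n. ?f i + 1)" by (rule sum_Pow_prod) simp
  also have "\<dots> = (\<Prod>i\<in>u. ?f i + 1) * (\<Prod>i\<in>{..<n} - u. ?f i + 1)"
    using assms by (intro prod.subset_diff[where B = u, THEN trans] mult.commute) auto
  also have "(\<Prod>i\<in>u. ?f i + 1) = (\<Prod>i\<in>u. [:1, -1:])"
    by (intro prod.cong) (auto simp: monom_altdef one_pCons)
  also have "(\<Prod>i\<in>{..<n} - u. ?f i + 1) = (\<Prod>i\<in>{..<n} - u. [:1, 1:])"
    by (intro prod.cong) (auto simp: monom_altdef one_pCons)
  also have "card ({..<n} - u) = n - card u"
    using assms fu by (subst card_Diff_subset) auto
  hence "(\<Prod>i\<in>u. [:1, -1:]) * (\<Prod>i\<in>{..<n} - u. [:1, 1:]) = [:1, -1:] ^ card u * [:1, 1::real:] ^ (n - card u)"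
    by simp
  finally have "kraw n s (card u) = coeff (\<Sum>y\<in>Pow {..<n}. monom (chi u y) (card y)) s"
    unfolding kraw_def by simp
  also have "\<dots> = (\<Sum>y\<in>Pow {..<n}. coeff (monom (chi u y) (card y)) s)"
    by (rule coeff_sum)
  also have "\<dots> = (\<Sum>y\<in>Pow {..<n}. if card y = s then chi u y else 0)"
    by (intro sum.cong) auto
  also have "\<dots> = (\<Sum>y\<in>level n s. chi u y)"
    unfolding level_def by (rule sum.inter_filter[symmetric]) simp
  finally show ?thesis .
qed

lemma sum_Pow_card:
  "(\<Sum>y\<in>Pow {..<n}. f (card y) * g y) = (\<Sum>s\<le>n. f s * (\<Sum>y\<in>level n s. g y :: real))"
proof -
  have "(\<Sum>y\<in>Pow {..<n}. f (card y) * g y) =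
      (\<Sum>s\<le>n. \<Sum>y\<in>{y \<in> Pow {..<n}. card y = s}. f (card y) * g y)"
    by (rule sum.group[symmetric]) (auto intro!: card_mono[of "{..<n}", simplified])
  also have "\<dots> = (\<Sum>s\<le>n. \<Sum>y\<in>level n s. f s * g y)"
    unfolding level_def by (intro sum.cong) auto
  finally show ?thesis by (simp add: sum_distrib_left)
qed

lemma sum_card_level: "(\<Sum>y\<in>Pow {..<n}. f (card y)) = (\<Sum>s\<le>n. real (n choose s) * f s)"
  using sum_Pow_card[of f "\<lambda>_. 1" n] by (simp add: card_level mult.commute)

lemma ex_subset_card: "x \<le> n \<Longrightarrow> \<exists>u\<in>Pow {..<n::nat}. card u = x"
  by (rule bexI[of _ "{..<x}"]) auto

text \<open>Both sides sum \<open>chi u y\<close> over the same pair of levels.\<close>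

lemma kraw_sym:
  assumes "x \<le> n" "s \<le> n"
  shows "real (n choose x) * kraw n s x = real (n choose s) * kraw n x s"
proof -
  have *: "real (n choose x) * kraw n s x = (\<Sum>u\<in>level n x. \<Sum>y\<in>level n s. chi u y)" for x s
  proof -
    have "(\<Sum>u\<in>level n x. \<Sum>y\<in>level n s. chi u y) = (\<Sum>u\<in>level n x. kraw n s x)"
      by (intro sum.cong) (auto simp: level_def kraw_eq_sum_chi)
    thus ?thesis by (simp add: card_level)
  qed
  have "(\<Sum>u\<in>level n x. \<Sum>y\<in>level n s. chi u y) = (\<Sum>y\<in>level n s. \<Sum>u\<in>level n x. chi y u)"
    by (subst sum.swap) (auto simp: level_def intro!: sum.cong chi_commute intro: finite_subset)
  thus ?thesis by (simp only: *)
qed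

text \<open>Orthogonality of characters, summed over two levels: only pairs with empty symmetric
  difference survive.\<close>

lemma kraw_orthogonal:
  "(\<Sum>x\<le>n. real (n choose x) * (kraw n s x * kraw n t x)) = (if s = t then 2 ^ n * real (n choose s) else 0)"
proof -
  have "(\<Sum>x\<le>n. real (n choose x) * (kraw n s x * kraw n t x)) =
      (\<Sum>u\<in>Pow {..<n}. kraw n s (card u) * kraw n t (card u))"
    by (rule sum_card_level[symmetric])
  also have "\<dots> = (\<Sum>u\<in>Pow {..<n}. \<Sum>y\<in>level n s. \<Sum>z\<in>level n t. chi u (sd y z))"
    by (intro sum.cong) (auto simp: kraw_eq_sum_chi sum_product chi_sd)
  also have "\<dots> = (\<Sum>y\<in>level n s. \<Sum>z\<in>level n t. \<Sum>u\<in>Pow {..<n}. chi u (sd y z))"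
    by (rule trans[OF sum.swap], rule sum.cong[OF refl], rule sum.swap)
  also have "\<dots> = (\<Sum>y\<in>level n s. \<Sum>z\<in>level n t. if y = z then 2 ^ n else 0)"
  proof (intro sum.cong refl)
    fix y z assume "y \<in> level n s" "z \<in> level n t"
    hence "sd y z \<in> Pow {..<n}" by (intro sd_in_Pow) (auto simp: level_def)
    thus "(\<Sum>u\<in>Pow {..<n}. chi u (sd y z)) = (if y = z then 2 ^ n else 0)"
      by (subst sum_chi) auto
  qed
  also have "\<dots> = (\<Sum>y\<in>level n s. if s = t then 2 ^ n else 0)"
    by (intro sum.cong refl, subst sum.delta') (auto simp: level_def)
  finally show ?thesis by (simp add: card_level)
qed

lemma kraw_0_left [simp]: "kraw n 0 x = 1"
  by (simp add: kraw_def coeff_mult coeff_0_power)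

lemma kraw_0_right: "kraw n s 0 = real (n choose s)"
  using kraw_eq_sum_chi[of "{}" n s] by (simp add: card_level)

lemma kraw_greater: 
  assumes "x \<le> n" "n < s"
  shows "kraw n s x = 0"
proof -
  have "card (level n s) = 0" using assms by (simp add: card_level)
  hence "level n s = {}" by simp
  moreover obtain u where "u \<in> Pow {..<n}" "card u = x" using ex_subset_card[OF assms(1)] by auto
  ultimately show ?thesis using kraw_eq_sum_chi[of u n s] by simp
qed

lemma sum_kraw:
  assumes "x \<le> n"
  shows "(\<Sum>s\<le>n. kraw n s x) = (if x = 0 then 2 ^ n else 0)"
proof -
  obtain u where u: "u \<in> Pow {..<n}" "card u = x" using ex_subset_card[OF assms] by auto
  have fu: "finite u" using u finite_subset by auto
  have "(\<Sum>s\<le>n. kraw n s x) = (\<Sum>y\<in>Pow {..<n}. chi u y)"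
    using sum_Pow_card[of "\<lambda>_. 1" "chi u" n] u kraw_eq_sum_chi[OF u(1)] by simp
  also have "\<dots> = (\<Sum>y\<in>Pow {..<n}. chi y u)"
    using fu by (intro sum.cong chi_commute) (auto intro: finite_subset)
  also have "\<dots> = (if x = 0 then 2 ^ n else 0)" using u fu by (subst sum_chi) auto
  finally show ?thesis .
qed

lemma kraw_reflect_right:
  assumes "x \<le> n"
  shows "kraw n s (n - x) = (-1) ^ s * kraw n s x"
proof -
  obtain u where u: "u \<in> Pow {..<n}" "card u = x" using ex_subset_card[OF assms] by auto
  have fu: "finite u" using u finite_subset by auto
  let ?c = "{..<n} - u"
  have c: "?c \<in> Pow {..<n}" "card ?c = n - x"
    using u fu by (auto simp: card_Diff_subset)
  have "kraw n s (n - x) = (\<Sum>y\<in>level n s. chi ?c y)"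
    using kraw_eq_sum_chi[OF c(1)] c(2) by simp
  also have "\<dots> = (\<Sum>y\<in>level n s. (-1) ^ s * chi u y)"
  proof (intro sum.cong refl)
    fix y assume y: "y \<in> level n s"
    hence fy: "finite y" by (auto simp: level_def intro: finite_subset)
    have "chi ?c y = chi y ?c" "chi u y = chi y u" using fu fy by (auto intro!: chi_commute)
    moreover have "chi y ?c = (\<Prod>i\<in>y. - 1 * (if i \<in> u then - 1 else 1))"
      unfolding chi_def using y by (intro prod.cong) (auto simp: level_def)
    moreover have "\<dots> = (-1) ^ s * chi y u"
      unfolding chi_def prod.distrib using y by (simp add: level_def)
    ultimately show "chi ?c y = (-1) ^ s * chi u y" by simp
  qed
  finally show ?thesis using kraw_eq_sum_chi[OF u(1)] u(2) by (simp add: sum_distrib_left)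
qed

lemma kraw_reflect_left:
  assumes "x \<le> n" "s \<le> n"
  shows "kraw n (n - s) x = (-1) ^ x * kraw n s x"
proof -
  have "real (n choose x) * kraw n (n - s) x = real (n choose s) * kraw n x (n - s)"
    using kraw_sym[of x n "n - s"] assms unfolding binomial_symmetric[OF assms(2)] by simp
  also have "\<dots> = (-1) ^ x * (real (n choose x) * kraw n s x)"
    using kraw_sym[OF assms] by (simp add: kraw_reflect_right assms)
  finally show ?thesis using assms by simp
qed

text \<open>The generating function P satisfies the differential equation (1 - z^2) P' = (n - 2 x -
  n z) P; compare the coefficients of z^s.\<close>

lemma kraw_three_term:
  assumes "x \<le> n"
  shows "real (s + 1) * kraw n (s + 1) x =
    (real n - 2 * real x) * kraw n s x - (if s = 0 then 0 else (real n - real s + 1) * kraw n (s - 1) x)"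
proof -
  have ring: "(a * b) * (A * B' + B * A') = (c * b + d * a) * (A * B)"
    if "a * A' = c * A" "b * B' = d * B" for a b A B A' B' c d :: "real poly"
  proof -
    have "(a * b) * (A * B' + B * A') = (a * A) * (b * B') + (b * B) * (a * A')"
      by (simp only: distrib_left mult.assoc mult.left_commute mult.commute)
    also have "\<dots> = (c * b + d * a) * (A * B)"
      unfolding that by (simp add: algebra_simps)
    finally show ?thesis .
  qed
  define P where "P = [:1, -1:] ^ x * [:1, 1::real:] ^ (n - x)"
  have d: "[:1, e:] * pderiv ([:1, e:] ^ y) = [:e * real y:] * [:1, e::real:] ^ y" for e y
  proof (cases y)
    case (Suc z)
    have "pderiv ([:1, e:] ^ Suc z) = smult (e * real (Suc z)) ([:1, e:] ^ z)"
      by (simp add: pderiv_power_Suc pderiv_pCons del: power_Suc of_nat_Suc)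
    thus ?thesis using Suc by simp
  qed simp
  have "[:1, 0, -1:] * pderiv P = ([:1, -1:] * [:1, 1:]) * pderiv P" by simp
  also have "\<dots> = ([:- 1 * real x:] * [:1, 1:] + [:1 * real (n - x):] * [:1, -1:]) * P"
    unfolding P_def pderiv_mult by (rule ring) (rule d)+
  also have "([:- 1 * real x:] * [:1, 1:] + [:1 * real (n - x):] * [:1, -1:]) = [:real n - 2 * real x, - real n:]"
    using assms by (simp add: of_nat_diff)
  finally have eq: "coeff ([:1, 0, -1:] * pderiv P) s = coeff ([:real n - 2 * real x, - real n:] * P) s"
    by simp
  have k: "coeff P s = kraw n s x" for s by (simp add: P_def kraw_def)
  show ?thesis
  proof (cases s)
    case 0
    with eq show ?thesis by (simp add: coeff_pderiv k)
  next
    case (Suc r)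
    have "coeff ([:1, 0, -1:] * pderiv P) (Suc r) = real (r + 2) * kraw n (r + 2) x - real r * kraw n r x"
      by (cases r) (simp_all add: coeff_pderiv k)
    moreover have "coeff ([:real n - 2 * real x, - real n:] * P) (Suc r) =
        (real n - 2 * real x) * kraw n (Suc r) x - real n * kraw n r x"
      by (simp add: k)
    ultimately have "real (r + 2) * kraw n (r + 2) x - real r * kraw n r x =
        (real n - 2 * real x) * kraw n (Suc r) x - real n * kraw n r x"
      using eq Suc by simp
    thus ?thesis by (simp add: Suc left_diff_distrib distrib_right)
  qed
qed

text \<open>A single term of the orthogonality relation for equal degrees is at most the whole
  sum.\<close>

lemma abs_kraw_le:
  assumes "x \<le> n"
  shows "\<bar>kraw n s x\<bar> \<le> sqrt (2 ^ n * real (n choose s) / real (n choose x))"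
proof (rule real_le_rsqrt)
  have "real (n choose x) * (kraw n s x)\<^sup>2 \<le> (\<Sum>x\<le>n. real (n choose x) * (kraw n s x * kraw n s x))"
    unfolding power2_eq_square by (rule member_le_sum) (use assms in auto)
  also have "\<dots> = 2 ^ n * real (n choose s)" by (simp add: kraw_orthogonal)
  finally show "\<bar>kraw n s x\<bar>\<^sup>2 \<le> 2 ^ n * real (n choose s) / real (n choose x)"
    using assms by (simp add: field_simps)
qed


section \<open>Homomorphisms and linear programming\<close>

text \<open>In \<open>primal_bound\<close>, \<open>W s\<close> is the weight of each single point at distance \<open>s\<close>, not of the whole sphere.\<close>

definition primal_bound :: "nat \<Rightarrow> nat \<Rightarrow> real \<Rightarrow> bool" where
  "primal_bound k d V \<longleftrightarrow> (\<exists>W :: nat \<Rightarrow> real. (\<forall>s. 0 \<le> W s) \<and> W 0 = 1 \<and>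
     (\<forall>s. 1 \<le> s \<and> s \<le> d \<longrightarrow> W s = 0) \<and>
     (\<forall>j\<le>k. 0 \<le> (\<Sum>s\<le>k. W s * kraw k s j)) \<and>
     V \<le> (\<Sum>s\<le>k. W s * real (k choose s)))"

definition dual_bound :: "nat \<Rightarrow> real \<Rightarrow> real \<Rightarrow> bool" where
  "dual_bound n D M \<longleftrightarrow> (\<exists>K :: nat set \<Rightarrow> nat set \<Rightarrow> real.
     (\<forall>y\<in>Pow {..<n}. \<forall>y'\<in>Pow {..<n}. D < real (card (sd y y')) \<longrightarrow> K y y' \<le> 0) \<and>
     (\<forall>y\<in>Pow {..<n}. K y y \<le> M) \<and>
     (\<forall>g. (\<Sum>y\<in>Pow {..<n}. g y)\<^sup>2 \<le> (\<Sum>y\<in>Pow {..<n}. \<Sum>y'\<in>Pow {..<n}. K y y' * g y * g y')))"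

lemma primal_bound_mono: "primal_bound k d V \<Longrightarrow> V' \<le> V \<Longrightarrow> primal_bound k d V'"
  unfolding primal_bound_def by (meson order_trans)

lemma dual_bound_mono:
  assumes "dual_bound n D M" "M \<le> M'"
  shows "dual_bound n D M'"
proof -
  obtain K where K: "\<forall>y\<in>Pow {..<n}. \<forall>y'\<in>Pow {..<n}. D < real (card (sd y y')) \<longrightarrow> K y y' \<le> 0"
      "\<forall>y\<in>Pow {..<n}. K y y \<le> M"
      "\<forall>g. (\<Sum>y\<in>Pow {..<n}. g y)\<^sup>2 \<le> (\<Sum>y\<in>Pow {..<n}. \<Sum>y'\<in>Pow {..<n}. K y y' * g y * g y')"
    using assms(1) unfolding dual_bound_def by auto
  have "\<forall>y\<in>Pow {..<n}. K y y \<le> M'" using K(2) assms(2) by (auto intro: order_trans)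
  with K(1,3) show ?thesis unfolding dual_bound_def by (intro exI[of _ K]) simp
qed

lemma primal_bound_1: "primal_bound k d 1"
  unfolding primal_bound_def
  by (rule exI[of _ "\<lambda>s. if s = 0 then 1 else 0"]) (auto simp: if_distrib[of "\<lambda>x. x * _"] cong: if_cong)

lemma Cauchy_Schwarz_sum:
  fixes f g :: "'a \<Rightarrow> real"
  shows "(\<Sum>i\<in>I. f i * g i)\<^sup>2 \<le> (\<Sum>i\<in>I. (f i)\<^sup>2) * (\<Sum>i\<in>I. (g i)\<^sup>2)"
proof -
  have "\<bar>\<Sum>i\<in>I. f i * g i\<bar> \<le> (\<Sum>i\<in>I. \<bar>f i\<bar> * \<bar>g i\<bar>)"
    using sum_abs[of "\<lambda>i. f i * g i" I] by (simp add: abs_mult)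
  also have "\<dots> \<le> L2_set f I * L2_set g I" by (rule L2_set_mult_ineq)
  finally have "\<bar>\<Sum>i\<in>I. f i * g i\<bar>\<^sup>2 \<le> (L2_set f I * L2_set g I)\<^sup>2" by (rule power_mono) simp
  also have "\<dots> = (\<Sum>i\<in>I. (f i)\<^sup>2) * (\<Sum>i\<in>I. (g i)\<^sup>2)"
    unfolding L2_set_def power_mult_distrib by (simp add: sum_nonneg)
  finally show ?thesis by simp
qed

text \<open>The kernel is a multiple of the identity, and its positivity condition is the
  Cauchy-Schwarz inequality. It is used where the wanted rate is 1 or more.\<close>

lemma dual_bound_trivial:
  assumes "0 \<le> D"
  shows "dual_bound n D (2 ^ n)"
  unfolding dual_bound_def
proof (intro exI[of _ "\<lambda>y y'. if y = y' then 2 ^ n else 0"] conjI allI ballI impI)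
  fix g :: "nat set \<Rightarrow> real"
  have "(\<Sum>y\<in>Pow {..<n}. g y)\<^sup>2 \<le> real (card (Pow {..<n})) * (\<Sum>y\<in>Pow {..<n}. (g y)\<^sup>2)"
    using Cauchy_Schwarz_sum[of "\<lambda>_. 1" g "Pow {..<n}"] by simp
  also have "\<dots> = (\<Sum>y\<in>Pow {..<n}. \<Sum>y'\<in>Pow {..<n}. (if y = y' then 2 ^ n else 0) * g y * g y')"
    by (simp add: card_Pow sum_distrib_left if_distrib[of "\<lambda>x. x * _"] power2_eq_square mult.assoc cong: if_cong)
  finally show "(\<Sum>y\<in>Pow {..<n}. g y)\<^sup>2 \<le>
    (\<Sum>y\<in>Pow {..<n}. \<Sum>y'\<in>Pow {..<n}. (if y = y' then 2 ^ n else 0) * g y * g y')" .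
qed (use assms in auto)

text \<open>Push the coefficients \<open>c\<close> forward along \<open>\<phi>\<close>, that is, sum
  them over the fibres, and apply the condition on \<open>K\<close> to the result.\<close>

lemma kernel_pullback:
  fixes K :: "'b \<Rightarrow> 'b \<Rightarrow> real"
  assumes "finite X" "finite Y" "\<phi> \<in> X \<rightarrow> Y"
    and K: "\<And>g. (\<Sum>y\<in>Y. g y)\<^sup>2 \<le> (\<Sum>y\<in>Y. \<Sum>y'\<in>Y. K y y' * g y * g y')"
  shows "(\<Sum>x\<in>X. c x)\<^sup>2 \<le> (\<Sum>x\<in>X. \<Sum>x'\<in>X. K (\<phi> x) (\<phi> x') * c x * c x')"
proof -
  define g where "g y = (\<Sum>x\<in>{x\<in>X. \<phi> x = y}. c x)" for y
  have grp: "(\<Sum>y\<in>Y. h y * g y) = (\<Sum>x\<in>X. h (\<phi> x) * c x)" for h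
  proof -
    have "(\<Sum>y\<in>Y. h y * g y) = (\<Sum>y\<in>Y. \<Sum>x\<in>{x\<in>X. \<phi> x = y}. h (\<phi> x) * c x)"
      unfolding g_def sum_distrib_left by (intro sum.cong) auto
    also have "\<dots> = (\<Sum>x\<in>X. h (\<phi> x) * c x)"
      by (rule sum.group) (use assms in auto)
    finally show ?thesis .
  qed
  have "(\<Sum>y\<in>Y. \<Sum>y'\<in>Y. K y y' * g y * g y') = (\<Sum>y\<in>Y. (\<Sum>y'\<in>Y. K y y' * g y') * g y)"
    by (simp add: sum_distrib_right sum_distrib_left mult_ac)
  also have "\<dots> = (\<Sum>y\<in>Y. (\<Sum>x'\<in>X. K y (\<phi> x') * c x') * g y)"
    by (simp add: grp)
  also have "\<dots> = (\<Sum>x\<in>X. (\<Sum>x'\<in>X. K (\<phi> x) (\<phi> x') * c x') * c x)"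
    by (rule grp)
  also have "\<dots> = (\<Sum>x\<in>X. \<Sum>x'\<in>X. K (\<phi> x) (\<phi> x') * c x * c x')"
    by (simp add: sum_distrib_right sum_distrib_left mult_ac)
  finally show ?thesis using K[of g] grp[of "\<lambda>_. 1"] by simp
qed

lemma fourier_inversion:
  assumes "z \<in> Pow {..<k}"
  shows "(\<Sum>u\<in>Pow {..<k}. (\<Sum>s\<le>k. W s * kraw k s (card u)) * chi u z) = 2 ^ k * W (card z)"
proof -
  have "(\<Sum>u\<in>Pow {..<k}. (\<Sum>s\<le>k. W s * kraw k s (card u)) * chi u z) =
      (\<Sum>u\<in>Pow {..<k}. (\<Sum>y\<in>Pow {..<k}. W (card y) * chi u y) * chi u z)"
    by (intro sum.cong) (auto simp: sum_Pow_card kraw_eq_sum_chi)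
  also have "\<dots> = (\<Sum>u\<in>Pow {..<k}. \<Sum>y\<in>Pow {..<k}. W (card y) * chi u (sd y z))"
    by (simp add: sum_distrib_right chi_sd mult.assoc)
  also have "\<dots> = (\<Sum>y\<in>Pow {..<k}. W (card y) * (\<Sum>u\<in>Pow {..<k}. chi u (sd y z)))"
    unfolding sum_distrib_left by (rule sum.swap)
  also have "\<dots> = (\<Sum>y\<in>Pow {..<k}. W (card y) * (if y = z then 2 ^ k else 0))"
  proof (rule sum.cong[OF refl])
    fix y assume "y \<in> Pow {..<k}"
    hence "sd y z \<in> Pow {..<k}" using assms by (rule sd_in_Pow)
    thus "W (card y) * (\<Sum>u\<in>Pow {..<k}. chi u (sd y z)) = W (card y) * (if y = z then 2 ^ k else 0)"
      by (simp add: sum_chi)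
  qed
  also have "\<dots> = 2 ^ k * W (card z)"
    using assms by (simp add: if_distrib[of "\<lambda>x. _ * x"] cong: if_cong)
  finally show ?thesis .
qed

text \<open>Weak duality for the sum \<open>S\<close> of the weight of the distance times the
  pulled-back kernel. Off the diagonal either the weight vanishes or the kernel is nonpositive, so
  \<open>S\<close> is at most \<open>2 ^ k * M\<close>. Expanding the weight in characters, with the
  nonnegative coefficients \<open>What\<close>, and keeping only the trivial character bounds
  \<open>S\<close> from below.\<close>

lemma primal_le_dual:
  assumes "primal_bound k d V" "dual_bound n D M"
    and \<phi>: "\<phi> \<in> Pow {..<k} \<rightarrow> Pow {..<n}"
    and hom: "\<And>x x'. x \<in> Pow {..<k} \<Longrightarrow> x' \<in> Pow {..<k} \<Longrightarrow>
      D < real (card (sd (\<phi> x) (\<phi> x'))) \<or> card (sd x x') \<le> d"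
  shows "V \<le> M"
proof -
  let ?X = "Pow {..<k}"
  obtain W :: "nat \<Rightarrow> real" where W: "\<And>s. 0 \<le> W s" "W 0 = 1" "\<And>s. 1 \<le> s \<Longrightarrow> s \<le> d \<Longrightarrow> W s = 0"
      "\<And>j. j \<le> k \<Longrightarrow> 0 \<le> (\<Sum>s\<le>k. W s * kraw k s j)" "V \<le> (\<Sum>s\<le>k. W s * real (k choose s))"
    using assms(1) unfolding primal_bound_def by auto
  obtain K where K': "\<forall>y\<in>Pow {..<n}. \<forall>y'\<in>Pow {..<n}. D < real (card (sd y y')) \<longrightarrow> K y y' \<le> 0"
      "\<forall>y\<in>Pow {..<n}. K y y \<le> M"
      "\<forall>g. (\<Sum>y\<in>Pow {..<n}. g y)\<^sup>2 \<le> (\<Sum>y\<in>Pow {..<n}. \<Sum>y'\<in>Pow {..<n}. K y y' * g y * g y')"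
    using assms(2) unfolding dual_bound_def by auto
  note K = K'(1)[rule_format] K'(2)[rule_format] K'(3)[rule_format]
  define \<kappa> where "\<kappa> x x' = K (\<phi> x) (\<phi> x')" for x x'
  define What where "What j = (\<Sum>s\<le>k. W s * kraw k s j)" for j
  have pos: "(\<Sum>x\<in>?X. c x)\<^sup>2 \<le> (\<Sum>x\<in>?X. \<Sum>x'\<in>?X. \<kappa> x x' * c x * c x')" for c
    unfolding \<kappa>_def by (rule kernel_pullback[OF _ _ \<phi> K(3)]) auto
  define S where "S = (\<Sum>x\<in>?X. \<Sum>x'\<in>?X. W (card (sd x x')) * \<kappa> x x')"
  have "S \<le> (\<Sum>x\<in>?X. \<Sum>x'\<in>?X. if x' = x then M else 0)"
    unfolding S_def
  proof (intro sum_mono)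
    fix x x' assume x: "x \<in> ?X" "x' \<in> ?X"
    hence \<phi>x: "\<phi> x \<in> Pow {..<n}" "\<phi> x' \<in> Pow {..<n}" using \<phi> by auto
    show "W (card (sd x x')) * \<kappa> x x' \<le> (if x' = x then M else 0)"
    proof (cases "x' = x")
      case True
      thus ?thesis using K(2)[OF \<phi>x(1)] W(2) by (simp add: \<kappa>_def)
    next
      case False
      have "finite (sd x x')" using sd_in_Pow[OF x] finite_subset by auto
      hence "card (sd x x') \<noteq> 0" using False by auto
      hence "W (card (sd x x')) = 0 \<or> \<kappa> x x' \<le> 0"
        using hom[OF x] W(3) K(1)[OF \<phi>x] unfolding \<kappa>_def by force
      thus ?thesis using False W(1) by (auto simp: mult_nonneg_nonpos)
    qed
  qed
  also have "\<dots> = 2 ^ k * M" by (simp add: card_Pow)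
  finally have upper: "S \<le> 2 ^ k * M" .
  have "2 ^ k * S = (\<Sum>x\<in>?X. \<Sum>x'\<in>?X. (2 ^ k * W (card (sd x x'))) * \<kappa> x x')"
    unfolding S_def by (simp add: sum_distrib_left mult.assoc)
  also have "\<dots> = (\<Sum>x\<in>?X. \<Sum>x'\<in>?X. (\<Sum>u\<in>?X. What (card u) * chi u (sd x x')) * \<kappa> x x')"
    unfolding What_def by (intro sum.cong refl) (subst fourier_inversion[OF sd_in_Pow]; simp)
  also have "\<dots> = (\<Sum>x\<in>?X. \<Sum>u\<in>?X. \<Sum>x'\<in>?X. What (card u) * (\<kappa> x x' * chi u x * chi u x'))"
    unfolding sum_distrib_right by (rule sum.cong[OF refl], rule trans[OF sum.swap]) (simp add: chi_sd mult_ac)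
  also have "\<dots> = (\<Sum>u\<in>?X. What (card u) * (\<Sum>x\<in>?X. \<Sum>x'\<in>?X. \<kappa> x x' * chi u x * chi u x'))"
    unfolding sum_distrib_left by (rule sum.swap)
  also have "\<dots> \<ge> (\<Sum>u\<in>{{}}. What (card u) * (\<Sum>x\<in>?X. \<Sum>x'\<in>?X. \<kappa> x x' * chi u x * chi u x'))"
  proof (rule sum_mono2)
    fix u assume "u \<in> ?X - {{}}"
    hence "card u \<le> k" using card_mono[of "{..<k}" u] by auto
    hence "0 \<le> What (card u)" unfolding What_def by (rule W(4))
    moreover have "0 \<le> (\<Sum>x\<in>?X. \<Sum>x'\<in>?X. \<kappa> x x' * chi u x * chi u x')"
      using pos[of "chi u"] by (meson order_trans zero_le_power2)
    ultimately show "0 \<le> What (card u) * (\<Sum>x\<in>?X. \<Sum>x'\<in>?X. \<kappa> x x' * chi u x * chi u x')" by simp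
  qed auto
  finally have "What 0 * (\<Sum>x\<in>?X. \<Sum>x'\<in>?X. \<kappa> x x') \<le> 2 ^ k * S" by simp
  moreover have "What 0 * (2 ^ k)\<^sup>2 \<le> What 0 * (\<Sum>x\<in>?X. \<Sum>x'\<in>?X. \<kappa> x x')"
    using pos[of "\<lambda>_. 1"] W(4)[of 0] by (intro mult_left_mono) (auto simp: card_Pow What_def)
  moreover have "2 ^ k * S \<le> 2 ^ k * (2 ^ k * M)" using upper by simp
  ultimately have "What 0 * (2 ^ k)\<^sup>2 \<le> 2 ^ k * (2 ^ k * M)" by linarith
  hence "(2 ^ k)\<^sup>2 * What 0 \<le> (2 ^ k)\<^sup>2 * M"
    by (simp only: power2_eq_square mult.assoc mult.commute[of "What 0"])
  hence "What 0 \<le> M" by simp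
  moreover have "V \<le> What 0" using W(5) by (simp add: What_def kraw_0_right)
  ultimately show ?thesis by simp
qed

section \<open>Samorodnitsky's average of the Gilbert--Varshamov and linear programming bounds\<close>

lemma mult_reflect_mono:
  assumes "i \<le> t" "2 * t \<le> n"
  shows "real i * (real n - real i + 1) \<le> real t * (real n - real t + 1)"
proof -
  have "0 \<le> (real t - real i) * (real n + 1 - real t - real i)"
    using assms by (intro mult_nonneg_nonneg) auto
  thus ?thesis by (simp add: algebra_simps)
qed

text \<open>The factor is the square root of the quotient of consecutive binomial coefficients, so
  the claim says that \<open>kraw n s x\<close> divided by the square root of
  \<open>n choose s\<close> does not decrease. In the three-term recurrence the induction hypothesis
  bounds the subtracted term; the two square roots that then occur are each at most the one in
  \<open>large\<close>.\<close>

lemma kraw_ratio: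
  assumes "x \<le> n" "2 * t \<le> n"
    and large: "2 * sqrt (real t * (real n - real t + 1)) \<le> real n - 2 * real x"
  shows "s < t \<Longrightarrow> 0 < kraw n s x \<and> sqrt (real (n - s) / real (s + 1)) * kraw n s x \<le> kraw n (s + 1) x"
proof (induction s)
  case 0
  have "sqrt (real n) \<le> sqrt (real t * (real n - real t + 1))"
    using mult_reflect_mono[of 1 t n] 0 assms by (intro real_sqrt_le_mono) auto
  moreover have "0 \<le> sqrt (real t * (real n - real t + 1))" using assms by simp
  ultimately have "sqrt (real n) \<le> real n - 2 * real x" using large by linarith
  thus ?case using kraw_three_term[OF assms(1), of 0] by simp
next
  case (Suc s)
  have IH: "0 < kraw n s x" "sqrt (real (n - s) / real (s + 1)) * kraw n s x \<le> kraw n (s + 1) x"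
    using Suc by auto
  have sn: "s + 2 \<le> t" "s < n" using Suc.prems assms by auto
  hence ps: "0 < sqrt (real (n - s) / real (s + 1))" by simp
  have p1: "0 < kraw n (s + 1) x" using IH ps by (meson less_le_trans mult_pos_pos)
  have e1: "real (n - s) = sqrt (real (n - s) * real (s + 1)) * sqrt (real (n - s) / real (s + 1))"
    unfolding real_sqrt_mult[symmetric] using sn by (simp add: real_sqrt_mult_self)
  have "real (n - s) * kraw n s x \<le> sqrt (real (n - s) * real (s + 1)) * kraw n (s + 1) x"
    by (subst e1, subst mult.assoc, rule mult_left_mono) (use IH in auto)
  moreover have "sqrt (real (n - s) * real (s + 1)) \<le> sqrt (real t * (real n - real t + 1))"
    using mult_reflect_mono[of "s + 1" t n] sn assms by (intro real_sqrt_le_mono) (simp add: of_nat_diff mult.commute)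
  moreover have "sqrt (real (s + 2) * real (n - (s + 1))) \<le> sqrt (real t * (real n - real t + 1))"
    using mult_reflect_mono[of "s + 2" t n] sn assms by (intro real_sqrt_le_mono) (simp add: of_nat_diff mult.commute diff_diff_eq add.commute)
  ultimately have b1: "real (n - s) * kraw n s x \<le> sqrt (real (n - s) * real (s + 1)) * kraw n (s + 1) x"
    and "sqrt (real (s + 2) * real (n - (s + 1))) + sqrt (real (n - s) * real (s + 1)) \<le> real n - 2 * real x"
    using large by linarith+
  from mult_right_mono[OF this(2), of "kraw n (s + 1) x"] p1
  have "(sqrt (real (s + 2) * real (n - (s + 1))) + sqrt (real (n - s) * real (s + 1))) * kraw n (s + 1) x
      \<le> (real n - 2 * real x) * kraw n (s + 1) x" by linarith
  with b1 have "sqrt (real (s + 2) * real (n - (s + 1))) * kraw n (s + 1) x + real (n - s) * kraw n s x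
      \<le> (real n - 2 * real x) * kraw n (s + 1) x"
    unfolding distrib_right by linarith
  moreover have "real (s + 2) * kraw n (s + 2) x = (real n - 2 * real x) * kraw n (s + 1) x - real (n - s) * kraw n s x"
    using kraw_three_term[OF assms(1), of "s + 1"] sn by (simp add: of_nat_diff)
  ultimately have main: "sqrt (real (s + 2) * real (n - (s + 1))) * kraw n (s + 1) x \<le> real (s + 2) * kraw n (s + 2) x"
    by linarith
  have "sqrt (real (s + 2) * real (n - (s + 1))) = real (s + 2) * sqrt (real (n - (s + 1)) / real (s + 2))"
  proof -
    have "real (s + 2) * real (n - (s + 1)) = (real (s + 2))\<^sup>2 * (real (n - (s + 1)) / real (s + 2))"
      by (simp add: power2_eq_square)
    thus ?thesis by (simp only: real_sqrt_mult) simp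
  qed
  with main have "real (s + 2) * (sqrt (real (n - (s + 1)) / real (s + 2)) * kraw n (s + 1) x) \<le> real (s + 2) * kraw n (s + 2) x"
    by (simp only: mult.assoc)
  hence "sqrt (real (n - (s + 1)) / real (s + 2)) * kraw n (s + 1) x \<le> kraw n (s + 2) x"
    by (subst (asm) mult_le_cancel_left_pos) auto
  thus ?case using p1 by simp
qed

lemma kraw_mono_before_root:
  assumes "x \<le> n" "2 * t \<le> n" "2 * sqrt (real t * (real n - real t + 1)) \<le> real n - 2 * real x" "s \<le> t"
  shows "0 \<le> kraw n s x \<and> kraw n s x \<le> kraw n t x"
  using assms(4)
proof (induction s rule: inc_induct)
  case base
  show ?case
  proof (cases t)
    case (Suc r)
    have "0 < kraw n r x" "sqrt (real (n - r) / real (r + 1)) * kraw n r x \<le> kraw n t x"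
      using kraw_ratio[OF assms(1-3), of r] Suc by auto
    thus ?thesis by (smt (verit) mult_nonneg_nonneg real_sqrt_ge_zero divide_nonneg_nonneg of_nat_0_le_iff)
  qed simp
next
  case (step s)
  have k: "0 < kraw n s x" "sqrt (real (n - s) / real (s + 1)) * kraw n s x \<le> kraw n (s + 1) x"
    using kraw_ratio[OF assms(1-3), of s] step by auto
  have "1 \<le> sqrt (real (n - s) / real (s + 1))"
    using step assms by (simp add: of_nat_diff)
  hence "kraw n s x \<le> kraw n (s + 1) x"
    using k by (smt (verit) mult_le_cancel_right1)
  thus ?case using step k by auto
qed

text \<open>Away from \<open>0\<close>, the transform of the constant weight on the distances above \<open>d\<close> is minus that of the
  weight on the distances up to \<open>d\<close>. Outside the oscillatory range of the Krawtchouk polynomials the additional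
  weight at \<open>t\<close> outweighs it; inside, \<open>abs_kraw_le\<close> bounds both.\<close>

lemma primal_bound_samorodnitsky:
  assumes "even t" "d < t" "2 * t \<le> n" "x0 \<le> n"
    and x0: "2 * sqrt (real t * (real n - real t + 1)) \<le> real n - 2 * real x0"
  shows "primal_bound n d (sqrt (2 ^ n * real (n choose x0) / real (n choose t)) / (4 * real n))"
proof -
  define Q where "Q = sqrt (2 ^ n * real (n choose t) / real (n choose x0))"
  have n: "0 < n" "d < n" using assms by auto
  have Q: "0 < Q" using assms by (simp add: Q_def)
  \<comment> \<open>Chosen so that the worst deviation, \<open>2 * n * Q\<close> in
    \<open>near\<close>, is exactly compensated by \<open>W 0 = 1\<close>.\<close>
  define c where "c = 1 / (2 * real n * Q)"
  have c: "0 < c" "c * (2 * real n * Q) = 1" using Q n by (auto simp: c_def)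
  define W where "W s = (if s = 0 then 1 else if s \<le> d then 0 else if s = t then c * (real n + 1) else c)" for s
  have Wsum: "(\<Sum>s\<le>n. W s * f s) = f 0 + c * ((\<Sum>s\<le>n. f s) - (\<Sum>s\<le>d. f s) + real n * f t)" for f
  proof -
    have "W s * f s = (if s = 0 then f 0 else 0) + c * (f s - (if s \<le> d then f s else 0) + (if s = t then real n * f t else 0))" for s
      using assms(2) by (auto simp: W_def algebra_simps)
    hence "(\<Sum>s\<le>n. W s * f s) = f 0 + c * ((\<Sum>s\<le>n. f s) - (\<Sum>s\<le>n. if s \<le> d then f s else 0) + real n * f t)"
      using assms by (simp add: sum.distrib sum_subtractf flip: sum_distrib_left)
    also have "(\<Sum>s\<le>n. if s \<le> d then f s else 0) = (\<Sum>s\<in>{s\<in>{..n}. s \<le> d}. f s)"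
      by (rule sum.inter_filter[symmetric]) simp
    also have "{s\<in>{..n}. s \<le> d} = {..d}" using n by auto
    finally show ?thesis .
  qed
  \<comment> \<open>As \<open>t\<close> is even, \<open>kraw n t\<close> is unchanged by the
    reflection of \<open>x\<close>, so the smaller of \<open>x\<close> and \<open>n - x\<close> may
    be used. Each of the \<open>d + 1\<close> terms, at most \<open>n\<close> in number, is then
    bounded by the value at \<open>t\<close>.\<close>
  have far: "0 \<le> - (\<Sum>s\<le>d. kraw n s x) + real n * kraw n t x"
    if x: "x \<le> n" "2 * sqrt (real t * (real n - real t + 1)) \<le> \<bar>real n - 2 * real x\<bar>" for x
  proof -
    define x' where "x' = min x (n - x)"
    have x': "x' \<le> n" "2 * sqrt (real t * (real n - real t + 1)) \<le> real n - 2 * real x'"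
      using x by (auto simp: x'_def min_def of_nat_diff split: if_splits)
    have "(\<Sum>s\<le>d. kraw n s x) \<le> (\<Sum>s\<le>d. kraw n t x')"
    proof (rule sum_mono)
      fix s assume "s \<in> {..d}"
      hence k: "0 \<le> kraw n s x'" "kraw n s x' \<le> kraw n t x'"
        using kraw_mono_before_root[OF x'(1) assms(3) x'(2)] assms(2) by auto
      have "kraw n s x \<le> kraw n s x'"
        using kraw_reflect_right[OF x(1), of s] k
        by (cases "even s") (auto simp: x'_def min_def split: if_splits)
      thus "kraw n s x \<le> kraw n t x'" using k by simp
    qed
    moreover have "kraw n t x' = kraw n t x"
      using kraw_reflect_right[OF x(1), of t] assms(1) by (auto simp: x'_def min_def)
    moreover have "0 \<le> kraw n t x'" using kraw_mono_before_root[OF x'(1) assms(3) x'(2)] by auto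
    hence "real (d + 1) * kraw n t x' \<le> real n * kraw n t x'" using n by (intro mult_right_mono) auto
    ultimately show ?thesis by simp
  qed
  have near: "- (2 * real n * Q) \<le> - (\<Sum>s\<le>d. kraw n s x) + real n * kraw n t x"
    if x: "x \<le> n" "\<bar>real n - 2 * real x\<bar> < 2 * sqrt (real t * (real n - real t + 1))" for x
  proof -
    have "x0 \<le> x" "x \<le> n - x0" using x x0 by auto
    hence "n choose x0 \<le> n choose x"
    proof (cases "2 * x \<le> n")
      case False
      have "n choose x0 \<le> n choose (n - x)" using \<open>x \<le> n - x0\<close> False x by (intro binomial_mono) auto
      thus ?thesis using binomial_symmetric[OF x(1)] by simp
    qed (intro binomial_mono)
    have b: "\<bar>kraw n s x\<bar> \<le> Q" if "s \<le> t" for s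
    proof -
      have "2 ^ n * real (n choose s) / real (n choose x) \<le> 2 ^ n * real (n choose t) / real (n choose x0)"
        using binomial_mono[OF that assms(3)] \<open>n choose x0 \<le> n choose x\<close> assms(4)
        by (intro frac_le mult_left_mono) auto
      thus ?thesis unfolding Q_def using abs_kraw_le[OF x(1), of s] real_sqrt_le_mono order_trans by blast
    qed
    have "(\<Sum>s\<le>d. kraw n s x) \<le> (\<Sum>s\<le>d. Q)"
      using b assms(2) by (intro sum_mono) (smt (verit) atMost_iff le_trans less_imp_le)
    also have "\<dots> \<le> real n * Q" using n Q by simp
    finally have "(\<Sum>s\<le>d. kraw n s x) \<le> real n * Q" .
    moreover have "- (real n * Q) \<le> real n * kraw n t x"
      using b[of t] mult_left_mono[of "-Q" "kraw n t x" "real n"] by auto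
    ultimately show ?thesis by linarith
  qed
  \<comment> \<open>Since \<open>2 * d < n\<close>, the distances up to \<open>d\<close> account for
    at most half of the cube.\<close>
  have tot: "c * 2 ^ n / 2 \<le> c * ((\<Sum>s\<le>n. real (n choose s)) - (\<Sum>s\<le>d. real (n choose s)) + real n * real (n choose t))"
  proof -
    have "(\<Sum>s\<le>n. real (n choose s)) = 2 ^ n"
      using choose_row_sum[of n] by (metis of_nat_numeral of_nat_power of_nat_sum)
    moreover have "(\<Sum>s\<le>d. real (n choose s)) \<le> 2 ^ n / 2"
    proof -
      have "2 * (\<Sum>s\<le>d. real (n choose s)) = (\<Sum>s\<le>d. real (n choose s)) + (\<Sum>s\<in>{n-d..n}. real (n choose s))"
      proof -
        have "(\<Sum>s\<in>{n-d..n}. real (n choose s)) = (\<Sum>s\<le>d. real (n choose (n - s)))"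
          by (rule sum.reindex_bij_witness[of _ "\<lambda>s. n - s" "\<lambda>s. n - s"]) (use n in auto)
        also have "\<dots> = (\<Sum>s\<le>d. real (n choose s))"
        proof (rule sum.cong[OF refl])
          fix s assume "s \<in> {..d}"
          hence "s \<le> n" using n by auto
          thus "real (n choose (n - s)) = real (n choose s)" by (metis binomial_symmetric)
        qed
        finally show ?thesis by simp
      qed
      also have "\<dots> = (\<Sum>s\<in>{..d} \<union> {n-d..n}. real (n choose s))"
        using assms by (subst sum.union_disjoint) auto
      also have "\<dots> \<le> (\<Sum>s\<le>n. real (n choose s))" using n by (intro sum_mono2) auto
      finally show ?thesis using \<open>(\<Sum>s\<le>n. real (n choose s)) = 2 ^ n\<close> by simp
    qed
    moreover have "0 \<le> real n * real (n choose t)" by simp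
    ultimately have "2 ^ n / 2 \<le> (\<Sum>s\<le>n. real (n choose s)) - (\<Sum>s\<le>d. real (n choose s)) + real n * real (n choose t)"
      by linarith
    from mult_left_mono[OF this, of c] c show ?thesis by simp
  qed
  show ?thesis
    unfolding primal_bound_def
  proof (intro exI[of _ W] conjI allI impI)
    show "0 \<le> W s" for s using c by (auto simp: W_def)
    show "W 0 = 1" by (simp add: W_def)
    show "W s = 0" if "1 \<le> s \<and> s \<le> d" for s using that by (simp add: W_def)
    show "0 \<le> (\<Sum>s\<le>n. W s * kraw n s j)" if j: "j \<le> n" for j
    proof (cases "j = 0")
      case True
      thus ?thesis using c by (auto intro!: sum_nonneg simp: W_def kraw_0_right)
    next
      case False
      have "- 1 \<le> c * (- (\<Sum>s\<le>d. kraw n s j) + real n * kraw n t j)"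
      proof (cases "\<bar>real n - 2 * real j\<bar> < 2 * sqrt (real t * (real n - real t + 1))")
        case True
        show ?thesis using mult_left_mono[OF near[OF j True], of c] c by simp
      next
        case F: False
        show ?thesis using mult_nonneg_nonneg[OF _ far[OF j], of c] c F by simp
      qed
      thus ?thesis using False j by (simp add: Wsum sum_kraw)
    qed
    have "sqrt (2 ^ n * real (n choose x0) / real (n choose t)) = 2 ^ n / Q"
    proof -
      have "2 ^ n * real (n choose x0) / real (n choose t) = (2 ^ n)\<^sup>2 / (2 ^ n * real (n choose t) / real (n choose x0))"
        by (simp add: power2_eq_square)
      thus ?thesis unfolding Q_def by (simp only: real_sqrt_divide) simp
    qed
    hence "sqrt (2 ^ n * real (n choose x0) / real (n choose t)) / (4 * real n) = c * 2 ^ n / 2"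
      using Q n by (simp add: c_def field_simps)
    thus "sqrt (2 ^ n * real (n choose x0) / real (n choose t)) / (4 * real n) \<le> (\<Sum>s\<le>n. W s * real (n choose s))"
      using tot by (simp add: Wsum)
  qed
qed


section \<open>Positivity of shifted products\<close>

definition nrm :: "nat \<Rightarrow> (nat \<Rightarrow> real) \<Rightarrow> (nat \<Rightarrow> real) \<Rightarrow> real" where
  "nrm n \<omega> h = L2_set (\<lambda>x. sqrt (\<omega> x) * h x) {..n}"

lemma nrm_nonneg: "0 \<le> nrm n \<omega> h"
  by (simp add: nrm_def)

lemma nrm_sq:
  assumes "\<And>x. 0 \<le> \<omega> x"
  shows "(nrm n \<omega> h)\<^sup>2 = (\<Sum>x\<le>n. \<omega> x * (h x)\<^sup>2)"
  unfolding nrm_def L2_set_def using assms by (simp add: sum_nonneg power_mult_distrib)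

lemma nrm_triangle: "nrm n \<omega> (\<lambda>x. f x + g x) \<le> nrm n \<omega> f + nrm n \<omega> g"
  unfolding nrm_def distrib_left by (rule L2_set_triangle_ineq)

lemma nrm_scale: "nrm n \<omega> (\<lambda>x. c * f x) = \<bar>c\<bar> * nrm n \<omega> f"
proof -
  have "nrm n \<omega> (\<lambda>x. c * f x) = sqrt (c\<^sup>2 * (\<Sum>x\<le>n. (sqrt (\<omega> x) * f x)\<^sup>2))"
    unfolding nrm_def L2_set_def sum_distrib_left by (simp add: power_mult_distrib mult_ac)
  thus ?thesis by (simp add: real_sqrt_mult nrm_def L2_set_def)
qed

lemma nrm_triangle_diff: "nrm n \<omega> (\<lambda>x. f x - g x) \<le> nrm n \<omega> f + nrm n \<omega> g"
  using nrm_triangle[of n \<omega> f "\<lambda>x. (-1) * g x"] nrm_scale[of n \<omega> "-1" g] by simp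

text \<open>The shift moves the value at \<open>x + 1\<close> to \<open>x\<close>, where the weight
  is smaller by at least the factor \<open>q\<^sup>2\<close>. As \<open>h\<close> vanishes beyond
  \<open>p\<close>, only the ratios below \<open>p\<close> enter.\<close>

lemma nrm_shift:
  assumes \<omega>: "\<And>x. 0 \<le> \<omega> x" and q: "0 \<le> q"
    and ratio: "\<And>x. x < p \<Longrightarrow> \<omega> x \<le> q\<^sup>2 * \<omega> (x + 1)"
    and supp: "\<And>x. p < x \<Longrightarrow> h x = 0"
    and pn: "p \<le> n"
  shows "nrm n \<omega> (\<lambda>x. h (x + 1)) \<le> q * nrm n \<omega> h"
proof (rule power2_le_imp_le)
  have "(\<Sum>x\<le>n. \<omega> x * (h (x + 1))\<^sup>2) = (\<Sum>x<p. \<omega> x * (h (x + 1))\<^sup>2)"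
    using pn supp by (intro sum.mono_neutral_right) auto
  also have "\<dots> \<le> (\<Sum>x<p. q\<^sup>2 * (\<omega> (x + 1) * (h (x + 1))\<^sup>2))"
  proof (rule sum_mono)
    fix x assume "x \<in> {..<p}"
    thus "\<omega> x * (h (x + 1))\<^sup>2 \<le> q\<^sup>2 * (\<omega> (x + 1) * (h (x + 1))\<^sup>2)"
      using mult_right_mono[OF ratio, of x "(h (x + 1))\<^sup>2"] by (simp add: mult.assoc)
  qed
  also have "\<dots> = (\<Sum>x\<in>Suc ` {..<p}. q\<^sup>2 * (\<omega> x * (h x)\<^sup>2))"
    by (subst sum.reindex) auto
  also have "\<dots> \<le> (\<Sum>x\<le>n. q\<^sup>2 * (\<omega> x * (h x)\<^sup>2))"
    using pn \<omega> by (intro sum_mono2) auto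
  finally show "(nrm n \<omega> (\<lambda>x. h (x + 1)))\<^sup>2 \<le> (q * nrm n \<omega> h)\<^sup>2"
    using nrm_sq[OF \<omega>] by (simp add: power_mult_distrib sum_distrib_left)
qed (use q in \<open>simp add: nrm_nonneg\<close>)

text \<open>Shifting by one and by two shrinks the norm by \<open>q\<close> and
  \<open>q\<^sup>2\<close>, so the unshifted \<open>h\<close> dominates the form when
  \<open>q\<close> is small.\<close>

lemma shifted_form_lower:
  fixes n p :: nat and \<omega> h :: "nat \<Rightarrow> real" and q :: real
  assumes \<omega>: "\<And>x. 0 \<le> \<omega> x" and q: "0 \<le> q" "q \<le> 1"
    and ratio: "\<And>x. x < p \<Longrightarrow> \<omega> x \<le> q\<^sup>2 * \<omega> (x + 1)"
    and supp: "\<And>x. p < x \<Longrightarrow> h x = 0"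
    and pn: "p \<le> n"
  shows "((1 - q\<^sup>2)\<^sup>2 - 4 * q\<^sup>2) * (\<Sum>x\<le>n. \<omega> x * (h x)\<^sup>2)
    \<le> (\<Sum>x\<le>n. \<omega> x * ((h x + h (x + 2))\<^sup>2 - 4 * (h (x + 1))\<^sup>2))"
proof -
  let ?N = "nrm n \<omega>"
  have s1: "?N (\<lambda>x. h (x + 1)) \<le> q * ?N h"
    by (rule nrm_shift[where p = p]) (use \<omega> q ratio supp pn in auto)
  have "?N (\<lambda>x. h (x + 1 + 1)) \<le> q * ?N (\<lambda>x. h (x + 1))"
    by (rule nrm_shift[where p = p]) (use \<omega> q ratio supp pn in auto)
  also have "\<dots> \<le> q * (q * ?N h)" using s1 q by (intro mult_left_mono)
  finally have s2: "?N (\<lambda>x. h (x + 2)) \<le> q\<^sup>2 * ?N h" by (simp add: power2_eq_square)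
  have "?N h \<le> ?N (\<lambda>x. h x + h (x + 2)) + ?N (\<lambda>x. h (x + 2))"
    using nrm_triangle_diff[of n \<omega> "\<lambda>x. h x + h (x + 2)" "\<lambda>x. h (x + 2)"] by simp
  hence "(1 - q\<^sup>2) * ?N h \<le> ?N (\<lambda>x. h x + h (x + 2))" using s2 by (simp add: left_diff_distrib)
  hence "((1 - q\<^sup>2) * ?N h)\<^sup>2 \<le> (?N (\<lambda>x. h x + h (x + 2)))\<^sup>2"
    by (rule power_mono) (use q nrm_nonneg in \<open>auto simp: power_le_one\<close>)
  moreover have "(?N (\<lambda>x. h (x + 1)))\<^sup>2 \<le> (q * ?N h)\<^sup>2" by (rule power_mono[OF s1 nrm_nonneg])
  ultimately have "((1 - q\<^sup>2)\<^sup>2 - 4 * q\<^sup>2) * (?N h)\<^sup>2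
      \<le> (?N (\<lambda>x. h x + h (x + 2)))\<^sup>2 - 4 * (?N (\<lambda>x. h (x + 1)))\<^sup>2"
    unfolding power_mult_distrib left_diff_distrib[of "(1 - q\<^sup>2)\<^sup>2"] by linarith
  thus ?thesis unfolding nrm_sq[OF \<omega>]
    by (simp add: right_diff_distrib sum_subtractf sum_distrib_left mult_ac)
qed

lemma binomial_ratio:
  assumes "8 * x + 7 \<le> n"
  shows "real (n choose x) \<le> real (n choose (x + 1)) / 7"
proof -
  have "real (x + 1) * real (n choose (x + 1)) = real (n - x) * real (n choose x)"
    using binomial_absorb_comp[of n x] Suc_times_binomial[of x "n - 1"] assms
    by (metis Suc_eq_plus1 Suc_times_binomial_eq binomial_absorption of_nat_mult)
  moreover have "7 * real (x + 1) \<le> real (n - x)" using assms by simp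
  hence "7 * real (x + 1) * real (n choose x) \<le> real (n - x) * real (n choose x)"
    by (intro mult_right_mono) auto
  ultimately have "real (x + 1) * (7 * real (n choose x)) \<le> real (x + 1) * real (n choose (x + 1))"
    by (simp only: mult_ac)
  thus ?thesis by (subst (asm) mult_le_cancel_left_pos) auto
qed

lemma sqrt_7: "(1 / sqrt 7)\<^sup>2 = (1/7 :: real)" "1 / sqrt 7 \<le> (378/1000 :: real)" "0 \<le> 1 / sqrt (7::real)"
proof -
  show sq: "(1 / sqrt 7)\<^sup>2 = (1/7 :: real)" by (simp add: power_divide)
  show "1 / sqrt 7 \<le> (378/1000 :: real)"
    by (rule power2_le_imp_le) (simp_all only: sq, simp_all add: power2_eq_square)
qed simp

text \<open>\<open>Y\<close> commutes with shifts up to terms in \<open>h\<close> without the factor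
  \<open>n\<close>, so in terms of \<open>g = Y h\<close> the form resembles that of
  \<open>shifted_form_lower\<close>. If the norm of \<open>g\<close> is at least 40 times that of
  \<open>h\<close>, the extra terms are absorbed. Otherwise the norm of \<open>YB\<close> is at most
  17 times that of \<open>h\<close>, and 1156 is 4 times the square of 17.\<close>

lemma Y_form_lower:
  assumes n: "8 * p + 15 \<le> n" and supp: "\<And>x. p < x \<Longrightarrow> h x = 0"
  defines "Y \<equiv> \<lambda>h x. real x * h (x - 1) - (real n - real x) * h (x + 1)"
  shows "- 1156 * (\<Sum>x\<le>n. real (n choose x) * (h x)\<^sup>2)
    \<le> (\<Sum>x\<le>n. real (n choose x) * ((Y (\<lambda>x. h x + h (x + 2)) x)\<^sup>2 - 4 * (Y (\<lambda>x. h (x + 1)) x)\<^sup>2))"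
proof -
  define C where "C x = real (n choose x)" for x
  let ?N = "nrm n C"
  define q where "q = 1 / sqrt (7::real)"
  have q: "q\<^sup>2 = 1/7" "q \<le> 378/1000" "0 \<le> q" using sqrt_7 by (auto simp: q_def)
  have qq: "q * q = 1/7" using q(1) by (simp only: power2_eq_square)
  have C: "0 \<le> C x" for x by (simp add: C_def)
  define g where "g = Y h"
  have gsupp: "g x = 0" if "p + 1 < x" for x
    using that supp[of "x - 1"] supp[of "x + 1"] by (simp add: g_def Y_def)
  have ratio: "C x \<le> q\<^sup>2 * C (x + 1)" if "x < p + 1" for x
    using binomial_ratio[of x n] that n unfolding q(1) by (simp add: C_def)
  have sh: "?N (\<lambda>x. f (x + 1)) \<le> q * ?N f" if "\<And>x. p + 1 < x \<Longrightarrow> f x = 0" for f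
    by (rule nrm_shift[where p = "p + 1"]) (use C q ratio that n in auto)
  have h1: "?N (\<lambda>x. h (x + 1)) \<le> q * ?N h" by (rule sh) (simp add: supp)
  have "?N (\<lambda>x. h (x + 1 + 1)) \<le> q * ?N (\<lambda>x. h (x + 1))" by (rule sh) (simp add: supp)
  also have "\<dots> \<le> q * (q * ?N h)" using h1 q by (intro mult_left_mono)
  also have "\<dots> = (1/7) * ?N h" by (simp only: mult.assoc[symmetric] qq)
  finally have h2: "?N (\<lambda>x. h (x + 2)) \<le> (1/7) * ?N h" by simp
  have "?N (\<lambda>x. h (x + 1 + 2)) \<le> q * ?N (\<lambda>x. h (x + 2))" using sh[of "\<lambda>x. h (x + 2)"] by (simp add: supp add_ac)
  also have "\<dots> \<le> q * ((1/7) * ?N h)" using h2 q by (intro mult_left_mono)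
  finally have h3: "?N (\<lambda>x. h (x + 3)) \<le> q / 7 * ?N h" by (simp add: add_ac numeral_3_eq_3)
  have g1: "?N (\<lambda>x. g (x + 1)) \<le> q * ?N g" by (rule sh) (simp add: gsupp)
  have "?N (\<lambda>x. g (x + 1 + 1)) \<le> q * ?N (\<lambda>x. g (x + 1))" by (rule sh) (simp add: gsupp)
  also have "\<dots> \<le> q * (q * ?N g)" using g1 q by (intro mult_left_mono)
  also have "\<dots> = (1/7) * ?N g" by (simp only: mult.assoc[symmetric] qq)
  finally have g2: "?N (\<lambda>x. g (x + 2)) \<le> (1/7) * ?N g" by simp
  define YA where "YA = Y (\<lambda>x. h x + h (x + 2))"
  define YB where "YB = Y (\<lambda>x. h (x + 1))"
  have YA: "YA x = g x + g (x + 2) - (2 * h (x + 1) + 2 * h (x + 3))" for x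
    unfolding YA_def g_def Y_def by (cases x) (simp_all add: algebra_simps eval_nat_numeral)
  have YB: "YB x = g (x + 1) - (h x + h (x + 2))" for x
    unfolding YB_def g_def Y_def by (cases x) (simp_all add: algebra_simps eval_nat_numeral)
  have hN: "0 \<le> ?N h" "0 \<le> ?N g" by (simp_all add: nrm_nonneg)
  have r: "?N (\<lambda>x. 2 * h (x + 1) + 2 * h (x + 3)) \<le> ?N h"
  proof -
    have "?N (\<lambda>x. 2 * h (x + 1) + 2 * h (x + 3)) \<le> 2 * ?N (\<lambda>x. h (x + 1)) + 2 * ?N (\<lambda>x. h (x + 3))"
      using nrm_triangle[of n C "\<lambda>x. 2 * h (x + 1)" "\<lambda>x. 2 * h (x + 3)"] by (simp add: nrm_scale)
    also have "\<dots> \<le> 2 * (q * ?N h) + 2 * (q / 7 * ?N h)" using h1 h3 by simp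
    also have "\<dots> = (2 * q + 2 * q / 7) * ?N h" by (simp add: algebra_simps)
    also have "\<dots> \<le> 1 * ?N h" using q hN by (intro mult_right_mono) auto
    finally show ?thesis by simp
  qed
  have NA: "(6/7) * ?N g - ?N h \<le> ?N YA"
  proof -
    have "?N g \<le> ?N (\<lambda>x. g x + g (x + 2)) + ?N (\<lambda>x. g (x + 2))"
      using nrm_triangle_diff[of n C "\<lambda>x. g x + g (x + 2)" "\<lambda>x. g (x + 2)"] by simp
    moreover have "?N (\<lambda>x. g x + g (x + 2)) \<le> ?N YA + ?N (\<lambda>x. 2 * h (x + 1) + 2 * h (x + 3))"
      using nrm_triangle[of n C YA "\<lambda>x. 2 * h (x + 1) + 2 * h (x + 3)"] by (simp add: YA)
    ultimately show ?thesis using g2 r by linarith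
  qed
  have NB: "?N YB \<le> (378/1000) * ?N g + (8/7) * ?N h"
  proof -
    have "?N YB \<le> ?N (\<lambda>x. g (x + 1)) + ?N (\<lambda>x. h x + h (x + 2))"
      using nrm_triangle_diff[of n C "\<lambda>x. g (x + 1)" "\<lambda>x. h x + h (x + 2)"] by (simp add: YB[abs_def])
    moreover have "?N (\<lambda>x. h x + h (x + 2)) \<le> ?N h + ?N (\<lambda>x. h (x + 2))" by (rule nrm_triangle)
    moreover have "q * ?N g \<le> (378/1000) * ?N g" using q hN by (intro mult_right_mono)
    ultimately show ?thesis using g1 h2 by linarith
  qed
  have "- 1156 * (?N h)\<^sup>2 \<le> (?N YA)\<^sup>2 - 4 * (?N YB)\<^sup>2"
  proof (cases "40 * ?N h \<le> ?N g")
    case True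
    hence "2 * ?N YB \<le> ?N YA" using NA NB hN by linarith
    hence "(2 * ?N YB)\<^sup>2 \<le> (?N YA)\<^sup>2" by (rule power_mono) (simp add: nrm_nonneg)
    hence "4 * (?N YB)\<^sup>2 \<le> (?N YA)\<^sup>2" by (simp add: power_mult_distrib)
    moreover have "0 \<le> (?N h)\<^sup>2" by simp
    ultimately show ?thesis by linarith
  next
    case False
    hence "?N YB \<le> 17 * ?N h" using NB hN by linarith
    hence "(?N YB)\<^sup>2 \<le> (17 * ?N h)\<^sup>2" by (rule power_mono) (simp add: nrm_nonneg)
    hence "(?N YB)\<^sup>2 \<le> 289 * (?N h)\<^sup>2" by (simp add: power_mult_distrib)
    moreover have "0 \<le> (?N YA)\<^sup>2" by simp
    ultimately show ?thesis by linarith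
  qed
  thus ?thesis unfolding nrm_sq[OF C]
    by (simp add: C_def YA_def YB_def right_diff_distrib sum_subtractf sum_distrib_left mult_ac)
qed

section \<open>Krawtchouk transforms: Parseval, change of length, multiplication\<close>

lemma kraw_parseval:
  "(\<Sum>s\<le>n. real (n choose s) * ((\<Sum>x\<le>n. F x * kraw n x s) * (\<Sum>x\<le>n. G x * kraw n x s)))
    = 2 ^ n * (\<Sum>x\<le>n. real (n choose x) * (F x * G x))"
proof -
  have "(\<Sum>s\<le>n. real (n choose s) * ((\<Sum>x\<le>n. F x * kraw n x s) * (\<Sum>x\<le>n. G x * kraw n x s)))
      = (\<Sum>s\<le>n. \<Sum>x\<le>n. \<Sum>y\<le>n. F x * G y * (real (n choose s) * (kraw n x s * kraw n y s)))"
    unfolding sum_product unfolding sum_distrib_left by (intro sum.cong refl) (simp add: mult_ac)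
  also have "\<dots> = (\<Sum>x\<le>n. \<Sum>s\<le>n. \<Sum>y\<le>n. F x * G y * (real (n choose s) * (kraw n x s * kraw n y s)))"
    by (rule sum.swap)
  also have "\<dots> = (\<Sum>x\<le>n. \<Sum>y\<le>n. F x * G y * (\<Sum>s\<le>n. real (n choose s) * (kraw n x s * kraw n y s)))"
    unfolding sum_distrib_left by (rule sum.cong[OF refl], rule sum.swap)
  also have "\<dots> = (\<Sum>x\<le>n. 2 ^ n * (real (n choose x) * (F x * G x)))"
    unfolding kraw_orthogonal by (rule sum.cong[OF refl]) (simp add: if_distrib[of "\<lambda>z. _ * z"] mult_ac cong: if_cong)
  finally show ?thesis by (simp add: sum_distrib_left)
qed

text \<open>A new coordinate multiplies the generating function by 1 + z if it lies outside the set
  and by 1 - z if it lies inside.\<close>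

lemma kraw_Suc_left:
  assumes "s \<le> n"
  shows "kraw (n + 1) x s = kraw n x s + (if x = 0 then 0 else kraw n (x - 1) s)"
    and "kraw (n + 1) x (s + 1) = kraw n x s - (if x = 0 then 0 else kraw n (x - 1) s)"
proof -
  define P where "P = [:1, -1:] ^ s * [:1, 1::real:] ^ (n - s)"
  have "[:1, -1:] ^ s * [:1, 1::real:] ^ (n + 1 - s) = [:1, 1:] * P"
    using assms by (simp only: P_def Suc_diff_le Suc_eq_plus1[symmetric] power_Suc mult_ac)
  thus "kraw (n + 1) x s = kraw n x s + (if x = 0 then 0 else kraw n (x - 1) s)"
    unfolding kraw_def P_def by (cases x) auto
  have "[:1, -1:] ^ (s + 1) * [:1, 1::real:] ^ (n + 1 - (s + 1)) = [:1, -1:] * P"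
    by (simp only: P_def Suc_eq_plus1[symmetric] power_Suc mult_ac diff_Suc_Suc)
  thus "kraw (n + 1) x (s + 1) = kraw n x s - (if x = 0 then 0 else kraw n (x - 1) s)"
    unfolding kraw_def P_def by (cases x) auto
qed

lemma sum_shift_down:
  fixes h k :: "nat \<Rightarrow> real"
  assumes "h (N + 1) = 0"
  shows "(\<Sum>x\<le>N. h x * (if x = 0 then 0 else k (x - 1))) = (\<Sum>x\<le>N. h (x + 1) * k x)"
proof -
  have "(\<Sum>x\<le>N. h x * (if x = 0 then 0 else k (x - 1))) = (\<Sum>x<N. h (x + 1) * k x)"
    by (subst sum.atMost_shift) simp
  also have "\<dots> = (\<Sum>x\<le>N. h (x + 1) * k x)"
    using assms by (simp add: lessThan_Suc_atMost[symmetric])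
  finally show ?thesis .
qed

lemma kraw_sum_Suc:
  assumes "s \<le> n" "h (N + 1) = 0"
  shows "(\<Sum>x\<le>N. h x * kraw (n + 1) x s) = (\<Sum>x\<le>N. (h x + h (x + 1)) * kraw n x s)"
    and "(\<Sum>x\<le>N. h x * kraw (n + 1) x (s + 1)) = (\<Sum>x\<le>N. (h x - h (x + 1)) * kraw n x s)"
  unfolding kraw_Suc_left[OF assms(1)]
  using sum_shift_down[of h N "\<lambda>x. kraw n x s"] assms(2)
  by (simp_all add: distrib_left right_diff_distrib distrib_right left_diff_distrib sum.distrib sum_subtractf)

text \<open>With T the shift of \<open>h\<close> by one, the two sides are the transforms of (1 +
  T)^2 \<open>h\<close> and (1 - T)^2 \<open>h\<close>. Thus the values at \<open>s\<close> and at
  \<open>s + 2\<close> become transforms at the same point and of the same length, and Parseval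
  applies to their product.\<close>

lemma kraw_sum_Suc_Suc:
  assumes "s \<le> n" "\<And>x. n < x \<Longrightarrow> h x = 0"
  shows "(\<Sum>x\<le>n. h x * kraw (n + 2) x s) = (\<Sum>x\<le>n. ((h x + h (x + 2)) + 2 * h (x + 1)) * kraw n x s)"
    and "(\<Sum>x\<le>n. h x * kraw (n + 2) x (s + 2)) = (\<Sum>x\<le>n. ((h x + h (x + 2)) - 2 * h (x + 1)) * kraw n x s)"
proof -
  have "(\<Sum>x\<le>n. h x * kraw (n + 2) x s) = (\<Sum>x\<le>n. (h x + h (x + 1)) * kraw (n + 1) x s)"
    using kraw_sum_Suc(1)[of s "n + 1" h n] assms by simp
  also have "\<dots> = (\<Sum>x\<le>n. ((h x + h (x + 1)) + (h (x + 1) + h (x + 1 + 1))) * kraw n x s)"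
    by (rule kraw_sum_Suc(1)) (use assms in auto)
  finally show "(\<Sum>x\<le>n. h x * kraw (n + 2) x s) = (\<Sum>x\<le>n. ((h x + h (x + 2)) + 2 * h (x + 1)) * kraw n x s)"
    by (simp add: algebra_simps)
  have "(\<Sum>x\<le>n. h x * kraw (n + 2) x (s + 2)) = (\<Sum>x\<le>n. (h x - h (x + 1)) * kraw (n + 1) x (s + 1))"
    using kraw_sum_Suc(2)[of "s + 1" "n + 1" h n] assms by simp
  also have "\<dots> = (\<Sum>x\<le>n. ((h x - h (x + 1)) - (h (x + 1) - h (x + 1 + 1))) * kraw n x s)"
    by (rule kraw_sum_Suc(2)) (use assms in auto)
  finally show "(\<Sum>x\<le>n. h x * kraw (n + 2) x (s + 2)) = (\<Sum>x\<le>n. ((h x + h (x + 2)) - 2 * h (x + 1)) * kraw n x s)"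
    by (simp add: algebra_simps)
qed

text \<open>The three-term recurrence transposed, so that it acts on the coefficients.\<close>

lemma kraw_sum_mult:
  assumes "s \<le> n"
  shows "(real n - 2 * real s) * (\<Sum>x\<le>n. F x * kraw n x s)
    = (\<Sum>x\<le>n. (real x * F (x - 1) + (real n - real x) * F (x + 1)) * kraw n x s)"
proof -
  have v: "(real n - 2 * real s) * kraw n x s = real (x + 1) * kraw n (x + 1) s +
      (if x = 0 then 0 else (real n - real x + 1) * kraw n (x - 1) s)" for x
    using kraw_three_term[OF assms, of x] by simp
  have "(real n - 2 * real s) * (\<Sum>x\<le>n. F x * kraw n x s) =
      (\<Sum>x\<le>n. F x * ((real n - 2 * real s) * kraw n x s))"
    by (simp add: sum_distrib_left mult_ac)
  also have "\<dots> = (\<Sum>x\<le>n. F x * real (x + 1) * kraw n (x + 1) s) +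
      (\<Sum>x\<le>n. ((real n - real x + 1) * F x) * (if x = 0 then 0 else kraw n (x - 1) s))"
    unfolding v sum.distrib[symmetric] by (rule sum.cong) (auto simp: algebra_simps)
  also have "(\<Sum>x\<le>n. ((real n - real x + 1) * F x) * (if x = 0 then 0 else kraw n (x - 1) s)) =
      (\<Sum>x\<le>n. ((real n - real (x + 1) + 1) * F (x + 1)) * kraw n x s)"
    by (rule sum_shift_down) simp
  also have "(\<Sum>x\<le>n. F x * real (x + 1) * kraw n (x + 1) s) = (\<Sum>x\<le>n + 1. real x * F (x - 1) * kraw n x s)"
    using sum.atMost_Suc_shift[of "\<lambda>x. real x * F (x - 1) * kraw n x s" n]
    by (simp add: mult_ac)
  also have "\<dots> = (\<Sum>x\<le>n. real x * F (x - 1) * kraw n x s)"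
    using kraw_greater[OF assms, of "Suc n"] by simp
  finally show ?thesis by (simp add: distrib_right sum.distrib)
qed

text \<open>By Parseval the sum is \<open>2 ^ n\<close> times the form of
  \<open>shifted_form_lower\<close> with binomial weights. Up to \<open>p\<close> these grow at
  least by the factor 7 in each step, and (1 - 1/7)^2 - 4/7 is positive.\<close>

lemma shifted_product_nonneg:
  assumes n: "8 * p + 15 \<le> n" and supp: "\<And>x. p < x \<Longrightarrow> h x = 0"
  defines "H \<equiv> \<lambda>s. \<Sum>x\<le>n. h x * kraw (n + 2) x s"
  shows "0 \<le> (\<Sum>s\<le>n. real (n choose s) * (H (s + 2) * H s))"
proof -
  define q where "q = 1 / sqrt (7::real)"
  have q: "q\<^sup>2 = 1/7" "q \<le> 378/1000" "0 \<le> q" using sqrt_7 by (auto simp: q_def)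
  have "((1 - q\<^sup>2)\<^sup>2 - 4 * q\<^sup>2) * (\<Sum>x\<le>n. real (n choose x) * (h x)\<^sup>2)
    \<le> (\<Sum>x\<le>n. real (n choose x) * ((h x + h (x + 2))\<^sup>2 - 4 * (h (x + 1))\<^sup>2))"
  proof (rule shifted_form_lower[where p = p])
    show "real (n choose x) \<le> q\<^sup>2 * real (n choose (x + 1))" if "x < p" for x
      using binomial_ratio[of x n] that n unfolding q(1) by simp
  qed (use q n supp in auto)
  moreover have "0 \<le> ((1 - q\<^sup>2)\<^sup>2 - 4 * q\<^sup>2) * (\<Sum>x\<le>n. real (n choose x) * (h x)\<^sup>2)"
    unfolding q(1) by (intro mult_nonneg_nonneg sum_nonneg) (auto simp: power2_eq_square)
  ultimately have pos: "0 \<le> (\<Sum>x\<le>n. real (n choose x) * ((h x + h (x + 2))\<^sup>2 - 4 * (h (x + 1))\<^sup>2))"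
    by linarith
  have "(\<Sum>s\<le>n. real (n choose s) * (H (s + 2) * H s)) =
      (\<Sum>s\<le>n. real (n choose s) * ((\<Sum>x\<le>n. ((h x + h (x + 2)) - 2 * h (x + 1)) * kraw n x s) *
         (\<Sum>x\<le>n. ((h x + h (x + 2)) + 2 * h (x + 1)) * kraw n x s)))"
  proof (rule sum.cong[OF refl])
    fix s assume "s \<in> {..n}"
    hence s: "s \<le> n" by simp
    have "h x = 0" if "n < x" for x using that supp n by simp
    from kraw_sum_Suc_Suc[OF s this] show "real (n choose s) * (H (s + 2) * H s) =
      real (n choose s) * ((\<Sum>x\<le>n. ((h x + h (x + 2)) - 2 * h (x + 1)) * kraw n x s) *
         (\<Sum>x\<le>n. ((h x + h (x + 2)) + 2 * h (x + 1)) * kraw n x s))"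
      unfolding H_def by simp
  qed
  also have "\<dots> = 2 ^ n * (\<Sum>x\<le>n. real (n choose x) * (((h x + h (x + 2)) - 2 * h (x + 1)) * ((h x + h (x + 2)) + 2 * h (x + 1))))"
    by (rule kraw_parseval)
  also have "\<dots> = 2 ^ n * (\<Sum>x\<le>n. real (n choose x) * ((h x + h (x + 2))\<^sup>2 - 4 * (h (x + 1))\<^sup>2))"
    by (simp add: power2_eq_square algebra_simps)
  finally show ?thesis using pos by simp
qed

section \<open>Positivity with an additional quadratic factor\<close>

lemma binomial_succ_absorb: "real (x + 1) * real (n choose (x + 1)) = (real n - real x) * real (n choose x)"
proof (cases "x \<le> n")
  case True
  have "real ((x + 1) * (n choose (x + 1))) = real ((n - x) * (n choose x))"
    using binomial_absorb_comp[of n x] binomial_absorption[of x "n - 1"]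
    by (metis Suc_eq_plus1 binomial_absorption)
  thus ?thesis using True by (simp only: of_nat_mult of_nat_diff)
next
  case False
  thus ?thesis by (simp add: binomial_eq_0)
qed

text \<open>This and the next lemma are summation by parts for the binomial weight; they bring the
  squares of the two halves of the operator \<open>V\<close> below back to the point
  \<open>x\<close>.\<close>

lemma sum_raise:
  fixes P :: "nat \<Rightarrow> real"
  shows "(\<Sum>x\<le>n. real (n choose x) * ((real x)\<^sup>2 * P (x - 1))) =
    (\<Sum>x\<le>n. real (n choose x) * ((real x + 1) * (real n - real x) * P x))"
proof -
  have e: "real (n choose (x + 1)) * ((real (x + 1))\<^sup>2 * P x) = real (n choose x) * ((real x + 1) * (real n - real x) * P x)" for x
  proof -
    have "real (n choose (x + 1)) * ((real (x + 1))\<^sup>2 * P x) = (real (x + 1) * real (n choose (x + 1))) * (real (x + 1) * P x)"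
      by (simp only: power2_eq_square mult_ac)
    also have "\<dots> = real (n choose x) * ((real x + 1) * (real n - real x) * P x)"
      unfolding binomial_succ_absorb by (simp add: algebra_simps)
    finally show ?thesis .
  qed
  have "(\<Sum>x\<le>n. real (n choose x) * ((real x)\<^sup>2 * P (x - 1))) = (\<Sum>x<n. real (n choose (x + 1)) * ((real (x + 1))\<^sup>2 * P x))"
    by (subst sum.atMost_shift) simp
  also have "\<dots> = (\<Sum>x<n. real (n choose x) * ((real x + 1) * (real n - real x) * P x))"
    by (simp only: e)
  also have "\<dots> = (\<Sum>x\<le>n. real (n choose x) * ((real x + 1) * (real n - real x) * P x))"
    by (simp add: lessThan_Suc_atMost[symmetric])
  finally show ?thesis .
qed

lemma sum_lower:
  fixes P :: "nat \<Rightarrow> real"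
  shows "(\<Sum>x\<le>n. real (n choose x) * ((real n - real x)\<^sup>2 * P (x + 1))) =
    (\<Sum>x\<le>n. real (n choose x) * (real x * (real n - real x + 1) * P x))"
proof -
  have e: "real (n choose x) * ((real n - real x)\<^sup>2 * P (x + 1)) =
      real (n choose (x + 1)) * (real (x + 1) * (real n - real (x + 1) + 1) * P (x + 1))" for x
  proof -
    have "real (n choose x) * ((real n - real x)\<^sup>2 * P (x + 1)) = ((real n - real x) * real (n choose x)) * ((real n - real x) * P (x + 1))"
      by (simp only: power2_eq_square mult_ac)
    also have "\<dots> = real (n choose (x + 1)) * (real (x + 1) * (real n - real (x + 1) + 1) * P (x + 1))"
      unfolding binomial_succ_absorb[symmetric] by (simp add: algebra_simps)
    finally show ?thesis .
  qed
  have "(\<Sum>x\<le>n. real (n choose x) * ((real n - real x)\<^sup>2 * P (x + 1))) =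
      (\<Sum>x<n. real (n choose x) * ((real n - real x)\<^sup>2 * P (x + 1)))"
    by (simp add: lessThan_Suc_atMost[symmetric])
  also have "\<dots> = (\<Sum>x<n. real (n choose (x + 1)) * (real (x + 1) * (real n - real (x + 1) + 1) * P (x + 1)))"
    by (simp only: e)
  also have "\<dots> = (\<Sum>x\<le>n. real (n choose x) * (real x * (real n - real x + 1) * P x))"
    by (subst sum.atMost_shift) simp
  finally show ?thesis .
qed

text \<open>On coefficients, multiplication by \<open>n - 2 * s\<close> is the operator
  \<open>V\<close>. Its form is a diagonal form minus that of the difference operator
  \<open>Y\<close>, so the additional factor contributes the weights \<open>\<Delta>\<close> and a
  remainder treated in \<open>Y_form_lower\<close>. In \<open>gap\<close> the term
  \<open>24 * n\<close> gives \<open>\<Delta> x \<le> 7/6 * \<Delta> (x + 1)\<close>, hence weights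
  growing by the factor 6. As (1 - 1/6)^2 - 4/6 = 1/36, the constant 41616 = 36 * 1156 pays for the
  remainder.\<close>

lemma shifted_product_edge_nonneg:
  assumes n: "8 * p + 15 \<le> n" and supp: "\<And>x. p < x \<Longrightarrow> h x = 0"
    and gap: "\<And>x. x \<le> p \<Longrightarrow> 24 * real n + 41616 \<le> \<Lambda>\<^sup>2 - 4 * real x * (real n - real x) - 2 * real n"
  defines "H \<equiv> \<lambda>s. \<Sum>x\<le>n. h x * kraw (n + 2) x s"
  shows "0 \<le> (\<Sum>s\<le>n. real (n choose s) * ((\<Lambda>\<^sup>2 - (real n - 2 * real s)\<^sup>2) * (H (s + 2) * H s)))"
proof -
  define A where "A x = h x + h (x + 2)" for x
  define B where "B x = h (x + 1)" for x
  define F where "F x = A x + 2 * B x" for x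
  define G where "G x = A x - 2 * B x" for x
  define V where "V f x = real x * f (x - 1) + (real n - real x) * f (x + 1)" for f and x :: nat
  define Y where "Y f x = real x * f (x - 1) - (real n - real x) * f (x + 1)" for f and x :: nat
  define \<Delta> where "\<Delta> x = \<Lambda>\<^sup>2 - 4 * real x * (real n - real x) - 2 * real n" for x :: nat
  define C where "C x = real (n choose x)" for x
  have Hs: "H s = (\<Sum>x\<le>n. F x * kraw n x s)" "H (s + 2) = (\<Sum>x\<le>n. G x * kraw n x s)" if "s \<le> n" for s
    unfolding H_def F_def G_def A_def B_def by (rule kraw_sum_Suc_Suc; use that supp n in auto)+
  have Vs: "(real n - 2 * real s) * H s = (\<Sum>x\<le>n. V F x * kraw n x s)"
      "(real n - 2 * real s) * H (s + 2) = (\<Sum>x\<le>n. V G x * kraw n x s)" if "s \<le> n" for s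
    unfolding Hs[OF that] V_def by (rule kraw_sum_mult[OF that])+
  have "(\<Sum>s\<le>n. real (n choose s) * ((\<Lambda>\<^sup>2 - (real n - 2 * real s)\<^sup>2) * (H (s + 2) * H s))) =
      \<Lambda>\<^sup>2 * (\<Sum>s\<le>n. real (n choose s) * ((\<Sum>x\<le>n. G x * kraw n x s) * (\<Sum>x\<le>n. F x * kraw n x s))) -
      (\<Sum>s\<le>n. real (n choose s) * ((\<Sum>x\<le>n. V G x * kraw n x s) * (\<Sum>x\<le>n. V F x * kraw n x s)))"
    unfolding sum_distrib_left[where r = "\<Lambda>\<^sup>2"] sum_subtractf[symmetric]
  proof (rule sum.cong[OF refl])
    fix s assume "s \<in> {..n}"
    hence s: "s \<le> n" by simp
    show "real (n choose s) * ((\<Lambda>\<^sup>2 - (real n - 2 * real s)\<^sup>2) * (H (s + 2) * H s)) =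
        \<Lambda>\<^sup>2 * (real (n choose s) * ((\<Sum>x\<le>n. G x * kraw n x s) * (\<Sum>x\<le>n. F x * kraw n x s))) -
        real (n choose s) * ((\<Sum>x\<le>n. V G x * kraw n x s) * (\<Sum>x\<le>n. V F x * kraw n x s))"
      unfolding Hs[OF s, symmetric] Vs[OF s, symmetric] by (simp add: power2_eq_square algebra_simps)
  qed
  also have "\<dots> = 2 ^ n * (\<Lambda>\<^sup>2 * (\<Sum>x\<le>n. C x * (G x * F x)) - (\<Sum>x\<le>n. C x * (V G x * V F x)))"
    unfolding kraw_parseval C_def by (simp add: right_diff_distrib)
  \<comment> \<open>The parallelogram law in polarized form: \<open>V\<close> and \<open>Y\<close>
    are the sum and the difference of the same two terms.\<close>
  also have "(\<Sum>x\<le>n. C x * (V G x * V F x)) =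
      2 * (\<Sum>x\<le>n. C x * ((real x)\<^sup>2 * (G (x - 1) * F (x - 1)))) +
      2 * (\<Sum>x\<le>n. C x * ((real n - real x)\<^sup>2 * (G (x + 1) * F (x + 1)))) - (\<Sum>x\<le>n. C x * (Y G x * Y F x))"
    unfolding sum_distrib_left sum.distrib[symmetric] sum_subtractf[symmetric]
    by (rule sum.cong[OF refl]) (simp add: V_def Y_def power2_eq_square algebra_simps)
  also have "(\<Sum>x\<le>n. C x * ((real x)\<^sup>2 * (G (x - 1) * F (x - 1)))) =
      (\<Sum>x\<le>n. C x * ((real x + 1) * (real n - real x) * (G x * F x)))"
    unfolding C_def using sum_raise[of n "\<lambda>x. G x * F x"] by simp
  also have "(\<Sum>x\<le>n. C x * ((real n - real x)\<^sup>2 * (G (x + 1) * F (x + 1)))) =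
      (\<Sum>x\<le>n. C x * (real x * (real n - real x + 1) * (G x * F x)))"
    unfolding C_def using sum_lower[of n "\<lambda>x. G x * F x"] by simp
  also have "\<Lambda>\<^sup>2 * (\<Sum>x\<le>n. C x * (G x * F x)) -
      (2 * (\<Sum>x\<le>n. C x * ((real x + 1) * (real n - real x) * (G x * F x))) +
       2 * (\<Sum>x\<le>n. C x * (real x * (real n - real x + 1) * (G x * F x))) - (\<Sum>x\<le>n. C x * (Y G x * Y F x)))
      = (\<Sum>x\<le>n. C x * \<Delta> x * ((A x)\<^sup>2 - 4 * (B x)\<^sup>2)) + (\<Sum>x\<le>n. C x * ((Y A x)\<^sup>2 - 4 * (Y B x)\<^sup>2))"
    unfolding sum_distrib_left sum.distrib[symmetric] sum_subtractf[symmetric]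
    by (rule sum.cong[OF refl]) (simp add: F_def G_def Y_def \<Delta>_def power2_eq_square algebra_simps)
  finally have main: "(\<Sum>s\<le>n. real (n choose s) * ((\<Lambda>\<^sup>2 - (real n - 2 * real s)\<^sup>2) * (H (s + 2) * H s))) =
      2 ^ n * ((\<Sum>x\<le>n. C x * \<Delta> x * ((A x)\<^sup>2 - 4 * (B x)\<^sup>2)) + (\<Sum>x\<le>n. C x * ((Y A x)\<^sup>2 - 4 * (Y B x)\<^sup>2)))" .
  define T where "T = (\<Sum>x\<le>n. C x * (h x)\<^sup>2)"
  have T: "0 \<le> T" by (auto simp: T_def C_def intro!: sum_nonneg)
  have gap': "24 * real n + 41616 \<le> \<Delta> x" if "x \<le> p" for x
    using gap[OF that] by (simp add: \<Delta>_def)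
  have Ypart: "- 1156 * T \<le> (\<Sum>x\<le>n. C x * ((Y A x)\<^sup>2 - 4 * (Y B x)\<^sup>2))"
    unfolding T_def C_def Y_def A_def B_def using Y_form_lower[OF n supp] by simp
  define \<omega> where "\<omega> x = (if x \<le> p then C x * \<Delta> x else 0)" for x
  have \<omega>0: "0 \<le> \<omega> x" for x using gap'[of x] by (auto simp: \<omega>_def C_def)
  have "((1 - (sqrt (1/6))\<^sup>2)\<^sup>2 - 4 * (sqrt (1/6))\<^sup>2) * (\<Sum>x\<le>n. \<omega> x * (h x)\<^sup>2)
    \<le> (\<Sum>x\<le>n. \<omega> x * ((h x + h (x + 2))\<^sup>2 - 4 * (h (x + 1))\<^sup>2))"
  proof (rule shifted_form_lower[where p = p])
    fix x assume x: "x < p"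
    have "\<Delta> x = \<Delta> (x + 1) + 4 * (real n - 2 * real x - 1)" by (simp add: \<Delta>_def algebra_simps)
    hence "\<Delta> x \<le> 7/6 * \<Delta> (x + 1)" using gap'[of "x + 1"] x by simp
    moreover have "C x \<le> C (x + 1) / 7" unfolding C_def by (rule binomial_ratio) (use x n in simp)
    ultimately have "C x * \<Delta> x \<le> (C (x + 1) / 7) * (7/6 * \<Delta> (x + 1))"
      using gap'[of x] x by (intro mult_mono) (auto simp: C_def)
    thus "\<omega> x \<le> (sqrt (1/6))\<^sup>2 * \<omega> (x + 1)" using x by (simp add: \<omega>_def)
  qed (use \<omega>0 supp n in \<open>auto simp: real_sqrt_le_1_iff\<close>)
  moreover have "(\<Sum>x\<le>n. \<omega> x * ((h x + h (x + 2))\<^sup>2 - 4 * (h (x + 1))\<^sup>2)) = (\<Sum>x\<le>n. C x * \<Delta> x * ((A x)\<^sup>2 - 4 * (B x)\<^sup>2))"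
    by (rule sum.cong) (auto simp: \<omega>_def A_def B_def supp)
  moreover have "41616 * T \<le> (\<Sum>x\<le>n. \<omega> x * (h x)\<^sup>2)"
    unfolding T_def sum_distrib_left
  proof (rule sum_mono)
    fix x
    show "41616 * (C x * (h x)\<^sup>2) \<le> \<omega> x * (h x)\<^sup>2"
    proof (cases "x \<le> p")
      case True
      have "41616 * (C x * (h x)\<^sup>2) \<le> \<Delta> x * (C x * (h x)\<^sup>2)"
        using gap'[OF True] by (intro mult_right_mono) (auto simp: C_def)
      thus ?thesis using True by (simp add: \<omega>_def mult_ac)
    qed (simp add: supp)
  qed
  ultimately have "1156 * T \<le> (\<Sum>x\<le>n. C x * \<Delta> x * ((A x)\<^sup>2 - 4 * (B x)\<^sup>2))"
    by (simp add: power2_eq_square)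
  with Ypart show ?thesis unfolding main by simp
qed


section \<open>Binary entropy and binomial coefficients\<close>

lemma bin_entropy_0 [simp]: "bin_entropy 0 = 0"
  by (simp add: bin_entropy_def)

lemma bin_entropy_1 [simp]: "bin_entropy 1 = 0"
  by (simp add: bin_entropy_def)

lemma bin_entropy_half [simp]: "bin_entropy (1/2) = 1"
  by (simp add: bin_entropy_def log_divide)

text \<open>Nonnegativity of the relative entropy of \<open>p\<close> with respect to
  \<open>\<theta>\<close>. The bound is affine in \<open>p\<close>, which makes it useful for
  numerical estimates as well.\<close>

lemma bin_entropy_gibbs:
  assumes "0 \<le> p" "p \<le> 1" "0 < \<theta>" "\<theta> < 1"
  shows "bin_entropy p \<le> - p * log 2 \<theta> - (1 - p) * log 2 (1 - \<theta>)"
proof -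
  have *: "x * ln y - x * ln x \<le> y - x" if "0 \<le> x" "0 < y" for x y :: real
  proof (cases "x = 0")
    case False
    hence x: "0 < x" using that by simp
    have "x * ln (y / x) \<le> x * (y / x - 1)" using x that by (intro mult_left_mono ln_le_minus_one) auto
    thus ?thesis using x that by (simp add: ln_div right_diff_distrib)
  qed (use that in simp)
  have "p * ln \<theta> - p * ln p + ((1 - p) * ln (1 - \<theta>) - (1 - p) * ln (1 - p)) \<le> 0"
    using *[of p \<theta>] *[of "1 - p" "1 - \<theta>"] assms by linarith
  hence "(p * ln \<theta> - p * ln p + ((1 - p) * ln (1 - \<theta>) - (1 - p) * ln (1 - p))) / ln 2 \<le> 0"
    by (simp add: divide_nonpos_pos)
  thus ?thesis unfolding bin_entropy_def log_def by (simp add: add_divide_distrib diff_divide_distrib)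
qed

lemma bin_entropy_le_1: "0 \<le> p \<Longrightarrow> p \<le> 1 \<Longrightarrow> bin_entropy p \<le> 1"
  using bin_entropy_gibbs[of p "1/2"] by (simp add: log_divide)

lemma bin_entropy_nonneg:
  assumes "0 \<le> p" "p \<le> 1"
  shows "0 \<le> bin_entropy p"
proof -
  have "x * log 2 x \<le> 0" if "0 \<le> x" "x \<le> 1" for x :: real
    using that by (cases "x = 0") (auto intro!: mult_nonneg_nonpos)
  from this[of p] this[of "1 - p"] assms show ?thesis by (simp add: bin_entropy_def)
qed

text \<open>Serves the case \<beta> > 2 of the second bound, where \<open>\<beta> / 2\<close> lies
  outside the unit interval. The logarithm of a negative number is here that of its absolute
  value.\<close>

lemma bin_entropy_le_1_ge_1:
  assumes "1 \<le> p"
  shows "bin_entropy p \<le> 1"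
proof (cases "p = 1")
  case False
  hence p: "1 < p" using assms by simp
  have l: "ln (1 - p) = ln (p - 1)" using ln_minus[of "p - 1"] by simp
  have "(p - 1) * ln (p - 1) \<le> (p - 1) * ln p"
    using p by (intro mult_left_mono) auto
  also have "\<dots> \<le> p * ln p" using p by (intro mult_right_mono) auto
  finally have "- p * ln p - (1 - p) * ln (1 - p) \<le> 0" unfolding l by (simp add: algebra_simps)
  hence "(- p * ln p - (1 - p) * ln (1 - p)) / ln 2 \<le> 0" by (simp add: divide_nonpos_pos)
  hence "bin_entropy p \<le> 0" by (simp add: bin_entropy_def log_def diff_divide_distrib)
  thus ?thesis by simp
qed simp

lemma continuous_on_x_ln_x: "continuous_on {0..} (\<lambda>x::real. x * ln x)"
  unfolding continuous_on_def
proof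
  fix x :: real assume x: "x \<in> {0..}"
  show "((\<lambda>x. x * ln x) \<longlongrightarrow> x * ln x) (at x within {0..})"
  proof (cases "x = 0")
    case True
    have "((\<lambda>x::real. x * ln x) \<longlongrightarrow> 0) (at_right 0)" by real_asymp
    moreover have "at (0::real) within {0..} = at_right 0"
      by (rule at_within_nhd[of _ UNIV]) auto
    ultimately show ?thesis using True by simp
  next
    case False
    hence "isCont (\<lambda>x. x * ln x) x" by (intro continuous_intros) auto
    thus ?thesis unfolding isCont_def by (rule tendsto_within_subset) simp
  qed
qed

lemma continuous_on_bin_entropy: "continuous_on {0..1} bin_entropy"
proof -
  have a: "continuous_on {0..1} (\<lambda>x::real. x * ln x)"
    by (rule continuous_on_subset[OF continuous_on_x_ln_x]) auto
  have b: "continuous_on {0..1} (\<lambda>x::real. (1 - x) * ln (1 - x))"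
    by (rule continuous_on_compose2[OF continuous_on_x_ln_x]) (auto intro!: continuous_intros)
  have eq: "bin_entropy = (\<lambda>x. - (x * ln x) / ln 2 - ((1 - x) * ln (1 - x)) / ln 2)"
    by (auto simp: bin_entropy_def log_def)
  show ?thesis unfolding eq by (intro continuous_intros a b) auto
qed

text \<open>The source of uniformity in \<alpha>, \<beta>, \<open>a\<close> and \<open>b\<close>
  throughout the asymptotic part.\<close>

lemma bin_entropy_uniform:
  assumes "0 < e"
  obtains d where "0 < d"
    "\<And>x y. x \<in> {0..1} \<Longrightarrow> y \<in> {0..1} \<Longrightarrow> \<bar>x - y\<bar> < d \<Longrightarrow> \<bar>bin_entropy x - bin_entropy y\<bar> < e"
proof -
  have "uniformly_continuous_on {0..1} bin_entropy"
    by (rule compact_uniformly_continuous[OF continuous_on_bin_entropy]) simp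
  thus ?thesis using assms that unfolding uniformly_continuous_on_def dist_real_def
    by (metis abs_minus_commute)
qed

section \<open>Entropy bounds for binomial coefficients\<close>

lemma power_eq_powr_entropy:
  assumes "0 < j" "j < n"
  defines "p \<equiv> real j / real n"
  shows "p ^ j * (1 - p) ^ (n - j) = 2 powr (- (real n * bin_entropy p))"
proof -
  have p: "0 < p" "p < 1" "real j = real n * p" "real (n - j) = real n * (1 - p)"
    using assms by (auto simp: p_def field_simps of_nat_diff)
  have "p ^ j * (1 - p) ^ (n - j) = 2 powr (real j * log 2 p) * 2 powr (real (n - j) * log 2 (1 - p))"
  proof -
    have "x ^ i = 2 powr (real i * log 2 x)" if "0 < x" for x :: real and i :: nat
    proof -
      have "2 powr (real i * log 2 x) = (2 powr log 2 x) powr real i" by (simp add: powr_powr mult.commute)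
      thus ?thesis using that by (simp add: powr_realpow)
    qed
    thus ?thesis using p by simp
  qed
  also have "\<dots> = 2 powr (real n * (p * log 2 p) + real n * ((1 - p) * log 2 (1 - p)))"
    by (simp add: powr_add p(3,4) mult.assoc)
  also have "real n * (p * log 2 p) + real n * ((1 - p) * log 2 (1 - p)) = - (real n * bin_entropy p)"
    by (simp add: bin_entropy_def algebra_simps)
  finally show ?thesis .
qed

text \<open>The binomial distribution with mean \<open>j\<close> has its mode at \<open>j\<close>:
  the quotient of neighbouring terms passes 1 there.\<close>

lemma binomial_max_term:
  assumes "0 < j" "j < n" "i \<le> n"
  defines "p \<equiv> real j / real n"
  shows "real (n choose i) * p ^ i * (1 - p) ^ (n - i) \<le> real (n choose j) * p ^ j * (1 - p) ^ (n - j)"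
proof -
  define T where "T i = real (n choose i) * p ^ i * (1 - p) ^ (n - i)" for i
  have p: "0 < p" "p < 1" using assms by (auto simp: p_def)
  have nz: "0 < real n" using assms by simp
  have p_eq: "x * p = x * real j / real n" "x * (1 - p) = x * (real n - real j) / real n" for x
    using nz by (simp_all add: p_def diff_divide_distrib right_diff_distrib)
  have T0: "0 \<le> T i" for i using p by (simp add: T_def)
  have step: "T (i + 1) * (real (i + 1) * (1 - p)) = T i * (real (n - i) * p)" if "i < n" for i
  proof -
    have "Suc i * (n choose Suc i) = (n - i) * (n choose i)"
      using binomial_absorb_comp[of n i] binomial_absorption[of i "n - 1"] by (metis binomial_absorption)
    hence "real (i + 1) * real (n choose (i + 1)) = real (n - i) * real (n choose i)"
      by (metis Suc_eq_plus1 of_nat_mult)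
    moreover have "n - i = Suc (n - (i + 1))" using that by simp
    ultimately have "T (i + 1) * (real (i + 1) * (1 - p)) = (real (n - i) * real (n choose i)) * (p * p ^ i) * ((1 - p) * (1 - p) ^ (n - (i + 1)))"
      by (simp add: T_def mult_ac)
    also have "(1 - p) * (1 - p) ^ (n - (i + 1)) = (1 - p) ^ (n - i)"
      using \<open>n - i = Suc (n - (i + 1))\<close> by simp
    finally show ?thesis by (simp add: T_def mult_ac)
  qed
  have up: "T i \<le> T (i + 1)" if "i < j" for i
  proof -
    have "real (i + 1) * (1 - p) \<le> real (n - i) * p"
    proof -
      have "real n * (real i + 1) \<le> real n * real j" using that by (intro mult_left_mono) auto
      hence "real (i + 1) * (real n - real j) \<le> (real n - real i) * real j" by (simp add: algebra_simps)
      hence "real (i + 1) * (real n - real j) / real n \<le> (real n - real i) * real j / real n"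
        by (rule divide_right_mono) simp
      thus ?thesis using nz that assms(2) by (simp add: p_eq of_nat_diff)
    qed
    hence "T i * (real (i + 1) * (1 - p)) \<le> T i * (real (n - i) * p)"
      by (rule mult_left_mono) (rule T0)
    also have "\<dots> = T (i + 1) * (real (i + 1) * (1 - p))" by (rule step[symmetric]) (use that assms(2) in simp)
    finally have "T i * (real (i + 1) * (1 - p)) \<le> T (i + 1) * (real (i + 1) * (1 - p))" .
    thus ?thesis using p by (subst (asm) mult_le_cancel_right_pos) auto
  qed
  have down: "T (i + 1) \<le> T i" if "j \<le> i" "i < n" for i
  proof -
    have "real (n - i) * p \<le> real (i + 1) * (1 - p)"
    proof -
      have "real n * real j \<le> real n * real i" "real j \<le> real n" using that assms(2) by (auto intro: mult_left_mono)
      moreover have "(real n - real i) * real j = real n * real j - real i * real j"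
        "real (i + 1) * (real n - real j) = real n * real i + real n - real i * real j - real j"
        by (simp_all add: algebra_simps)
      ultimately have "(real n - real i) * real j \<le> real (i + 1) * (real n - real j)" by linarith
      hence "(real n - real i) * real j / real n \<le> real (i + 1) * (real n - real j) / real n"
        by (rule divide_right_mono) simp
      thus ?thesis using nz that assms(2) by (simp add: p_eq of_nat_diff)
    qed
    hence "T i * (real (n - i) * p) \<le> T i * (real (i + 1) * (1 - p))"
      by (rule mult_left_mono) (rule T0)
    hence "T (i + 1) * (real (i + 1) * (1 - p)) \<le> T i * (real (i + 1) * (1 - p))"
      by (simp only: step[OF that(2)])
    thus ?thesis using p by (subst (asm) mult_le_cancel_right_pos) auto
  qed
  have "T i \<le> T j"
  proof (cases "i \<le> j")
    case True
    thus ?thesis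
    proof (induction rule: inc_induct)
      case (step k)
      have "T k \<le> T (k + 1)" using step by (intro up) auto
      thus ?case using step by simp
    qed simp
  next
    case False
    hence "j \<le> i" by simp
    thus ?thesis using assms(3)
    proof (induction rule: dec_induct)
      case (step k)
      have "T (k + 1) \<le> T k" using step by (intro down) auto
      moreover have "T k \<le> T j" using step by auto
      ultimately show ?case by simp
    qed simp
  qed
  thus ?thesis by (simp add: T_def)
qed

text \<open>For p = j/n the probability of \<open>j\<close> is \<open>n choose j\<close> divided by
  the power of 2 in question. It is at most 1 and, being the largest of \<open>n + 1\<close>
  probabilities, at least \<open>1 / (n + 1)\<close>.\<close>

lemma binomial_entropy_bounds:
  assumes "j \<le> n" "0 < n"
  shows "real (n choose j) \<le> 2 powr (real n * bin_entropy (real j / real n))"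
    and "2 powr (real n * bin_entropy (real j / real n)) \<le> (real n + 1) * real (n choose j)"
proof -
  define p where "p = real j / real n"
  have "real (n choose j) \<le> 2 powr (real n * bin_entropy p) \<and>
    2 powr (real n * bin_entropy p) \<le> (real n + 1) * real (n choose j)"
  proof (cases "j = 0 \<or> j = n")
    case True
    thus ?thesis using assms by (auto simp: p_def)
  next
    case False
    hence j: "0 < j" "j < n" using assms by auto
    have p: "0 \<le> p" "p \<le> 1" using assms by (auto simp: p_def)
    let ?T = "\<lambda>i. real (n choose i) * p ^ i * (1 - p) ^ (n - i)"
    have s1: "(\<Sum>i\<le>n. ?T i) = 1" using binomial_ring[of p "1 - p" n] by simp
    define E where "E = 2 powr (real n * bin_entropy p)"
    have E: "0 < E" "2 powr (- (real n * bin_entropy p)) = 1 / E" by (auto simp: E_def powr_minus divide_inverse)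
    have Tj: "?T j = real (n choose j) / E"
      using power_eq_powr_entropy[OF j] E unfolding p_def[symmetric] by (simp add: mult.assoc)
    have "?T j \<le> (\<Sum>i\<le>n. ?T i)" by (rule member_le_sum) (use j p in auto)
    hence "real (n choose j) / E \<le> 1" unfolding Tj s1 .
    hence a: "real (n choose j) \<le> E" using E by simp
    have "(\<Sum>i\<le>n. ?T i) \<le> (\<Sum>i\<le>n. ?T j)"
      using binomial_max_term[OF j] unfolding p_def[symmetric] by (intro sum_mono) auto
    hence "1 \<le> (real n + 1) * ?T j" unfolding s1 by (simp add: add.commute)
    hence "1 \<le> (real n + 1) * real (n choose j) / E" unfolding Tj by simp
    hence "E \<le> (real n + 1) * real (n choose j)" using E by simp
    with a show ?thesis by (simp add: E_def)
  qed
  thus "real (n choose j) \<le> 2 powr (real n * bin_entropy (real j / real n))"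
    "2 powr (real n * bin_entropy (real j / real n)) \<le> (real n + 1) * real (n choose j)"
    by (auto simp: p_def)
qed

lemma bin_entropy_sym: "bin_entropy (1 - x) = bin_entropy x"
  by (simp add: bin_entropy_def algebra_simps)

lemma ln_le_cubic:
  assumes "0 \<le> (u::real)"
  shows "ln (1 + u) \<le> u - u\<^sup>2 / 2 + u ^ 3 / 3"
proof -
  have "0 \<le> (u - u\<^sup>2 / 2 + u ^ 3 / 3) - ln (1 + u)"
  proof (rule DERIV_nonneg_imp_nondecreasing[OF assms, of "\<lambda>u. (u - u\<^sup>2 / 2 + u ^ 3 / 3) - ln (1 + u)", THEN order_trans[rotated]])
    fix x assume x: "0 \<le> x" "x \<le> u"
    have "((\<lambda>u. (u - u\<^sup>2 / 2 + u ^ 3 / 3) - ln (1 + u)) has_real_derivative (1 - x + x\<^sup>2 - 1 / (1 + x))) (at x)"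
      using x by (auto intro!: derivative_eq_intros simp: power2_eq_square)
    moreover have "1 - x + x\<^sup>2 - 1 / (1 + x) = x ^ 3 / (1 + x)"
      using x by (simp add: field_simps power2_eq_square power3_eq_cube)
    moreover have "0 \<le> x ^ 3 / (1 + x)" using x by simp
    ultimately show "\<exists>y. ((\<lambda>u. (u - u\<^sup>2 / 2 + u ^ 3 / 3) - ln (1 + u)) has_real_derivative y) (at x) \<and> 0 \<le> y"
      by auto
  qed simp
  thus ?thesis by simp
qed

lemma ln_le_quadratic_neg:
  assumes "0 \<le> (u::real)" "u < 1"
  shows "ln (1 - u) \<le> - u - u\<^sup>2 / 2"
proof -
  have "0 \<le> (- u - u\<^sup>2 / 2) - ln (1 - u)"
  proof (rule DERIV_nonneg_imp_nondecreasing[OF assms(1), of "\<lambda>u. (- u - u\<^sup>2 / 2) - ln (1 - u)", THEN order_trans[rotated]])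
    fix x assume x: "0 \<le> x" "x \<le> u"
    have "((\<lambda>u. (- u - u\<^sup>2 / 2) - ln (1 - u)) has_real_derivative (- 1 - x + 1 / (1 - x))) (at x)"
      using x assms by (auto intro!: derivative_eq_intros simp: power2_eq_square)
    moreover have "- 1 - x + 1 / (1 - x) = x\<^sup>2 / (1 - x)"
      using x assms by (simp add: field_simps power2_eq_square)
    moreover have "0 \<le> x\<^sup>2 / (1 - x)" using x assms by simp
    ultimately show "\<exists>y. ((\<lambda>u. (- u - u\<^sup>2 / 2) - ln (1 - u)) has_real_derivative y) (at x) \<and> 0 \<le> y"
      by auto
  qed simp
  thus ?thesis by simp
qed

text \<open>Taylor bounds for the logarithm leave the factor 1/2 + u/6 + u^2/6. At u = 2/3 it equals
  37/54, just below ln 2, whence the range of \<open>u\<close>.\<close>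

lemma entropy_quadratic:
  assumes "0 \<le> u" "u \<le> 2/3"
  shows "1 - bin_entropy ((1 - u) / 2) \<le> u\<^sup>2"
proof -
  have ln2: "37/54 \<le> ln (2::real)"
    using ln_approx_bounds[of 2 2, simplified, simplified eval_nat_numeral, simplified] by simp
  have "(1 - bin_entropy ((1 - u) / 2)) * ln 2 = ((1 + u) * ln (1 + u) + (1 - u) * ln (1 - u)) / 2"
  proof -
    have e: "1 - (1 - u) / 2 = (1 + u) / 2" by (simp add: field_simps)
    have "bin_entropy ((1 - u) / 2) * ln 2 = - ((1 - u) / 2) * ln ((1 - u) / 2) - ((1 + u) / 2) * ln ((1 + u) / 2)"
      unfolding bin_entropy_def e log_def by (simp add: field_simps)
    also have "\<dots> = - ((1 - u) / 2) * (ln (1 - u) - ln 2) - ((1 + u) / 2) * (ln (1 + u) - ln 2)"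
      using assms by (simp add: ln_div)
    finally show ?thesis by (simp add: field_simps)
  qed
  also have "\<dots> \<le> ((1 + u) * (u - u\<^sup>2 / 2 + u ^ 3 / 3) + (1 - u) * (- u - u\<^sup>2 / 2)) / 2"
    using assms ln_le_cubic[of u] ln_le_quadratic_neg[of u]
    by (intro divide_right_mono add_mono mult_left_mono) auto
  also have "\<dots> = u\<^sup>2 * (1/2 + u / 6 + u\<^sup>2 / 6)"
    by (simp add: field_simps power2_eq_square power3_eq_cube)
  also have "\<dots> \<le> u\<^sup>2 * (37/54)"
  proof (rule mult_left_mono)
    have "u\<^sup>2 \<le> (2/3)\<^sup>2" using assms by (intro power_mono) auto
    thus "1/2 + u / 6 + u\<^sup>2 / 6 \<le> 37/54" using assms by (simp add: power2_eq_square)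
  qed simp
  also have "\<dots> \<le> u\<^sup>2 * ln 2" using ln2 by (intro mult_left_mono) auto
  finally show ?thesis by simp
qed


section \<open>Positive quadrature on even integers\<close>

lemma kraw_poly:
  "\<exists>P :: real poly. degree P \<le> x \<and> (\<forall>s\<le>n. poly P (real s) = kraw n x s)"
proof (induction x rule: induct_nat_012)
  case 0
  show ?case by (rule exI[of _ 1]) simp
next
  case 1
  show ?case
    by (rule exI[of _ "[:real n, -2:]"]) (use kraw_three_term[of _ n 0] in auto)
next
  case (ge2 x)
  then obtain P Q :: "real poly" where PQ: "degree P \<le> x" "degree Q \<le> Suc x"
      "\<forall>s\<le>n. poly P (real s) = kraw n x s" "\<forall>s\<le>n. poly Q (real s) = kraw n (Suc x) s" by auto
  let ?R = "smult (1 / real (x + 2)) ([:real n, -2:] * Q - smult (real n - real (x + 1) + 1) P)"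
  have "degree ([:real n, -2:] * Q) \<le> Suc (Suc x)"
    using degree_mult_le[of "[:real n, -2:]" Q] PQ by simp
  moreover have "degree (smult (real n - real (x + 1) + 1) P) \<le> Suc (Suc x)"
    using PQ by (intro order_trans[OF degree_smult_le]) simp
  ultimately have "degree ?R \<le> Suc (Suc x)"
    by (rule order_trans[OF degree_smult_le degree_diff_le])
  moreover have "poly ?R (real s) = kraw n (Suc (Suc x)) s" if "s \<le> n" for s
  proof -
    have "poly ?R (real s) = ((real n - 2 * real s) * kraw n (Suc x) s - (real n - real (x + 1) + 1) * kraw n x s) / real (x + 2)"
    proof -
      have e: "poly [:real n, -2:] (real s) = real n - 2 * real s" by simp
      show ?thesis unfolding poly_smult poly_diff poly_mult e using PQ that by simp
    qed
    also have "\<dots> = real (Suc x + 1) * kraw n (Suc x + 1) s / real (x + 2)"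
      unfolding kraw_three_term[OF that, of "Suc x"] by simp
    finally show ?thesis by simp
  qed
  ultimately show ?case by blast
qed

text \<open>Induction on the degree; by the recurrence, multiplication by the variable raises the
  highest Krawtchouk index by at most one.\<close>

lemma poly_kraw_expansion:
  fixes f :: "real poly"
  assumes "degree f \<le> m"
  shows "\<exists>h. (\<forall>x>m. h x = 0) \<and> (\<forall>s\<le>n. poly f (real s) = (\<Sum>x\<le>m. h x * kraw n x s))"
  using assms
proof (induction m arbitrary: f)
  case 0
  then obtain c where "f = [:c:]" by (auto elim: degree_eq_zeroE)
  thus ?case by (intro exI[of _ "\<lambda>x. if x = 0 then c else 0"]) auto
next
  case (Suc m)
  obtain c g where f: "f = pCons c g" by (cases f) auto
  have "degree g \<le> m" using Suc.prems f by (cases "g = 0") auto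
  from Suc.IH[OF this] obtain h where h: "\<forall>x>m. h x = 0"
      "\<forall>s\<le>n. poly g (real s) = (\<Sum>x\<le>m. h x * kraw n x s)" by auto
  define h' where "h' x = (if x = 0 then c else 0) + real n / 2 * h x
      - ((if x = 0 then 0 else real x * h (x - 1)) + (real n - real x) * h (x + 1)) / 2" for x
  have "poly f (real s) = (\<Sum>x\<le>Suc m. h' x * kraw n x s)" if s: "s \<le> n" for s
  proof -
    have k: "real s * kraw n x s = real n / 2 * kraw n x s -
        (real (x + 1) * kraw n (x + 1) s + (if x = 0 then 0 else (real n - real x + 1) * kraw n (x - 1) s)) / 2" for x
      using kraw_three_term[OF s, of x] by (simp add: field_simps)
    have "real s * poly g (real s) = (\<Sum>x\<le>m. h x * (real s * kraw n x s))"
      using h(2) s by (simp add: sum_distrib_left mult_ac)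
    also have "\<dots> = real n / 2 * (\<Sum>x\<le>m. h x * kraw n x s) - ((\<Sum>x\<le>m. real (x + 1) * h x * kraw n (x + 1) s) +
        (\<Sum>x\<le>m. ((real n - real x + 1) * h x) * (if x = 0 then 0 else kraw n (x - 1) s))) / 2"
      unfolding k sum_distrib_left sum.distrib[symmetric] sum_subtractf[symmetric] sum_divide_distrib
      by (rule sum.cong) (auto simp: algebra_simps)
    also have "(\<Sum>x\<le>m. ((real n - real x + 1) * h x) * (if x = 0 then 0 else kraw n (x - 1) s)) =
        (\<Sum>x\<le>m. ((real n - real (x + 1) + 1) * h (x + 1)) * kraw n x s)"
      by (rule sum_shift_down) (use h in auto)
    also have "\<dots> = (\<Sum>x\<le>Suc m. ((real n - real x) * h (x + 1)) * kraw n x s)"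
      using h by simp
    also have "(\<Sum>x\<le>m. real (x + 1) * h x * kraw n (x + 1) s) =
        (\<Sum>x\<le>Suc m. (if x = 0 then 0 else real x * h (x - 1)) * kraw n x s)"
      by (subst sum.atMost_Suc_shift) simp
    also have "(\<Sum>x\<le>m. h x * kraw n x s) = (\<Sum>x\<le>Suc m. h x * kraw n x s)" using h by simp
    finally have sg: "real s * poly g (real s) = real n / 2 * (\<Sum>x\<le>Suc m. h x * kraw n x s) -
        ((\<Sum>x\<le>Suc m. (if x = 0 then 0 else real x * h (x - 1)) * kraw n x s) +
         (\<Sum>x\<le>Suc m. ((real n - real x) * h (x + 1)) * kraw n x s)) / 2" .
    have "c = (\<Sum>x\<le>Suc m. (if x = 0 then c else 0) * kraw n x s)"
      by (subst sum.atMost_Suc_shift) simp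
    hence "poly f (real s) = (\<Sum>x\<le>Suc m. (if x = 0 then c else 0) * kraw n x s) + real s * poly g (real s)"
      by (simp add: f)
    also have "\<dots> = (\<Sum>x\<le>Suc m. h' x * kraw n x s)"
      unfolding sg sum_distrib_left sum.distrib[symmetric] sum_subtractf[symmetric] sum_divide_distrib
      by (rule sum.cong[OF refl]) (simp add: h'_def field_simps)
    finally show ?thesis .
  qed
  moreover have "\<forall>x>Suc m. h' x = 0" using h by (auto simp: h'_def)
  ultimately show ?case by blast
qed

text \<open>\<open>2 ^ n\<close> times the mean under the symmetric binomial distribution.\<close>

definition binsum :: "nat \<Rightarrow> real poly \<Rightarrow> real" where
  "binsum n p = (\<Sum>s\<le>n. real (n choose s) * poly p (real s))"

lemma binsum_add: "binsum n (p + q) = binsum n p + binsum n q"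
  by (simp add: binsum_def sum.distrib distrib_left)

lemma binsum_smult: "binsum n (smult c p) = c * binsum n p"
  by (simp add: binsum_def sum_distrib_left mult_ac)

text \<open>The product is \<open>f(s) * f(s + 2)\<close> for the polynomial \<open>f\<close> with
  zeros \<open>t + 2\<close>. Length \<open>n + 2\<close> makes both arguments admissible for all
  \<open>s \<le> n\<close>.\<close>

lemma pair_expansion:
  fixes T :: "nat set"
  assumes "finite T" "card T \<le> p" "p \<le> n"
  shows "\<exists>h. (\<forall>x>p. h x = 0) \<and> (\<forall>s\<le>n. (\<Prod>t\<in>T. (real s - real t) * (real s - real (t + 2))) =
     (\<Sum>x\<le>n. h x * kraw (n + 2) x (s + 2)) * (\<Sum>x\<le>n. h x * kraw (n + 2) x s))"
proof -
  define f :: "real poly" where "f = (\<Prod>t\<in>T. [:- real (t + 2), 1:])"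
  have "degree f \<le> card T"
    unfolding f_def using degree_prod_sum_le[OF assms(1), of "\<lambda>t. [:- real (t + 2), 1:]"] by simp
  hence "degree f \<le> p" using assms by simp
  from poly_kraw_expansion[OF this, of "n + 2"] obtain h where h: "\<forall>x>p. h x = 0"
    "\<forall>s\<le>n + 2. poly f (real s) = (\<Sum>x\<le>p. h x * kraw (n + 2) x s)" by auto
  have ext: "(\<Sum>x\<le>n. h x * kraw (n + 2) x s) = poly f (real s)" if "s \<le> n + 2" for s
    using h that assms by (subst sum.mono_neutral_right[of _ "{..p}"]) auto
  have "(\<Prod>t\<in>T. (real s - real t) * (real s - real (t + 2))) = poly f (real (s + 2)) * poly f (real s)" for s
    unfolding f_def poly_prod prod.distrib by (simp add: algebra_simps)
  thus ?thesis using h(1) ext by (intro exI[of _ h]) simp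
qed

lemma pair_sum_nonneg:
  assumes "finite (T :: nat set)" "8 * card T + 15 \<le> n"
  shows "0 \<le> (\<Sum>s\<le>n. real (n choose s) * (\<Prod>t\<in>T. (real s - real t) * (real s - real (t + 2))))"
proof -
  obtain h where h: "\<forall>x>card T. h x = 0" "\<forall>s\<le>n. (\<Prod>t\<in>T. (real s - real t) * (real s - real (t + 2))) =
     (\<Sum>x\<le>n. h x * kraw (n + 2) x (s + 2)) * (\<Sum>x\<le>n. h x * kraw (n + 2) x s)"
    using pair_expansion[OF assms(1) order_refl, of n] assms by auto
  show ?thesis using shifted_product_nonneg[of "card T" n h] assms h by simp
qed

lemma pair_edge_sum_nonneg:
  assumes "finite (T :: nat set)" "8 * card T + 15 \<le> n" "a \<le> n"
    and gap: "\<And>x. x \<le> card T \<Longrightarrow> 24 * real n + 41616 \<le>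
      (real n - 2 * real a)\<^sup>2 - 4 * real x * (real n - real x) - 2 * real n"
  shows "0 \<le> (\<Sum>s\<le>n. real (n choose s) * ((real s - real a) * (real (n - a) - real s) *
    (\<Prod>t\<in>T. (real s - real t) * (real s - real (t + 2)))))"
proof -
  obtain h where h: "\<forall>x>card T. h x = 0" "\<forall>s\<le>n. (\<Prod>t\<in>T. (real s - real t) * (real s - real (t + 2))) =
     (\<Sum>x\<le>n. h x * kraw (n + 2) x (s + 2)) * (\<Sum>x\<le>n. h x * kraw (n + 2) x s)"
    using pair_expansion[OF assms(1) order_refl, of n] assms by auto
  have "0 \<le> (\<Sum>s\<le>n. real (n choose s) * (((real n - 2 * real a)\<^sup>2 - (real n - 2 * real s)\<^sup>2) *
      (\<Prod>t\<in>T. (real s - real t) * (real s - real (t + 2)))))"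
    using shifted_product_edge_nonneg[of "card T" n h "real n - 2 * real a"] assms h by simp
  also have "\<dots> = (\<Sum>s\<le>n. 4 * (real (n choose s) * ((real s - real a) * (real (n - a) - real s) *
    (\<Prod>t\<in>T. (real s - real t) * (real s - real (t + 2))))))"
  proof (rule sum.cong[OF refl])
    fix s
    have "(real n - 2 * real a)\<^sup>2 - (real n - 2 * real s)\<^sup>2 = 4 * ((real s - real a) * (real (n - a) - real s))"
      using assms(3) by (simp add: power2_eq_square of_nat_diff algebra_simps)
    thus "real (n choose s) * (((real n - 2 * real a)\<^sup>2 - (real n - 2 * real s)\<^sup>2) *
      (\<Prod>t\<in>T. (real s - real t) * (real s - real (t + 2)))) = 4 * (real (n choose s) * ((real s - real a) * (real (n - a) - real s) *
    (\<Prod>t\<in>T. (real s - real t) * (real s - real (t + 2)))))" by simp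
  qed
  finally show ?thesis by (simp flip: sum_distrib_left)
qed

section \<open>Extreme nonnegative polynomials on an interval of even integers\<close>

definition evens :: "nat \<Rightarrow> nat \<Rightarrow> nat set" where
  "evens a b = {s. even s \<and> a \<le> s \<and> s \<le> b}"

lemma finite_evens [simp]: "finite (evens a b)"
  by (rule finite_subset[of _ "{..b}"]) (auto simp: evens_def)

text \<open>This is Gale's evenness condition. If the smallest zero \<open>t\<close> were not
  followed by \<open>t + 2\<close>, all zeros except \<open>t\<close>, an odd number, would lie
  above \<open>t + 2\<close>, which then is a node outside \<open>Z\<close> or lies beyond
  \<open>b\<close>; both are impossible. Remove the pair and continue. The conclusion speaks of
  arbitrary \<open>f\<close> so that products of linear factors can be rewritten directly.\<close>

lemma parity_pairing:
  assumes "Z \<subseteq> evens a b" "even (card Z)" "\<And>s. s \<in> evens a b - Z \<Longrightarrow> even (card {z\<in>Z. s < z})"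
  shows "\<exists>T. finite T \<and> 2 * card T = card Z \<and>
    (\<forall>f :: nat \<Rightarrow> real. (\<Prod>z\<in>Z. f z) = (\<Prod>t\<in>T. f t * f (t + 2)))"
  using assms
proof (induction "card Z" arbitrary: Z rule: less_induct)
  case less
  have fin: "finite Z" by (rule finite_subset[OF less.prems(1)]) simp
  show ?case
  proof (cases "Z = {}")
    case True
    thus ?thesis by (intro exI[of _ "{}"]) auto
  next
    case False
    define t where "t = Min Z"
    have t: "t \<in> Z" "\<And>z. z \<in> Z \<Longrightarrow> t \<le> z" using False fin by (auto simp: t_def)
    have ev: "\<And>z. z \<in> Z \<Longrightarrow> even z \<and> a \<le> z \<and> z \<le> b" using less.prems(1) by (auto simp: evens_def)
    have t2: "t + 2 \<in> Z"
    proof (rule ccontr)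
      assume n2: "t + 2 \<notin> Z"
      have gt: "{z\<in>Z. t + 2 < z} = Z - {t}"
      proof -
        have "t + 2 < z" if "z \<in> Z" "z \<noteq> t" for z
        proof -
          have "t < z" using t(2)[OF that(1)] that by simp
          moreover have "z \<noteq> t + 1" using ev[OF that(1)] ev[OF t(1)] by auto
          moreover have "z \<noteq> t + 2" using n2 that by auto
          ultimately show ?thesis by linarith
        qed
        thus ?thesis by auto
      qed
      have odd: "odd (card (Z - {t}))" using fin t(1) less.prems(2) False by (simp add: card_Diff_singleton card_gt_0_iff)
      show False
      proof (cases "t + 2 \<le> b")
        case True
        hence "t + 2 \<in> evens a b - Z" using n2 ev[OF t(1)] by (auto simp: evens_def)
        from less.prems(3)[OF this] gt odd show False by simp
      next
        case F: False
        have "\<not> t + 2 < z" if "z \<in> Z" for z using F ev[OF that] by linarith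
        hence "{z\<in>Z. t + 2 < z} = {}" by auto
        hence "card (Z - {t}) = 0" unfolding gt by (simp only: card.empty)
        thus False using odd by simp
      qed
    qed
    define Z' where "Z' = Z - {t, t + 2}"
    have cZ': "card Z' + 2 = card Z"
      using fin t(1) t2 card_mono[of Z "{t, t + 2}"] by (simp add: Z'_def card_Diff_subset)
    hence cE: "even (card Z')" using less.prems(2) by (metis even_add even_numeral)
    have cnt: "even (card {z\<in>Z'. s < z})" if s: "s \<in> evens a b - Z'" for s
    proof (cases "s \<in> {t, t + 2} \<or> s < t")
      case True
      have "t + 2 < z" if "z \<in> Z'" for z
      proof -
        have "t < z" using t(2) that by (auto simp: Z'_def le_less)
        moreover have "z \<noteq> t + 1" using ev[of z] ev[OF t(1)] that by (auto simp: Z'_def)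
        moreover have "z \<noteq> t + 2" using that by (simp add: Z'_def)
        ultimately show ?thesis by linarith
      qed
      hence "{z\<in>Z'. s < z} = Z'" using True by force
      thus ?thesis using cZ' less.prems(2) by (metis even_add even_numeral)
    next
      case False
      hence s': "s \<in> evens a b - Z" using s by (auto simp: Z'_def)
      have "t + 2 < s"
      proof -
        have "s \<noteq> t + 1" using s ev[OF t(1)] by (auto simp: evens_def)
        thus ?thesis using False by auto
      qed
      hence "{z\<in>Z'. s < z} = {z\<in>Z. s < z}" by (auto simp: Z'_def)
      thus ?thesis using less.prems(3)[OF s'] by simp
    qed
    obtain T where T: "finite T" "2 * card T = card Z'"
        "\<forall>f :: nat \<Rightarrow> real. (\<Prod>z\<in>Z'. f z) = (\<Prod>t\<in>T. f t * f (t + 2))"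
      using less.hyps[of Z', OF _ _ _ cnt] less.prems(1) cZ' cE by (auto simp: Z'_def)
    \<comment> \<open>\<open>T\<close> is known only through the product identity, so it is tested
      on the function that vanishes just at \<open>t\<close>.\<close>
    have "t \<notin> T"
    proof
      assume "t \<in> T"
      hence "(\<Prod>u\<in>T. (if u = t then 0 else 1 :: real) * 1) = 0" using T(1) by auto
      moreover have "(\<Prod>z\<in>Z'. if z = t then 0 else 1 :: real) = 1" by (rule prod.neutral) (auto simp: Z'_def)
      moreover have "(\<Prod>u\<in>T. (if u = t then 0 else 1 :: real) * (if u + 2 = t then 0 else 1)) = 0"
        using T(1) \<open>t \<in> T\<close> by auto
      ultimately show False using T(3)[rule_format, of "\<lambda>z. if z = t then 0 else 1"] by simp
    qed
    have "(\<Prod>z\<in>Z. f z) = (\<Prod>u\<in>insert t T. f u * f (u + 2))" for f :: "nat \<Rightarrow> real"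
    proof -
      have "Z = insert t (insert (t + 2) Z')" using t(1) t2 by (auto simp: Z'_def)
      moreover have "finite Z'" "t \<notin> insert (t + 2) Z'" "t + 2 \<notin> Z'" using fin by (auto simp: Z'_def)
      ultimately show ?thesis using T \<open>t \<notin> T\<close> by (simp add: mult_ac)
    qed
    moreover have "2 * card (insert t T) = card Z" using T \<open>t \<notin> T\<close> cZ' by simp
    ultimately show ?thesis using T(1) by (intro exI[of _ "insert t T"]) blast
  qed
qed

lemma prod_diff_sign:
  assumes "finite Z" "s \<notin> Z"
  shows "0 < (-1) ^ card {z\<in>Z. s < z} * (\<Prod>z\<in>Z. real s - real z)"
  using assms
proof (induction Z rule: finite_induct)
  case (insert y Z)
  show ?case
  proof (cases "s < y")
    case True
    hence "{z \<in> insert y Z. s < z} = insert y {z\<in>Z. s < z}" by auto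
    moreover have "card (insert y {z\<in>Z. s < z}) = Suc (card {z\<in>Z. s < z})" using insert by simp
    moreover have "0 < ((-1) ^ card {z\<in>Z. s < z} * (\<Prod>z\<in>Z. real s - real z)) * (real y - real s)"
      using insert True by (intro mult_pos_pos[of _ "real y - real s"]) auto
    ultimately show ?thesis using insert by (simp add: algebra_simps)
  next
    case False
    hence e: "{z \<in> insert y Z. s < z} = {z\<in>Z. s < z}" by auto
    have "0 < ((-1) ^ card {z\<in>Z. s < z} * (\<Prod>z\<in>Z. real s - real z)) * (real s - real y)"
      using insert False by (intro mult_pos_pos[of _ "real s - real y"]) auto
    thus ?thesis unfolding e using insert by (simp add: mult_ac)
  qed
qed simp

text \<open>Move from \<open>p\<close> in the direction of \<open>- q\<close> until the first node
  at which the value reaches zero. As \<open>q\<close> vanishes at the zeros of \<open>p\<close>,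
  none of them is lost.\<close>

lemma push_to_zero:
  fixes p q :: "real poly" and S :: "nat set"
  assumes "finite S" and pos: "\<And>s. s \<in> S \<Longrightarrow> 0 \<le> poly p (real s)"
    and zero: "\<And>s. s \<in> S \<Longrightarrow> poly p (real s) = 0 \<Longrightarrow> poly q (real s) = 0"
    and s0: "s0 \<in> S" "0 < poly q (real s0)"
  shows "\<exists>\<tau>>0. (\<forall>s\<in>S. 0 \<le> poly (p - smult \<tau> q) (real s)) \<and>
    card {s\<in>S. poly p (real s) = 0} < card {s\<in>S. poly (p - smult \<tau> q) (real s) = 0}"
proof -
  define A where "A = {s\<in>S. 0 < poly q (real s)}"
  define r where "r s = poly p (real s) / poly q (real s)" for s
  have A: "finite A" "A \<noteq> {}" using assms by (auto simp: A_def)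
  define \<tau> where "\<tau> = Min (r ` A)"
  have "\<tau> \<in> r ` A" unfolding \<tau>_def using A by (intro Min_in) auto
  then obtain s1 where s1: "s1 \<in> A" "\<tau> = r s1" by auto
  have min: "\<tau> \<le> r s" if "s \<in> A" for s unfolding \<tau>_def using A that by (intro Min_le) auto
  have s1': "s1 \<in> S" "0 < poly q (real s1)" using s1 by (auto simp: A_def)
  hence "poly p (real s1) \<noteq> 0" using zero by force
  hence p1: "0 < poly p (real s1)" using pos[OF s1'(1)] by simp
  have \<tau>: "0 < \<tau>" using p1 s1' s1 by (simp add: r_def)
  have nn: "0 \<le> poly (p - smult \<tau> q) (real s)" if s: "s \<in> S" for s
  proof (cases "0 < poly q (real s)")
    case True
    hence "\<tau> \<le> poly p (real s) / poly q (real s)" using min[of s] s by (simp add: A_def r_def)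
    thus ?thesis using True by (simp add: field_simps)
  next
    case False
    hence "\<tau> * poly q (real s) \<le> 0" using \<tau> by (simp add: mult_nonneg_nonpos)
    thus ?thesis using pos[OF s] by simp
  qed
  have "poly (p - smult \<tau> q) (real s1) = 0" using s1' s1 by (simp add: r_def)
  hence "s1 \<in> {s\<in>S. poly (p - smult \<tau> q) (real s) = 0}" using s1' by simp
  moreover have "s1 \<notin> {s\<in>S. poly p (real s) = 0}" using p1 by simp
  moreover have "{s\<in>S. poly p (real s) = 0} \<subseteq> {s\<in>S. poly (p - smult \<tau> q) (real s) = 0}"
    using zero by auto
  ultimately have "{s\<in>S. poly p (real s) = 0} \<subset> {s\<in>S. poly (p - smult \<tau> q) (real s) = 0}" by blast
  hence "card {s\<in>S. poly p (real s) = 0} < card {s\<in>S. poly (p - smult \<tau> q) (real s) = 0}"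
    using assms(1) by (intro psubset_card_mono) auto
  thus ?thesis using \<tau> nn by blast
qed

text \<open>Induction on the number of zeros at nodes. With fewer than \<open>2 * m\<close> zeros
  there is a direction \<open>q\<close> that vanishes at them and takes both signs, and
  \<open>p\<close> is a positive combination of two polynomials with more zeros. With
  \<open>2 * m\<close> zeros \<open>p\<close> is a multiple of the product over them. A positive
  factor makes the zeros fall into adjacent pairs; a negative one puts both end nodes among the
  zeros and pairs the others.\<close>

lemma binsum_nonneg:
  fixes p :: "real poly"
  assumes ev: "even a" "even n" "a \<le> n" and cS: "2 * m < card (evens a (n - a))" and mn: "8 * m + 15 \<le> n"
    and gap: "\<And>x. x \<le> m \<Longrightarrow> 24 * real n + 41616 \<le>
      (real n - 2 * real a)\<^sup>2 - 4 * real x * (real n - real x) - 2 * real n"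
    and deg: "degree p \<le> 2 * m" and pos: "\<And>s. s \<in> evens a (n - a) \<Longrightarrow> 0 \<le> poly p (real s)"
  shows "0 \<le> binsum n p"
  using deg pos
proof (induction "2 * m - card {s \<in> evens a (n - a). poly p (real s) = 0}" arbitrary: p rule: less_induct)
  case less
  define S where "S = evens a (n - a)"
  define Z where "Z = {s\<in>S. poly p (real s) = 0}"
  have fS: "finite S" and fZ: "finite Z" and ZS: "Z \<subseteq> S" by (auto simp: S_def Z_def)
  define \<pi> :: "real poly" where "\<pi> = (\<Prod>z\<in>Z. [:- real z, 1:])"
  have \<pi>: "poly \<pi> x = (\<Prod>z\<in>Z. x - real z)" for x by (simp add: \<pi>_def poly_prod)
  have \<pi>0: "poly \<pi> (real s) = 0 \<longleftrightarrow> s \<in> Z" for s using fZ by (auto simp: \<pi>)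
  have d\<pi>: "degree \<pi> \<le> card Z"
    unfolding \<pi>_def using degree_prod_sum_le[OF fZ, of "\<lambda>t. [:- real t, 1:]"] by simp
  have ppos: "0 < poly p (real s)" if "s \<in> S - Z" for s
    using less.prems(2)[of s] that by (auto simp: S_def Z_def)
  show ?case
  proof (cases "card Z < 2 * m")
    case True
    have cSZ: "2 \<le> card (S - Z)" using True cS fZ ZS by (simp add: card_Diff_subset S_def)
    then obtain s1 where s1: "s1 \<in> S - Z" by (metis card.empty all_not_in_conv not_numeral_le_zero)
    have "card (S - Z - {s1}) \<noteq> 0" using cSZ s1 fS by (simp add: card_Diff_singleton)
    then obtain s2 where s2: "s2 \<in> S - Z" "s2 \<noteq> s1" by (metis card.empty all_not_in_conv Diff_iff singletonI)
    \<comment> \<open>The product over the zeros serves if it has opposite signs at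
      \<open>s1\<close> and \<open>s2\<close>; otherwise a further zero at their midpoint creates
      the sign change, within the degree bound as \<open>card Z < 2 * m\<close>.\<close>
    obtain q where q: "degree q \<le> 2 * m" "poly q (real s1) * poly q (real s2) < 0" "\<And>s. s \<in> Z \<Longrightarrow> poly q (real s) = 0"
    proof (cases "poly \<pi> (real s1) * poly \<pi> (real s2) < 0")
      case T: True
      show thesis by (rule that[of \<pi>]) (use T d\<pi> True \<pi>0 in auto)
    next
      case F: False
      have "poly \<pi> (real s1) * poly \<pi> (real s2) \<noteq> 0" using \<pi>0 s1 s2 by simp
      hence P: "0 < poly \<pi> (real s1) * poly \<pi> (real s2)" using F by linarith
      define c where "c = (real s1 + real s2) / 2"
      have "poly (\<pi> * [:- c, 1:]) (real s1) * poly (\<pi> * [:- c, 1:]) (real s2) =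
          - (poly \<pi> (real s1) * poly \<pi> (real s2) * ((real s1 - real s2) / 2)\<^sup>2)"
        by (simp add: c_def power2_eq_square field_simps)
      moreover have "0 < ((real s1 - real s2) / 2)\<^sup>2" using s2 by simp
      ultimately have "poly (\<pi> * [:- c, 1:]) (real s1) * poly (\<pi> * [:- c, 1:]) (real s2) < 0"
        using mult_pos_pos[OF P] by simp
      moreover have "degree (\<pi> * [:- c, 1:]) \<le> 2 * m"
        using degree_mult_le[of \<pi> "[:- c, 1:]"] d\<pi> True by simp
      ultimately show thesis using \<pi>0 by (intro that[of "\<pi> * [:- c, 1:]"]) auto
    qed
    have ex: "\<exists>s\<in>S. 0 < poly q (real s)" "\<exists>s\<in>S. 0 < poly (- q) (real s)"
      using q(2) s1 s2 by (auto simp: mult_less_0_iff)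
    have step: "\<exists>\<tau>>0. 0 \<le> binsum n p - \<tau> * binsum n q"
      if "degree q \<le> 2 * m" "\<And>s. s \<in> Z \<Longrightarrow> poly q (real s) = 0" "\<exists>s\<in>S. 0 < poly q (real s)" for q
    proof -
      from that(3) obtain s0 where s0: "s0 \<in> S" "0 < poly q (real s0)" by blast
      have "\<exists>\<tau>>0. (\<forall>s\<in>S. 0 \<le> poly (p - smult \<tau> q) (real s)) \<and>
          card {s\<in>S. poly p (real s) = 0} < card {s\<in>S. poly (p - smult \<tau> q) (real s) = 0}"
        by (rule push_to_zero[OF fS _ _ s0]) (use less.prems that in \<open>auto simp: S_def Z_def\<close>)
      then obtain \<tau> where \<tau>: "0 < \<tau>" "\<forall>s\<in>S. 0 \<le> poly (p - smult \<tau> q) (real s)"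
          "card Z < card {s\<in>S. poly (p - smult \<tau> q) (real s) = 0}" by (auto simp: Z_def)
      have "degree (p - smult \<tau> q) \<le> 2 * m"
        using less.prems(1) that(1) by (intro degree_diff_le order_trans[OF degree_smult_le])
      hence "0 \<le> binsum n (p - smult \<tau> q)"
        using \<tau> True by (intro less.hyps) (auto simp: S_def Z_def)
      also have "binsum n (p - smult \<tau> q) = binsum n (p + smult (- \<tau>) q)" by simp
      also have "\<dots> = binsum n p - \<tau> * binsum n q" unfolding binsum_add binsum_smult by simp
      finally show ?thesis using \<tau>(1) by blast
    qed
    obtain t1 where t1: "0 < t1" "0 \<le> binsum n p - t1 * binsum n q" using step[OF q(1,3) ex(1)] by blast
    obtain t2 where t2: "0 < t2" "0 \<le> binsum n p - t2 * binsum n (- q)" using step[OF _ _ ex(2)] q by auto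
    have "binsum n (- q) = - binsum n q" using binsum_smult[of n "-1" q] by simp
    hence "0 \<le> t2 * (binsum n p - t1 * binsum n q)" "0 \<le> t1 * (binsum n p + t2 * binsum n q)"
      using t1 t2 by simp_all
    hence "0 \<le> t2 * (binsum n p - t1 * binsum n q) + t1 * (binsum n p + t2 * binsum n q)" by linarith
    also have "\<dots> = (t1 + t2) * binsum n p" by (simp add: algebra_simps)
    finally show ?thesis using t1 t2 by (simp add: zero_le_mult_iff)
  next
    case False
    show ?thesis
    proof (cases "p = 0")
      case True
      thus ?thesis by (simp add: binsum_def)
    next
      case p0: False
      have rb: "card Y \<le> degree r" if "r \<noteq> 0" "\<And>s. s \<in> Y \<Longrightarrow> poly r (real s) = 0" for r and Y :: "nat set"
      proof -
        have "card Y = card (real ` Y)" by (simp add: card_image inj_on_def)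
        also have "\<dots> \<le> card {x. poly r x = 0}"
          using that poly_roots_finite[OF that(1)] by (intro card_mono) auto
        also have "\<dots> \<le> degree r" by (rule card_poly_roots_bound[OF that(1)])
        finally show ?thesis .
      qed
      have "card Z \<le> degree p" by (rule rb[OF p0]) (simp add: Z_def)
      hence cZ: "card Z = 2 * m" using False less.prems(1) by simp
      have "\<not> S \<subseteq> Z" using card_mono[OF fZ, of S] cZ cS unfolding S_def by linarith
      then obtain s0 where s0: "s0 \<in> S - Z" by blast
      define c where "c = poly p (real s0) / poly \<pi> (real s0)"
      have "p - smult c \<pi> = 0"
      proof (rule ccontr)
        assume "p - smult c \<pi> \<noteq> 0"
        moreover have "poly (p - smult c \<pi>) (real s) = 0" if s: "s \<in> insert s0 Z" for s
        proof (cases "s \<in> Z")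
          case True
          hence "poly \<pi> (real s) = 0" "poly p (real s) = 0" using \<pi>0[of s] by (auto simp: Z_def)
          thus ?thesis by simp
        next
          case False
          hence "s = s0" "poly \<pi> (real s) \<noteq> 0" using s \<pi>0[of s] by auto
          thus ?thesis by (simp add: c_def)
        qed
        ultimately have "card (insert s0 Z) \<le> degree (p - smult c \<pi>)" by (rule rb)
        also have "\<dots> \<le> 2 * m"
          using less.prems(1) d\<pi> cZ by (intro degree_diff_le order_trans[OF degree_smult_le]) auto
        finally show False using s0 fZ cZ by simp
      qed
      hence p: "poly p x = c * (\<Prod>z\<in>Z. x - real z)" for x by (simp add: \<pi>[symmetric])
      have c0: "c \<noteq> 0" using ppos[OF s0] p by auto
      show ?thesis
      proof (cases "0 < c")
        case True
        have "even (card {z\<in>Z. s < z})" if "s \<in> S - Z" for s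
        proof (rule ccontr)
          assume "odd (card {z\<in>Z. s < z})"
          hence "(\<Prod>z\<in>Z. real s - real z) < 0" using prod_diff_sign[OF fZ, of s] that by simp
          thus False using ppos[OF that] True by (simp add: p zero_less_mult_iff)
        qed
        then obtain T where T: "finite T" "2 * card T = card Z"
            "\<forall>f :: nat \<Rightarrow> real. (\<Prod>z\<in>Z. f z) = (\<Prod>t\<in>T. f t * f (t + 2))"
          using parity_pairing[of Z a "n - a"] ZS cZ by (auto simp: S_def)
        have "binsum n p = c * (\<Sum>s\<le>n. real (n choose s) * (\<Prod>t\<in>T. (real s - real t) * (real s - real (t + 2))))"
          unfolding binsum_def p T(3)[rule_format] by (simp add: sum_distrib_left mult_ac)
        moreover have "0 \<le> (\<Sum>s\<le>n. real (n choose s) * (\<Prod>t\<in>T. (real s - real t) * (real s - real (t + 2))))"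
          by (rule pair_sum_nonneg[OF T(1)]) (use T(2) cZ mn in simp)
        ultimately show ?thesis using True by simp
      next
        case F: False
        hence cneg: "c < 0" using c0 by simp
        have od: "odd (card {z\<in>Z. s < z})" if "s \<in> S - Z" for s
        proof
          assume "even (card {z\<in>Z. s < z})"
          hence "0 < (\<Prod>z\<in>Z. real s - real z)" using prod_diff_sign[OF fZ, of s] that by simp
          hence "poly p (real s) < 0" using cneg by (simp add: p mult_neg_pos)
          thus False using ppos[OF that] by simp
        qed
        have "a \<le> n - a" using s0 by (auto simp: S_def evens_def)
        hence abS: "a \<in> S" "n - a \<in> S" using ev by (auto simp: S_def evens_def)
        have aZ: "a \<in> Z"
        proof (rule ccontr)
          assume a: "a \<notin> Z"
          have "{z\<in>Z. a < z} = Z" using ZS a by (auto simp: S_def evens_def le_less)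
          thus False using od[of a] a abS cZ by simp
        qed
        have bZ: "n - a \<in> Z"
        proof (rule ccontr)
          assume b: "n - a \<notin> Z"
          have "{z\<in>Z. n - a < z} = {}" using ZS by (auto simp: S_def evens_def)
          hence "card {z\<in>Z. n - a < z} = 0" by (simp only: card.empty)
          thus False using od[of "n - a"] b abS by simp
        qed
        have ab: "a \<noteq> n - a"
        proof
          assume "a = n - a"
          hence "Z \<subseteq> {a}" using ZS by (auto simp: S_def evens_def)
          hence "Z = {a}" using aZ by auto
          hence "card Z = 1" by simp
          thus False using cZ by presburger
        qed
        define Z' where "Z' = Z - {a, n - a}"
        have cZ': "card Z' + 2 = card Z"
          using fZ aZ bZ ab card_mono[of Z "{a, n - a}"] by (simp add: Z'_def card_Diff_subset)
        have "even (card {z\<in>Z'. s < z})" if s: "s \<in> S - Z'" for s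
        proof -
          consider "s = a" | "s = n - a" | "s \<in> S - Z" using s by (auto simp: Z'_def)
          thus ?thesis
          proof cases
            case 1
            hence "{z\<in>Z'. s < z} = Z'" using ZS by (auto simp: Z'_def S_def evens_def le_less)
            thus ?thesis using cZ' cZ by (metis dvd_triv_left even_add even_numeral)
          next
            case 2
            hence "{z\<in>Z'. s < z} = {}" using ZS by (auto simp: Z'_def S_def evens_def)
            thus ?thesis by (simp only: card.empty) simp
          next
            case 3
            have "{z\<in>Z. s < z} = insert (n - a) {z\<in>Z'. s < z}"
              using 3 bZ aZ by (auto simp: Z'_def S_def evens_def le_less)
            moreover have "n - a \<notin> {z\<in>Z'. s < z}" "finite {z\<in>Z'. s < z}" using fZ by (auto simp: Z'_def)
            ultimately show ?thesis using od[OF 3] by simp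
          qed
        qed
        moreover have "even (card Z')" using cZ' cZ by (metis dvd_triv_left even_add even_numeral)
        ultimately obtain T where T: "finite T" "2 * card T = card Z'"
            "\<forall>f :: nat \<Rightarrow> real. (\<Prod>z\<in>Z'. f z) = (\<Prod>t\<in>T. f t * f (t + 2))"
          using parity_pairing[of Z' a "n - a"] ZS by (auto simp: S_def Z'_def)
        have Zp: "(\<Prod>z\<in>Z. f z) = f a * f (n - a) * (\<Prod>t\<in>T. f t * f (t + 2))" for f :: "nat \<Rightarrow> real"
        proof -
          have "Z = insert a (insert (n - a) Z')" using aZ bZ by (auto simp: Z'_def)
          moreover have "finite Z'" "a \<notin> insert (n - a) Z'" "n - a \<notin> Z'" using fZ ab by (auto simp: Z'_def)
          ultimately show ?thesis using T(3) by (simp add: mult_ac)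
        qed
        have "binsum n p = - c * (\<Sum>s\<le>n. real (n choose s) * ((real s - real a) * (real (n - a) - real s) *
            (\<Prod>t\<in>T. (real s - real t) * (real s - real (t + 2)))))"
          unfolding binsum_def p Zp sum_distrib_left by (rule sum.cong[OF refl]) (simp add: algebra_simps)
        moreover have "0 \<le> (\<Sum>s\<le>n. real (n choose s) * ((real s - real a) * (real (n - a) - real s) *
            (\<Prod>t\<in>T. (real s - real t) * (real s - real (t + 2)))))"
          by (rule pair_edge_sum_nonneg[OF T(1) _ ev(3)]) (use T(2) cZ cZ' mn gap in auto)
        ultimately show ?thesis using cneg by (simp add: mult_nonpos_nonneg)
      qed
    qed
  qed
qed

text \<open>A minimizer of the residual over the simplex has zero residual: otherwise the residual itself
  is a separating functional.\<close>

lemma simplex_annihilator_exists: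
  fixes k :: "nat \<Rightarrow> nat \<Rightarrow> real"
  assumes "finite S" "S \<noteq> {}" "finite X"
    and sep: "\<And>e c. (\<And>s. s \<in> S \<Longrightarrow> c \<le> (\<Sum>x\<in>X. e x * k x s)) \<Longrightarrow> c \<le> 0"
  shows "\<exists>W :: nat \<Rightarrow> real. (\<forall>s\<in>S. 0 \<le> W s) \<and> (\<Sum>s\<in>S. W s) = 1 \<and> (\<forall>x\<in>X. (\<Sum>s\<in>S. W s * k x s) = 0)"
proof -
  define T where "T = product_topology (\<lambda>_::nat. euclideanreal) S"
  define B where "B = (PiE S (\<lambda>_. {0..1}) :: (nat \<Rightarrow> real) set)"
  define r where "r W x = (\<Sum>s\<in>S. W s * k x s)" for W x
  define \<Phi> where "\<Phi> W = (\<Sum>x\<in>X. (r W x)\<^sup>2)" for W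
  have proj: "continuous_map T euclideanreal (\<lambda>W. W s)" if "s \<in> S" for s
    unfolding T_def using that by (rule continuous_map_product_projection)
  have cr: "continuous_map T euclideanreal (\<lambda>W. r W x)" for x
    unfolding r_def using assms(1) proj by (intro continuous_map_sum continuous_map_real_mult_right) auto
  have c\<Phi>: "continuous_map T euclideanreal \<Phi>"
    unfolding \<Phi>_def using assms(3) cr by (intro continuous_map_sum continuous_map_real_pow) auto
  have csum: "continuous_map T euclideanreal (\<lambda>W. \<Sum>s\<in>S. W s)"
    using assms(1) proj by (intro continuous_map_sum) auto
  define D where "D = {W \<in> topspace T. (\<Sum>s\<in>S. W s) \<in> {1}} \<inter> B"
  have "compactin T B" unfolding T_def B_def compactin_PiE by auto
  moreover have "closedin T {W \<in> topspace T. (\<Sum>s\<in>S. W s) \<in> {1}}"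
    by (rule closedin_continuous_map_preimage[OF csum]) simp
  ultimately have "compactin T D" unfolding D_def by (intro closed_Int_compactin)
  hence "compact (\<Phi> ` D)" using image_compactin[OF _ c\<Phi>, of D] by simp
  moreover have Dchar: "W \<in> D \<longleftrightarrow> W \<in> extensional S \<and> (\<forall>s\<in>S. 0 \<le> W s \<and> W s \<le> 1) \<and> (\<Sum>s\<in>S. W s) = 1" for W
    by (auto simp: D_def B_def T_def PiE_def)
  obtain s0 where s0: "s0 \<in> S" using assms(2) by auto
  have delta: "(\<Sum>s'\<in>S. (if s' = s then 1 else 0) * f s') = f s" if "s \<in> S" for s and f :: "nat \<Rightarrow> real"
    using that assms(1) by (simp add: if_distrib[of "\<lambda>x. x * _"] cong: if_cong)
  have "restrict (\<lambda>s. if s = s0 then 1 else 0) S \<in> D"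
    using delta[OF s0, of "\<lambda>_. 1"] by (simp add: Dchar)
  ultimately obtain W where W: "W \<in> D" "\<And>W'. W' \<in> D \<Longrightarrow> \<Phi> W \<le> \<Phi> W'"
    using compact_attains_inf[of "\<Phi> ` D"] by auto
  have "\<Phi> W \<le> (\<Sum>x\<in>X. r W x * k x s)" if s: "s \<in> S" for s
  proof -
    define d where "d x = k x s - r W x" for x
    \<comment> \<open>Minimality of \<open>W\<close> along the segment towards the vertex of the
      simplex at \<open>s\<close>, divided by \<open>\<theta>\<close>.\<close>
    have q: "0 \<le> 2 * (\<Sum>x\<in>X. r W x * d x) + \<theta> * (\<Sum>x\<in>X. (d x)\<^sup>2)" if \<theta>: "0 < \<theta>" "\<theta> \<le> 1" for \<theta>
    proof -
      define W' where "W' = restrict (\<lambda>s'. (1 - \<theta>) * W s' + \<theta> * (if s' = s then 1 else 0)) S"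
      have lin: "(\<Sum>s'\<in>S. W' s' * f s') = (1 - \<theta>) * (\<Sum>s'\<in>S. W s' * f s') + \<theta> * f s" for f
      proof -
        have "(\<Sum>s'\<in>S. W' s' * f s') = (\<Sum>s'\<in>S. (1 - \<theta>) * (W s' * f s') + \<theta> * ((if s' = s then 1 else 0) * f s'))"
          unfolding W'_def by (rule sum.cong) (simp_all add: algebra_simps)
        thus ?thesis unfolding sum.distrib sum_distrib_left[symmetric] delta[OF s] .
      qed
      have "W' \<in> D" unfolding Dchar
      proof (intro conjI ballI)
        show "W' \<in> extensional S" by (simp add: W'_def)
        show sum1: "(\<Sum>s\<in>S. W' s) = 1" using lin[of "\<lambda>_. 1"] W(1) by (simp add: Dchar)
        show nn: "0 \<le> W' s'" if "s' \<in> S" for s' using that W(1) \<theta> by (auto simp: W'_def Dchar)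
        show "W' s' \<le> 1" if "s' \<in> S" for s'
          using member_le_sum[OF that, of W'] nn assms(1) sum1 by simp
      qed
      hence "\<Phi> W \<le> \<Phi> W'" by (rule W(2))
      moreover have "r W' x = r W x + \<theta> * d x" for x
        unfolding r_def lin d_def by (simp add: algebra_simps)
      hence "\<Phi> W' = \<Phi> W + \<theta> * (2 * (\<Sum>x\<in>X. r W x * d x) + \<theta> * (\<Sum>x\<in>X. (d x)\<^sup>2))"
        unfolding \<Phi>_def by (simp add: power2_eq_square algebra_simps sum.distrib sum_distrib_left)
      ultimately have "0 \<le> \<theta> * (2 * (\<Sum>x\<in>X. r W x * d x) + \<theta> * (\<Sum>x\<in>X. (d x)\<^sup>2))" by simp
      thus ?thesis using \<theta> by (simp add: zero_le_mult_iff)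
    qed
    have "0 \<le> (\<Sum>x\<in>X. r W x * d x)"
    proof (rule ccontr)
      assume neg: "\<not> 0 \<le> (\<Sum>x\<in>X. r W x * d x)"
      define u where "u = - (\<Sum>x\<in>X. r W x * d x)"
      define v where "v = (\<Sum>x\<in>X. (d x)\<^sup>2)"
      have u: "0 < u" "0 \<le> v" using neg by (auto simp: u_def v_def sum_nonneg)
      define \<theta> where "\<theta> = min 1 (u / (v + 1))"
      have \<theta>: "0 < \<theta>" "\<theta> \<le> 1" using u by (auto simp: \<theta>_def)
      have "2 * u \<le> \<theta> * v" using q[OF \<theta>] by (simp add: u_def v_def)
      also have "\<dots> \<le> u / (v + 1) * v" using u by (intro mult_right_mono) (auto simp: \<theta>_def)
      also have "\<dots> \<le> u" using u by (simp add: field_simps)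
      finally show False using u by simp
    qed
    thus ?thesis unfolding d_def \<Phi>_def by (simp add: right_diff_distrib sum_subtractf power2_eq_square)
  qed
  hence "\<Phi> W \<le> 0" by (rule sep)
  hence "\<forall>x\<in>X. r W x = 0"
    using assms(3) sum_nonneg_eq_0_iff[of X "\<lambda>x. (r W x)\<^sup>2"] sum_nonneg[of X "\<lambda>x. (r W x)\<^sup>2"]
    by (auto simp: \<Phi>_def)
  thus ?thesis using W(1) by (intro exI[of _ W]) (auto simp: Dchar r_def)
qed

text \<open>Weights that annihilate all Krawtchouk polynomials of degrees 1 to \<open>2 * m\<close>
  reproduce binomial means. For the separation condition, a combination of these polynomials that is
  at least \<open>c\<close> on the nodes has binomial mean 0, so \<open>binsum_nonneg\<close>,
  applied after subtracting \<open>c\<close>, gives \<open>c \<le> 0\<close>.\<close>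

lemma even_quadrature:
  assumes ev: "even a" "even n" "a \<le> n" and cS: "2 * m < card (evens a (n - a))" and mn: "8 * m + 15 \<le> n"
    and gap: "\<And>x. x \<le> m \<Longrightarrow> 24 * real n + 41616 \<le>
      (real n - 2 * real a)\<^sup>2 - 4 * real x * (real n - real x) - 2 * real n"
  shows "\<exists>W :: nat \<Rightarrow> real. (\<forall>s\<in>evens a (n - a). 0 \<le> W s) \<and>
    (\<forall>p. degree p \<le> 2 * m \<longrightarrow> (\<Sum>s\<in>evens a (n - a). W s * poly p (real s)) = binsum n p / 2 ^ n)"
proof -
  define S where "S = evens a (n - a)"
  have Sn: "s \<le> n" if "s \<in> S" for s using that by (auto simp: S_def evens_def)
  have S0: "S \<noteq> {}" using cS unfolding S_def by (metis card.empty not_less_zero)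
  have krawsum: "(\<Sum>s\<le>n. real (n choose s) * kraw n x s) = (if x = 0 then 2 ^ n else 0)" for x
    using kraw_orthogonal[of n x 0] by (cases "x = 0") auto
  have bexp: "binsum n p = 2 ^ n * h 0" if h: "\<forall>s\<le>n. poly p (real s) = (\<Sum>x\<le>2 * m. h x * kraw n x s)" for p h
  proof -
    have "binsum n p = (\<Sum>s\<le>n. \<Sum>x\<le>2 * m. h x * (real (n choose s) * kraw n x s))"
      unfolding binsum_def using h by (intro sum.cong) (auto simp: sum_distrib_left mult_ac)
    also have "\<dots> = (\<Sum>x\<le>2 * m. h x * (\<Sum>s\<le>n. real (n choose s) * kraw n x s))"
      unfolding sum_distrib_left by (rule sum.swap)
    also have "\<dots> = 2 ^ n * h 0" unfolding krawsum by (simp add: if_distrib[of "\<lambda>z. _ * z"] mult.commute cong: if_cong)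
    finally show ?thesis .
  qed
  have "\<exists>W :: nat \<Rightarrow> real. (\<forall>s\<in>S. 0 \<le> W s) \<and> (\<Sum>s\<in>S. W s) = 1 \<and> (\<forall>x\<in>{1..2 * m}. (\<Sum>s\<in>S. W s * kraw n x s) = 0)"
  proof (rule simplex_annihilator_exists)
    fix e :: "nat \<Rightarrow> real" and c assume le: "\<And>s. s \<in> S \<Longrightarrow> c \<le> (\<Sum>x\<in>{1..2 * m}. e x * kraw n x s)"
    have "\<exists>P. \<forall>x. degree (P x :: real poly) \<le> x \<and> (\<forall>s\<le>n. poly (P x) (real s) = kraw n x s)"
      by (intro choice allI kraw_poly)
    then obtain P where P: "\<And>x. degree (P x :: real poly) \<le> x" "\<And>x s. s \<le> n \<Longrightarrow> poly (P x) (real s) = kraw n x s"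
      by blast
    define p where "p = (\<Sum>x\<in>{1..2 * m}. smult (e x) (P x)) - [:c:]"
    define h where "h x = (if x = 0 then - c else e x)" for x
    have "degree (\<Sum>x\<in>{1..2 * m}. smult (e x) (P x)) \<le> 2 * m"
      by (intro degree_sum_le) (auto intro!: order_trans[OF degree_smult_le] order_trans[OF P(1)])
    hence dp: "degree p \<le> 2 * m" unfolding p_def by (intro degree_diff_le) auto
    have pv: "poly p (real s) = (\<Sum>x\<in>{1..2 * m}. e x * kraw n x s) - c" if "s \<le> n" for s
      using that by (simp add: p_def poly_sum P)
    have "0 \<le> binsum n p"
      by (rule binsum_nonneg[OF ev cS mn gap dp]) (use le pv Sn in \<open>auto simp: S_def\<close>)
    also have "binsum n p = 2 ^ n * h 0"
    proof (rule bexp, intro allI impI)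
      fix s assume "s \<le> n"
      have "(\<Sum>x\<le>2 * m. h x * kraw n x s) = (\<Sum>x\<in>insert 0 {1..2 * m}. h x * kraw n x s)"
        by (rule sum.cong) auto
      also have "\<dots> = - c + (\<Sum>x\<in>{1..2 * m}. e x * kraw n x s)"
        by (subst sum.insert) (auto simp: h_def intro!: sum.cong)
      finally show "poly p (real s) = (\<Sum>x\<le>2 * m. h x * kraw n x s)" using pv[OF \<open>s \<le> n\<close>] by simp
    qed
    finally have "2 ^ n * c \<le> 0" by (simp add: h_def)
    moreover have "(0::real) < 2 ^ n" by simp
    ultimately show "c \<le> 0" by (simp only: mult_le_0_iff) linarith
  qed (use S0 in \<open>auto simp: S_def\<close>)
  then obtain W :: "nat \<Rightarrow> real" where W: "\<forall>s\<in>S. 0 \<le> W s" "(\<Sum>s\<in>S. W s) = 1"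
    "\<And>x. x \<in> {1..2 * m} \<Longrightarrow> (\<Sum>s\<in>S. W s * kraw n x s) = 0" by blast
  have "(\<Sum>s\<in>S. W s * poly p (real s)) = binsum n p / 2 ^ n" if "degree p \<le> 2 * m" for p
  proof -
    from poly_kraw_expansion[OF that, of n]
    obtain h where h: "\<forall>s\<le>n. poly p (real s) = (\<Sum>x\<le>2 * m. h x * kraw n x s)" by auto
    have "(\<Sum>s\<in>S. W s * poly p (real s)) = (\<Sum>s\<in>S. \<Sum>x\<le>2 * m. h x * (W s * kraw n x s))"
      using h Sn by (intro sum.cong) (auto simp: sum_distrib_left mult_ac)
    also have "\<dots> = (\<Sum>x\<le>2 * m. h x * (\<Sum>s\<in>S. W s * kraw n x s))"
      unfolding sum_distrib_left by (rule sum.swap)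
    also have "\<dots> = (\<Sum>x\<in>insert 0 {1..2 * m}. h x * (\<Sum>s\<in>S. W s * kraw n x s))"
      by (rule sum.cong) auto
    also have "\<dots> = h 0" using W by (subst sum.insert) auto
    finally show ?thesis using bexp[OF h] by simp
  qed
  thus ?thesis using W(1) by (intro exI[of _ W]) (auto simp: S_def)
qed


section \<open>The primal solution from the quadrature\<close>

lemma power_pair_le:
  fixes a b :: real
  assumes "i + k = 2 * j"
  shows "a ^ i * b ^ k + a ^ k * b ^ i \<le> a ^ (2 * j) + b ^ (2 * j)"
proof -
  let ?A = "\<bar>a\<bar>" and ?B = "\<bar>b\<bar>"
  have "0 \<le> (?A ^ i - ?B ^ i) * (?A ^ k - ?B ^ k)"
  proof (cases "?A \<le> ?B")
    case True
    thus ?thesis by (intro mult_nonpos_nonpos) (auto intro: power_mono)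
  next
    case False
    thus ?thesis by (intro mult_nonneg_nonneg) (auto intro: power_mono)
  qed
  hence "?A ^ i * ?B ^ k + ?A ^ k * ?B ^ i \<le> ?A ^ (i + k) + ?B ^ (i + k)"
    by (simp add: algebra_simps power_add)
  moreover have "a ^ i * b ^ k \<le> ?A ^ i * ?B ^ k" "a ^ k * b ^ i \<le> ?A ^ k * ?B ^ i"
    by (metis abs_ge_self abs_mult power_abs)+
  moreover have "?A ^ (i + k) = a ^ (2 * j)" "?B ^ (i + k) = b ^ (2 * j)"
    unfolding assms by (simp_all add: power_mult)
  ultimately show ?thesis by linarith
qed

text \<open>Factor the difference and pair each term of the resulting sum with its mirror
  image.\<close>

lemma odd_power_diff_le:
  fixes u :: real
  shows "u ^ (2 * j + 1) - (u - 2) ^ (2 * j + 1) \<le> real (2 * j + 1) * (u ^ (2 * j) + (u - 2) ^ (2 * j))"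
proof -
  let ?w = "u - 2"
  define S where "S = (\<Sum>i<2 * j + 1. ?w ^ (2 * j - i) * u ^ i)"
  have "u ^ (2 * j + 1) - ?w ^ (2 * j + 1) = 2 * S"
    using power_diff_sumr2[of u "2 * j + 1" ?w] by (simp add: S_def)
  moreover have "S = (\<Sum>i<2 * j + 1. ?w ^ i * u ^ (2 * j - i))"
    unfolding S_def by (rule sum.reindex_bij_witness[of _ "\<lambda>i. 2 * j - i" "\<lambda>i. 2 * j - i"]) auto
  ultimately have "u ^ (2 * j + 1) - ?w ^ (2 * j + 1) = (\<Sum>i<2 * j + 1. ?w ^ (2 * j - i) * u ^ i + ?w ^ i * u ^ (2 * j - i))"
    by (simp add: sum.distrib S_def)
  also have "\<dots> \<le> (\<Sum>i<2 * j + 1. ?w ^ (2 * j) + u ^ (2 * j))"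
    by (intro sum_mono power_pair_le) auto
  finally show ?thesis by (simp add: algebra_simps)
qed

text \<open>\<open>2 ^ n\<close> times the moment of order \<open>2 * j\<close> of a sum of
  \<open>n\<close> independent signs.\<close>

definition moment :: "nat \<Rightarrow> nat \<Rightarrow> real" where
  "moment n j = (\<Sum>s\<le>n. real (n choose s) * (real n - 2 * real s) ^ (2 * j))"

lemma binomial_sum_Suc:
  fixes g :: "nat \<Rightarrow> real"
  shows "(\<Sum>s\<le>Suc N. real (Suc N choose s) * g s) = (\<Sum>s\<le>N. real (N choose s) * (g s + g (s + 1)))"
proof -
  have "(\<Sum>s\<le>Suc N. real (Suc N choose s) * g s) = g 0 + (\<Sum>s\<le>N. real (N choose s) * g (s + 1) + real (N choose Suc s) * g (s + 1))"
    by (subst sum.atMost_Suc_shift) (simp add: distrib_right)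
  also have "\<dots> = (\<Sum>s\<le>N. real (N choose s) * g (s + 1)) + (g 0 + (\<Sum>s\<le>N. real (N choose Suc s) * g (Suc s)))"
    by (simp add: sum.distrib)
  also have "g 0 + (\<Sum>s\<le>N. real (N choose Suc s) * g (Suc s)) = (\<Sum>s\<le>Suc N. real (N choose s) * g s)"
    by (simp add: sum.atMost_Suc_shift del: sum.atMost_Suc)
  also have "\<dots> = (\<Sum>s\<le>N. real (N choose s) * g s)" by simp
  finally show ?thesis by (simp add: distrib_left sum.distrib)
qed

text \<open>Summation by parts, the discrete counterpart of Gaussian integration by parts.\<close>

lemma binomial_sum_Suc_weighted:
  fixes g :: "nat \<Rightarrow> real"
  shows "(\<Sum>s\<le>Suc N. real (Suc N choose s) * ((real (Suc N) - 2 * real s) * g s)) =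
    real (Suc N) * (\<Sum>s\<le>N. real (N choose s) * (g s - g (s + 1)))"
proof -
  have w: "real (Suc N choose Suc s) * (real (Suc N) - 2 * real (Suc s)) =
      real (Suc N) * (real (N choose Suc s) - real (N choose s))" for s
  proof -
    have "Suc s * (Suc N choose Suc s) = Suc N * (N choose s)" by (rule Suc_times_binomial)
    hence a: "real (Suc s) * real (Suc N choose Suc s) = real (Suc N) * real (N choose s)" by (metis of_nat_mult)
    have p: "real (Suc N choose Suc s) = real (N choose s) + real (N choose Suc s)" by simp
    have "real (Suc N choose Suc s) * (real (Suc N) - 2 * real (Suc s)) =
        real (Suc N) * real (Suc N choose Suc s) - 2 * (real (Suc s) * real (Suc N choose Suc s))"
      by (simp only: right_diff_distrib mult_ac)
    also have "\<dots> = real (Suc N) * (real (N choose s) + real (N choose Suc s)) - 2 * (real (Suc N) * real (N choose s))"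
      unfolding a by (simp only: p)
    finally show ?thesis by (simp only: algebra_simps)
  qed
  have "(\<Sum>s\<le>Suc N. real (Suc N choose s) * ((real (Suc N) - 2 * real s) * g s)) =
      real (Suc N) * g 0 + (\<Sum>s\<le>N. (real (Suc N choose Suc s) * (real (Suc N) - 2 * real (Suc s))) * g (Suc s))"
    by (subst sum.atMost_Suc_shift) (simp add: mult.assoc)
  also have "\<dots> = real (Suc N) * ((g 0 + (\<Sum>s\<le>N. real (N choose Suc s) * g (Suc s))) - (\<Sum>s\<le>N. real (N choose s) * g (Suc s)))"
    unfolding w by (simp add: algebra_simps sum_subtractf sum.distrib sum_distrib_left)
  also have "g 0 + (\<Sum>s\<le>N. real (N choose Suc s) * g (Suc s)) = (\<Sum>s\<le>Suc N. real (N choose s) * g s)"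
    by (simp add: sum.atMost_Suc_shift del: sum.atMost_Suc)
  also have "\<dots> = (\<Sum>s\<le>N. real (N choose s) * g s)" by simp
  finally show ?thesis by (simp add: right_diff_distrib sum_subtractf)
qed

text \<open>The factor is that of a Gaussian variable of variance \<open>n\<close>; iteration gives
  the product of the first \<open>j\<close> odd numbers.\<close>

lemma moment_step:
  assumes "0 < n"
  shows "moment n (j + 1) \<le> real n * real (2 * j + 1) * moment n j"
proof -
  obtain N where n: "n = Suc N" using assms by (cases n) auto
  define v where "v s = real n - 2 * real s" for s :: nat
  have v1: "v (s + 1) = v s - 2" for s by (simp add: v_def)
  have "moment n (j + 1) = (\<Sum>s\<le>Suc N. real (Suc N choose s) * ((real (Suc N) - 2 * real s) * v s ^ (2 * j + 1)))"
    unfolding moment_def n v_def by (simp add: mult_ac)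
  also have "\<dots> = real n * (\<Sum>s\<le>N. real (N choose s) * (v s ^ (2 * j + 1) - (v s - 2) ^ (2 * j + 1)))"
    unfolding binomial_sum_Suc_weighted v1 n ..
  also have "\<dots> \<le> real n * (\<Sum>s\<le>N. real (N choose s) * (real (2 * j + 1) * (v s ^ (2 * j) + (v s - 2) ^ (2 * j))))"
    by (intro mult_left_mono sum_mono odd_power_diff_le) auto
  also have "\<dots> = real n * real (2 * j + 1) * (\<Sum>s\<le>N. real (N choose s) * (v s ^ (2 * j) + v (s + 1) ^ (2 * j)))"
    unfolding v1 by (simp only: sum_distrib_left mult_ac)
  also have "(\<Sum>s\<le>N. real (N choose s) * (v s ^ (2 * j) + v (s + 1) ^ (2 * j))) = moment n j"
    unfolding moment_def n v_def using binomial_sum_Suc[of N "\<lambda>s. (real (Suc N) - 2 * real s) ^ (2 * j)"] by simp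
  finally show ?thesis .
qed

text \<open>Pair each factor with its mirror image. The two add up to \<open>2 * j\<close>, so their
  product is at most \<open>j * j\<close>.\<close>

lemma odd_prod_le: "(\<Prod>i<j. real (2 * i + 1)) \<le> real j ^ j"
proof -
  have "(\<Prod>i<j. real (2 * i + 1)) = (\<Prod>i<j. real (2 * (j - 1 - i) + 1))"
    by (rule prod.reindex_bij_witness[of _ "\<lambda>i. j - 1 - i" "\<lambda>i. j - 1 - i"]) auto
  hence "(\<Prod>i<j. real (2 * i + 1))\<^sup>2 = (\<Prod>i<j. real (2 * i + 1) * real (2 * (j - 1 - i) + 1))"
    by (simp add: power2_eq_square prod.distrib)
  also have "\<dots> \<le> (\<Prod>i<j. real j * real j)"
  proof (rule prod_mono)
    fix i assume "i \<in> {..<j}"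
    hence r: "real (2 * (j - 1 - i) + 1) = 2 * real j - 2 * real i - 1" by (simp add: of_nat_diff)
    have "0 \<le> (real j - (2 * real i + 1))\<^sup>2" by simp
    hence "real (2 * i + 1) * real (2 * (j - 1 - i) + 1) \<le> real j * real j"
      unfolding r by (simp add: power2_eq_square algebra_simps)
    thus "0 \<le> real (2 * i + 1) * real (2 * (j - 1 - i) + 1) \<and>
        real (2 * i + 1) * real (2 * (j - 1 - i) + 1) \<le> real j * real j" by simp
  qed
  also have "\<dots> = (real j ^ j)\<^sup>2" by (simp add: power_mult_distrib power2_eq_square)
  finally show ?thesis by (rule power2_le_imp_le) simp
qed

lemma moment_le:
  assumes "0 < n"
  shows "moment n j \<le> 2 ^ n * (real j * real n) ^ j"
proof -
  have "moment n j \<le> 2 ^ n * (real n ^ j * (\<Prod>i<j. real (2 * i + 1)))"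
  proof (induction j)
    case 0
    have "(\<Sum>s\<le>n. real (n choose s)) = 2 ^ n"
      using choose_row_sum[of n] by (metis of_nat_numeral of_nat_power of_nat_sum)
    thus ?case by (simp add: moment_def)
  next
    case (Suc j)
    have "moment n (Suc j) \<le> real n * real (2 * j + 1) * moment n j" using moment_step[OF assms, of j] by simp
    also have "\<dots> \<le> real n * real (2 * j + 1) * (2 ^ n * (real n ^ j * (\<Prod>i<j. real (2 * i + 1))))"
      using Suc by (intro mult_left_mono) auto
    finally show ?case by (simp add: mult_ac)
  qed
  also have "\<dots> \<le> 2 ^ n * (real n ^ j * real j ^ j)"
    by (intro mult_left_mono odd_prod_le) auto
  finally show ?thesis by (simp add: power_mult_distrib mult_ac)
qed

lemma binomial_central_lower:
  assumes "s \<le> n" "0 < n" "3 * \<bar>real n - 2 * real s\<bar> \<le> 2 * real n"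
  shows "2 ^ n \<le> (real n + 1) * real (n choose s) * 2 powr ((real n - 2 * real s)\<^sup>2 / real n)"
proof -
  define u where "u = \<bar>real n - 2 * real s\<bar> / real n"
  have u: "0 \<le> u" "u \<le> 2/3" using assms by (auto simp: u_def field_simps)
  have nu: "real n * u\<^sup>2 = (real n - 2 * real s)\<^sup>2 / real n"
    using assms by (simp add: u_def power_divide power2_eq_square)
  have "bin_entropy (real s / real n) = bin_entropy ((1 - u) / 2)"
  proof (cases "2 * real s \<le> real n")
    case True
    hence "(1 - u) / 2 = real s / real n" using assms by (simp add: u_def field_simps)
    thus ?thesis by simp
  next
    case False
    hence "(1 - u) / 2 = 1 - real s / real n" using assms by (simp add: u_def field_simps)
    thus ?thesis by (simp only: bin_entropy_sym)
  qed
  hence "1 - u\<^sup>2 \<le> bin_entropy (real s / real n)" using entropy_quadratic[OF u] by simp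
  hence "real n * (1 - u\<^sup>2) \<le> real n * bin_entropy (real s / real n)" by (intro mult_left_mono) auto
  hence "2 powr (real n * (1 - u\<^sup>2)) \<le> 2 powr (real n * bin_entropy (real s / real n))"
    by (intro powr_mono) auto
  also have "\<dots> \<le> (real n + 1) * real (n choose s)" by (rule binomial_entropy_bounds(2)[OF assms(1,2)])
  finally have "2 powr (real n * (1 - u\<^sup>2)) * 2 powr (real n * u\<^sup>2) \<le> (real n + 1) * real (n choose s) * 2 powr (real n * u\<^sup>2)"
    by (intro mult_right_mono) auto
  moreover have "2 powr (real n * (1 - u\<^sup>2)) * 2 powr (real n * u\<^sup>2) = 2 ^ n"
    by (simp add: powr_add[symmetric] right_diff_distrib powr_realpow)
  ultimately show ?thesis unfolding nu[symmetric] by linarith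
qed

text \<open>With the quadrature weights divided by the sizes of the spheres, \<open>kraw_sym\<close>
  turns the transform at \<open>j\<close> into 1 plus \<open>V\<close> times the quadrature of
  \<open>kraw n j\<close>, divided by \<open>n choose j\<close>. For \<open>j \<le> 2 * m\<close>
  the quadrature is exact. For \<open>n - j \<le> 2 * m\<close> the even nodes allow reflection to
  \<open>n - j\<close>. In between, \<open>abs_kraw_le\<close> applies, and
  \<open>n choose j\<close> is at least \<open>n choose (2 * m)\<close>, which \<open>V\<close> is
  adapted to.\<close>

lemma primal_bound_quadrature:
  assumes ev: "even a" "even n" and an: "2 * a + 4 * m \<le> n" and mn: "8 * m + 15 \<le> n"
    and gap: "\<And>x. x \<le> m \<Longrightarrow> 24 * real n + 41616 \<le>
      (real n - 2 * real a)\<^sup>2 - 4 * real x * (real n - real x) - 2 * real n"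
    and da: "d < a" and m_large: "(real n - 2 * real a)\<^sup>2 \<le> 4 * real n * real m"
    and central: "3 * (real n - 2 * real a) \<le> 2 * real n"
  shows "primal_bound n d (sqrt (real (n choose (2 * m))) / (4 * (real n + 1)\<^sup>2))"
proof -
  define S where "S = evens a (n - a)"
  have n0: "0 < n" using mn by simp
  have fS: "finite S" by (simp add: S_def)
  have Sn: "s \<le> n" "even s" "\<bar>real n - 2 * real s\<bar> \<le> real n - 2 * real a" if "s \<in> S" for s
    using that an by (auto simp: S_def evens_def of_nat_diff)
  have "2 * m < card S"
  proof -
    have "(\<lambda>i. a + 2 * i) ` {..2 * m} \<subseteq> S" using ev an by (auto simp: S_def evens_def)
    hence "card ((\<lambda>i. a + 2 * i) ` {..2 * m}) \<le> card S" using fS by (intro card_mono)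
    moreover have "card ((\<lambda>i. a + 2 * i) ` {..2 * m}) = 2 * m + 1" by (subst card_image) (auto simp: inj_on_def)
    ultimately show ?thesis by simp
  qed
  then obtain W :: "nat \<Rightarrow> real" where W: "\<And>s. s \<in> S \<Longrightarrow> 0 \<le> W s"
      and quad: "\<And>p. degree p \<le> 2 * m \<Longrightarrow> (\<Sum>s\<in>S. W s * poly p (real s)) = binsum n p / 2 ^ n"
    using even_quadrature[of a n m] ev an mn gap unfolding S_def by auto
  have krawW: "(\<Sum>s\<in>S. W s * kraw n x s) = (if x = 0 then 1 else 0)" if "x \<le> 2 * m" for x
  proof -
    obtain P :: "real poly" where P: "degree P \<le> x" "\<forall>s\<le>n. poly P (real s) = kraw n x s" using kraw_poly by blast
    have "(\<Sum>s\<in>S. W s * kraw n x s) = (\<Sum>s\<in>S. W s * poly P (real s))" using P Sn by (intro sum.cong) auto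
    also have "\<dots> = binsum n P / 2 ^ n" using P that by (intro quad) simp
    also have "binsum n P = (\<Sum>s\<le>n. real (n choose s) * (kraw n x s * kraw n 0 s))"
      unfolding binsum_def using P by (intro sum.cong) auto
    also have "\<dots> = (if x = 0 then 2 ^ n else 0)" unfolding kraw_orthogonal by simp
    finally show ?thesis by simp
  qed
  \<comment> \<open>Markov's inequality for the moment of order \<open>2 * i\<close>, with
    \<open>i\<close> near v^2/(4n), bounds \<open>W s\<close> by 4^(-i). This balances the square
    root, which by \<open>binomial_central_lower\<close> is at most 4^(i+1) times
    \<open>n + 1\<close>. The hypothesis \<open>m_large\<close> keeps the order within the exactness
    of the quadrature.\<close>
  have Wb: "W s * sqrt (2 ^ n / real (n choose s)) \<le> 4 * (real n + 1)" if s: "s \<in> S" for s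
  proof -
    define v where "v = real n - 2 * real s"
    define i where "i = nat \<lfloor>v\<^sup>2 / (4 * real n)\<rfloor>"
    have i1: "real i \<le> v\<^sup>2 / (4 * real n)" and i2: "v\<^sup>2 / (4 * real n) < real i + 1"
      unfolding i_def by (simp_all add: n0)
    have "v\<^sup>2 \<le> (real n - 2 * real a)\<^sup>2" unfolding v_def using Sn(3)[OF s] by (rule abs_le_square_iff[THEN iffD1, OF order_trans]) simp
    hence "v\<^sup>2 \<le> 4 * real n * real m" using m_large by simp
    hence "v\<^sup>2 / (4 * real n) \<le> real m" using n0 by (simp add: field_simps)
    hence im: "i \<le> m" using i1 by linarith
    define p :: "real poly" where "p = [:real n, -2:] ^ (2 * i)"
    have "degree p \<le> 2 * m" unfolding p_def using im degree_power_le[of "[:real n, -2:]" "2 * i"] by simp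
    moreover have pp: "poly p (real t) = (real n - 2 * real t) ^ (2 * i)" for t by (simp add: p_def algebra_simps)
    ultimately have "(\<Sum>s\<in>S. W s * (real n - 2 * real s) ^ (2 * i)) = moment n i / 2 ^ n"
      using quad[of p] by (simp add: binsum_def moment_def)
    moreover have "W s * v ^ (2 * i) \<le> (\<Sum>s\<in>S. W s * (real n - 2 * real s) ^ (2 * i))"
      unfolding v_def using s fS W by (intro member_le_sum) (auto simp: power_mult)
    moreover have "moment n i / 2 ^ n \<le> (real i * real n) ^ i" using moment_le[OF n0, of i] by (simp add: field_simps)
    ultimately have "W s * (v\<^sup>2) ^ i \<le> (real i * real n) ^ i" by (simp add: power_mult)
    moreover have "(4 * (real i * real n)) ^ i \<le> (v\<^sup>2) ^ i"
      using i1 n0 by (intro power_mono) (auto simp: field_simps)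
    hence "W s * (4 * (real i * real n)) ^ i \<le> W s * (v\<^sup>2) ^ i" by (rule mult_left_mono[OF _ W[OF s]])
    ultimately have "W s * (4 * (real i * real n)) ^ i \<le> (real i * real n) ^ i" by linarith
    hence "(W s * 4 ^ i) * (real i * real n) ^ i \<le> 1 * (real i * real n) ^ i" by (simp add: power_mult_distrib mult_ac)
    moreover have "0 < (real i * real n) ^ i" using n0 by (cases "i = 0") auto
    ultimately have W4: "W s * 4 ^ i \<le> 1" by (simp only: mult_le_cancel_right_pos)
    have "v\<^sup>2 / (2 * real n) \<le> 2 * real (i + 1)" using i2 n0 by (simp add: field_simps)
    hence "2 powr (v\<^sup>2 / (2 * real n)) \<le> 2 powr (2 * real (i + 1))" by simp
    also have "\<dots> = 4 ^ (i + 1)" by (simp add: powr_powr[symmetric] powr_realpow flip: of_nat_Suc)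
    finally have e: "2 powr (v\<^sup>2 / (2 * real n)) \<le> 4 * 4 ^ i" by simp
    have "2 ^ n / real (n choose s) \<le> (real n + 1) * 2 powr (v\<^sup>2 / real n)"
      using binomial_central_lower[OF Sn(1)[OF s] n0] Sn(3)[OF s] central Sn(1)[OF s]
      by (simp add: v_def field_simps)
    also have "\<dots> \<le> ((real n + 1) * 2 powr (v\<^sup>2 / (2 * real n)))\<^sup>2"
    proof -
      have "2 powr (v\<^sup>2 / real n) = (2 powr (v\<^sup>2 / (2 * real n)))\<^sup>2"
        by (simp add: power2_eq_square powr_add[symmetric])
      moreover have "real n + 1 \<le> (real n + 1)\<^sup>2" by (simp add: power2_eq_square)
      ultimately show ?thesis unfolding power_mult_distrib by (intro mult_mono) auto
    qed
    finally have "sqrt (2 ^ n / real (n choose s)) \<le> (real n + 1) * 2 powr (v\<^sup>2 / (2 * real n))"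
      by (intro real_le_lsqrt) auto
    also have "\<dots> \<le> (real n + 1) * (4 * 4 ^ i)" using e by (intro mult_left_mono) auto
    finally have "W s * sqrt (2 ^ n / real (n choose s)) \<le> W s * ((real n + 1) * (4 * 4 ^ i))"
      by (rule mult_left_mono[OF _ W[OF s]])
    also have "\<dots> = 4 * (real n + 1) * (W s * 4 ^ i)" by (simp add: mult_ac)
    also have "\<dots> \<le> 4 * (real n + 1) * 1" using W4 by (intro mult_left_mono) auto
    finally show ?thesis by simp
  qed
  have Wsum: "(\<Sum>s\<in>S. W s * sqrt (2 ^ n / real (n choose s))) \<le> 4 * (real n + 1)\<^sup>2"
  proof -
    have "(\<Sum>s\<in>S. W s * sqrt (2 ^ n / real (n choose s))) \<le> real (card S) * (4 * (real n + 1))"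
      by (rule sum_bounded_above) (rule Wb)
    also have "card S \<le> card {..n}" by (rule card_mono) (use Sn in auto)
    hence "real (card S) * (4 * (real n + 1)) \<le> (real n + 1) * (4 * (real n + 1))"
      by (intro mult_right_mono) auto
    finally show ?thesis by (simp only: power2_eq_square mult_ac)
  qed
  define V where "V = sqrt (real (n choose (2 * m))) / (4 * (real n + 1)\<^sup>2)"
  have V0: "0 \<le> V" by (simp add: V_def)
  define W' where "W' s = (if s = 0 then 1 else if s \<in> S then V * W s / real (n choose s) else 0)" for s
  have S0: "0 \<notin> S" using da by (auto simp: S_def evens_def)
  have W'sum: "(\<Sum>s\<le>n. W' s * f s) = f 0 + V * (\<Sum>s\<in>S. W s * (f s / real (n choose s)))" for f
  proof -
    have "(\<Sum>s\<le>n. W' s * f s) = (\<Sum>s\<in>insert 0 S. W' s * f s)"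
      by (rule sum.mono_neutral_right) (use Sn in \<open>auto simp: W'_def\<close>)
    also have "\<dots> = f 0 + (\<Sum>s\<in>S. W' s * f s)" using S0 fS by (simp add: W'_def)
    also have "(\<Sum>s\<in>S. W' s * f s) = V * (\<Sum>s\<in>S. W s * (f s / real (n choose s)))"
      unfolding sum_distrib_left using S0 by (intro sum.cong) (auto simp: W'_def)
    finally show ?thesis .
  qed
  show ?thesis unfolding primal_bound_def V_def[symmetric]
  proof (intro exI[of _ W'] conjI allI impI)
    show "0 \<le> W' s" for s using V0 W by (simp add: W'_def)
    show "W' 0 = 1" by (simp add: W'_def)
    show "W' s = 0" if "1 \<le> s \<and> s \<le> d" for s using that da by (auto simp: W'_def S_def evens_def)
    show "V \<le> (\<Sum>s\<le>n. W' s * real (n choose s))"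
    proof -
      have "(\<Sum>s\<in>S. W s * (real (n choose s) / real (n choose s))) = (\<Sum>s\<in>S. W s * kraw n 0 s)"
      proof (rule sum.cong[OF refl])
        fix s assume "s \<in> S"
        hence "0 < real (n choose s)" using Sn(1) by simp
        thus "W s * (real (n choose s) / real (n choose s)) = W s * kraw n 0 s" by simp
      qed
      thus ?thesis unfolding W'sum using krawW[of 0] by simp
    qed
    show "0 \<le> (\<Sum>s\<le>n. W' s * kraw n s j)" if j: "j \<le> n" for j
    proof -
      have Cj: "0 < real (n choose j)" using j by simp
      have "(\<Sum>s\<in>S. W s * (kraw n s j / real (n choose s))) = (\<Sum>s\<in>S. W s * kraw n j s / real (n choose j))"
      proof (rule sum.cong[OF refl])
        fix s assume s: "s \<in> S"
        have "0 < real (n choose s)" using Sn(1)[OF s] by simp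
        thus "W s * (kraw n s j / real (n choose s)) = W s * kraw n j s / real (n choose j)"
          using kraw_sym[OF j Sn(1)[OF s]] Cj by (simp add: field_simps)
      qed
      hence eq: "(\<Sum>s\<le>n. W' s * kraw n s j) = 1 + V * ((\<Sum>s\<in>S. W s * kraw n j s) / real (n choose j))"
        unfolding W'sum by (simp add: sum_divide_distrib)
      consider "j \<le> 2 * m" | "n - j \<le> 2 * m" | "2 * m \<le> j" "2 * m \<le> n - j" by linarith
      thus ?thesis
      proof cases
        case 1
        thus ?thesis unfolding eq krawW[OF 1] using V0 by simp
      next
        case 2
        have "(\<Sum>s\<in>S. W s * kraw n j s) = (\<Sum>s\<in>S. W s * kraw n (n - j) s)"
          using kraw_reflect_left[of _ n j] j Sn by (intro sum.cong) auto
        thus ?thesis unfolding eq krawW[OF 2] using V0 by simp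
      next
        case 3
        have mono: "real (n choose (2 * m)) \<le> real (n choose j)"
        proof (cases "2 * j \<le> n")
          case True
          thus ?thesis using binomial_mono[OF 3(1)] by simp
        next
          case False
          hence "n choose (2 * m) \<le> n choose (n - j)" using 3 by (intro binomial_mono) auto
          thus ?thesis using binomial_symmetric[OF j] by simp
        qed
        have "\<bar>\<Sum>s\<in>S. W s * kraw n j s\<bar> \<le> (\<Sum>s\<in>S. \<bar>W s * kraw n j s\<bar>)" by (rule sum_abs)
        also have "\<dots> \<le> (\<Sum>s\<in>S. sqrt (real (n choose j)) * (W s * sqrt (2 ^ n / real (n choose s))))"
        proof (rule sum_mono)
          fix s assume s: "s \<in> S"
          have "\<bar>kraw n j s\<bar> \<le> sqrt (real (n choose j)) * sqrt (2 ^ n / real (n choose s))"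
            using abs_kraw_le[OF Sn(1)[OF s], of j] unfolding real_sqrt_mult[symmetric] by (simp add: mult.commute)
          from mult_left_mono[OF this W[OF s]]
          show "\<bar>W s * kraw n j s\<bar> \<le> sqrt (real (n choose j)) * (W s * sqrt (2 ^ n / real (n choose s)))"
            using W[OF s] by (simp add: abs_mult mult_ac)
        qed
        also have "\<dots> = sqrt (real (n choose j)) * (\<Sum>s\<in>S. W s * sqrt (2 ^ n / real (n choose s)))"
          by (simp add: sum_distrib_left)
        also have "\<dots> \<le> sqrt (real (n choose j)) * (4 * (real n + 1)\<^sup>2)"
          by (rule mult_left_mono[OF Wsum]) simp
        finally have "V * \<bar>\<Sum>s\<in>S. W s * kraw n j s\<bar> \<le> V * (sqrt (real (n choose j)) * (4 * (real n + 1)\<^sup>2))"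
          by (rule mult_left_mono[OF _ V0])
        also have "\<dots> = sqrt (real (n choose (2 * m))) * sqrt (real (n choose j))"
          by (simp add: V_def)
        also have "\<dots> \<le> sqrt (real (n choose j)) * sqrt (real (n choose j))"
          using mono by (intro mult_right_mono) auto
        also have "\<dots> = real (n choose j)" by simp
        finally have "V * \<bar>(\<Sum>s\<in>S. W s * kraw n j s) / real (n choose j)\<bar> \<le> 1"
          using Cj by (simp add: abs_divide field_simps)
        hence "\<bar>V * ((\<Sum>s\<in>S. W s * kraw n j s) / real (n choose j))\<bar> \<le> 1" using V0 by (simp add: abs_mult)
        thus ?thesis unfolding eq by linarith
      qed
    qed
  qed
qed


section \<open>Hahn polynomials\<close>

text \<open>The falling factorial, with a real base so that identities in \<open>n\<close>,
  \<open>w\<close> and \<open>l\<close> can be treated as polynomial identities.\<close>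

definition ff :: "real \<Rightarrow> nat \<Rightarrow> real" where
  "ff x j = (\<Prod>i<j. x - real i)"

lemma ff_0 [simp]: "ff x 0 = 1"
  by (simp add: ff_def)

lemma ff_Suc: "ff x (Suc j) = ff x j * (x - real j)"
  by (simp add: ff_def)

lemma ff_Suc_shift: "ff (x + 1) (Suc j) = (x + 1) * ff x j"
  unfolding ff_def by (subst prod.lessThan_Suc_shift) (simp add: algebra_simps)

lemma ff_eq_0: "l < j \<Longrightarrow> ff (real l) j = 0"
  by (auto simp: ff_def)

lemma ff_eq_fact:
  assumes "j \<le> a"
  shows "ff (real a) j = fact a / fact (a - j)"
  using assms
proof (induction j)
  case (Suc j)
  have "fact (a - j) = real (a - j) * fact (a - Suc j)"
    using Suc.prems by (metis Suc_diff_Suc Suc_le_lessD fact_Suc of_nat_fact of_nat_mult)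
  moreover have "real (a - j) \<noteq> 0" using Suc.prems by simp
  ultimately show ?case using Suc by (simp add: ff_Suc of_nat_diff)
qed simp

text \<open>The finite difference of order \<open>l\<close> of a polynomial in \<open>j\<close> of
  degree \<open>k < l\<close>.\<close>

lemma alternating_binomial_sum:
  "k < l \<Longrightarrow> l \<le> N \<Longrightarrow> (\<Sum>j\<le>l. real (l choose j) * ((-1) ^ j * real ((N - j) choose k))) = 0"
proof (induction l arbitrary: N k)
  case (Suc l)
  have "(\<Sum>j\<le>Suc l. real (Suc l choose j) * ((-1) ^ j * real ((N - j) choose k))) =
      (\<Sum>j\<le>l. real (l choose j) * ((-1) ^ j * real ((N - j) choose k) + (-1) ^ (j + 1) * real ((N - (j + 1)) choose k)))"
    by (rule binomial_sum_Suc)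
  also have "\<dots> = 0"
  proof (cases k)
    case (Suc k')
    have "(-1) ^ j * real ((N - j) choose k) + (-1) ^ (j + 1) * real ((N - (j + 1)) choose k) =
        (-1) ^ j * real ((N - 1 - j) choose k')" if "j \<le> l" for j
    proof -
      have "N - j = Suc (N - (j + 1))" using that Suc.prems by simp
      hence "real ((N - j) choose k) = real ((N - (j + 1)) choose k') + real ((N - (j + 1)) choose k)"
        by (simp add: \<open>k = Suc k'\<close>)
      thus ?thesis by (simp add: distrib_left)
    qed
    thus ?thesis using Suc.IH[of k' "N - 1"] Suc.prems \<open>k = Suc k'\<close> by simp
  qed simp
  finally show ?case .
qed simp

context
  fixes n w :: nat
  assumes wn: "2 * w < n"
begin

text \<open>\<open>hahn_A\<close> and \<open>hahn_C\<close> are the outer coefficients of the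
  three-term recurrence. The middle one is their sum, because the normalization
  \<open>hahn l 0 = (-1) ^ l\<close> makes the recurrence an identity at
  \<open>t = 0\<close>.\<close>

definition hahn_A :: "nat \<Rightarrow> real" where
  "hahn_A l = (real n + 1 - real l) * (real w - real l)\<^sup>2 / ((real n + 1 - 2 * real l) * (real n - 2 * real l))"

definition hahn_C :: "nat \<Rightarrow> real" where
  "hahn_C l = real l * (real n + 1 - real w - real l)\<^sup>2 / ((real n + 2 - 2 * real l) * (real n + 1 - 2 * real l))"

definition hahn_coeff :: "nat \<Rightarrow> nat \<Rightarrow> real" where
  "hahn_coeff l j = (-1) ^ (l + j) * ff (real l) j * ff (real n + 1 - real l) j / (ff (real w) j)\<^sup>2"

text \<open>Up to scaling the zonal functions of the Johnson scheme of \<open>w\<close>-sets, in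
  terms of the size \<open>t\<close> of the intersection. The signs make the leading coefficient
  positive.\<close>

definition hahn :: "nat \<Rightarrow> nat \<Rightarrow> real" where
  "hahn l t = (\<Sum>j\<le>l. hahn_coeff l j * real (t choose j))"

text \<open>The number of \<open>w\<close>-subsets of an \<open>n\<close>-set that meet a given one
  in \<open>t\<close> points; hence \<open>hsum\<close> is the row sum of a kernel that depends on
  the intersection.\<close>

definition hweight :: "nat \<Rightarrow> real" where
  "hweight t = real (w choose t) * real ((n - w) choose (w - t))"

definition hsum :: "(nat \<Rightarrow> real) \<Rightarrow> real" where
  "hsum g = (\<Sum>t\<le>w. hweight t * g t)"

lemma ff_w_pos: "j \<le> w \<Longrightarrow> 0 < ff (real w) j"
  by (simp add: ff_eq_fact)

lemma hahn_0 [simp]: "hahn 0 t = 1"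
  by (simp add: hahn_def hahn_coeff_def)

lemma hahn_C_0 [simp]: "hahn_C 0 = 0"
  by (simp add: hahn_C_def)

lemma hahn_A_pos: "l < w \<Longrightarrow> 0 < hahn_A l"
  unfolding hahn_A_def using wn by (intro divide_pos_pos mult_pos_pos) auto

lemma hahn_A_w: "hahn_A w = 0"
  by (simp add: hahn_A_def)

lemma hahn_C_pos: "0 < l \<Longrightarrow> l \<le> w \<Longrightarrow> 0 < hahn_C l"
  unfolding hahn_C_def using wn by (intro divide_pos_pos mult_pos_pos) auto

lemma hahn_extend:
  assumes "l \<le> L"
  shows "hahn l t = (\<Sum>j\<le>L. hahn_coeff l j * real (t choose j))"
  unfolding hahn_def using assms
  by (intro sum.mono_neutral_left) (auto simp: hahn_coeff_def ff_eq_0)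

text \<open>The comparison of coefficients in the recurrence, stripped of common factors. In p = N +
  1 - 2 l the denominators are p, p - 1 and p + 1, and clearing them leaves a polynomial
  identity.\<close>

lemma hahn_contiguous:
  fixes N W l i :: real
  assumes "N + 1 - 2 * l \<noteq> 0" "N - 2 * l \<noteq> 0" "N + 2 - 2 * l \<noteq> 0"
  defines "A \<equiv> (W - l)\<^sup>2 / ((N + 1 - 2 * l) * (N - 2 * l))"
    and "C \<equiv> (N + 1 - W - l)\<^sup>2 / ((N + 2 - 2 * l) * (N + 1 - 2 * l))"
  shows "(i + 1) * ((W - i)\<^sup>2 - (l - i) * (N + 1 - l - i)) =
    A * (l + 1) * (N + 1 - l - i) * (N - l - i) - ((N + 1 - l) * A + l * C) * (l - i) * (N + 1 - l - i)
    + C * (l - i) * (l - 1 - i) * (N + 2 - l)"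
proof -
  define p where "p = N + 1 - 2 * l"
  have N: "N = p - 1 + 2 * l" by (simp add: p_def)
  have nz: "p \<noteq> 0" "p - 1 \<noteq> 0" "p + 1 \<noteq> 0" using assms(1-3) by (auto simp: p_def)
  have A: "A = (W - l)\<^sup>2 / (p * (p - 1))" unfolding A_def N by simp
  have C: "C = (p + l - W)\<^sup>2 / ((p + 1) * p)" unfolding C_def N by (simp add: algebra_simps)
  have poly_id: "((i + 1) * ((W - i)\<^sup>2 - (l - i) * (N + 1 - l - i))) * (p * (p - 1) * (p + 1)) =
     (W - l)\<^sup>2 * (p + 1) * (l + 1) * (N + 1 - l - i) * (N - l - i)
      - ((N + 1 - l) * ((W - l)\<^sup>2 * (p + 1)) + l * ((p + l - W)\<^sup>2 * (p - 1))) * (l - i) * (N + 1 - l - i)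
      + ((p + l - W)\<^sup>2 * (p - 1)) * (l - i) * (l - 1 - i) * (N + 2 - l)"
    unfolding N by (simp add: power2_eq_square algebra_simps)
  have AD: "(W - l)\<^sup>2 * (p + 1) = A * (p * (p - 1) * (p + 1))" and CD: "(p + l - W)\<^sup>2 * (p - 1) = C * (p * (p - 1) * (p + 1))"
  proof -
    have "A * (p * (p - 1)) = (W - l)\<^sup>2" "C * ((p + 1) * p) = (p + l - W)\<^sup>2" unfolding A C using nz by simp_all
    moreover have "A * (p * (p - 1) * (p + 1)) = A * (p * (p - 1)) * (p + 1)"
      "C * (p * (p - 1) * (p + 1)) = C * ((p + 1) * p) * (p - 1)" by (simp_all only: mult_ac)
    ultimately show "(W - l)\<^sup>2 * (p + 1) = A * (p * (p - 1) * (p + 1))"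
      "(p + l - W)\<^sup>2 * (p - 1) = C * (p * (p - 1) * (p + 1))" by (simp_all only:)
  qed
  have "((i + 1) * ((W - i)\<^sup>2 - (l - i) * (N + 1 - l - i))) * (p * (p - 1) * (p + 1)) =
     (A * (l + 1) * (N + 1 - l - i) * (N - l - i) - ((N + 1 - l) * A + l * C) * (l - i) * (N + 1 - l - i)
    + C * (l - i) * (l - 1 - i) * (N + 2 - l)) * (p * (p - 1) * (p + 1))"
  proof -
    have "X * (l + 1) * u * v - (k * X + l * Z) * r * u + Z * r * r' * q =
        (A * (l + 1) * u * v - (k * A + l * C) * r * u + C * r * r' * q) * D"
      if "X = A * D" "Z = C * D" for X Z D u v k r r' q
      unfolding that by (simp add: algebra_simps)
    thus ?thesis using poly_id AD CD by simp
  qed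
  thus ?thesis using nz by simp
qed

text \<open>Comparison of the coefficients of \<open>t choose j\<close> in the recurrence; the left
  side is what multiplication by \<open>t\<close> produces. The truncated \<open>l - 1\<close> does
  no harm at \<open>l = 0\<close>, where \<open>hahn_C\<close> vanishes.\<close>

lemma hahn_coeff_recurrence:
  assumes "l \<le> w" "j \<le> w"
  shows "real j * (hahn_coeff l j + (if j = 0 then 0 else hahn_coeff l (j - 1))) =
    hahn_A l * hahn_coeff (l + 1) j + (hahn_A l + hahn_C l) * hahn_coeff l j + hahn_C l * hahn_coeff (l - 1) j"
proof (cases j)
  case 0
  show ?thesis
  proof (cases l)
    case (Suc l')
    thus ?thesis using 0 by (simp add: hahn_coeff_def algebra_simps)
  qed (use 0 in \<open>simp add: hahn_coeff_def\<close>)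
next
  case (Suc i)
  have iw: "i < w" using Suc assms by simp
  define N W L I where "N = real n" and "W = real w" and "L = real l" and "I = real i"
  define A' where "A' = (W - L)\<^sup>2 / ((N + 1 - 2 * L) * (N - 2 * L))"
  define C' where "C' = (N + 1 - W - L)\<^sup>2 / ((N + 2 - 2 * L) * (N + 1 - 2 * L))"
  define s P Y Q where "s = (-1::real) ^ (l + i)" and "P = ff L i" and "Y = ff (N + 1 - L) i" and "Q = (ff W i)\<^sup>2"
  have Q0: "Q \<noteq> 0" using ff_w_pos[of i] iw by (simp add: Q_def W_def)
  have WI: "W - I \<noteq> 0" using iw by (simp add: W_def I_def)
  have NL: "0 < N + 1 - L" "0 < N + 1 - L - I" using assms iw wn by (auto simp: N_def L_def I_def)
  have A: "hahn_A l = (N + 1 - L) * A'" by (simp add: hahn_A_def A'_def N_def W_def L_def)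
  have C: "hahn_C l = L * C'" by (simp add: hahn_C_def C'_def N_def W_def L_def)
  have ffW: "(ff (real w) j)\<^sup>2 = Q * (W - I)\<^sup>2"
    by (simp add: Suc ff_Suc Q_def W_def I_def power_mult_distrib)
  have c0: "hahn_coeff l i = s * P * Y / Q"
    by (simp add: hahn_coeff_def s_def P_def Y_def Q_def N_def L_def W_def)
  have c1: "hahn_coeff l j = - s * (P * (L - I)) * (Y * (N + 1 - L - I)) / (Q * (W - I)\<^sup>2)"
    unfolding hahn_coeff_def ffW by (simp add: Suc ff_Suc s_def P_def Y_def N_def L_def I_def)
  have X: "ff (N - L) i * (N + 1 - L) = Y * (N + 1 - L - I)"
  proof -
    have "ff (N - L + 1) (Suc i) = (N - L + 1) * ff (N - L) i" by (rule ff_Suc_shift)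
    moreover have "ff (N - L + 1) (Suc i) = ff (N - L + 1) i * (N - L + 1 - I)" by (simp add: ff_Suc I_def)
    moreover have "N - L + 1 = N + 1 - L" by simp
    ultimately show ?thesis unfolding Y_def by (simp only: mult.commute)
  qed
  have c2: "hahn_coeff (l + 1) j = s * ((L + 1) * P) * (ff (N - L) i * (N - L - I)) / (Q * (W - I)\<^sup>2)"
  proof -
    have "ff (real (l + 1)) j = (L + 1) * P" unfolding Suc P_def L_def using ff_Suc_shift[of "real l" i] by (simp add: add.commute)
    moreover have "ff (real n + 1 - real (l + 1)) j = ff (N - L) i * (N - L - I)" by (simp add: Suc ff_Suc N_def L_def I_def)
    ultimately show ?thesis unfolding hahn_coeff_def ffW by (simp add: s_def Suc)
  qed
  have c3: "L * hahn_coeff (l - 1) j = s * (P * (L - I) * (L - 1 - I)) * ((N + 2 - L) * Y) / (Q * (W - I)\<^sup>2)"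
  proof (cases l)
    case 0
    have "P * (L - I) * (L - 1 - I) = 0 \<or> i = 0" using 0 ff_eq_0[of 0 i] by (auto simp: P_def L_def)
    thus ?thesis using 0 by (auto simp: L_def I_def)
  next
    case (Suc l')
    have "L = real l' + 1" using Suc by (simp add: L_def)
    hence "ff L (Suc i) = L * ff (real l') i" using ff_Suc_shift[of "real l'" i] by simp
    hence "L * ff (real l') i = P * (L - I)" by (simp add: ff_Suc P_def I_def)
    moreover have "ff (real l') j = ff (real l') i * (L - 1 - I)"
      using \<open>L = real l' + 1\<close> by (simp add: \<open>j = Suc i\<close> ff_Suc I_def)
    ultimately have "L * ff (real l') j = P * (L - I) * (L - 1 - I)" by (simp add: mult.assoc[symmetric])
    moreover have "ff (real n + 1 - real l') j = (N + 2 - L) * Y"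
    proof -
      have "real n + 1 - real l' = (N + 1 - L) + 1" using Suc by (simp add: N_def L_def)
      hence "ff (real n + 1 - real l') j = (N + 1 - L + 1) * Y"
        unfolding \<open>j = Suc i\<close> Y_def by (simp only: ff_Suc_shift)
      thus ?thesis by (simp add: algebra_simps)
    qed
    moreover have "(-1::real) ^ (l' + j) = s" using Suc \<open>j = Suc i\<close> by (simp add: s_def)
    moreover have "L * hahn_coeff l' j = (-1) ^ (l' + j) * (L * ff (real l') j) * ff (real n + 1 - real l') j / (ff (real w) j)\<^sup>2"
      by (simp add: hahn_coeff_def)
    ultimately show ?thesis using Suc by (simp add: ffW)
  qed
  have id: "(I + 1) * ((W - I)\<^sup>2 - (L - I) * (N + 1 - L - I)) =
    A' * (L + 1) * (N + 1 - L - I) * (N - L - I) - ((N + 1 - L) * A' + L * C') * (L - I) * (N + 1 - L - I)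
    + C' * (L - I) * (L - 1 - I) * (N + 2 - L)"
    unfolding A'_def C'_def by (rule hahn_contiguous) (use assms wn in \<open>auto simp: N_def L_def\<close>)
  have "real j * (hahn_coeff l j + hahn_coeff l i) * (Q * (W - I)\<^sup>2) =
      s * P * Y * ((I + 1) * ((W - I)\<^sup>2 - (L - I) * (N + 1 - L - I)))"
  proof -
    have "hahn_coeff l i * (Q * (W - I)\<^sup>2) = s * P * Y * (W - I)\<^sup>2" unfolding c0 using Q0 by simp
    moreover have "hahn_coeff l j * (Q * (W - I)\<^sup>2) = - s * (P * (L - I)) * (Y * (N + 1 - L - I))" unfolding c1 using Q0 WI by simp
    ultimately have "(hahn_coeff l j + hahn_coeff l i) * (Q * (W - I)\<^sup>2) = s * P * Y * ((W - I)\<^sup>2 - (L - I) * (N + 1 - L - I))"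
      unfolding distrib_right by (simp add: algebra_simps)
    moreover have "real j = I + 1" by (simp add: Suc I_def)
    ultimately show ?thesis by (simp only: mult_ac)
  qed
  also have "\<dots> = (hahn_A l * hahn_coeff (l + 1) j + (hahn_A l + hahn_C l) * hahn_coeff l j + hahn_C l * hahn_coeff (l - 1) j) * (Q * (W - I)\<^sup>2)"
  proof -
    have "hahn_A l * hahn_coeff (l + 1) j * (Q * (W - I)\<^sup>2) = A' * s * ((L + 1) * P) * ((ff (N - L) i * (N + 1 - L)) * (N - L - I))"
      unfolding A c2 using Q0 WI by simp
    also have "\<dots> = s * P * Y * (A' * (L + 1) * (N + 1 - L - I) * (N - L - I))" unfolding X by (simp add: mult_ac)
    finally have t1: "hahn_A l * hahn_coeff (l + 1) j * (Q * (W - I)\<^sup>2) = s * P * Y * (A' * (L + 1) * (N + 1 - L - I) * (N - L - I))" .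
    have t2: "(hahn_A l + hahn_C l) * hahn_coeff l j * (Q * (W - I)\<^sup>2) = - (s * P * Y * (((N + 1 - L) * A' + L * C') * (L - I) * (N + 1 - L - I)))"
      unfolding A C c1 using Q0 WI by simp
    have "hahn_C l * hahn_coeff (l - 1) j * (Q * (W - I)\<^sup>2) = C' * (L * hahn_coeff (l - 1) j) * (Q * (W - I)\<^sup>2)"
      unfolding C by (simp add: mult_ac)
    also have "\<dots> = s * P * Y * (C' * (L - I) * (L - 1 - I) * (N + 2 - L))" unfolding c3 using Q0 WI by simp
    finally have t3: "hahn_C l * hahn_coeff (l - 1) j * (Q * (W - I)\<^sup>2) = s * P * Y * (C' * (L - I) * (L - 1 - I) * (N + 2 - L))" .
    have g1: "(x + y + z) * k = x * k + y * k + z * k" and g2: "k * (x - y + z) = k * x + - (k * y) + k * z" for x y z k :: real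
      by (simp_all add: algebra_simps)
    show ?thesis unfolding g1 t1 t2 t3 unfolding id g2 ..
  qed
  finally have "real j * (hahn_coeff l j + hahn_coeff l i) =
      hahn_A l * hahn_coeff (l + 1) j + (hahn_A l + hahn_C l) * hahn_coeff l j + hahn_C l * hahn_coeff (l - 1) j"
    using Q0 WI by (subst (asm) mult_right_cancel) auto
  thus ?thesis by (simp only: Suc diff_Suc_1 if_False nat.distinct)
qed

lemma hahn_three_term:
  assumes "l \<le> w" "t \<le> w"
  shows "real t * hahn l t = hahn_A l * hahn (l + 1) t + (hahn_A l + hahn_C l) * hahn l t + hahn_C l * hahn (l - 1) t"
proof -
  have tc: "real t * real (t choose j) = real (j + 1) * real (t choose (j + 1)) + real j * real (t choose j)" for j
  proof (cases "j \<le> t")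
    case True
    have "Suc j * (t choose Suc j) = (t - j) * (t choose j)"
      using binomial_absorb_comp[of t j] binomial_absorption[of j "t - 1"] by (metis binomial_absorption)
    hence "real (Suc j) * real (t choose Suc j) = (real t - real j) * real (t choose j)"
      using True by (metis of_nat_mult of_nat_diff)
    thus ?thesis by (simp add: algebra_simps)
  qed (simp add: binomial_eq_0)
  have "real t * hahn l t = (\<Sum>j\<le>l + 1. hahn_coeff l j * (real t * real (t choose j)))"
    unfolding hahn_extend[of l "l + 1" t, OF le_add1] sum_distrib_left by (simp only: mult_ac)
  also have "\<dots> = (\<Sum>j\<le>l + 1. real (j + 1) * hahn_coeff l j * real (t choose (j + 1))) + (\<Sum>j\<le>l + 1. real j * hahn_coeff l j * real (t choose j))"
    unfolding tc by (simp add: distrib_left sum.distrib mult_ac)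
  also have "(\<Sum>j\<le>l + 1. real (j + 1) * hahn_coeff l j * real (t choose (j + 1))) =
      (\<Sum>j\<le>l. real (j + 1) * hahn_coeff l j * real (t choose (j + 1)))"
    by (simp add: hahn_coeff_def ff_eq_0)
  also have "\<dots> = (\<Sum>j\<le>l + 1. real j * (if j = 0 then 0 else hahn_coeff l (j - 1)) * real (t choose j))"
    using sum.atMost_Suc_shift[of "\<lambda>j. real j * (if j = 0 then 0 else hahn_coeff l (j - 1)) * real (t choose j)" l] by simp
  also have "\<dots> + (\<Sum>j\<le>l + 1. real j * hahn_coeff l j * real (t choose j)) =
      (\<Sum>j\<le>l + 1. real j * (hahn_coeff l j + (if j = 0 then 0 else hahn_coeff l (j - 1))) * real (t choose j))"
    unfolding sum.distrib[symmetric] by (rule sum.cong[OF refl]) (simp add: algebra_simps)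
  also have "\<dots> = (\<Sum>j\<le>l + 1. (hahn_A l * hahn_coeff (l + 1) j + (hahn_A l + hahn_C l) * hahn_coeff l j + hahn_C l * hahn_coeff (l - 1) j) * real (t choose j))"
  proof (rule sum.cong[OF refl])
    fix j assume "j \<in> {..l + 1}"
    show "real j * (hahn_coeff l j + (if j = 0 then 0 else hahn_coeff l (j - 1))) * real (t choose j) =
      (hahn_A l * hahn_coeff (l + 1) j + (hahn_A l + hahn_C l) * hahn_coeff l j + hahn_C l * hahn_coeff (l - 1) j) * real (t choose j)"
    proof (cases "j \<le> w")
      case True
      show ?thesis unfolding hahn_coeff_recurrence[OF assms(1) True] ..
    next
      \<comment> \<open>Here \<open>j = w + 1\<close>, which occurs for \<open>l = w\<close>; then
        \<open>t choose j\<close> is 0.\<close>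
      case False
      thus ?thesis using assms by (simp add: binomial_eq_0)
    qed
  qed
  also have "\<dots> = hahn_A l * hahn (l + 1) t + (hahn_A l + hahn_C l) * hahn l t + hahn_C l * hahn (l - 1) t"
    using hahn_extend[of "l + 1" "l + 1" t] hahn_extend[of l "l + 1" t] hahn_extend[of "l - 1" "l + 1" t]
    by (simp only: sum_distrib_left sum.distrib distrib_right mult.assoc)
  finally show ?thesis .
qed

section \<open>Orthogonality, norms and diagonal values of the Hahn polynomials\<close>

lemma hsum_cong: "(\<And>t. t \<le> w \<Longrightarrow> f t = g t) \<Longrightarrow> hsum f = hsum g"
  unfolding hsum_def by (intro sum.cong) auto

lemma hsum_add: "hsum (\<lambda>t. f t + g t) = hsum f + hsum g"
  by (simp add: hsum_def distrib_left sum.distrib)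

lemma hsum_mult: "hsum (\<lambda>t. c * f t) = c * hsum f"
  by (simp add: hsum_def sum_distrib_left mult_ac)

lemma hsum_sum: "hsum (\<lambda>t. \<Sum>i\<in>I. f i t) = (\<Sum>i\<in>I. hsum (f i))"
  unfolding hsum_def sum_distrib_left by (rule sum.swap)

lemma hsum_choose:
  assumes "j \<le> w"
  shows "hsum (\<lambda>t. real (t choose j)) = real (w choose j) * real ((n - j) choose (w - j))"
proof -
  have "hsum (\<lambda>t. real (t choose j)) = (\<Sum>t\<in>{j..w}. hweight t * real (t choose j))"
    unfolding hsum_def by (rule sum.mono_neutral_right) (auto simp: binomial_eq_0)
  also have "\<dots> = (\<Sum>r\<le>w - j. hweight (j + r) * real ((j + r) choose j))"
    by (rule sum.reindex_bij_witness[of _ "\<lambda>r. j + r" "\<lambda>t. t - j"]) (use assms in auto)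
  also have "\<dots> = (\<Sum>r\<le>w - j. real (w choose j) * real (((w - j) choose r) * ((n - w) choose (w - j - r))))"
  proof (rule sum.cong[OF refl])
    fix r assume "r \<in> {..w - j}"
    hence "(w choose (j + r)) * ((j + r) choose j) = (w choose j) * ((w - j) choose r)"
      using choose_mult[of j "j + r" w] assms by simp
    hence "real (w choose (j + r)) * real ((j + r) choose j) = real (w choose j) * real ((w - j) choose r)"
      by (metis of_nat_mult)
    moreover have "w - (j + r) = w - j - r" by simp
    ultimately show "hweight (j + r) * real ((j + r) choose j) = real (w choose j) * real (((w - j) choose r) * ((n - w) choose (w - j - r)))"
      unfolding hweight_def by (simp add: mult_ac)
  qed
  also have "\<dots> = real (w choose j) * real (\<Sum>r\<le>w - j. ((w - j) choose r) * ((n - w) choose (w - j - r)))"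
    by (simp add: sum_distrib_left)
  also have "(\<Sum>r\<le>w - j. ((w - j) choose r) * ((n - w) choose (w - j - r))) = (w - j + (n - w)) choose (w - j)"
    by (rule vandermonde)
  also have "w - j + (n - w) = n - j" using assms wn by simp
  finally show ?thesis .
qed

text \<open>Once the sums of \<open>t choose j\<close> are evaluated by \<open>hsum_choose\<close>,
  the factorials combine to a constant times a vanishing alternating sum.\<close>

lemma hsum_hahn:
  assumes "1 \<le> l" "l \<le> w"
  shows "hsum (hahn l) = 0"
proof -
  define K :: real where "K = (-1) ^ l * fact (n + 1 - l) * fact (l - 1) / (fact w * fact (n - w))"
  have "hsum (hahn l) = (\<Sum>j\<le>l. hahn_coeff l j * hsum (\<lambda>t. real (t choose j)))"
    unfolding hahn_def hsum_sum hsum_mult ..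
  also have "\<dots> = (\<Sum>j\<le>l. K * (real (l choose j) * ((-1) ^ j * real ((n - j) choose (l - 1)))))"
  proof (rule sum.cong[OF refl])
    fix j assume "j \<in> {..l}"
    hence j: "j \<le> l" "j \<le> w" using assms by auto
    have f1: "ff (real l) j = fact l / fact (l - j)" by (rule ff_eq_fact) (use j in simp)
    have "real n + 1 - real l = real (n + 1 - l)" using assms wn by (simp add: of_nat_diff)
    hence "ff (real n + 1 - real l) j = ff (real (n + 1 - l)) j" by (simp only:)
    also have "\<dots> = fact (n + 1 - l) / fact (n + 1 - l - j)" by (rule ff_eq_fact) (use j assms wn in simp)
    finally have f2: "ff (real n + 1 - real l) j = fact (n + 1 - l) / fact (n + 1 - l - j)" .
    have f3: "ff (real w) j = fact w / fact (w - j)" by (rule ff_eq_fact) (use j in simp)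
    have b1: "real (w choose j) = fact w / (fact j * fact (w - j))" using j by (intro binomial_fact) auto
    have "n - j - (w - j) = n - w" using j by simp
    moreover have "real ((n - j) choose (w - j)) = fact (n - j) / (fact (w - j) * fact (n - j - (w - j)))"
      by (rule binomial_fact) (use j wn in simp)
    ultimately have b2: "real ((n - j) choose (w - j)) = fact (n - j) / (fact (w - j) * fact (n - w))" by simp
    have b3: "real (l choose j) = fact l / (fact j * fact (l - j))" using j by (intro binomial_fact) auto
    have "n - j - (l - 1) = n + 1 - l - j" using assms by simp
    moreover have "real ((n - j) choose (l - 1)) = fact (n - j) / (fact (l - 1) * fact (n - j - (l - 1)))"
      by (rule binomial_fact) (use j assms wn in simp)
    ultimately have b4: "real ((n - j) choose (l - 1)) = fact (n - j) / (fact (l - 1) * fact (n + 1 - l - j))" by simp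
    show "hahn_coeff l j * hsum (\<lambda>t. real (t choose j)) = K * (real (l choose j) * ((-1) ^ j * real ((n - j) choose (l - 1))))"
      unfolding hahn_coeff_def hsum_choose[OF j(2)] f1 f2 f3 b1 b2 b3 b4 K_def
      by (simp add: field_simps power2_eq_square power_add)
  qed
  also have "\<dots> = K * (\<Sum>j\<le>l. real (l choose j) * ((-1) ^ j * real ((n - j) choose (l - 1))))"
    by (simp only: sum_distrib_left)
  also have "\<dots> = 0" using alternating_binomial_sum[of "l - 1" l n] assms wn by simp
  finally show ?thesis .
qed

text \<open>The recurrence trades one power of \<open>t\<close> for the neighbours of
  \<open>l\<close>, so induction on \<open>k\<close> applies. At \<open>l = w\<close> the upper
  neighbour has coefficient \<open>hahn_A w = 0\<close>.\<close>

lemma hsum_power_hahn: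
  "k < l \<Longrightarrow> l \<le> w \<Longrightarrow> hsum (\<lambda>t. real t ^ k * hahn l t) = 0"
proof (induction k arbitrary: l)
  case 0
  thus ?case using hsum_hahn[of l] by simp
next
  case (Suc k)
  have "hsum (\<lambda>t. real t ^ Suc k * hahn l t) =
      hsum (\<lambda>t. hahn_A l * (real t ^ k * hahn (l + 1) t) + ((hahn_A l + hahn_C l) * (real t ^ k * hahn l t) + hahn_C l * (real t ^ k * hahn (l - 1) t)))"
  proof (rule hsum_cong)
    fix t assume t: "t \<le> w"
    have "real t ^ Suc k * hahn l t = real t ^ k * (real t * hahn l t)" by simp
    also have "\<dots> = hahn_A l * (real t ^ k * hahn (l + 1) t) + ((hahn_A l + hahn_C l) * (real t ^ k * hahn l t) + hahn_C l * (real t ^ k * hahn (l - 1) t))"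
      unfolding hahn_three_term[OF Suc.prems(2) t] by (simp only: algebra_simps)
    finally show "real t ^ Suc k * hahn l t = hahn_A l * (real t ^ k * hahn (l + 1) t) + ((hahn_A l + hahn_C l) * (real t ^ k * hahn l t) + hahn_C l * (real t ^ k * hahn (l - 1) t))" .
  qed
  also have "\<dots> = hahn_A l * hsum (\<lambda>t. real t ^ k * hahn (l + 1) t) + ((hahn_A l + hahn_C l) * hsum (\<lambda>t. real t ^ k * hahn l t) + hahn_C l * hsum (\<lambda>t. real t ^ k * hahn (l - 1) t))"
    by (simp only: hsum_add hsum_mult)
  also have "hahn_A l * hsum (\<lambda>t. real t ^ k * hahn (l + 1) t) = 0"
    using Suc.IH[of "l + 1"] Suc.prems hahn_A_w by (cases "l = w") auto
  also have "hsum (\<lambda>t. real t ^ k * hahn l t) = 0" using Suc by simp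
  also have "hsum (\<lambda>t. real t ^ k * hahn (l - 1) t) = 0" using Suc by simp
  finally show ?case by simp
qed

lemma hsum_poly_hahn:
  assumes "degree p < l" "l \<le> w"
  shows "hsum (\<lambda>t. poly p (real t) * hahn l t) = 0"
proof -
  have "hsum (\<lambda>t. poly p (real t) * hahn l t) = hsum (\<lambda>t. \<Sum>k\<le>degree p. coeff p k * (real t ^ k * hahn l t))"
    by (rule hsum_cong) (simp add: poly_altdef sum_distrib_right mult.assoc)
  also have "\<dots> = (\<Sum>k\<le>degree p. coeff p k * hsum (\<lambda>t. real t ^ k * hahn l t))"
    unfolding hsum_sum hsum_mult ..
  also have "\<dots> = 0" using hsum_power_hahn assms by (intro sum.neutral) auto
  finally show ?thesis .
qed

lemma choose_poly:
  "\<exists>p :: real poly. degree p \<le> j \<and> (\<forall>t. poly p (real t) = real (t choose j))"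
proof -
  define p :: "real poly" where "p = smult (1 / fact j) (\<Prod>i<j. [:- real i, 1:])"
  have "degree (\<Prod>i<j. [:- real i, 1:]) \<le> j"
    using degree_prod_sum_le[of "{..<j}" "\<lambda>i. [:- real i, 1:]"] by simp
  hence "degree p \<le> j" unfolding p_def by (rule order_trans[OF degree_smult_le])
  moreover have "poly p (real t) = real (t choose j)" for t
  proof -
    have "poly p (real t) = ff (real t) j / fact j" by (simp add: p_def poly_prod ff_def)
    also have "\<dots> = real (t choose j)"
    proof (cases "j \<le> t")
      case True
      have "real (t choose j) = fact t / (fact j * fact (t - j))" using True by (rule binomial_fact)
      thus ?thesis using True by (simp add: ff_eq_fact)
    qed (simp add: ff_eq_0 binomial_eq_0)
    finally show ?thesis .
  qed
  ultimately show ?thesis by blast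
qed

lemma hsum_choose_choose_hahn:
  assumes "i + k < l" "l \<le> w"
  shows "hsum (\<lambda>t. real (t choose i) * real ((w - t) choose k) * hahn l t) = 0"
proof -
  obtain p q :: "real poly" where p: "degree p \<le> i" "\<forall>t. poly p (real t) = real (t choose i)"
      and q: "degree q \<le> k" "\<forall>t. poly q (real t) = real (t choose k)" using choose_poly by metis
  define r where "r = p * pcompose q [:real w, -1:]"
  have "degree (pcompose q [:real w, -1:]) \<le> k" using degree_pcompose_le[of q "[:real w, -1:]"] q by simp
  hence "degree r < l" unfolding r_def using degree_mult_le[of p "pcompose q [:real w, -1:]"] p assms by linarith
  hence "hsum (\<lambda>t. poly r (real t) * hahn l t) = 0" using assms by (intro hsum_poly_hahn)
  moreover have "poly r (real t) = real (t choose i) * real ((w - t) choose k)" if "t \<le> w" for t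
    using p q that q(2)[rule_format, of "w - t"] by (simp add: r_def poly_pcompose of_nat_diff)
  ultimately show ?thesis using hsum_cong[of "\<lambda>t. poly r (real t) * hahn l t" "\<lambda>t. real (t choose i) * real ((w - t) choose k) * hahn l t"] by simp
qed

lemma hahn_poly:
  "\<exists>p :: real poly. degree p \<le> l \<and> (\<forall>t. poly p (real t) = hahn l t)"
proof -
  have "\<exists>P. \<forall>j. degree (P j :: real poly) \<le> j \<and> (\<forall>t. poly (P j) (real t) = real (t choose j))"
    by (intro choice allI choose_poly)
  then obtain P where P: "\<And>j. degree (P j :: real poly) \<le> j" "\<And>j t. poly (P j) (real t) = real (t choose j)" by blast
  have "degree (\<Sum>j\<le>l. smult (hahn_coeff l j) (P j)) \<le> l"
    by (intro degree_sum_le) (auto intro!: order_trans[OF degree_smult_le] order_trans[OF P(1)])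
  moreover have "poly (\<Sum>j\<le>l. smult (hahn_coeff l j) (P j)) (real t) = hahn l t" for t
    by (simp add: poly_sum P hahn_def)
  ultimately show ?thesis by blast
qed

lemma hahn_orthogonal:
  assumes "l \<le> w" "l' \<le> w" "l \<noteq> l'"
  shows "hsum (\<lambda>t. hahn l t * hahn l' t) = 0"
proof -
  have *: "hsum (\<lambda>t. hahn l t * hahn l' t) = 0" if "l < l'" "l' \<le> w" for l l'
  proof -
    obtain p :: "real poly" where "degree p \<le> l" "\<forall>t. poly p (real t) = hahn l t" using hahn_poly by blast
    thus ?thesis using hsum_poly_hahn[of p l'] that by simp
  qed
  show ?thesis using *[of l l'] *[of l' l] assms by (cases "l < l'") (auto simp: mult.commute)
qed

definition hnorm :: "nat \<Rightarrow> real" where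
  "hnorm l = hsum (\<lambda>t. hahn l t * hahn l t)"

text \<open>Evaluate the pairing of \<open>t * hahn l t\<close> with \<open>hahn (l + 1) t\<close>
  by applying the recurrence to either factor.\<close>

lemma hnorm_rec:
  assumes "l < w"
  shows "hahn_A l * hnorm (l + 1) = hahn_C (l + 1) * hnorm l"
proof -
  have "hsum (\<lambda>t. (real t * hahn l t) * hahn (l + 1) t) =
      hsum (\<lambda>t. hahn_A l * (hahn (l + 1) t * hahn (l + 1) t) + ((hahn_A l + hahn_C l) * (hahn l t * hahn (l + 1) t) + hahn_C l * (hahn (l - 1) t * hahn (l + 1) t)))"
    by (rule hsum_cong, subst hahn_three_term) (use assms in \<open>auto simp: algebra_simps\<close>)
  also have "\<dots> = hahn_A l * hnorm (l + 1)"
    unfolding hsum_add hsum_mult hnorm_def using hahn_orthogonal[of l "l + 1"] hahn_orthogonal[of "l - 1" "l + 1"] assms by simp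
  finally have 1: "hsum (\<lambda>t. (real t * hahn l t) * hahn (l + 1) t) = hahn_A l * hnorm (l + 1)" .
  have "hsum (\<lambda>t. (real t * hahn l t) * hahn (l + 1) t) = hsum (\<lambda>t. (real t * hahn (l + 1) t) * hahn l t)"
    by (rule hsum_cong) (simp add: mult_ac)
  also have "\<dots> = hsum (\<lambda>t. hahn_A (l + 1) * (hahn (l + 2) t * hahn l t) + ((hahn_A (l + 1) + hahn_C (l + 1)) * (hahn (l + 1) t * hahn l t) + hahn_C (l + 1) * (hahn l t * hahn l t)))"
    by (rule hsum_cong, subst hahn_three_term) (use assms in \<open>auto simp: algebra_simps\<close>)
  also have "\<dots> = hahn_C (l + 1) * hnorm l"
  proof -
    have "hahn_A (l + 1) * hsum (\<lambda>t. hahn (l + 2) t * hahn l t) = 0"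
      using hahn_orthogonal[of "l + 2" l] hahn_A_w assms by (cases "l + 1 = w") auto
    moreover have "hsum (\<lambda>t. hahn (l + 1) t * hahn l t) = 0" using hahn_orthogonal[of "l + 1" l] assms by simp
    ultimately show ?thesis unfolding hsum_add hsum_mult hnorm_def by simp
  qed
  finally show ?thesis using 1 by simp
qed

lemma hnorm_0: "hnorm 0 = real (n choose w)"
  using hsum_choose[of 0] by (simp add: hnorm_def)

lemma hnorm_pos: "l \<le> w \<Longrightarrow> 0 < hnorm l"
proof (induction l)
  case 0
  thus ?case using wn by (simp add: hnorm_0)
next
  case (Suc l)
  have "0 < hahn_A l * hnorm (Suc l)" using hnorm_rec[of l] Suc hahn_C_pos[of "Suc l"] by simp
  thus ?case using hahn_A_pos[of l] Suc.prems by (simp add: zero_less_mult_iff)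
qed

text \<open>The point \<open>t = w\<close> is the diagonal of the kernel. The recurrence propagates
  the two-term relation thanks to the identity \<open>sum\<close> between its coefficients.\<close>

lemma hahn_at_w_step:
  assumes "l < w"
  shows "hahn (l + 1) w * (real w - real l) = hahn l w * (real n - real w - real l)"
  using assms
proof (induction l)
  case 0
  have "real w * hahn 0 w = hahn_A 0 * hahn 1 w + (hahn_A 0 + hahn_C 0) * hahn 0 w + hahn_C 0 * hahn 0 w"
    using hahn_three_term[of 0 w] by simp
  hence "hahn_A 0 * hahn 1 w = real w - hahn_A 0" by simp
  moreover have "hahn_A 0 = (real w)\<^sup>2 / real n" by (simp add: hahn_A_def)
  ultimately have "(real w)\<^sup>2 * hahn 1 w = real w * real n - (real w)\<^sup>2" using wn by (simp add: field_simps)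
  hence "real w * (real w * hahn 1 w) = real w * (real n - real w)" by (simp add: power2_eq_square algebra_simps)
  thus ?case using 0 by (simp add: mult.commute)
next
  case (Suc l)
  define L N W where "L = real (Suc l)" and "N = real n" and "W = real w"
  define h0 h1 h2 where "h0 = hahn l w" and "h1 = hahn (Suc l) w" and "h2 = hahn (Suc l + 1) w"
  have pos: "0 < W - L" "0 < N - 2 * L" "0 < N + 1 - W - L" "0 < N + 1 - 2 * L" "0 < N + 2 - 2 * L" "0 < N + 1 - L" "0 < W - L + 1" "0 < L"
    using Suc.prems wn by (auto simp: W_def L_def N_def)
  have "h1 * (W - real l) = h0 * (N - W - real l)"
    using Suc by (simp add: h0_def h1_def W_def N_def)
  moreover have "real l = L - 1" by (simp add: L_def)
  ultimately have IH: "h1 * (W - L + 1) = h0 * (N + 1 - W - L)" by (simp add: algebra_simps)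
  have rec: "W * h1 = hahn_A (Suc l) * h2 + (hahn_A (Suc l) + hahn_C (Suc l)) * h1 + hahn_C (Suc l) * h0"
    using hahn_three_term[of "Suc l" w] Suc.prems by (simp add: h0_def h1_def h2_def W_def)
  define a c where "a = (N + 1 - L) * (W - L) / ((N + 1 - 2 * L) * (N - 2 * L))"
    and "c = L * (N + 1 - W - L) / ((N + 2 - 2 * L) * (N + 1 - 2 * L))"
  have A: "hahn_A (Suc l) = a * (W - L)" unfolding hahn_A_def a_def by (simp add: N_def W_def L_def power2_eq_square)
  have C: "hahn_C (Suc l) = c * (N + 1 - W - L)" unfolding hahn_C_def c_def by (simp add: N_def W_def L_def power2_eq_square)
  have "a * (N - 2 * L) = (N + 1 - L) * (W - L) / (N + 1 - 2 * L)" "c * (N + 2 - 2 * L) = L * (N + 1 - W - L) / (N + 1 - 2 * L)"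
    unfolding a_def c_def using pos by simp_all
  hence "a * (N - 2 * L) + c * (N + 2 - 2 * L) = ((N + 1 - L) * (W - L) + L * (N + 1 - W - L)) / (N + 1 - 2 * L)"
    by (simp add: add_divide_distrib)
  also have "(N + 1 - L) * (W - L) + L * (N + 1 - W - L) = W * (N + 1 - 2 * L)" by (simp add: algebra_simps)
  finally have sum: "a * (N - 2 * L) + c * (N + 2 - 2 * L) = W" using pos by simp
  have "a * (h2 * (W - L)) = W * h1 - a * (W - L) * h1 - c * (N + 1 - W - L) * h1 - c * (h0 * (N + 1 - W - L))"
    using rec unfolding A C by (simp add: algebra_simps)
  also have "W * h1 = a * (N - 2 * L) * h1 + c * (N + 2 - 2 * L) * h1"
    unfolding distrib_right[symmetric] sum ..
  also have "a * (N - 2 * L) * h1 + c * (N + 2 - 2 * L) * h1 - a * (W - L) * h1 - c * (N + 1 - W - L) * h1 - c * (h0 * (N + 1 - W - L))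
      = a * (h1 * (N - W - L))"
    unfolding IH[symmetric] by (simp add: algebra_simps)
  finally have "h2 * (W - L) = h1 * (N - W - L)" using pos by (simp add: a_def)
  thus ?case by (simp add: h1_def h2_def W_def N_def L_def)
qed

text \<open>Divided by \<open>hnorm l\<close>, the left side is the dimension of the eigenspace with
  index \<open>l\<close> of the Johnson scheme, which is at most \<open>n choose l\<close>. The
  proof compares the growth of the two sides from \<open>l\<close> to \<open>l + 1\<close>; this is
  \<open>key\<close>.\<close>

lemma hahn_dim_le:
  "l \<le> w \<Longrightarrow> (hahn l w)\<^sup>2 * real (n choose w) \<le> real (n choose l) * hnorm l"
proof (induction l)
  case 0
  show ?case by (simp add: hnorm_0)
next
  case (Suc l)
  define L N W where "L = real l" and "N = real n" and "W = real w"
  have pos: "0 < W - L" "0 < N - 2 * L" "0 < N - 1 - 2 * L" "0 < N + 1 - 2 * L" "0 < N + 1 - L" "0 < N - W - L" "0 \<le> L" "0 < N - L"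
    using Suc.prems wn by (auto simp: W_def L_def N_def)
  have A: "0 < hahn_A l" using hahn_A_pos Suc.prems by simp
  have key: "hahn_A l * ((L + 1) * (N - W - L)\<^sup>2) \<le> hahn_C (l + 1) * ((N - L) * (W - L)\<^sup>2)"
  proof -
    have "(N + 1 - L) * (N - 1 - 2 * L) \<le> (N - L) * (N + 1 - 2 * L)" using pos by (simp add: algebra_simps)
    hence "(N + 1 - L) / (N + 1 - 2 * L) \<le> (N - L) / (N - 1 - 2 * L)" using pos by (simp add: field_simps)
    hence "(N + 1 - L) / (N + 1 - 2 * L) * ((L + 1) * (W - L)\<^sup>2 * (N - W - L)\<^sup>2 / (N - 2 * L)) \<le>
        (N - L) / (N - 1 - 2 * L) * ((L + 1) * (W - L)\<^sup>2 * (N - W - L)\<^sup>2 / (N - 2 * L))"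
      using pos by (intro mult_right_mono) auto
    moreover have "hahn_A l * ((L + 1) * (N - W - L)\<^sup>2) = (N + 1 - L) / (N + 1 - 2 * L) * ((L + 1) * (W - L)\<^sup>2 * (N - W - L)\<^sup>2 / (N - 2 * L))"
      unfolding hahn_A_def by (simp add: N_def W_def L_def mult_ac)
    moreover have "hahn_C (l + 1) * ((N - L) * (W - L)\<^sup>2) = (N - L) / (N - 1 - 2 * L) * ((L + 1) * (W - L)\<^sup>2 * (N - W - L)\<^sup>2 / (N - 2 * L))"
    proof -
      have "hahn_C (l + 1) = (L + 1) * (N - W - L)\<^sup>2 / ((N - 2 * L) * (N - 1 - 2 * L))"
        unfolding hahn_C_def by (simp add: N_def W_def L_def algebra_simps)
      thus ?thesis by (simp add: mult_ac)
    qed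
    ultimately show ?thesis by simp
  qed
  have ch: "real (n choose (l + 1)) * (L + 1) = real (n choose l) * (N - L)"
    using binomial_succ_absorb[of l n] by (simp add: L_def N_def mult.commute add.commute)
  have st: "hahn (l + 1) w * (W - L) = hahn l w * (N - W - L)"
    using hahn_at_w_step[of l] Suc.prems by (simp add: W_def L_def N_def)
  have "hahn_A l * ((L + 1) * (W - L)\<^sup>2) * ((hahn (l + 1) w)\<^sup>2 * real (n choose w)) =
      hahn_A l * (L + 1) * real (n choose w) * (hahn (l + 1) w * (W - L))\<^sup>2"
    by (simp add: power_mult_distrib mult_ac)
  also have "\<dots> = (hahn_A l * ((L + 1) * (N - W - L)\<^sup>2)) * ((hahn l w)\<^sup>2 * real (n choose w))"
    unfolding st by (simp add: power_mult_distrib mult_ac)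
  also have "\<dots> \<le> (hahn_A l * ((L + 1) * (N - W - L)\<^sup>2)) * (real (n choose l) * hnorm l)"
    using Suc A pos by (intro mult_left_mono) auto
  also have "\<dots> \<le> (hahn_C (l + 1) * ((N - L) * (W - L)\<^sup>2)) * (real (n choose l) * hnorm l)"
    using key hnorm_pos[of l] Suc.prems by (intro mult_right_mono) auto
  also have "\<dots> = (real (n choose l) * (N - L)) * (W - L)\<^sup>2 * (hahn_C (l + 1) * hnorm l)" by (simp add: mult_ac)
  also have "\<dots> = hahn_A l * ((L + 1) * (W - L)\<^sup>2) * (real (n choose (l + 1)) * hnorm (l + 1))"
    unfolding ch[symmetric] using hnorm_rec[of l] Suc.prems by (simp add: mult_ac)
  finally have le: "hahn_A l * ((L + 1) * (W - L)\<^sup>2) * ((hahn (l + 1) w)\<^sup>2 * real (n choose w)) \<le>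
    hahn_A l * ((L + 1) * (W - L)\<^sup>2) * (real (n choose (l + 1)) * hnorm (l + 1))" .
  have "0 < hahn_A l * ((L + 1) * (W - L)\<^sup>2)" using A pos by (intro mult_pos_pos) auto
  from mult_le_cancel_left_pos[OF this, THEN iffD1, OF le] show ?case by simp
qed

end


section \<open>The Johnson scheme and the second linear programming bound\<close>

lemma card_subsets_between:
  assumes "finite Y" "X \<subseteq> Y" "card X \<le> t"
  shows "card {B. X \<subseteq> B \<and> B \<subseteq> Y \<and> card B = t} = (card Y - card X) choose (t - card X)"
proof -
  have fX: "finite X" using assms finite_subset by auto
  have "card {B. X \<subseteq> B \<and> B \<subseteq> Y \<and> card B = t} = card {B. B \<subseteq> Y - X \<and> card B = t - card X}"
  proof (rule bij_betw_same_card[of "\<lambda>B. B - X"], rule bij_betw_byWitness[where f' = "\<lambda>B. B \<union> X"])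
    show "(\<lambda>B. B - X) ` {B. X \<subseteq> B \<and> B \<subseteq> Y \<and> card B = t} \<subseteq> {B. B \<subseteq> Y - X \<and> card B = t - card X}"
      using fX by (auto simp: card_Diff_subset)
    show "(\<lambda>B. B \<union> X) ` {B. B \<subseteq> Y - X \<and> card B = t - card X} \<subseteq> {B. X \<subseteq> B \<and> B \<subseteq> Y \<and> card B = t}"
    proof
      fix B' assume "B' \<in> (\<lambda>B. B \<union> X) ` {B. B \<subseteq> Y - X \<and> card B = t - card X}"
      then obtain B where B: "B' = B \<union> X" "B \<subseteq> Y - X" "card B = t - card X" by auto
      have "finite B" using B assms(1) finite_subset by blast
      hence "card (B \<union> X) = card B + card X" using B fX by (intro card_Un_disjoint) auto
      thus "B' \<in> {B. X \<subseteq> B \<and> B \<subseteq> Y \<and> card B = t}" using B assms by auto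
    qed
  qed auto
  also have "\<dots> = card (Y - X) choose (t - card X)" using assms by (intro n_subsets) auto
  also have "card (Y - X) = card Y - card X" using assms fX by (intro card_Diff_subset)
  finally show ?thesis .
qed

lemma level_finite: "y \<in> level n s \<Longrightarrow> finite y" "y \<in> level n s \<Longrightarrow> y \<subseteq> {..<n}" "y \<in> level n s \<Longrightarrow> card y = s"
  by (auto simp: level_def intro: finite_subset)

text \<open>Gram-Schmidt for a family that may be dependent: if the residual \<open>B\<close> of the
  new function is zero, the new coefficient is taken to be 0.\<close>

lemma orthogonal_projection:
  fixes b :: "'i \<Rightarrow> 'a \<Rightarrow> real"
  assumes "finite I"
  shows "\<exists>c. \<forall>i\<in>I. (\<Sum>z\<in>\<Omega>. (g z - (\<Sum>j\<in>I. c j * b j z)) * b i z) = 0"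
  using assms
proof (induction I arbitrary: g rule: finite_induct)
  case (insert k I)
  obtain c where c: "\<forall>i\<in>I. (\<Sum>z\<in>\<Omega>. (g z - (\<Sum>j\<in>I. c j * b j z)) * b i z) = 0" using insert.IH by blast
  obtain e where e: "\<forall>i\<in>I. (\<Sum>z\<in>\<Omega>. (b k z - (\<Sum>j\<in>I. e j * b j z)) * b i z) = 0" using insert.IH by blast
  define G where "G z = g z - (\<Sum>j\<in>I. c j * b j z)" for z
  define B where "B z = b k z - (\<Sum>j\<in>I. e j * b j z)" for z
  have ortho: "(\<Sum>z\<in>\<Omega>. F z * b k z) = (\<Sum>z\<in>\<Omega>. F z * B z)" if "\<forall>i\<in>I. (\<Sum>z\<in>\<Omega>. F z * b i z) = 0" for F
  proof -
    have "(\<Sum>z\<in>\<Omega>. F z * B z) = (\<Sum>z\<in>\<Omega>. F z * b k z) - (\<Sum>z\<in>\<Omega>. \<Sum>j\<in>I. e j * (F z * b j z))"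
      by (simp add: B_def right_diff_distrib sum_subtractf sum_distrib_left mult_ac)
    also have "(\<Sum>z\<in>\<Omega>. \<Sum>j\<in>I. e j * (F z * b j z)) = (\<Sum>j\<in>I. e j * (\<Sum>z\<in>\<Omega>. F z * b j z))"
      unfolding sum_distrib_left by (rule sum.swap)
    also have "\<dots> = 0" using that by (intro sum.neutral) auto
    finally show ?thesis by simp
  qed
  define \<mu> where "\<mu> = (if (\<Sum>z\<in>\<Omega>. B z * B z) = 0 then 0 else (\<Sum>z\<in>\<Omega>. G z * B z) / (\<Sum>z\<in>\<Omega>. B z * B z))"
  define H where "H z = G z - \<mu> * B z" for z
  define c' where "c' j = (if j = k then \<mu> else c j - \<mu> * e j)" for j
  have HI: "\<forall>i\<in>I. (\<Sum>z\<in>\<Omega>. H z * b i z) = 0"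
  proof
    fix i assume "i \<in> I"
    have "(\<Sum>z\<in>\<Omega>. H z * b i z) = (\<Sum>z\<in>\<Omega>. G z * b i z) - \<mu> * (\<Sum>z\<in>\<Omega>. B z * b i z)"
      by (simp add: H_def left_diff_distrib sum_subtractf sum_distrib_left mult.assoc)
    thus "(\<Sum>z\<in>\<Omega>. H z * b i z) = 0" using c e \<open>i \<in> I\<close> by (simp add: G_def B_def)
  qed
  have "(\<Sum>z\<in>\<Omega>. H z * b k z) = (\<Sum>z\<in>\<Omega>. H z * B z)" by (rule ortho[OF HI])
  also have "\<dots> = (\<Sum>z\<in>\<Omega>. G z * B z) - \<mu> * (\<Sum>z\<in>\<Omega>. B z * B z)"
    by (simp add: H_def left_diff_distrib sum_subtractf sum_distrib_left mult.assoc)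
  also have "\<dots> = 0"
  proof (cases "(\<Sum>z\<in>\<Omega>. B z * B z) = 0")
    case True
    have "(\<Sum>z\<in>\<Omega>. G z * B z) = 0"
    proof (cases "finite \<Omega>")
      case fin: True
      hence "\<forall>z\<in>\<Omega>. B z = 0" using True by (subst (asm) sum_nonneg_eq_0_iff) auto
      thus ?thesis by (intro sum.neutral) auto
    qed simp
    thus ?thesis using True by simp
  qed (simp add: \<mu>_def)
  finally have Hk: "(\<Sum>z\<in>\<Omega>. H z * b k z) = 0" .
  have "H z = g z - (\<Sum>j\<in>insert k I. c' j * b j z)" for z
  proof -
    have "(\<Sum>j\<in>I. c' j * b j z) = (\<Sum>j\<in>I. c j * b j z - \<mu> * (e j * b j z))"
      using insert.hyps by (intro sum.cong) (auto simp: c'_def algebra_simps)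
    hence "(\<Sum>j\<in>insert k I. c' j * b j z) = \<mu> * b k z + ((\<Sum>j\<in>I. c j * b j z) - \<mu> * (\<Sum>j\<in>I. e j * b j z))"
      using insert.hyps by (simp add: c'_def sum_subtractf sum_distrib_left)
    thus ?thesis by (simp add: H_def G_def B_def algebra_simps)
  qed
  thus ?case using HI Hk by (intro exI[of _ c']) auto
qed simp

text \<open>Schur's product theorem: the product of two Gram kernels is the Gram kernel of all
  products of their features.\<close>

lemma gram_product_nonneg:
  fixes r :: "'i \<Rightarrow> 'a \<Rightarrow> real" and r' :: "'j \<Rightarrow> 'a \<Rightarrow> real"
  shows "0 \<le> (\<Sum>y\<in>\<Omega>. \<Sum>y'\<in>\<Omega>. (\<Sum>i\<in>I. r i y * r i y') * (\<Sum>j\<in>J. r' j y * r' j y') * g y * g y')"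
proof -
  have "(\<Sum>y\<in>\<Omega>. \<Sum>y'\<in>\<Omega>. (\<Sum>i\<in>I. r i y * r i y') * (\<Sum>j\<in>J. r' j y * r' j y') * g y * g y') =
      (\<Sum>y\<in>\<Omega>. \<Sum>y'\<in>\<Omega>. \<Sum>p\<in>I \<times> J. (r (fst p) y * r' (snd p) y * g y) * (r (fst p) y' * r' (snd p) y' * g y'))"
  proof (intro sum.cong refl)
    fix y y'
    have eq: "(\<Sum>i\<in>I. r i y * r i y') * (\<Sum>j\<in>J. r' j y * r' j y') =
        (\<Sum>p\<in>I \<times> J. (r (fst p) y * r (fst p) y') * (r' (snd p) y * r' (snd p) y'))"
      unfolding sum_product sum.cartesian_product by (simp add: case_prod_unfold)
    show "(\<Sum>i\<in>I. r i y * r i y') * (\<Sum>j\<in>J. r' j y * r' j y') * g y * g y' =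
        (\<Sum>p\<in>I \<times> J. (r (fst p) y * r' (snd p) y * g y) * (r (fst p) y' * r' (snd p) y' * g y'))"
      unfolding eq unfolding sum_distrib_right by (rule sum.cong[OF refl]) (simp only: mult_ac)
  qed
  also have "\<dots> = (\<Sum>y\<in>\<Omega>. \<Sum>p\<in>I \<times> J. \<Sum>y'\<in>\<Omega>. (r (fst p) y * r' (snd p) y * g y) * (r (fst p) y' * r' (snd p) y' * g y'))"
    by (rule sum.cong[OF refl], rule sum.swap)
  also have "\<dots> = (\<Sum>p\<in>I \<times> J. \<Sum>y\<in>\<Omega>. \<Sum>y'\<in>\<Omega>. (r (fst p) y * r' (snd p) y * g y) * (r (fst p) y' * r' (snd p) y' * g y'))"
    by (rule sum.swap)
  also have "\<dots> = (\<Sum>p\<in>I \<times> J. (\<Sum>y\<in>\<Omega>. r (fst p) y * r' (snd p) y * g y)\<^sup>2)"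
    unfolding power2_eq_square sum_product ..
  also have "\<dots> \<ge> 0" by (rule sum_nonneg) simp
  finally show ?thesis .
qed

section \<open>Positive semidefinite kernels on a level of the cube\<close>

context
  fixes n w :: nat
  assumes wn: "2 * w < n"
begin

lemma level_group:
  assumes y: "y \<in> level n w"
  shows "(\<Sum>y'\<in>{y'\<in>level n w. X \<subseteq> y'}. f (card (y \<inter> y'))) =
    (\<Sum>t\<le>w. real (card {y'\<in>level n w. X \<subseteq> y' \<and> card (y \<inter> y') = t}) * f t)"
proof -
  have "card (y \<inter> y') \<le> w" for y' using card_mono[of y "y \<inter> y'"] level_finite[OF y] by auto
  hence "(\<Sum>y'\<in>{y'\<in>level n w. X \<subseteq> y'}. f (card (y \<inter> y'))) =
      (\<Sum>t\<le>w. \<Sum>y'\<in>{y'\<in>{y'\<in>level n w. X \<subseteq> y'}. card (y \<inter> y') = t}. f (card (y \<inter> y')))"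
    by (intro sum.group[symmetric]) auto
  also have "\<dots> = (\<Sum>t\<le>w. \<Sum>y'\<in>{y'\<in>level n w. X \<subseteq> y' \<and> card (y \<inter> y') = t}. f t)"
    by (intro sum.cong) auto
  finally show ?thesis by simp
qed

text \<open>After multiplication by the two binomials the count appears as \<open>hweight\<close>
  times a polynomial in \<open>t\<close> of degree \<open>i + k\<close>, also in the cases where it
  is zero.\<close>

lemma card_level_above:
  assumes y: "y \<in> level n w" and X: "X \<subseteq> {..<n}" "card (X \<inter> y) = i" "card (X - y) = k" and t: "t \<le> w"
  shows "real (card {y'\<in>level n w. X \<subseteq> y' \<and> card (y \<inter> y') = t}) * (real (w choose i) * real ((n - w) choose k)) =
    hweight n w t * (real (t choose i) * real ((w - t) choose k))"
proof -
  note yl = level_finite[OF y]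
  have fX: "finite X" using X finite_subset by auto
  let ?S = "{y'\<in>level n w. X \<subseteq> y' \<and> card (y \<inter> y') = t}"
  let ?S1 = "{B. X \<inter> y \<subseteq> B \<and> B \<subseteq> y \<and> card B = t}"
  let ?S2 = "{B. X - y \<subseteq> B \<and> B \<subseteq> {..<n} - y \<and> card B = w - t}"
  have fin: "finite y'" if "y' \<subseteq> {..<n}" for y' using that finite_subset by auto
  have bij: "bij_betw (\<lambda>y'. (y' \<inter> y, y' - y)) ?S (?S1 \<times> ?S2)"
  proof (rule bij_betw_byWitness[where f' = "\<lambda>(a, b). a \<union> b"])
    show "\<forall>y'\<in>?S. (case (y' \<inter> y, y' - y) of (a, b) \<Rightarrow> a \<union> b) = y'" by auto
    show "\<forall>p\<in>?S1 \<times> ?S2. ((case p of (a, b) \<Rightarrow> a \<union> b) \<inter> y, (case p of (a, b) \<Rightarrow> a \<union> b) - y) = p" by auto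
    show "(\<lambda>y'. (y' \<inter> y, y' - y)) ` ?S \<subseteq> ?S1 \<times> ?S2"
    proof (rule image_subsetI)
      fix y' assume y': "y' \<in> ?S"
      hence "y' \<in> level n w" by simp
      note l = level_finite[OF this]
      have "card (y' - y) = card y' - card (y' \<inter> y)" using l by (intro card_Diff_subset_Int) auto
      hence "card (y' - y) = w - t" using l y' by (simp add: Int_commute)
      moreover have "card (y' \<inter> y) = t" using y' by (simp add: Int_commute)
      ultimately show "(y' \<inter> y, y' - y) \<in> ?S1 \<times> ?S2" using y' l by auto
    qed
    show "(\<lambda>(a, b). a \<union> b) ` (?S1 \<times> ?S2) \<subseteq> ?S"
    proof (rule image_subsetI)
      fix p assume "p \<in> ?S1 \<times> ?S2"
      then obtain a b where p: "p = (a, b)" and a: "X \<inter> y \<subseteq> a" "a \<subseteq> y" "card a = t"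
        and b: "X - y \<subseteq> b" "b \<subseteq> {..<n} - y" "card b = w - t" by auto
      have fa: "finite a" "finite b" using a b yl finite_subset[of a y] fin[of b] by auto
      have "a \<inter> b = {}" using a b by auto
      hence "card (a \<union> b) = w" using fa b a t by (simp add: card_Un_disjoint)
      moreover have "a \<union> b \<subseteq> {..<n}" using a b yl by auto
      moreover have "y \<inter> (a \<union> b) = a" using a b by auto
      moreover have "X \<subseteq> a \<union> b" using a b by auto
      ultimately show "(case p of (a, b) \<Rightarrow> a \<union> b) \<in> ?S" using a by (simp add: level_def p)
    qed
  qed
  have cS: "card ?S = card ?S1 * card ?S2" using bij_betw_same_card[OF bij] by (simp add: card_cartesian_product)
  have cy: "card ({..<n} - y) = n - w" using yl by (simp add: card_Diff_subset)
  show ?thesis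
  proof (cases "i \<le> t \<and> k \<le> w - t")
    case True
    have iw: "i \<le> w" using True t by simp
    have "card ?S1 = (w - i) choose (t - i)"
      using card_subsets_between[of y "X \<inter> y" t] yl X True by simp
    moreover have "card ?S2 = (n - w - k) choose (w - t - k)"
      using card_subsets_between[of "{..<n} - y" "X - y" "w - t"] X True cy by auto
    moreover have "(w choose t) * (t choose i) = (w choose i) * ((w - i) choose (t - i))"
      using choose_mult[of i t w] True t by simp
    moreover have "((n - w) choose (w - t)) * ((w - t) choose k) = ((n - w) choose k) * ((n - w - k) choose (w - t - k))"
      using choose_mult[of k "w - t" "n - w"] True wn by simp
    ultimately have "card ?S * ((w choose i) * ((n - w) choose k)) = (w choose t) * ((n - w) choose (w - t)) * ((t choose i) * ((w - t) choose k))"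
      unfolding cS by (simp add: mult_ac)
    hence "real (card ?S * ((w choose i) * ((n - w) choose k))) = real ((w choose t) * ((n - w) choose (w - t)) * ((t choose i) * ((w - t) choose k)))"
      by (simp only:)
    thus ?thesis by (simp only: hweight_def[OF wn] of_nat_mult)
  next
    case False
    have "?S1 = {} \<or> ?S2 = {}"
    proof (cases "i \<le> t")
      case T: True
      have "B \<notin> ?S2" for B
      proof
        assume B: "B \<in> ?S2"
        hence "B \<subseteq> {..<n}" "X - y \<subseteq> B" "card B = w - t" by auto
        hence "k \<le> w - t" using card_mono[OF fin, of B "X - y"] X(3) by simp
        thus False using False T by simp
      qed
      hence "?S2 = {}" by blast
      thus ?thesis by simp
    next
      case F: False
      have "B \<notin> ?S1" for B
      proof
        assume B: "B \<in> ?S1"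
        hence "finite B" using yl(1) finite_subset[of B y] by blast
        hence "i \<le> t" using card_mono[of B "X \<inter> y"] B X(2) by simp
        thus False using F by simp
      qed
      hence "?S1 = {}" by blast
      thus ?thesis by simp
    qed
    hence "card ?S1 * card ?S2 = 0"
    proof
      assume "?S1 = {}"
      thus ?thesis by (simp only: card.empty mult_zero_left)
    next
      assume "?S2 = {}"
      thus ?thesis by (simp only: card.empty mult_zero_right)
    qed
    hence "card ?S = 0" by (simp only: cS)
    moreover have "real (t choose i) * real ((w - t) choose k) = 0"
      using False by (auto simp: binomial_eq_0 not_le)
    ultimately show ?thesis by (simp only: of_nat_0 mult_zero_left mult_zero_right)
  qed
qed

text \<open>By \<open>card_level_above\<close> the sum is, up to a factor, \<open>hsum\<close> of
  \<open>hahn l\<close> times a polynomial of degree \<open>card X < l\<close>, and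
  \<open>hahn l\<close> is orthogonal to it.\<close>

lemma hahn_annihilates:
  assumes y: "y \<in> level n w" and X: "X \<subseteq> {..<n}" "card X < l" and l: "l \<le> w"
  shows "(\<Sum>y'\<in>{y'\<in>level n w. X \<subseteq> y'}. hahn n w l (card (y \<inter> y'))) = 0"
proof -
  note yl = level_finite[OF y]
  have fX: "finite X" using X finite_subset by auto
  define i k where "i = card (X \<inter> y)" and "k = card (X - y)"
  have ik: "i + k = card X" unfolding i_def k_def using card_Int_Diff[OF fX, of y] by simp
  have iw: "i \<le> w" "k \<le> n - w"
  proof -
    show "i \<le> w" unfolding i_def using card_mono[of y "X \<inter> y"] yl by auto
    have "card (X - y) \<le> card ({..<n} - y)" using X by (intro card_mono) auto
    thus "k \<le> n - w" unfolding k_def using yl by (simp add: card_Diff_subset)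
  qed
  define c where "c = real (w choose i) * real ((n - w) choose k)"
  have c: "0 < c" using iw by (simp add: c_def)
  have "c * (\<Sum>y'\<in>{y'\<in>level n w. X \<subseteq> y'}. hahn n w l (card (y \<inter> y'))) =
      (\<Sum>t\<le>w. (real (card {y'\<in>level n w. X \<subseteq> y' \<and> card (y \<inter> y') = t}) * c) * hahn n w l t)"
    unfolding level_group[OF y] sum_distrib_left by (simp only: mult_ac)
  also have "\<dots> = (\<Sum>t\<le>w. (hweight n w t * (real (t choose i) * real ((w - t) choose k))) * hahn n w l t)"
    unfolding c_def using card_level_above[OF y X(1)] by (intro sum.cong) (auto simp: i_def k_def)
  also have "\<dots> = hsum n w (\<lambda>t. real (t choose i) * real ((w - t) choose k) * hahn n w l t)"
    unfolding hsum_def[OF wn] by (simp only: mult.assoc)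
  also have "\<dots> = 0" by (rule hsum_choose_choose_hahn[OF wn]) (use ik X l in auto)
  finally show ?thesis using c by simp
qed

lemma hahn_coeff_self_pos:
  assumes "l \<le> w"
  shows "0 < hahn_coeff n w l l"
proof -
  have "ff (real l) l = fact l" using ff_eq_fact[of l l] by simp
  moreover have "0 < ff (real n + 1 - real l) l"
    unfolding ff_def using assms wn by (intro prod_pos) auto
  moreover have "0 < ff (real w) l" by (rule ff_w_pos[OF wn assms])
  ultimately show ?thesis unfolding hahn_coeff_def[OF wn] by (simp flip: mult_2)
qed

text \<open>The kernel \<open>q\<close> annihilates the indicators \<open>one X\<close> with
  \<open>card X < l\<close>. Hence the point mass at \<open>y\<close> may be replaced on both sides
  by its residual \<open>P y\<close> modulo these indicators. Expanding \<open>q\<close> in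
  binomials of the intersection, which are Gram sums over the sets \<open>X\<close> of size
  \<open>j\<close>, kills all terms with \<open>j < l\<close>. What remains is a Gram sum with the
  positive leading coefficient.\<close>

lemma hahn_gram:
  assumes l: "l \<le> w"
  shows "\<exists>r :: nat set \<Rightarrow> nat set \<Rightarrow> real. \<forall>y\<in>level n w. \<forall>y'\<in>level n w.
    hahn n w l (card (y \<inter> y')) = (\<Sum>X\<in>level n l. r X y * r X y')"
proof -
  define \<Omega> where "\<Omega> = level n w"
  define XS where "XS = {X. X \<subseteq> {..<n} \<and> card X < l}"
  define one where "one X z = (if X \<subseteq> z then 1 else 0 :: real)" for X z :: "nat set"
  define q where "q z z' = hahn n w l (card (z \<inter> z'))" for z z' :: "nat set"
  have fXS: "finite XS" by (rule finite_subset[of _ "Pow {..<n}"]) (auto simp: XS_def)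
  have f\<Omega>: "finite \<Omega>" by (simp add: \<Omega>_def)
  have "\<exists>c. \<forall>y. \<forall>X\<in>XS. (\<Sum>z\<in>\<Omega>. ((if z = y then 1 else 0) - (\<Sum>X'\<in>XS. c y X' * one X' z)) * one X z) = 0"
    by (intro choice allI orthogonal_projection[OF fXS])
  then obtain c where c: "\<And>y X. X \<in> XS \<Longrightarrow>
      (\<Sum>z\<in>\<Omega>. ((if z = y then 1 else 0) - (\<Sum>X'\<in>XS. c y X' * one X' z)) * one X z) = 0" by blast
  define P where "P y z = (if z = y then 1 else 0) - (\<Sum>X'\<in>XS. c y X' * one X' z)" for y z
  have Pone: "(\<Sum>z\<in>\<Omega>. P y z * one X z) = 0" if "X \<in> XS" for y X using c[OF that] by (simp add: P_def)
  have qsym: "q z z' = q z' z" for z z' by (simp add: q_def Int_commute)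
  have A: "(\<Sum>z'\<in>\<Omega>. P y z' * q z z') = q z y" if z: "z \<in> \<Omega>" and y: "y \<in> \<Omega>" for z y
  proof -
    have "(\<Sum>z'\<in>\<Omega>. P y z' * q z z') = (\<Sum>z'\<in>\<Omega>. (if z' = y then 1 else 0) * q z z') - (\<Sum>z'\<in>\<Omega>. \<Sum>X\<in>XS. c y X * (one X z' * q z z'))"
      by (simp add: P_def left_diff_distrib sum_subtractf sum_distrib_right mult.assoc)
    also have "(\<Sum>z'\<in>\<Omega>. (if z' = y then 1 else 0) * q z z') = q z y"
      using y f\<Omega> by (simp add: if_distrib[of "\<lambda>x. x * _"] cong: if_cong)
    also have "(\<Sum>z'\<in>\<Omega>. \<Sum>X\<in>XS. c y X * (one X z' * q z z')) = (\<Sum>X\<in>XS. c y X * (\<Sum>z'\<in>\<Omega>. one X z' * q z z'))"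
      unfolding sum_distrib_left by (rule sum.swap)
    also have "\<dots> = 0"
    proof (rule sum.neutral, rule ballI)
      fix X assume X: "X \<in> XS"
      have "(\<Sum>z'\<in>\<Omega>. one X z' * q z z') = (\<Sum>z'\<in>\<Omega>. if X \<subseteq> z' then q z z' else 0)"
        by (rule sum.cong) (auto simp: one_def)
      also have "\<dots> = (\<Sum>z'\<in>{z'\<in>\<Omega>. X \<subseteq> z'}. q z z')" by (rule sum.inter_filter[symmetric, OF f\<Omega>])
      also have "\<dots> = 0" unfolding q_def \<Omega>_def
        by (rule hahn_annihilates) (use z X l in \<open>auto simp: \<Omega>_def XS_def\<close>)
      finally show "c y X * (\<Sum>z'\<in>\<Omega>. one X z' * q z z') = 0" by simp
    qed
    finally show ?thesis by simp
  qed
  have C: "q z z' = (\<Sum>j\<le>l. hahn_coeff n w l j * (\<Sum>X\<in>level n j. one X z * one X z'))" if "z \<in> \<Omega>" for z z'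
  proof -
    have zn: "z \<subseteq> {..<n}" "finite z" using that level_finite[of z n w] by (auto simp: \<Omega>_def)
    have "real (card (z \<inter> z') choose j) = (\<Sum>X\<in>level n j. one X z * one X z')" for j
    proof -
      have "(\<Sum>X\<in>level n j. one X z * one X z') = (\<Sum>X\<in>level n j. if X \<subseteq> z \<inter> z' then 1 else 0)"
        by (rule sum.cong) (auto simp: one_def)
      also have "\<dots> = real (card {X\<in>level n j. X \<subseteq> z \<inter> z'})" by (simp add: sum.inter_filter[symmetric])
      also have "{X\<in>level n j. X \<subseteq> z \<inter> z'} = {X. X \<subseteq> z \<inter> z' \<and> card X = j}" using zn by (auto simp: level_def)
      also have "card \<dots> = card (z \<inter> z') choose j" using zn by (intro n_subsets) auto
      finally show ?thesis by simp
    qed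
    thus ?thesis unfolding q_def hahn_def[OF wn] by simp
  qed
  define R where "R X y = (\<Sum>z\<in>\<Omega>. P y z * one X z)" for X y
  have main: "q y y' = hahn_coeff n w l l * (\<Sum>X\<in>level n l. R X y * R X y')" if y: "y \<in> \<Omega>" "y' \<in> \<Omega>" for y y'
  proof -
    have "q y y' = (\<Sum>z\<in>\<Omega>. P y z * q y' z)" using A[OF y(2,1)] qsym by simp
    also have "\<dots> = (\<Sum>z\<in>\<Omega>. P y z * (\<Sum>z'\<in>\<Omega>. P y' z' * q z z'))"
      using A[OF _ y(2)] by (intro sum.cong) (auto simp: qsym[of y'])
    also have "\<dots> = (\<Sum>z\<in>\<Omega>. P y z * (\<Sum>z'\<in>\<Omega>. P y' z' * (\<Sum>j\<le>l. hahn_coeff n w l j * (\<Sum>X\<in>level n j. one X z * one X z'))))"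
      using C by (intro sum.cong) auto
    also have "\<dots> = (\<Sum>z\<in>\<Omega>. \<Sum>z'\<in>\<Omega>. \<Sum>j\<le>l. \<Sum>X\<in>level n j. hahn_coeff n w l j * ((P y z * one X z) * (P y' z' * one X z')))"
      unfolding sum_distrib_left by (intro sum.cong refl) (simp only: mult_ac)
    also have "\<dots> = (\<Sum>z\<in>\<Omega>. \<Sum>j\<le>l. \<Sum>z'\<in>\<Omega>. \<Sum>X\<in>level n j. hahn_coeff n w l j * ((P y z * one X z) * (P y' z' * one X z')))"
      by (rule sum.cong[OF refl], rule sum.swap)
    also have "\<dots> = (\<Sum>j\<le>l. \<Sum>z\<in>\<Omega>. \<Sum>z'\<in>\<Omega>. \<Sum>X\<in>level n j. hahn_coeff n w l j * ((P y z * one X z) * (P y' z' * one X z')))"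
      by (rule sum.swap)
    also have "\<dots> = (\<Sum>j\<le>l. hahn_coeff n w l j * (\<Sum>X\<in>level n j. R X y * R X y'))"
    proof (rule sum.cong[OF refl])
      fix j
      have "(\<Sum>z\<in>\<Omega>. \<Sum>z'\<in>\<Omega>. \<Sum>X\<in>level n j. hahn_coeff n w l j * ((P y z * one X z) * (P y' z' * one X z'))) =
          (\<Sum>z\<in>\<Omega>. \<Sum>X\<in>level n j. \<Sum>z'\<in>\<Omega>. hahn_coeff n w l j * ((P y z * one X z) * (P y' z' * one X z')))"
        by (rule sum.cong[OF refl], rule sum.swap)
      also have "\<dots> = (\<Sum>X\<in>level n j. \<Sum>z\<in>\<Omega>. \<Sum>z'\<in>\<Omega>. hahn_coeff n w l j * ((P y z * one X z) * (P y' z' * one X z')))"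
        by (rule sum.swap)
      also have "\<dots> = hahn_coeff n w l j * (\<Sum>X\<in>level n j. R X y * R X y')"
        unfolding R_def sum_product unfolding sum_distrib_left ..
      finally show "(\<Sum>z\<in>\<Omega>. \<Sum>z'\<in>\<Omega>. \<Sum>X\<in>level n j. hahn_coeff n w l j * ((P y z * one X z) * (P y' z' * one X z'))) =
        hahn_coeff n w l j * (\<Sum>X\<in>level n j. R X y * R X y')" .
    qed
    also have "\<dots> = (\<Sum>j\<in>{l}. hahn_coeff n w l j * (\<Sum>X\<in>level n j. R X y * R X y'))"
    proof (rule sum.mono_neutral_right, simp, simp, rule ballI)
      fix j assume "j \<in> {..l} - {l}"
      hence "R X y = 0" if "X \<in> level n j" for X
        unfolding R_def using that level_finite[OF that] by (intro Pone) (auto simp: XS_def)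
      thus "hahn_coeff n w l j * (\<Sum>X\<in>level n j. R X y * R X y') = 0" by simp
    qed
    finally show ?thesis by simp
  qed
  define r where "r X y = sqrt (hahn_coeff n w l l) * R X y" for X y
  have "hahn n w l (card (y \<inter> y')) = (\<Sum>X\<in>level n l. r X y * r X y')" if "y \<in> level n w" "y' \<in> level n w" for y y'
  proof -
    have "(\<Sum>X\<in>level n l. r X y * r X y') = (\<Sum>X\<in>level n l. (sqrt (hahn_coeff n w l l) * sqrt (hahn_coeff n w l l)) * (R X y * R X y'))"
      unfolding r_def by (simp only: mult_ac)
    also have "\<dots> = hahn_coeff n w l l * (\<Sum>X\<in>level n l. R X y * R X y')"
      using hahn_coeff_self_pos[OF l] by (simp add: sum_distrib_left)
    finally show ?thesis using main[of y y'] that by (simp add: q_def \<Omega>_def)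
  qed
  thus ?thesis by blast
qed

lemma level_row_sum:
  assumes y: "y \<in> level n w"
  shows "(\<Sum>y'\<in>level n w. k (card (y \<inter> y'))) = hsum n w k"
proof -
  have "(\<Sum>y'\<in>level n w. k (card (y \<inter> y'))) = (\<Sum>t\<le>w. real (card {y'\<in>level n w. {} \<subseteq> y' \<and> card (y \<inter> y') = t}) * k t)"
    using level_group[OF y, where X = "{}" and f = k] by simp
  also have "\<dots> = (\<Sum>t\<le>w. hweight n w t * k t)"
    using card_level_above[OF y, of "{}" 0 0] by (intro sum.cong) auto
  finally show ?thesis by (simp only: hsum_def[OF wn])
qed

text \<open>The product kernel is positive semidefinite by Schur's theorem, and by orthogonality all
  its row sums equal \<open>\<theta>\<close>. So constants are eigenvectors, and the form evaluated
  at \<open>h\<close> minus its mean gives the bound.\<close>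

lemma johnson_kernel:
  fixes f g :: "nat \<Rightarrow> real"
  assumes fg: "\<And>l. 0 \<le> f l" "\<And>l. 0 \<le> g l"
  defines "F \<equiv> \<lambda>t. \<Sum>l\<le>w. f l * hahn n w l t" and "G \<equiv> \<lambda>t. \<Sum>l\<le>w. g l * hahn n w l t"
  shows "(\<Sum>l\<le>w. f l * g l * hnorm n w l) / real (n choose w) * (\<Sum>y\<in>level n w. h y)\<^sup>2 \<le>
    (\<Sum>y\<in>level n w. \<Sum>y'\<in>level n w. F (card (y \<inter> y')) * G (card (y \<inter> y')) * h y * h y')"
proof -
  define \<Omega> where "\<Omega> = level n w"
  define k where "k t = F t * G t" for t
  define Q where "Q a b = (\<Sum>y\<in>\<Omega>. \<Sum>y'\<in>\<Omega>. k (card (y \<inter> y')) * a y * b y')" for a b :: "nat set \<Rightarrow> real"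
  have psd: "0 \<le> Q a a" for a
  proof -
    have "k t = (\<Sum>l\<le>w. \<Sum>l'\<le>w. f l * g l' * (hahn n w l t * hahn n w l' t))" for t
      unfolding k_def F_def G_def sum_product by (intro sum.cong refl) (simp only: mult_ac)
    hence "Q a a = (\<Sum>y\<in>\<Omega>. \<Sum>y'\<in>\<Omega>. \<Sum>l\<le>w. \<Sum>l'\<le>w. f l * g l' * (hahn n w l (card (y \<inter> y')) * hahn n w l' (card (y \<inter> y')) * a y * a y'))"
      unfolding Q_def by (simp add: sum_distrib_right mult.assoc)
    also have "\<dots> = (\<Sum>y\<in>\<Omega>. \<Sum>l\<le>w. \<Sum>y'\<in>\<Omega>. \<Sum>l'\<le>w. f l * g l' * (hahn n w l (card (y \<inter> y')) * hahn n w l' (card (y \<inter> y')) * a y * a y'))"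
      by (rule sum.cong[OF refl], rule sum.swap)
    also have "\<dots> = (\<Sum>l\<le>w. \<Sum>y\<in>\<Omega>. \<Sum>y'\<in>\<Omega>. \<Sum>l'\<le>w. f l * g l' * (hahn n w l (card (y \<inter> y')) * hahn n w l' (card (y \<inter> y')) * a y * a y'))"
      by (rule sum.swap)
    also have "\<dots> = (\<Sum>l\<le>w. \<Sum>l'\<le>w. f l * g l' * (\<Sum>y\<in>\<Omega>. \<Sum>y'\<in>\<Omega>. hahn n w l (card (y \<inter> y')) * hahn n w l' (card (y \<inter> y')) * a y * a y'))"
    proof (rule sum.cong[OF refl])
      fix l
      have "(\<Sum>y\<in>\<Omega>. \<Sum>y'\<in>\<Omega>. \<Sum>l'\<le>w. f l * g l' * (hahn n w l (card (y \<inter> y')) * hahn n w l' (card (y \<inter> y')) * a y * a y'))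
          = (\<Sum>y\<in>\<Omega>. \<Sum>l'\<le>w. \<Sum>y'\<in>\<Omega>. f l * g l' * (hahn n w l (card (y \<inter> y')) * hahn n w l' (card (y \<inter> y')) * a y * a y'))"
        by (rule sum.cong[OF refl], rule sum.swap)
      also have "\<dots> = (\<Sum>l'\<le>w. \<Sum>y\<in>\<Omega>. \<Sum>y'\<in>\<Omega>. f l * g l' * (hahn n w l (card (y \<inter> y')) * hahn n w l' (card (y \<inter> y')) * a y * a y'))"
        by (rule sum.swap)
      finally show "(\<Sum>y\<in>\<Omega>. \<Sum>y'\<in>\<Omega>. \<Sum>l'\<le>w. f l * g l' * (hahn n w l (card (y \<inter> y')) * hahn n w l' (card (y \<inter> y')) * a y * a y'))
        = (\<Sum>l'\<le>w. f l * g l' * (\<Sum>y\<in>\<Omega>. \<Sum>y'\<in>\<Omega>. hahn n w l (card (y \<inter> y')) * hahn n w l' (card (y \<inter> y')) * a y * a y'))"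
        by (simp only: sum_distrib_left)
    qed
    also have "\<dots> \<ge> 0"
    proof (rule sum_nonneg, rule sum_nonneg, rule mult_nonneg_nonneg, rule mult_nonneg_nonneg, rule fg, rule fg)
      fix l l' assume "l \<in> {..w}" "l' \<in> {..w}"
      then obtain r r' where r: "\<forall>y\<in>\<Omega>. \<forall>y'\<in>\<Omega>. hahn n w l (card (y \<inter> y')) = (\<Sum>X\<in>level n l. r X y * r X y')"
          "\<forall>y\<in>\<Omega>. \<forall>y'\<in>\<Omega>. hahn n w l' (card (y \<inter> y')) = (\<Sum>X\<in>level n l'. r' X y * r' X y')"
        using hahn_gram[of l] hahn_gram[of l'] unfolding \<Omega>_def by (meson atMost_iff)
      have "(\<Sum>y\<in>\<Omega>. \<Sum>y'\<in>\<Omega>. hahn n w l (card (y \<inter> y')) * hahn n w l' (card (y \<inter> y')) * a y * a y') =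
        (\<Sum>y\<in>\<Omega>. \<Sum>y'\<in>\<Omega>. (\<Sum>X\<in>level n l. r X y * r X y') * (\<Sum>X\<in>level n l'. r' X y * r' X y') * a y * a y')"
        using r by (intro sum.cong refl) simp
      thus "0 \<le> (\<Sum>y\<in>\<Omega>. \<Sum>y'\<in>\<Omega>. hahn n w l (card (y \<inter> y')) * hahn n w l' (card (y \<inter> y')) * a y * a y')"
        using gram_product_nonneg by simp
    qed
    finally show ?thesis .
  qed
  define \<theta> where "\<theta> = (\<Sum>l\<le>w. f l * g l * hnorm n w l)"
  have theta: "hsum n w k = \<theta>"
  proof -
    have "hsum n w k = hsum n w (\<lambda>t. \<Sum>l\<le>w. \<Sum>l'\<le>w. f l * g l' * (hahn n w l t * hahn n w l' t))"
      by (rule hsum_cong[OF wn], unfold k_def F_def G_def sum_product, intro sum.cong refl) (simp only: mult_ac)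
    also have "\<dots> = (\<Sum>l\<le>w. \<Sum>l'\<le>w. f l * g l' * hsum n w (\<lambda>t. hahn n w l t * hahn n w l' t))"
      by (simp only: hsum_sum[OF wn] hsum_mult[OF wn])
    also have "\<dots> = (\<Sum>l\<le>w. \<Sum>l'\<le>w. if l' = l then f l * g l * hnorm n w l else 0)"
      using hahn_orthogonal[OF wn] by (intro sum.cong refl) (auto simp: hnorm_def[OF wn])
    also have "\<dots> = \<theta>" unfolding \<theta>_def by simp
    finally show ?thesis .
  qed
  have row: "(\<Sum>y'\<in>\<Omega>. k (card (y \<inter> y'))) = \<theta>" if "y \<in> \<Omega>" for y
    using level_row_sum[of y k] that theta by (simp add: \<Omega>_def)
  define N where "N = real (n choose w)"
  have N: "0 < N" using wn by (simp add: N_def)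
  have cardN: "real (card \<Omega>) = N" by (simp add: \<Omega>_def card_level N_def)
  define s where "s = (\<Sum>y\<in>\<Omega>. h y)"
  define c where "c = s / N"
  define h0 where "h0 y = h y - c" for y
  have "0 \<le> Q h0 h0" by (rule psd)
  also have "Q h0 h0 = Q h h - c * (\<Sum>y\<in>\<Omega>. \<Sum>y'\<in>\<Omega>. k (card (y \<inter> y')) * h y) - c * (\<Sum>y\<in>\<Omega>. \<Sum>y'\<in>\<Omega>. k (card (y \<inter> y')) * h y')
      + c\<^sup>2 * (\<Sum>y\<in>\<Omega>. \<Sum>y'\<in>\<Omega>. k (card (y \<inter> y')))"
    unfolding Q_def h0_def sum_distrib_left sum_subtractf[symmetric] sum.distrib[symmetric]
    by (intro sum.cong refl) (simp add: algebra_simps power2_eq_square)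
  also have "(\<Sum>y\<in>\<Omega>. \<Sum>y'\<in>\<Omega>. k (card (y \<inter> y')) * h y') = (\<Sum>y'\<in>\<Omega>. \<Sum>y\<in>\<Omega>. k (card (y' \<inter> y)) * h y')"
    by (rule trans[OF sum.swap]) (simp add: Int_commute)
  also have "(\<Sum>y\<in>\<Omega>. \<Sum>y'\<in>\<Omega>. k (card (y \<inter> y')) * h y) = \<theta> * s"
    using row by (simp add: s_def sum_distrib_right[symmetric] sum_distrib_left)
  also have "(\<Sum>y\<in>\<Omega>. \<Sum>y'\<in>\<Omega>. k (card (y \<inter> y'))) = \<theta> * N"
    using row cardN by simp
  also have "Q h h - c * (\<theta> * s) - c * (\<theta> * s) + c\<^sup>2 * (\<theta> * N) = Q h h - \<theta> / N * s\<^sup>2"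
    using N by (simp add: c_def field_simps power2_eq_square)
  finally show ?thesis by (simp add: Q_def k_def \<theta>_def N_def s_def \<Omega>_def)
qed

end


text \<open>\<open>\<phi>\<close> holds the coordinates of \<open>F\<close> in the normalized Hahn
  basis, where multiplication by \<open>t\<close> is a Jacobi matrix. By \<open>sub\<close> this
  matrix minus \<open>\<tau>\<close> maps \<open>\<phi>\<close> to something at least
  \<open>\<kappa>\<close> times as large. Hence \<open>G = (t - \<tau>) * F\<close> is a positive
  combination too, and \<open>\<theta>\<close> is at least \<open>\<kappa> * \<Phi>\<close>. The
  diagonal value \<open>F w\<close> is bounded by Cauchy-Schwarz and the dimension bound
  \<open>hahn_dim_le\<close>.\<close>

lemma dual_bound_johnson:
  fixes n w m :: nat and \<phi> :: "nat \<Rightarrow> real" and \<kappa> \<tau> D :: real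
  assumes wn: "2 * w < n" and mw: "m < w"
    and \<phi>: "\<And>l. 0 \<le> \<phi> l" "\<And>l. m < l \<Longrightarrow> \<phi> l = 0" "\<exists>l\<le>m. 0 < \<phi> l"
    and \<kappa>: "0 < \<kappa>" and \<tau>: "\<tau> \<le> real w" "2 * (real w - \<tau>) \<le> D"
    and sub: "\<And>l. l \<le> m \<Longrightarrow> \<kappa> * \<phi> l \<le>
      (if l = 0 then 0 else sqrt (hahn_A n w (l - 1) * hahn_C n w l) * \<phi> (l - 1)) +
      (hahn_A n w l + hahn_C n w l - \<tau>) * \<phi> l + sqrt (hahn_A n w l * hahn_C n w (l + 1)) * \<phi> (l + 1)"
  shows "dual_bound n D (2 ^ n / real (n choose w) * ((real w - \<tau>) / \<kappa>) * (\<Sum>l\<le>m. real (n choose l)))"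
proof -
  define A where "A = hahn_A n w"
  define C where "C = hahn_C n w"
  define \<eta> where "\<eta> = hnorm n w"
  define J where "J l = sqrt (A l * C (l + 1))" for l
  define f where "f l = \<phi> l / sqrt (\<eta> l)" for l
  define g where "g l = (if l = 0 then 0 else A (l - 1) * f (l - 1)) + (A l + C l - \<tau>) * f l + C (l + 1) * f (l + 1)" for l
  define F where "F t = (\<Sum>l\<le>w. f l * hahn n w l t)" for t
  define G where "G t = (\<Sum>l\<le>w. g l * hahn n w l t)" for t
  have \<eta>: "0 < \<eta> l" if "l \<le> w" for l using hnorm_pos[OF wn, of l] that by (simp add: \<eta>_def)
  have Apos: "0 < A l" if "l < w" for l using hahn_A_pos[OF wn that] by (simp add: A_def)
  have Cpos: "0 < C (l + 1)" if "l < w" for l using hahn_C_pos[OF wn, of "l + 1"] that by (simp add: C_def)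
  have rec: "A l * \<eta> (l + 1) = C (l + 1) * \<eta> l" if "l < w" for l
    using hnorm_rec[OF wn that] by (simp add: A_def C_def \<eta>_def)
  have J1: "J l / sqrt (\<eta> l) = C (l + 1) / sqrt (\<eta> (l + 1))" and J2: "J l / sqrt (\<eta> (l + 1)) = A l / sqrt (\<eta> l)"
    if "l < w" for l
  proof -
    have p: "0 < \<eta> l" "0 < \<eta> (l + 1)" "0 < A l" "0 < C (l + 1)" using \<eta>[of l] \<eta>[of "l + 1"] Apos[OF that] Cpos[OF that] that by auto
    have "J l / sqrt (\<eta> l) = sqrt (A l * C (l + 1) / \<eta> l)" by (simp add: J_def real_sqrt_divide)
    also have "A l * C (l + 1) / \<eta> l = (C (l + 1))\<^sup>2 / \<eta> (l + 1)"
      using rec[OF that] p by (simp add: field_simps power2_eq_square)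
    finally show "J l / sqrt (\<eta> l) = C (l + 1) / sqrt (\<eta> (l + 1))" using p by (simp add: real_sqrt_divide)
    have "J l / sqrt (\<eta> (l + 1)) = sqrt (A l * C (l + 1) / \<eta> (l + 1))" by (simp add: J_def real_sqrt_divide)
    also have "A l * C (l + 1) / \<eta> (l + 1) = (A l)\<^sup>2 / \<eta> l"
      using rec[OF that] p by (simp add: field_simps power2_eq_square)
    finally show "J l / sqrt (\<eta> (l + 1)) = A l / sqrt (\<eta> l)" using p by (simp add: real_sqrt_divide)
  qed
  have f0: "0 \<le> f l" for l
  proof (cases "l \<le> w")
    case True
    thus ?thesis using \<eta>[OF True] \<phi>(1)[of l] by (simp add: f_def)
  next
    case False
    thus ?thesis using \<phi>(2)[of l] mw by (simp add: f_def)
  qed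
  have fz: "f l = 0" if "m < l" for l using \<phi>(2)[OF that] by (simp add: f_def)
  have gl: "g l * sqrt (\<eta> l) = (if l = 0 then 0 else J (l - 1) * \<phi> (l - 1)) + (A l + C l - \<tau>) * \<phi> l + J l * \<phi> (l + 1)"
    if "l < w" for l
  proof -
    have s: "0 < sqrt (\<eta> l)" using \<eta>[of l] that by simp
    have 1: "C (l + 1) * f (l + 1) * sqrt (\<eta> l) = J l * \<phi> (l + 1)"
    proof -
      have "C (l + 1) * f (l + 1) = C (l + 1) / sqrt (\<eta> (l + 1)) * \<phi> (l + 1)" by (simp add: f_def)
      also have "\<dots> = J l / sqrt (\<eta> l) * \<phi> (l + 1)" by (simp only: J1[OF that])
      finally show ?thesis using s by simp
    qed
    have 2: "A (l - 1) * f (l - 1) * sqrt (\<eta> l) = J (l - 1) * \<phi> (l - 1)" if "l \<noteq> 0"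
    proof -
      have lw: "l - 1 < w" "l - 1 + 1 = l" using that \<open>l < w\<close> by auto
      have "A (l - 1) * f (l - 1) = A (l - 1) / sqrt (\<eta> (l - 1)) * \<phi> (l - 1)" by (simp add: f_def)
      also have "\<dots> = J (l - 1) / sqrt (\<eta> l) * \<phi> (l - 1)" using J2[OF lw(1)] by (simp only: lw(2))
      finally show ?thesis using s by simp
    qed
    have 3: "f l * sqrt (\<eta> l) = \<phi> l" using s by (simp add: f_def)
    have "g l * sqrt (\<eta> l) = (if l = 0 then 0 else A (l - 1) * f (l - 1) * sqrt (\<eta> l)) + (A l + C l - \<tau>) * (f l * sqrt (\<eta> l)) + C (l + 1) * f (l + 1) * sqrt (\<eta> l)"
      by (simp add: g_def algebra_simps)
    thus ?thesis using 1 2 3 by simp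
  qed
  have gk: "\<kappa> * \<phi> l \<le> g l * sqrt (\<eta> l)" if "l \<le> m" for l
  proof -
    have "(if l = 0 then 0 else J (l - 1) * \<phi> (l - 1)) = (if l = 0 then 0 else sqrt (hahn_A n w (l - 1) * hahn_C n w l) * \<phi> (l - 1))"
      by (simp add: J_def A_def C_def)
    moreover have "l < w" using that mw by simp
    ultimately show ?thesis using sub[OF that] gl[of l] unfolding J_def A_def C_def by linarith
  qed
  have g0: "0 \<le> g l" for l
  proof (cases "l \<le> m")
    case True
    have "0 \<le> g l * sqrt (\<eta> l)" using gk[OF True] \<kappa> \<phi>(1)[of l] by (meson mult_nonneg_nonneg order_trans less_imp_le)
    thus ?thesis using \<eta>[of l] True mw by (simp add: zero_le_mult_iff)
  next
    case False
    \<comment> \<open>Beyond \<open>m\<close> only the lower neighbour can contribute, namely at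
      \<open>l = m + 1\<close>.\<close>
    hence "g l = A (l - 1) * f (l - 1)" using fz[of l] fz[of "l + 1"] by (simp add: g_def)
    also have "\<dots> \<ge> 0" using Apos[of "l - 1"] f0[of "l - 1"] fz[of "l - 1"] mw by (cases "l - 1 \<le> m") auto
    finally show ?thesis .
  qed
  have FG: "(real t - \<tau>) * F t = G t" if t: "t \<le> w" for t
  proof -
    define H where "H l = hahn n w l t" for l
    have H: "real t * H l = A l * H (l + 1) + (A l + C l) * H l + C l * H (l - 1)" if "l \<le> w" for l
      using hahn_three_term[OF wn that t] by (simp add: H_def A_def C_def)
    have "(real t - \<tau>) * F t = (\<Sum>l\<le>w. f l * (real t * H l) - \<tau> * (f l * H l))"
      unfolding F_def H_def sum_distrib_left by (intro sum.cong refl) (simp add: algebra_simps)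
    also have "\<dots> = (\<Sum>l\<le>w. f l * A l * H (l + 1) + (A l + C l - \<tau>) * f l * H l + f l * C l * H (l - 1))"
      using H by (intro sum.cong refl) (simp add: algebra_simps)
    also have "\<dots> = (\<Sum>l\<le>w. f l * A l * H (l + 1)) + (\<Sum>l\<le>w. (A l + C l - \<tau>) * f l * H l) + (\<Sum>l\<le>w. f l * C l * H (l - 1))"
      by (simp add: sum.distrib)
    also have "(\<Sum>l\<le>w. f l * A l * H (l + 1)) = (\<Sum>l\<le>w. (if l = 0 then 0 else A (l - 1) * f (l - 1)) * H l)"
    proof -
      have "(\<Sum>l\<le>Suc w. (if l = 0 then 0 else A (l - 1) * f (l - 1)) * H l) = (\<Sum>l\<le>w. f l * A l * H (l + 1))"
        by (subst sum.atMost_Suc_shift) (simp add: mult_ac)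
      moreover have "A w = 0" using hahn_A_w[OF wn] by (simp add: A_def)
      ultimately show ?thesis by simp
    qed
    also have "(\<Sum>l\<le>w. f l * C l * H (l - 1)) = (\<Sum>l\<le>w. C (l + 1) * f (l + 1) * H l)"
    proof -
      have "(\<Sum>l\<le>Suc w. f l * C l * H (l - 1)) = (\<Sum>l\<le>w. C (l + 1) * f (l + 1) * H l)"
        by (subst sum.atMost_Suc_shift) (simp add: mult_ac C_def hahn_C_0[OF wn])
      moreover have "f (Suc w) = 0" using fz mw by simp
      ultimately show ?thesis by simp
    qed
    finally show ?thesis unfolding G_def g_def H_def by (simp add: sum.distrib[symmetric] algebra_simps)
  qed
  define \<Phi> where "\<Phi> = (\<Sum>l\<le>w. (\<phi> l)\<^sup>2)"
  have \<Phi>: "0 < \<Phi>"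
  proof -
    obtain l where l: "l \<le> m" "0 < \<phi> l" using \<phi>(3) by auto
    have "0 < (\<phi> l)\<^sup>2" using l by simp
    also have "\<dots> \<le> \<Phi>" unfolding \<Phi>_def using l mw by (intro member_le_sum) auto
    finally show ?thesis .
  qed
  define \<theta> where "\<theta> = (\<Sum>l\<le>w. f l * g l * \<eta> l)"
  have \<theta>1: "\<kappa> * \<Phi> \<le> \<theta>"
    unfolding \<Phi>_def \<theta>_def sum_distrib_left
  proof (rule sum_mono)
    fix l assume "l \<in> {..w}"
    hence e: "0 < \<eta> l" using \<eta> by simp
    have "f l * g l * \<eta> l = (f l * sqrt (\<eta> l)) * (g l * sqrt (\<eta> l))" using e by (simp add: algebra_simps)
    also have "f l * sqrt (\<eta> l) = \<phi> l" using e by (simp add: f_def)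
    finally have eq: "f l * g l * \<eta> l = \<phi> l * (g l * sqrt (\<eta> l))" .
    show "\<kappa> * (\<phi> l)\<^sup>2 \<le> f l * g l * \<eta> l"
    proof (cases "l \<le> m")
      case True
      have "\<phi> l * (\<kappa> * \<phi> l) \<le> \<phi> l * (g l * sqrt (\<eta> l))" by (rule mult_left_mono[OF gk[OF True] \<phi>(1)])
      thus ?thesis unfolding eq by (simp add: power2_eq_square mult_ac)
    next
      case False
      thus ?thesis unfolding eq using \<phi>(2) by simp
    qed
  qed
  hence \<theta>: "0 < \<theta>" using \<kappa> \<Phi> by (meson less_le_trans mult_pos_pos)
  define N where "N = real (n choose w)"
  have N: "0 < N" using wn by (simp add: N_def)
  define S where "S = (\<Sum>l\<le>m. real (n choose l))"
  have Fw: "(F w)\<^sup>2 \<le> \<Phi> * (S / N)"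
  proof -
    have "F w = (\<Sum>l\<le>m. f l * hahn n w l w)"
      unfolding F_def by (rule sum.mono_neutral_right) (use mw fz in auto)
    also have "\<dots> = (\<Sum>l\<le>m. \<phi> l * (hahn n w l w / sqrt (\<eta> l)))" by (simp add: f_def)
    finally have "(F w)\<^sup>2 \<le> (\<Sum>l\<le>m. (\<phi> l)\<^sup>2) * (\<Sum>l\<le>m. (hahn n w l w / sqrt (\<eta> l))\<^sup>2)"
      by (simp only: Cauchy_Schwarz_sum)
    also have "\<dots> \<le> \<Phi> * (S / N)"
    proof (rule mult_mono)
      show "(\<Sum>l\<le>m. (\<phi> l)\<^sup>2) \<le> \<Phi>" unfolding \<Phi>_def by (rule sum_mono2) (use mw in auto)
      show "(\<Sum>l\<le>m. (hahn n w l w / sqrt (\<eta> l))\<^sup>2) \<le> S / N"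
        unfolding S_def sum_divide_distrib
      proof (rule sum_mono)
        fix l assume "l \<in> {..m}"
        hence lw: "l \<le> w" using mw by simp
        show "(hahn n w l w / sqrt (\<eta> l))\<^sup>2 \<le> real (n choose l) / N"
          using hahn_dim_le[OF wn lw] \<eta>[OF lw] N by (simp add: power_divide \<eta>_def N_def field_simps)
      qed
    qed (use \<Phi> in \<open>auto intro: sum_nonneg\<close>)
    finally show ?thesis .
  qed
  define k where "k t = F t * G t" for t
  have kt: "k t = (real t - \<tau>) * (F t)\<^sup>2" if "t \<le> w" for t
    unfolding k_def FG[OF that, symmetric] by (simp add: power2_eq_square)
  \<comment> \<open>Scales the sum over all translates so that it dominates the all-ones kernel:
    each translate contributes \<open>\<theta> / N\<close> times \<open>(s u)\<^sup>2\<close>, and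
    the \<open>s u\<close> add up to \<open>N\<close> times the sum of \<open>h\<close>.\<close>
  define c where "c = 2 ^ n / (\<theta> * N)"
  have c: "0 < c" using \<theta> N by (simp add: c_def)
  define q where "q y y' = (if y \<in> level n w \<and> y' \<in> level n w then k (card (y \<inter> y')) else 0)" for y y'
  define K where "K y y' = c * (\<Sum>u\<in>Pow {..<n}. q (sd y u) (sd y' u))" for y y'
  have sd_shift: "(\<Sum>y\<in>Pow {..<n}. h (sd y u)) = (\<Sum>y\<in>Pow {..<n}. h y)" if "u \<in> Pow {..<n}" for u and h :: "nat set \<Rightarrow> real"
    using sum_sd[OF that, of h] by (simp add: sd_commute)
  show ?thesis
    unfolding dual_bound_def
  proof (intro exI[of _ K] conjI ballI allI impI)
    fix y y' assume y: "y \<in> Pow {..<n}" "y' \<in> Pow {..<n}" "D < real (card (sd y y'))"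
    have "q (sd y u) (sd y' u) \<le> 0" if "u \<in> Pow {..<n}" for u
    proof (cases "sd y u \<in> level n w \<and> sd y' u \<in> level n w")
      case True
      define z z' where "z = sd y u" and "z' = sd y' u"
      have z: "z \<in> level n w" "z' \<in> level n w" using True by (auto simp: z_def z'_def)
      have fin: "finite z" "finite z'" "card z = w" "card z' = w" using level_finite[OF z(1)] level_finite[OF z(2)] by auto
      have tw: "card (z \<inter> z') \<le> w" using card_mono[of z "z \<inter> z'"] fin by auto
      have "sd y y' = sd z z'" by (simp add: z_def z'_def sd_sd_cancel)
      also have "\<dots> = (z - z \<inter> z') \<union> (z' - z \<inter> z')" by (auto simp: sd_def)
      also have "card \<dots> = card (z - z \<inter> z') + card (z' - z \<inter> z')" using fin by (intro card_Un_disjoint) auto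
      also have "\<dots> = (w - card (z \<inter> z')) + (w - card (z \<inter> z'))" using fin by (simp add: card_Diff_subset)
      finally have "real (card (sd y y')) = 2 * (real w - real (card (z \<inter> z')))" using tw by simp
      hence "2 * (real w - \<tau>) < 2 * (real w - real (card (z \<inter> z')))" using y(3) \<tau>(2) by (metis order_le_less_trans)
      hence "real (card (z \<inter> z')) \<le> \<tau>" by simp
      hence "k (card (z \<inter> z')) \<le> 0" unfolding kt[OF tw] by (intro mult_nonpos_nonneg) auto
      thus ?thesis using z by (simp add: q_def z_def z'_def)
    qed (auto simp: q_def)
    hence "(\<Sum>u\<in>Pow {..<n}. q (sd y u) (sd y' u)) \<le> 0" by (rule sum_nonpos)
    thus "K y y' \<le> 0" unfolding K_def using c by (simp add: mult_le_0_iff)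
  next
    fix y assume y: "y \<in> Pow {..<n}"
    have "(\<Sum>u\<in>Pow {..<n}. q (sd y u) (sd y u)) = (\<Sum>u\<in>Pow {..<n}. q u u)"
      using sd_shift[OF y, of "\<lambda>u. q u u"] by (simp add: sd_commute)
    also have "\<dots> = (\<Sum>u\<in>Pow {..<n}. if u \<in> level n w then k w else 0)"
      by (rule sum.cong[OF refl]) (auto simp: q_def level_finite(3))
    also have "\<dots> = (\<Sum>u\<in>{u\<in>Pow {..<n}. u \<in> level n w}. k w)" by (rule sum.inter_filter[symmetric]) simp
    also have "{u\<in>Pow {..<n}. u \<in> level n w} = level n w" by (auto simp: level_def)
    finally have "K y y = c * (N * k w)" by (simp add: K_def card_level N_def)
    also have "\<dots> = 2 ^ n / \<theta> * ((real w - \<tau>) * (F w)\<^sup>2)" using N \<theta> kt[of w] by (simp add: c_def)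
    also have "\<dots> \<le> 2 ^ n / (\<kappa> * \<Phi>) * ((real w - \<tau>) * (\<Phi> * (S / N)))"
      using \<theta>1 \<theta> \<kappa> \<Phi> Fw \<tau>(1)
      by (intro mult_mono divide_left_mono mult_left_mono mult_nonneg_nonneg) auto
    also have "\<dots> = 2 ^ n / N * ((real w - \<tau>) / \<kappa>) * S" using \<Phi> \<kappa> N by (simp add: divide_simps mult_ac)
    finally show "K y y \<le> 2 ^ n / real (n choose w) * ((real w - \<tau>) / \<kappa>) * (\<Sum>l\<le>m. real (n choose l))"
      by (simp add: N_def S_def)
  next
    fix h :: "nat set \<Rightarrow> real"
    define P where "P = Pow {..<n}"
    define s where "s u = (\<Sum>z\<in>level n w. h (sd z u))" for u
    have lev: "(\<Sum>z\<in>P. if z \<in> level n w then r z else 0) = (\<Sum>z\<in>level n w. r z)" for r :: "nat set \<Rightarrow> real"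
    proof -
      have "(\<Sum>z\<in>P. if z \<in> level n w then r z else 0) = (\<Sum>z\<in>{z\<in>P. z \<in> level n w}. r z)"
        by (rule sum.inter_filter[symmetric]) (simp add: P_def)
      also have "{z\<in>P. z \<in> level n w} = level n w" by (auto simp: level_def P_def)
      finally show ?thesis .
    qed
    have "(\<Sum>u\<in>P. s u) = (\<Sum>z\<in>level n w. \<Sum>u\<in>P. h (sd z u))" unfolding s_def by (rule sum.swap)
    also have "\<dots> = (\<Sum>z\<in>level n w. \<Sum>u\<in>P. h u)"
    proof (rule sum.cong[OF refl])
      fix z assume "z \<in> level n w"
      hence "z \<in> Pow {..<n}" by (auto simp: level_def)
      from sd_shift[OF this, of h] show "(\<Sum>u\<in>P. h (sd z u)) = (\<Sum>u\<in>P. h u)" by (simp add: P_def sd_commute)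
    qed
    also have "\<dots> = N * (\<Sum>u\<in>P. h u)" by (simp add: card_level N_def)
    finally have S1: "(\<Sum>u\<in>P. s u) = N * (\<Sum>u\<in>P. h u)" .
    have "(\<Sum>u\<in>P. s u)\<^sup>2 \<le> real (card P) * (\<Sum>u\<in>P. (s u)\<^sup>2)"
      using Cauchy_Schwarz_sum[of "\<lambda>_. 1" s P] by simp
    hence S2: "N\<^sup>2 * (\<Sum>u\<in>P. h u)\<^sup>2 \<le> 2 ^ n * (\<Sum>u\<in>P. (s u)\<^sup>2)"
      unfolding S1 by (simp add: P_def card_Pow power_mult_distrib)
    have S3: "\<theta> / N * (s u)\<^sup>2 \<le> (\<Sum>y\<in>P. \<Sum>y'\<in>P. q (sd y u) (sd y' u) * h y * h y')" if u: "u \<in> P" for u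
    proof -
      have uP: "u \<in> Pow {..<n}" using u by (simp add: P_def)
      have ss: "sd (sd y u) u = y" for y by (auto simp: sd_def)
      have "\<theta> / N * (s u)\<^sup>2 \<le> (\<Sum>y\<in>level n w. \<Sum>y'\<in>level n w. k (card (y \<inter> y')) * h (sd y u) * h (sd y' u))"
        using johnson_kernel[OF wn, of f g "\<lambda>y. h (sd y u)", OF f0 g0]
        unfolding \<theta>_def \<eta>_def N_def s_def k_def F_def G_def .
      also have "\<dots> = (\<Sum>y\<in>P. if y \<in> level n w then (\<Sum>y'\<in>P. if y' \<in> level n w then k (card (y \<inter> y')) * h (sd y u) * h (sd y' u) else 0) else 0)"
        by (simp only: lev)
      also have "\<dots> = (\<Sum>y\<in>P. \<Sum>y'\<in>P. q y y' * h (sd y u) * h (sd y' u))"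
        by (rule sum.cong[OF refl]) (auto simp: q_def intro!: sum.cong)
      also have "\<dots> = (\<Sum>y\<in>P. \<Sum>y'\<in>P. q (sd y u) y' * h (sd (sd y u) u) * h (sd y' u))"
        using sd_shift[OF uP, of "\<lambda>y. \<Sum>y'\<in>P. q y y' * h (sd y u) * h (sd y' u)"] by (simp add: P_def)
      also have "\<dots> = (\<Sum>y\<in>P. \<Sum>y'\<in>P. q (sd y u) (sd y' u) * h (sd (sd y u) u) * h (sd (sd y' u) u))"
      proof (rule sum.cong[OF refl])
        fix y
        show "(\<Sum>y'\<in>P. q (sd y u) y' * h (sd (sd y u) u) * h (sd y' u)) = (\<Sum>y'\<in>P. q (sd y u) (sd y' u) * h (sd (sd y u) u) * h (sd (sd y' u) u))"
          using sd_shift[OF uP, of "\<lambda>y'. q (sd y u) y' * h (sd (sd y u) u) * h (sd y' u)"] by (simp add: P_def)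
      qed
      finally show ?thesis by (simp only: ss)
    qed
    have "\<theta> * N * (\<Sum>u\<in>P. h u)\<^sup>2 = \<theta> / N * (N\<^sup>2 * (\<Sum>u\<in>P. h u)\<^sup>2)" using N by (simp add: power2_eq_square)
    also have "\<dots> \<le> \<theta> / N * (2 ^ n * (\<Sum>u\<in>P. (s u)\<^sup>2))" by (rule mult_left_mono[OF S2]) (use \<theta> N in simp)
    also have "\<dots> = 2 ^ n * (\<Sum>u\<in>P. \<theta> / N * (s u)\<^sup>2)" by (simp add: sum_distrib_left mult_ac)
    also have "\<dots> \<le> 2 ^ n * (\<Sum>u\<in>P. \<Sum>y\<in>P. \<Sum>y'\<in>P. q (sd y u) (sd y' u) * h y * h y')"
      using S3 by (intro mult_left_mono) (auto intro: sum_mono)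
    finally have "(\<Sum>u\<in>P. h u)\<^sup>2 \<le> c * (\<Sum>u\<in>P. \<Sum>y\<in>P. \<Sum>y'\<in>P. q (sd y u) (sd y' u) * h y * h y')"
      using \<theta> N by (simp add: c_def field_simps)
    also have "(\<Sum>u\<in>P. \<Sum>y\<in>P. \<Sum>y'\<in>P. q (sd y u) (sd y' u) * h y * h y') = (\<Sum>y\<in>P. \<Sum>u\<in>P. \<Sum>y'\<in>P. q (sd y u) (sd y' u) * h y * h y')"
      by (rule sum.swap)
    also have "\<dots> = (\<Sum>y\<in>P. \<Sum>y'\<in>P. \<Sum>u\<in>P. q (sd y u) (sd y' u) * h y * h y')"
      by (rule sum.cong[OF refl], rule sum.swap)
    also have "c * \<dots> = (\<Sum>y\<in>P. \<Sum>y'\<in>P. K y y' * h y * h y')"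
      unfolding K_def P_def[symmetric] sum_distrib_left sum_distrib_right by (simp only: mult.assoc)
    finally show "(\<Sum>y\<in>Pow {..<n}. h y)\<^sup>2 \<le> (\<Sum>y\<in>Pow {..<n}. \<Sum>y'\<in>Pow {..<n}. K y y' * h y * h y')"
      by (simp only: P_def)
  qed
qed


section \<open>Anticodes\<close>

text \<open>Gaussian elimination: solve one equation for one unknown \<open>p\<close> and substitute
  into the others.\<close>

lemma homogeneous_system:
  fixes u :: "'i \<Rightarrow> 'a \<Rightarrow> 'f::field"
  assumes "finite I" "finite A" "card I < card A"
  shows "\<exists>c. (\<exists>x\<in>A. c x \<noteq> 0) \<and> (\<forall>i\<in>I. (\<Sum>x\<in>A. c x * u i x) = 0)"
  using assms
proof (induction I arbitrary: A u rule: finite_induct)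
  case empty
  then obtain p where "p \<in> A" by fastforce
  thus ?case by (intro exI[of _ "\<lambda>_. 1"]) auto
next
  case (insert k I)
  show ?case
  proof (cases "\<forall>x\<in>A. u k x = 0")
    case True
    obtain c where c: "\<exists>x\<in>A. c x \<noteq> 0" "\<forall>i\<in>I. (\<Sum>x\<in>A. c x * u i x) = 0"
    proof -
      have "card I < card A" using insert by simp
      from insert.IH[OF insert.prems(1) this, of u] show ?thesis using that by blast
    qed
    moreover have "(\<Sum>x\<in>A. c x * u k x) = 0" using True by (intro sum.neutral) auto
    ultimately show ?thesis by (intro exI[of _ c]) auto
  next
    case False
    then obtain p where p: "p \<in> A" "u k p \<noteq> 0" by auto
    define A' where "A' = A - {p}"
    have A': "finite A'" "card I < card A'" "p \<notin> A'" "A = insert p A'" using insert p by (auto simp: A'_def)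
    define u' where "u' i x = u i x - u k x / u k p * u i p" for i x
    obtain c where c: "\<exists>x\<in>A'. c x \<noteq> 0" "\<forall>i\<in>I. (\<Sum>x\<in>A'. c x * u' i x) = 0"
      using insert.IH[OF A'(1,2), of u'] by blast
    define s where "s = (\<Sum>x\<in>A'. c x * u k x)"
    define c' where "c' x = (if x = p then - s / u k p else c x)" for x
    have sumc: "(\<Sum>x\<in>A. c' x * u i x) = - s / u k p * u i p + (\<Sum>x\<in>A'. c x * u i x)" for i
    proof -
      have "(\<Sum>x\<in>A'. c' x * u i x) = (\<Sum>x\<in>A'. c x * u i x)" using A'(3) by (intro sum.cong) (auto simp: c'_def)
      thus ?thesis using A' by (simp add: c'_def)
    qed
    have "(\<Sum>x\<in>A. c' x * u i x) = 0" if "i \<in> insert k I" for i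
    proof (cases "i = k")
      case True
      thus ?thesis unfolding sumc using p by (simp add: s_def)
    next
      case False
      hence "(\<Sum>x\<in>A'. c x * u' i x) = 0" using c(2) that by auto
      moreover have "(\<Sum>x\<in>A'. c x * u' i x) = (\<Sum>x\<in>A'. c x * u i x) - s / u k p * u i p"
      proof -
        have "(\<Sum>x\<in>A'. c x * u' i x) = (\<Sum>x\<in>A'. c x * u i x - (c x * u k x) * (u i p / u k p))"
          by (intro sum.cong refl) (simp add: u'_def right_diff_distrib)
        also have "\<dots> = (\<Sum>x\<in>A'. c x * u i x) - s * (u i p / u k p)"
          unfolding s_def sum_distrib_right by (rule sum_subtractf)
        finally show ?thesis by simp
      qed
      ultimately show ?thesis unfolding sumc by simp
    qed
    moreover have "\<exists>x\<in>A. c' x \<noteq> 0" using c(1) A'(3,4) by (auto simp: c'_def)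
    ultimately show ?thesis by blast
  qed
qed

text \<open>The identity matrix of size \<open>card A\<close> factors through a space of dimension
  \<open>card I\<close>.\<close>

lemma card_le_rank:
  fixes u v :: "'i \<Rightarrow> 'a \<Rightarrow> 'f::field"
  assumes "finite I" "finite A"
    and id: "\<And>x y. x \<in> A \<Longrightarrow> y \<in> A \<Longrightarrow> (\<Sum>i\<in>I. u i x * v i y) = (if x = y then 1 else 0)"
  shows "card A \<le> card I"
proof (rule ccontr)
  assume "\<not> card A \<le> card I"
  then obtain c where c: "\<exists>x\<in>A. c x \<noteq> 0" "\<forall>i\<in>I. (\<Sum>x\<in>A. c x * u i x) = 0"
    using homogeneous_system[OF assms(1,2), of u] by auto
  have "c y = 0" if y: "y \<in> A" for y
  proof -
    have "c y = (\<Sum>x\<in>A. c x * (if x = y then 1 else 0))" using y assms(2) by (simp add: if_distrib[of "\<lambda>z. _ * z"] cong: if_cong)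
    also have "\<dots> = (\<Sum>x\<in>A. \<Sum>i\<in>I. (c x * u i x) * v i y)"
    proof (rule sum.cong[OF refl])
      fix x assume "x \<in> A"
      show "c x * (if x = y then 1 else 0) = (\<Sum>i\<in>I. (c x * u i x) * v i y)"
        unfolding id[OF \<open>x \<in> A\<close> y, symmetric] by (simp only: sum_distrib_left mult.assoc)
    qed
    also have "\<dots> = (\<Sum>i\<in>I. (\<Sum>x\<in>A. c x * u i x) * v i y)"
      unfolding sum_distrib_right by (rule sum.swap)
    also have "\<dots> = 0" using c(2) by (intro sum.neutral) auto
    finally show ?thesis .
  qed
  thus False using c(1) by auto
qed

lemma sum_UNIV_bool: "sum h (UNIV :: bool set) = h True + h False"
  by (simp add: UNIV_bool add.commute)

lemma card_Pow_le:
  "card {S \<in> Pow {..<n::nat}. card S \<le> e} = (\<Sum>i\<le>e. n choose i)"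
proof -
  have "{S \<in> Pow {..<n::nat}. card S \<le> e} = (\<Union>i\<le>e. level n i)" by (auto simp: level_def)
  also have "card \<dots> = (\<Sum>i\<le>e. card (level n i))"
    by (rule card_UN_disjoint) (auto simp: level_def)
  finally show ?thesis by (simp add: card_level)
qed

text \<open>Croot--Lev--Pach: over the two-element field the number of subsets of size at most \<open>2 * e\<close> of \<open>x + y\<close> is a
  polynomial of degree \<open>2 * e\<close>, each monomial of which has degree at most \<open>e\<close> in \<open>x\<close> or in \<open>y\<close>.\<close>

lemma anticode_card_le:
  assumes A: "A \<subseteq> Pow {..<n::nat}" and diam: "\<And>x y. x \<in> A \<Longrightarrow> y \<in> A \<Longrightarrow> card (sd x y) \<le> 2 * e"
  shows "card A \<le> 2 * (\<Sum>i\<le>e. n choose i)"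
proof -
  define N where "N = {..<n}"
  define one where "one I x = (if I \<subseteq> x then 1 else 0 :: bit)" for I x :: "nat set"
  define Sm where "Sm = {S \<in> Pow N. card S \<le> e}"
  define P where "P = {p \<in> Pow N \<times> Pow N. fst p \<inter> snd p = {} \<and> card (fst p) + card (snd p) \<le> 2 * e}"
  have fN: "finite N" and fSm: "finite Sm" and fP: "finite P" by (auto simp: N_def Sm_def P_def)
  have finS: "finite S" if "S \<subseteq> N" for S using that fN finite_subset by auto
  define M where "M x y = (\<Sum>S\<in>{S\<in>Pow N. card S \<le> 2 * e}. one S (sd x y))" for x y
  \<comment> \<open>By the bound on the diameter all subsets of the symmetric difference are
    counted. Their number is a power of 2 and vanishes over the two-element field unless the
    difference is empty.\<close>
  have Mdiag: "M x y = (if x = y then 1 else 0)" if xy: "x \<in> A" "y \<in> A" for x y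
  proof -
    let ?z = "sd x y"
    have zN: "?z \<subseteq> N" using A xy by (auto simp: N_def sd_def)
    have fz: "finite ?z" by (rule finS[OF zN])
    have "M x y = of_nat (card {S \<in> {S\<in>Pow N. card S \<le> 2 * e}. S \<subseteq> ?z})"
      unfolding M_def one_def using fN by (simp add: sum.inter_filter[symmetric])
    also have "{S \<in> {S\<in>Pow N. card S \<le> 2 * e}. S \<subseteq> ?z} = Pow ?z"
      using zN diam[OF xy] card_mono[OF fz] by (auto intro: order_trans)
    also have "(of_nat (card (Pow ?z)) :: bit) = of_nat 2 ^ card ?z" using fz by (simp add: card_Pow)
    also have "\<dots> = (if x = y then 1 else 0)" using fz by (simp add: card_0_eq)
    finally show ?thesis .
  qed
  have split: "one S (sd x y) = (\<Sum>I\<in>Pow S. one I x * one (S - I) y)" if "S \<subseteq> N" for S x y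
  proof -
    have fS: "finite S" by (rule finS[OF that])
    have po: "(\<Prod>i\<in>T. if i \<in> z then 1 else 0 :: bit) = one T z" if "finite T" for T z
    proof (cases "T \<subseteq> z")
      case True
      thus ?thesis by (simp add: one_def) (intro prod.neutral, auto)
    next
      case False
      then obtain i where "i \<in> T" "i \<notin> z" by auto
      thus ?thesis using that False by (simp add: one_def) (intro bexI[of _ i], auto)
    qed
    have "one S (sd x y) = (\<Prod>i\<in>S. (if i \<in> x then 1 else 0) + (if i \<in> y then 1 else 0 :: bit))"
    proof -
      have "one S (sd x y) = (\<Prod>i\<in>S. if i \<in> sd x y then 1 else 0)" by (rule po[OF fS, symmetric])
      also have "\<dots> = (\<Prod>i\<in>S. (if i \<in> x then 1 else 0) + (if i \<in> y then 1 else 0 :: bit))"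
        by (rule prod.cong) (auto simp: sd_def)
      finally show ?thesis .
    qed
    also have "\<dots> = (\<Sum>I\<in>Pow S. (\<Prod>i\<in>I. if i \<in> x then 1 else 0) * (\<Prod>i\<in>S - I. if i \<in> y then 1 else 0))"
      by (rule prod_add[OF fS])
    also have "\<dots> = (\<Sum>I\<in>Pow S. one I x * one (S - I) y)"
      using fS by (intro sum.cong refl) (auto simp: po finite_subset)
    finally show ?thesis .
  qed
  have MP: "M x y = (\<Sum>p\<in>P. one (fst p) x * one (snd p) y)" for x y
  proof -
    have "M x y = (\<Sum>S\<in>{S\<in>Pow N. card S \<le> 2 * e}. \<Sum>I\<in>Pow S. one I x * one (S - I) y)"
      unfolding M_def using split by (intro sum.cong) auto
    also have "\<dots> = (\<Sum>q\<in>Sigma {S\<in>Pow N. card S \<le> 2 * e} Pow. one (snd q) x * one (fst q - snd q) y)"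
      using fN finS by (subst sum.Sigma) (auto simp: case_prod_unfold)
    also have "\<dots> = (\<Sum>p\<in>P. one (fst p) x * one (snd p) y)"
    proof (rule sum.reindex_bij_witness[of _ "\<lambda>p. (fst p \<union> snd p, fst p)" "\<lambda>q. (snd q, fst q - snd q)"])
      fix q assume q: "q \<in> Sigma {S\<in>Pow N. card S \<le> 2 * e} Pow"
      hence s: "snd q \<subseteq> fst q" "fst q \<subseteq> N" "card (fst q) \<le> 2 * e" by auto
      have "card (fst q - snd q) + card (snd q) = card (fst q)"
        using card_Diff_subset[of "snd q" "fst q"] card_mono[of "fst q" "snd q"] s finS[OF s(2)] finite_subset[OF s(1)] by simp
      thus "(snd q, fst q - snd q) \<in> P" using s by (auto simp: P_def)
      show "(fst (snd q, fst q - snd q) \<union> snd (snd q, fst q - snd q), fst (snd q, fst q - snd q)) = q"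
        using s by (cases q) auto
    next
      fix p assume p: "p \<in> P"
      hence s: "fst p \<subseteq> N" "snd p \<subseteq> N" "fst p \<inter> snd p = {}" "card (fst p) + card (snd p) \<le> 2 * e" by (auto simp: P_def)
      have "card (fst p \<union> snd p) = card (fst p) + card (snd p)" using s finS by (intro card_Un_disjoint) auto
      thus "(fst p \<union> snd p, fst p) \<in> Sigma {S\<in>Pow N. card S \<le> 2 * e} Pow" using s by auto
      show "(snd (fst p \<union> snd p, fst p), fst (fst p \<union> snd p, fst p) - snd (fst p \<union> snd p, fst p)) = p"
        using s by (cases p) auto
    qed auto
    finally show ?thesis .
  qed
  \<comment> \<open>A pair is grouped by its first set if that has at most \<open>e\<close>
    elements, and otherwise by the second, which is then small because the sizes add up to at most
    \<open>2 * e\<close>.\<close>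
  define vv where "vv I y = (\<Sum>p\<in>{p\<in>P. fst p = I}. one (snd p) y)" for I y
  define uu where "uu J x = (\<Sum>p\<in>{p\<in>P. e < card (fst p) \<and> snd p = J}. one (fst p) x)" for J x
  have MU: "M x y = (\<Sum>I\<in>Sm. one I x * vv I y) + (\<Sum>J\<in>Sm. uu J x * one J y)" for x y
  proof -
    have "M x y = (\<Sum>p\<in>{p\<in>P. card (fst p) \<le> e}. one (fst p) x * one (snd p) y) +
        (\<Sum>p\<in>{p\<in>P. e < card (fst p)}. one (fst p) x * one (snd p) y)"
    proof -
      have "P = {p\<in>P. card (fst p) \<le> e} \<union> {p\<in>P. e < card (fst p)}" by auto
      hence "M x y = (\<Sum>p\<in>{p\<in>P. card (fst p) \<le> e} \<union> {p\<in>P. e < card (fst p)}. one (fst p) x * one (snd p) y)"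
        unfolding MP by (rule sum.cong) (rule refl)
      also have "\<dots> = (\<Sum>p\<in>{p\<in>P. card (fst p) \<le> e}. one (fst p) x * one (snd p) y) +
          (\<Sum>p\<in>{p\<in>P. e < card (fst p)}. one (fst p) x * one (snd p) y)"
        by (rule sum.union_disjoint) (use fP in auto)
      finally show ?thesis .
    qed
    also have "(\<Sum>p\<in>{p\<in>P. card (fst p) \<le> e}. one (fst p) x * one (snd p) y) =
        (\<Sum>I\<in>Sm. \<Sum>p\<in>{p\<in>{p\<in>P. card (fst p) \<le> e}. fst p = I}. one (fst p) x * one (snd p) y)"
      by (rule sum.group[symmetric, OF _ fSm], simp add: fP) (auto simp: P_def Sm_def)
    also have "\<dots> = (\<Sum>I\<in>Sm. one I x * vv I y)"
      unfolding vv_def sum_distrib_left by (intro sum.cong refl) (auto simp: Sm_def)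
    also have "(\<Sum>p\<in>{p\<in>P. e < card (fst p)}. one (fst p) x * one (snd p) y) =
        (\<Sum>J\<in>Sm. \<Sum>p\<in>{p\<in>{p\<in>P. e < card (fst p)}. snd p = J}. one (fst p) x * one (snd p) y)"
      by (rule sum.group[symmetric, OF _ fSm], simp add: fP) (auto simp: P_def Sm_def)
    also have "\<dots> = (\<Sum>J\<in>Sm. uu J x * one J y)"
      unfolding uu_def sum_distrib_right by (intro sum.cong refl) auto
    finally show ?thesis .
  qed
  \<comment> \<open>The tag of type \<open>bool\<close> joins the two families into one index set
    and is the source of the factor 2.\<close>
  define U where "U i x = (if fst i then one (snd i) x else uu (snd i) x)" for i :: "bool \<times> nat set" and x
  define V where "V i y = (if fst i then vv (snd i) y else one (snd i) y)" for i :: "bool \<times> nat set" and y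
  have "card A \<le> card ((UNIV :: bool set) \<times> Sm)"
  proof (rule card_le_rank[where u = U and v = V])
    show "finite ((UNIV :: bool set) \<times> Sm)" using fSm by simp
    show "finite A" using A finite_subset by blast
    fix x y assume xy: "x \<in> A" "y \<in> A"
    have "(\<Sum>i\<in>UNIV \<times> Sm. U i x * V i y) = (\<Sum>b\<in>UNIV. \<Sum>S\<in>Sm. U (b, S) x * V (b, S) y)"
      by (simp add: sum.cartesian_product case_prod_unfold)
    also have "\<dots> = (\<Sum>I\<in>Sm. one I x * vv I y) + (\<Sum>J\<in>Sm. uu J x * one J y)"
      by (simp only: sum_UNIV_bool U_def V_def fst_conv snd_conv if_True if_False simp_thms)
    also have "\<dots> = (if x = y then 1 else 0)" using MU Mdiag[OF xy] by metis
    finally show "(\<Sum>i\<in>UNIV \<times> Sm. U i x * V i y) = (if x = y then 1 else 0)" .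
  qed
  also have "\<dots> = 2 * (\<Sum>i\<le>e. n choose i)"
    using card_Pow_le[of n e] by (simp add: card_cartesian_product Sm_def N_def)
  finally show ?thesis .
qed

text \<open>Count the pairs of \<open>x\<close> and \<open>t\<close> with \<open>\<phi> x\<close> at
  distance \<open>\<rho>\<close> from \<open>t\<close>. For fixed \<open>t\<close> two such images
  differ in at most \<open>2 * \<rho> \<le> D\<close> places, so the points \<open>x\<close> form a
  set of diameter at most \<open>d\<close>.\<close>

lemma hom_anticode_bound:
  assumes \<phi>: "\<phi> \<in> Pow {..<k} \<rightarrow> Pow {..<n}"
    and hom: "\<And>x x'. x \<in> Pow {..<k} \<Longrightarrow> x' \<in> Pow {..<k} \<Longrightarrow>
      D < real (card (sd (\<phi> x) (\<phi> x'))) \<or> card (sd x x') \<le> d"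
    and \<rho>: "2 * real \<rho> \<le> D" and e: "d \<le> 2 * e"
  shows "2 ^ k * real (n choose \<rho>) \<le> 2 ^ n * (2 * real (\<Sum>i\<le>e. k choose i))"
proof -
  define A where "A t = {x \<in> Pow {..<k}. sd (\<phi> x) t \<in> level n \<rho>}" for t
  have cA: "card (A t) \<le> 2 * (\<Sum>i\<le>e. k choose i)" for t
  proof (rule anticode_card_le)
    show "A t \<subseteq> Pow {..<k}" by (auto simp: A_def)
    fix x y assume xy: "x \<in> A t" "y \<in> A t"
    have l: "sd (\<phi> x) t \<in> level n \<rho>" "sd (\<phi> y) t \<in> level n \<rho>" using xy by (auto simp: A_def)
    have "card (sd (\<phi> x) (\<phi> y)) = card (sd (sd (\<phi> x) t) (sd (\<phi> y) t))" by (simp add: sd_sd_cancel)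
    also have "\<dots> \<le> card (sd (\<phi> x) t \<union> sd (\<phi> y) t)"
      using l by (intro card_mono) (auto simp: sd_def level_def intro: finite_subset[of _ "{..<n}"])
    also have "\<dots> \<le> card (sd (\<phi> x) t) + card (sd (\<phi> y) t)" by (rule card_Un_le)
    also have "\<dots> = 2 * \<rho>" using l by (simp add: level_def)
    finally have "real (card (sd (\<phi> x) (\<phi> y))) \<le> D" using \<rho> by linarith
    thus "card (sd x y) \<le> 2 * e" using hom[of x y] xy e by (auto simp: A_def)
  qed
  have "(\<Sum>t\<in>Pow {..<n}. card (A t)) = (\<Sum>t\<in>Pow {..<n}. \<Sum>x\<in>Pow {..<k}. if sd (\<phi> x) t \<in> level n \<rho> then 1 else 0)"
    unfolding A_def by (intro sum.cong refl) (simp add: sum.inter_filter[symmetric])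
  also have "\<dots> = (\<Sum>x\<in>Pow {..<k}. \<Sum>t\<in>Pow {..<n}. if sd (\<phi> x) t \<in> level n \<rho> then 1 else 0)" by (rule sum.swap)
  also have "\<dots> = (\<Sum>x\<in>Pow {..<k}. n choose \<rho>)"
  proof (rule sum.cong[OF refl])
    fix x assume "x \<in> Pow {..<k}"
    hence "\<phi> x \<in> Pow {..<n}" using \<phi> by auto
    have "(\<Sum>t\<in>Pow {..<n}. if sd (\<phi> x) t \<in> level n \<rho> then 1 else 0) = (\<Sum>t\<in>Pow {..<n}. if t \<in> level n \<rho> then 1 else 0 :: nat)"
      using sum_sd[OF \<open>\<phi> x \<in> Pow {..<n}\<close>, of "\<lambda>t. if t \<in> level n \<rho> then 1 else 0 :: nat"] by (simp add: sd_commute)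
    also have "\<dots> = card {t \<in> Pow {..<n}. t \<in> level n \<rho>}" by (simp add: sum.inter_filter[symmetric])
    also have "{t \<in> Pow {..<n}. t \<in> level n \<rho>} = level n \<rho>" by (auto simp: level_def)
    finally show "(\<Sum>t\<in>Pow {..<n}. if sd (\<phi> x) t \<in> level n \<rho> then 1 else 0) = n choose \<rho>" by (simp add: card_level)
  qed
  also have "\<dots> = 2 ^ k * (n choose \<rho>)" by (simp add: card_Pow)
  finally have "2 ^ k * (n choose \<rho>) = (\<Sum>t\<in>Pow {..<n}. card (A t))" by simp
  also have "\<dots> \<le> (\<Sum>t\<in>Pow {..<n}. 2 * (\<Sum>i\<le>e. k choose i))" by (rule sum_mono) (rule cA)
  also have "\<dots> = 2 ^ n * (2 * (\<Sum>i\<le>e. k choose i))" by (simp add: card_Pow)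
  finally have "real (2 ^ k * (n choose \<rho>)) \<le> real (2 ^ n * (2 * (\<Sum>i\<le>e. k choose i)))" by (rule of_nat_mono)
  thus ?thesis by simp
qed


section \<open>Asymptotics\<close>

text \<open>Take the infimum of the errors that work at \<open>n\<close>. It need not work itself,
  hence the summand \<open>1 / (n + 1)\<close>; \<open>triv\<close> provides a working error for the
  \<open>n\<close> that \<open>ev\<close> does not reach.\<close>

lemma null_sequence_exists:
  fixes P :: "nat \<Rightarrow> real \<Rightarrow> bool"
  assumes mono: "\<And>n e e'. P n e \<Longrightarrow> e \<le> e' \<Longrightarrow> P n e'"
    and ev: "\<And>e. 0 < e \<Longrightarrow> eventually (\<lambda>n. P n e) sequentially"
    and triv: "\<And>n. P n C"
  shows "\<exists>\<delta>. \<delta> \<longlonglongrightarrow> 0 \<and> (\<forall>n. 0 \<le> \<delta> n \<and> P n (\<delta> n))"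
proof -
  define E where "E n = {e. 0 \<le> e \<and> P n e}" for n
  define \<delta> where "\<delta> n = Inf (E n) + 1 / (real n + 1)" for n
  have ne: "E n \<noteq> {}" for n
  proof -
    have "max C 0 \<in> E n" using mono[OF triv[of n], of "max C 0"] by (simp add: E_def)
    thus ?thesis by blast
  qed
  have bdd: "bdd_below (E n)" for n by (rule bdd_belowI[of _ 0]) (auto simp: E_def)
  have Inf0: "0 \<le> Inf (E n)" for n by (rule cInf_greatest[OF ne]) (auto simp: E_def)
  have P: "0 \<le> \<delta> n \<and> P n (\<delta> n)" for n
  proof -
    have "Inf (E n) < \<delta> n" by (simp add: \<delta>_def)
    then obtain e where "e \<in> E n" "e < \<delta> n" using cInf_lessD[OF ne] by blast
    thus ?thesis using mono[of n e "\<delta> n"] by (auto simp: E_def)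
  qed
  have "\<delta> \<longlonglongrightarrow> 0"
  proof (rule LIMSEQ_I)
    fix r :: real assume r: "0 < r"
    have "eventually (\<lambda>n. 1 / (real n + 1) < r / 2) sequentially" using r by real_asymp
    moreover have "eventually (\<lambda>n. P n (r / 2)) sequentially" using r by (intro ev) simp
    ultimately have "eventually (\<lambda>n. norm (\<delta> n - 0) < r) sequentially"
    proof eventually_elim
      case (elim n)
      have "Inf (E n) \<le> r / 2" using elim r by (intro cInf_lower[OF _ bdd]) (auto simp: E_def)
      thus ?case using elim P[of n] by (simp add: \<delta>_def)
    qed
    thus "\<exists>no. \<forall>n\<ge>no. norm (\<delta> n - 0) < r" unfolding eventually_sequentially .
  qed
  thus ?thesis using P by blast
qed

text \<open>A single inequality that absorbs all polynomial factors below.\<close>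

lemma poly_le_powr:
  assumes "0 < e"
  shows "eventually (\<lambda>n. 8 * (real n + 1) ^ 4 \<le> 2 powr (real n * e)) sequentially"
  using assms by real_asymp

text \<open>Gibbs' inequality with reference \<open>\<theta>\<close>: the bound is affine and
  nondecreasing in \<open>p\<close> and exact at \<open>p = \<theta>\<close>.\<close>

lemma bin_entropy_mono:
  assumes "0 \<le> p" "p \<le> \<theta>" "\<theta> \<le> 1/2"
  shows "bin_entropy p \<le> bin_entropy \<theta>"
proof (cases "\<theta> = 0")
  case False
  hence \<theta>: "0 < \<theta>" "\<theta> < 1" using assms by auto
  have "log 2 \<theta> \<le> log 2 (1 - \<theta>)" using \<theta> assms by simp
  hence "0 \<le> (\<theta> - p) * (log 2 (1 - \<theta>) - log 2 \<theta>)" using assms by (intro mult_nonneg_nonneg) auto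
  moreover have "bin_entropy p \<le> - p * log 2 \<theta> - (1 - p) * log 2 (1 - \<theta>)"
    using assms \<theta> by (intro bin_entropy_gibbs) auto
  ultimately show ?thesis by (simp add: bin_entropy_def algebra_simps)
qed (use assms in auto)

lemma dual_bound_mono_distance:
  assumes "dual_bound n D M" "D \<le> D'"
  shows "dual_bound n D' M"
proof -
  obtain K where K: "\<forall>y\<in>Pow {..<n}. \<forall>y'\<in>Pow {..<n}. D < real (card (sd y y')) \<longrightarrow> K y y' \<le> 0"
      "\<forall>y\<in>Pow {..<n}. K y y \<le> M"
      "\<forall>g. (\<Sum>y\<in>Pow {..<n}. g y)\<^sup>2 \<le> (\<Sum>y\<in>Pow {..<n}. \<Sum>y'\<in>Pow {..<n}. K y y' * g y * g y')"
    using assms(1) unfolding dual_bound_def by auto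
  have "\<forall>y\<in>Pow {..<n}. \<forall>y'\<in>Pow {..<n}. D' < real (card (sd y y')) \<longrightarrow> K y y' \<le> 0"
    using K(1) assms(2) by (meson order_le_less_trans)
  with K(2,3) show ?thesis unfolding dual_bound_def by (intro exI[of _ K]) simp
qed

section \<open>The distance function of \<open>R_LP2\<close> and the limits of the Hahn
  coefficients\<close>

definition lp2_dist :: "real \<Rightarrow> real \<Rightarrow> real" where
  "lp2_dist a b = 2 * ((a * (1 - a) - b * (1 - b)) / (1 + 2 * sqrt (b * (1 - b))))"

lemma mult_one_minus_mono:
  assumes "0 \<le> b" "b \<le> a" "a \<le> (1/2 :: real)"
  shows "b * (1 - b) \<le> a * (1 - a)"
proof -
  have "0 \<le> (a - b) * (1 - a - b)" using assms by (intro mult_nonneg_nonneg) auto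
  thus ?thesis by (simp add: algebra_simps)
qed

lemma lp2_dist_nonneg:
  assumes "0 \<le> b" "b \<le> a" "a \<le> 1/2"
  shows "0 \<le> lp2_dist a b"
  unfolding lp2_dist_def using mult_one_minus_mono[OF assms] assms by (auto intro!: divide_nonneg_nonneg add_nonneg_nonneg)

lemma lp2_dist_le:
  assumes "0 \<le> b" "b \<le> a" "a \<le> 1/2"
  shows "lp2_dist a b \<le> 1/2"
proof -
  have "a * (1 - a) \<le> 1/4" using mult_one_minus_mono[of a "1/2"] assms by simp
  moreover have b0: "0 \<le> b * (1 - b)" using assms by (intro mult_nonneg_nonneg) auto
  ultimately have "(a * (1 - a) - b * (1 - b)) / (1 + 2 * sqrt (b * (1 - b))) \<le> (1/4) / 1"
    using mult_one_minus_mono[OF assms] by (intro frac_le) auto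
  thus ?thesis unfolding lp2_dist_def by linarith
qed

text \<open>Quantifies the decrease in the second argument; the gain pays for all approximation
  errors in \<open>dual_bound_lp2_raw\<close>. The factor 2 in \<open>lp2_dist\<close> cancels the
  bound 2 for the denominator.\<close>

lemma lp2_dist_gap:
  assumes "0 \<le> b" "b \<le> c" "c \<le> a" "a \<le> 1/2"
  shows "(c - b) * (1 - b - c) \<le> lp2_dist a b - lp2_dist a c"
proof -
  define s t where "s = b * (1 - b)" and "t = c * (1 - c)"
  have st: "0 \<le> s" "s \<le> t" "t \<le> a * (1 - a)" using assms mult_one_minus_mono[of b c] mult_one_minus_mono[of c a] by (auto simp: s_def t_def)
  have t1: "sqrt t \<le> 1/2"
  proof -
    have "t \<le> 1/4" using mult_one_minus_mono[of c "1/2"] assms by (simp add: t_def)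
    hence "sqrt t \<le> sqrt (1/4)" by (rule real_sqrt_le_mono)
    also have "sqrt (1/4) = (1/2::real)" by (rule real_sqrt_unique) (auto simp: power2_eq_square)
    finally show ?thesis .
  qed
  have ss: "0 \<le> sqrt s" "sqrt s \<le> sqrt t" using st by auto
  define v where "v = 1 + 2 * sqrt t"
  have v: "0 < v" "v \<le> 2" using t1 ss unfolding v_def by linarith+
  have "(a * (1 - a) - s) / v \<le> (a * (1 - a) - s) / (1 + 2 * sqrt s)"
    using st ss v by (intro divide_left_mono) (auto simp: v_def intro!: mult_pos_pos add_pos_nonneg)
  hence "(t - s) / v \<le> (a * (1 - a) - s) / (1 + 2 * sqrt s) - (a * (1 - a) - t) / v"
    by (simp add: diff_divide_distrib)
  moreover have "(t - s) / 2 \<le> (t - s) / v" using st v by (intro divide_left_mono) auto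
  moreover have "t - s = (c - b) * (1 - b - c)" by (simp add: t_def s_def algebra_simps)
  moreover have "R \<le> P - Q \<Longrightarrow> X / 2 \<le> R \<Longrightarrow> X = Y \<Longrightarrow> Y \<le> 2 * P - 2 * Q" for P Q R X Y :: real by linarith
  ultimately have "(c - b) * (1 - b - c) \<le> 2 * ((a * (1 - a) - s) / (1 + 2 * sqrt s)) - 2 * ((a * (1 - a) - t) / v)"
    by blast
  thus ?thesis by (simp only: lp2_dist_def s_def t_def v_def)
qed

text \<open>\<open>hahn_A\<close> divided by \<open>n\<close>, in the variables \<open>s\<close> =
  1/n, \<open>y\<close> = w/n, \<open>x\<close> = l/n. It extends continuously to
  \<open>s = 0\<close>, which is the limit.\<close>

definition hahn_alpha :: "real \<Rightarrow> real \<Rightarrow> real \<Rightarrow> real" where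
  "hahn_alpha s y x = (1 + s - x) * (y - x)\<^sup>2 / ((1 + s - 2 * x) * (1 - 2 * x))"

definition hahn_gamma :: "real \<Rightarrow> real \<Rightarrow> real \<Rightarrow> real" where
  "hahn_gamma s y x = x * (1 + s - y - x)\<^sup>2 / ((1 + 2 * s - 2 * x) * (1 + s - 2 * x))"

text \<open>The origin of the constraint in \<open>R_LP2\<close>. The left side is the upper edge of
  the spectrum of a Jacobi matrix with constant coefficients, so it is the limit of the admissible
  \<open>\<tau> / n\<close>, and \<open>2 * (w - \<tau>)\<close> becomes
  \<open>n * lp2_dist a b\<close>. With p = sqrt (1 - b) and q = sqrt b the sum of the roots
  simplifies to (a + p q) / (p + q).\<close>

lemma hahn_limit_identity:
  assumes "0 \<le> b" "b \<le> a" "a \<le> 1/2" "b < 1/2"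
  shows "(sqrt (hahn_alpha 0 a b) + sqrt (hahn_gamma 0 a b))\<^sup>2 = a - lp2_dist a b / 2"
proof -
  define p q where "p = sqrt (1 - b)" and "q = sqrt b"
  have p2: "p\<^sup>2 = 1 - b" and q2: "q\<^sup>2 = b" using assms by (auto simp: p_def q_def)
  have q0: "0 \<le> q" and p0: "0 < p" using assms by (auto simp: p_def q_def)
  have pq: "q < p" using assms by (simp add: p_def q_def)
  have d: "1 - 2 * b = (p - q) * (p + q)" using p2 q2 by (simp add: algebra_simps power2_eq_square)
  have 1: "sqrt (hahn_alpha 0 a b) = p * (a - b) / (1 - 2 * b)"
  proof -
    have "hahn_alpha 0 a b = (1 - b) * (a - b)\<^sup>2 / (1 - 2 * b)\<^sup>2" by (simp add: hahn_alpha_def power2_eq_square)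
    thus ?thesis using assms by (simp add: real_sqrt_divide real_sqrt_mult p_def)
  qed
  have 2: "sqrt (hahn_gamma 0 a b) = q * (1 - a - b) / (1 - 2 * b)"
  proof -
    have "hahn_gamma 0 a b = b * (1 - a - b)\<^sup>2 / (1 - 2 * b)\<^sup>2" by (simp add: hahn_gamma_def power2_eq_square)
    thus ?thesis using assms by (simp add: real_sqrt_divide real_sqrt_mult q_def)
  qed
  have "p * (a - b) + q * (1 - a - b) = p * (a - q\<^sup>2) + q * (p\<^sup>2 - a)" unfolding p2 q2 by (simp add: algebra_simps)
  also have "\<dots> = (p - q) * (a + p * q)" by (simp add: algebra_simps power2_eq_square)
  finally have "sqrt (hahn_alpha 0 a b) + sqrt (hahn_gamma 0 a b) = ((p - q) * (a + p * q)) / ((p - q) * (p + q))"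
    unfolding 1 2 d by (simp add: add_divide_distrib[symmetric])
  also have "\<dots> = (a + p * q) / (p + q)" using pq by simp
  finally have L: "(sqrt (hahn_alpha 0 a b) + sqrt (hahn_gamma 0 a b))\<^sup>2 = (a + p * q)\<^sup>2 / (p + q)\<^sup>2"
    by (simp add: power_divide)
  define s where "s = p * q"
  have s: "sqrt (b * (1 - b)) = s" by (simp add: s_def p_def q_def real_sqrt_mult mult.commute)
  have s2: "s\<^sup>2 = b * (1 - b)" using p2 q2 by (simp add: s_def power_mult_distrib mult.commute)
  have "0 \<le> s" using p0 q0 by (simp add: s_def)
  have e: "(p + q)\<^sup>2 = 1 + 2 * s" using p2 q2 by (simp add: s_def power2_sum)
  have "a - lp2_dist a b / 2 = (a * (1 + 2 * s) - (a * (1 - a) - s\<^sup>2)) / (1 + 2 * s)"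
    using \<open>0 \<le> s\<close> unfolding lp2_dist_def s s2 by (simp add: field_simps)
  also have "a * (1 + 2 * s) - (a * (1 - a) - s\<^sup>2) = (a + s)\<^sup>2" by (simp add: power2_eq_square algebra_simps)
  finally show ?thesis unfolding L e by (simp add: s_def)
qed

lemma uniform_modulus:
  fixes F :: "real \<Rightarrow> real \<Rightarrow> real \<Rightarrow> real"
  assumes "compact S" "compact Y" "compact X" "continuous_on (S \<times> Y \<times> X) (\<lambda>(s, y, x). F s y x)" "0 < e"
  obtains d where "0 < d" "\<And>s y x s' y' x'. s \<in> S \<Longrightarrow> s' \<in> S \<Longrightarrow> y \<in> Y \<Longrightarrow> y' \<in> Y \<Longrightarrow> x \<in> X \<Longrightarrow> x' \<in> X \<Longrightarrow>
    \<bar>s - s'\<bar> < d \<Longrightarrow> \<bar>y - y'\<bar> < d \<Longrightarrow> \<bar>x - x'\<bar> < d \<Longrightarrow> \<bar>F s y x - F s' y' x'\<bar> < e"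
proof -
  have "uniformly_continuous_on (S \<times> Y \<times> X) (\<lambda>(s, y, x). F s y x)"
    using assms by (intro compact_uniformly_continuous compact_Times)
  then obtain d where d: "0 < d" "\<And>p q. p \<in> S \<times> Y \<times> X \<Longrightarrow> q \<in> S \<times> Y \<times> X \<Longrightarrow> dist q p < d \<Longrightarrow>
      dist (case q of (s, y, x) \<Rightarrow> F s y x) (case p of (s, y, x) \<Rightarrow> F s y x) < e"
    unfolding uniformly_continuous_on_def using \<open>0 < e\<close> by metis
  show ?thesis
  proof (rule that[of "d / 3"])
    show "0 < d / 3" using d by simp
    fix s y x s' y' x'
    assume m: "s \<in> S" "s' \<in> S" "y \<in> Y" "y' \<in> Y" "x \<in> X" "x' \<in> X"
      and c: "\<bar>s - s'\<bar> < d / 3" "\<bar>y - y'\<bar> < d / 3" "\<bar>x - x'\<bar> < d / 3"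
    have "dist (s, y, x) (s', y', x') \<le> \<bar>dist s s'\<bar> + \<bar>dist (y, x) (y', x')\<bar>"
      unfolding dist_Pair_Pair[of s] by (rule sqrt_sum_squares_le_sum_abs)
    also have "\<bar>dist (y, x) (y', x')\<bar> \<le> \<bar>dist y y'\<bar> + \<bar>dist x x'\<bar>"
      unfolding dist_Pair_Pair abs_of_nonneg[OF real_sqrt_ge_zero[OF sum_power2_ge_zero]] by (rule sqrt_sum_squares_le_sum_abs)
    finally have "dist (s, y, x) (s', y', x') < d" using c by (simp add: dist_real_def)
    thus "\<bar>F s y x - F s' y' x'\<bar> < e" using d(2)[of "(s', y', x')" "(s, y, x)"] m by (simp add: dist_real_def)
  qed
qed

text \<open>Also covers the case that \<open>u0 - \<epsilon>\<close> or
  \<open>v0 - \<epsilon>\<close> is negative; the left side is then nonpositive.\<close>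

lemma mult_lower:
  fixes u v u0 v0 \<epsilon> :: real
  assumes "0 \<le> u" "0 \<le> v" "0 \<le> u0" "0 \<le> v0" "0 \<le> \<epsilon>" "u0 - \<epsilon> \<le> u" "v0 - \<epsilon> \<le> v"
  shows "u0 * v0 - \<epsilon> * (u0 + v0) \<le> u * v"
proof (cases "\<epsilon> \<le> u0 \<and> \<epsilon> \<le> v0")
  case True
  hence "(u0 - \<epsilon>) * (v0 - \<epsilon>) \<le> u * v" using assms by (intro mult_mono) auto
  moreover have "(u0 - \<epsilon>) * (v0 - \<epsilon>) = u0 * v0 - \<epsilon> * (u0 + v0) + \<epsilon> * \<epsilon>" by (simp add: algebra_simps)
  moreover have "0 \<le> \<epsilon> * \<epsilon>" by simp
  ultimately show ?thesis by linarith
next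
  case False
  have neg: "x * y - \<epsilon> * (x + y) \<le> 0" if "x < \<epsilon>" "0 \<le> x" "0 \<le> y" for x y
  proof -
    have "x * y \<le> \<epsilon> * y" using that by (intro mult_right_mono) auto
    also have "\<dots> \<le> \<epsilon> * (x + y)" using that assms by (intro mult_left_mono) auto
    finally show ?thesis by simp
  qed
  have "u0 * v0 - \<epsilon> * (u0 + v0) \<le> 0"
    using False neg[of u0 v0] neg[of v0 u0] assms by (auto simp: mult.commute add.commute not_le)
  also have "0 \<le> u * v" using assms by simp
  finally show ?thesis .
qed

lemma continuous_on_hahn_alpha:
  assumes "c < 1/2"
  shows "continuous_on ({0..1} \<times> {0..1/2} \<times> {0..c}) (\<lambda>(s, y, x). sqrt (hahn_alpha s y x))"
  unfolding hahn_alpha_def case_prod_unfold using assms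
  by (intro continuous_intros ballI) auto

lemma continuous_on_hahn_gamma:
  assumes "c < 1/2"
  shows "continuous_on ({0..1} \<times> {0..1/2} \<times> {0..c}) (\<lambda>(s, y, x). sqrt (hahn_gamma s y x))"
  unfolding hahn_gamma_def case_prod_unfold using assms
  by (intro continuous_intros ballI) auto

lemma hahn_A_scaled:
  assumes "2 * w < n"
  shows "hahn_A n w l = real n * hahn_alpha (1 / real n) (real w / real n) (real l / real n)"
proof -
  define N where "N = real n"
  have N: "0 < N" using assms by (simp add: N_def)
  have e: "1 + 1 / N - real l / N = (N + 1 - real l) / N" "real w / N - real l / N = (real w - real l) / N"
      "1 + 1 / N - 2 * (real l / N) = (N + 1 - 2 * real l) / N" "1 - 2 * (real l / N) = (N - 2 * real l) / N"
    using N by (auto simp: field_simps)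
  show ?thesis unfolding hahn_A_def[OF assms] hahn_alpha_def N_def[symmetric] e
    using N by (simp add: power_divide power2_eq_square)
qed

lemma hahn_C_scaled:
  assumes "2 * w < n"
  shows "hahn_C n w l = real n * hahn_gamma (1 / real n) (real w / real n) (real l / real n)"
proof -
  define N where "N = real n"
  have N: "0 < N" using assms by (simp add: N_def)
  have e: "1 + 1 / N - real w / N - real l / N = (N + 1 - real w - real l) / N"
      "1 + 1 / N - 2 * (real l / N) = (N + 1 - 2 * real l) / N"
      "1 + 2 * (1 / N) - 2 * (real l / N) = (N + 2 - 2 * real l) / N"
    using N by (auto simp: field_simps)
  show ?thesis unfolding hahn_C_def[OF assms] hahn_gamma_def N_def[symmetric] e
    using N by (simp add: power_divide power2_eq_square)
qed

text \<open>On a short window the Jacobi matrix of the Hahn polynomials is nearly constant, and sines are the positive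
  eigenvector of the constant one.\<close>

lemma dual_bound_window:
  fixes n w m L :: nat and \<tau> D uA uC :: real
  assumes wn: "2 * w < n" and mw: "m < w" and L: "1 \<le> L" "L \<le> m"
    and \<tau>: "\<tau> \<le> real w" "2 * (real w - \<tau>) \<le> D"
    and u: "0 \<le> uA" "0 \<le> uC"
    and uA: "\<And>l. m - L \<le> l \<Longrightarrow> l \<le> m \<Longrightarrow> uA \<le> sqrt (hahn_A n w l)"
    and uC: "\<And>l. m - L \<le> l \<Longrightarrow> l \<le> m + 1 \<Longrightarrow> uC \<le> sqrt (hahn_C n w l)"
    and key: "\<tau> + 1 \<le> uA\<^sup>2 + uC\<^sup>2 + 2 * cos (pi / (real L + 1)) * (uA * uC)"
  shows "dual_bound n D (2 ^ n / real (n choose w) * (real w - \<tau>) * (\<Sum>l\<le>m. real (n choose l)))"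
proof -
  define \<theta> where "\<theta> = pi / (real L + 1)"
  have \<theta>: "0 < \<theta>" "\<theta> * (real L + 1) = pi" using pi_gt_zero by (auto simp: \<theta>_def)
  \<comment> \<open>The sine vanishes at both ends \<open>m - L\<close> and \<open>m + 1\<close>, so
    the eigenvector relation holds inside the window without boundary terms.\<close>
  define \<phi> where "\<phi> l = (if m - L \<le> l \<and> l \<le> m + 1 then sin (\<theta> * (real l - real (m - L))) else 0)" for l
  have \<phi>0: "0 \<le> \<phi> l" for l
  proof (cases "m - L \<le> l \<and> l \<le> m + 1")
    case True
    have "real l - real (m - L) \<le> real L + 1" using True L by (simp add: of_nat_diff)
    hence "\<theta> * (real l - real (m - L)) \<le> \<theta> * (real L + 1)" using \<theta> by (intro mult_left_mono) auto
    hence "0 \<le> sin (\<theta> * (real l - real (m - L)))" using \<theta> True by (intro sin_ge_zero) auto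
    thus ?thesis using True by (simp add: \<phi>_def)
  qed (auto simp: \<phi>_def)
  have \<phi>m: "\<phi> (m + 1) = 0"
  proof -
    have "real (m + 1) - real (m - L) = real L + 1" using L by (simp add: of_nat_diff)
    thus ?thesis using \<theta>(2) unfolding \<phi>_def by (simp only:) simp
  qed
  have \<phi>out: "\<phi> l = 0" if "m < l" for l using that \<phi>m by (cases "l = m + 1") (auto simp: \<phi>_def)
  have A0: "0 \<le> hahn_A n w l" if "l \<le> m" for l using hahn_A_pos[OF wn, of l] that mw by simp
  have C0: "0 \<le> hahn_C n w l" if "l \<le> m + 1" for l
    using hahn_C_pos[OF wn, of l] hahn_C_0[OF wn] that mw by (cases "l = 0") auto
  have pos: "\<exists>l\<le>m. 0 < \<phi> l"
  proof (intro exI[of _ "m - L + 1"] conjI)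
    show "m - L + 1 \<le> m" using L by simp
    have "\<theta> * 2 \<le> pi" using \<theta> L mult_left_mono[of 2 "real L + 1" \<theta>] by simp
    hence "0 < sin \<theta>" using \<theta> pi_gt_zero by (intro sin_gt_zero) auto
    thus "0 < \<phi> (m - L + 1)" using L by (simp add: \<phi>_def)
  qed
  have sub: "1 * \<phi> l \<le> (if l = 0 then 0 else sqrt (hahn_A n w (l - 1) * hahn_C n w l) * \<phi> (l - 1)) +
      (hahn_A n w l + hahn_C n w l - \<tau>) * \<phi> l + sqrt (hahn_A n w l * hahn_C n w (l + 1)) * \<phi> (l + 1)"
    if lm: "l \<le> m" for l
  proof (cases "m - L < l")
    case True
    define x where "x = \<theta> * (real l - real (m - L))"
    have xs: "\<phi> l = sin x" "\<phi> (l - 1) = sin (x - \<theta>)" "\<phi> (l + 1) = sin (x + \<theta>)"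
      using True lm by (auto simp: \<phi>_def x_def algebra_simps of_nat_diff)
    have tri: "\<phi> (l - 1) + \<phi> (l + 1) = 2 * cos \<theta> * \<phi> l" unfolding xs by (simp add: sin_add sin_diff)
    have J1: "uA * uC \<le> sqrt (hahn_A n w (l - 1) * hahn_C n w l)" unfolding real_sqrt_mult
      using True lm u A0[of "l - 1"] by (intro mult_mono uA uC) auto
    have J2: "uA * uC \<le> sqrt (hahn_A n w l * hahn_C n w (l + 1))" unfolding real_sqrt_mult
      using True lm u A0[of l] by (intro mult_mono uA uC) auto
    have A1: "uA\<^sup>2 \<le> hahn_A n w l" using uA[of l] True lm u A0[of l] by (simp add: real_le_rsqrt sqrt_ge_absD)
    have C1: "uC\<^sup>2 \<le> hahn_C n w l" using uC[of l] True lm u C0[of l] by (simp add: real_le_rsqrt sqrt_ge_absD)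
    \<comment> \<open>The surplus of 1 over \<open>\<tau>\<close> in \<open>key\<close> plays the
      role of \<open>\<kappa>\<close>.\<close>
    have "1 * \<phi> l \<le> (uA\<^sup>2 + uC\<^sup>2 + 2 * cos \<theta> * (uA * uC) - \<tau>) * \<phi> l"
      using key \<phi>0[of l] by (intro mult_right_mono) (auto simp: \<theta>_def)
    also have "\<dots> = uA * uC * (2 * cos \<theta> * \<phi> l) + (uA\<^sup>2 + uC\<^sup>2 - \<tau>) * \<phi> l" by (simp add: algebra_simps)
    also have "\<dots> = uA * uC * \<phi> (l - 1) + (uA\<^sup>2 + uC\<^sup>2 - \<tau>) * \<phi> l + uA * uC * \<phi> (l + 1)"
      unfolding tri[symmetric] by (simp add: algebra_simps)
    also have "\<dots> \<le> sqrt (hahn_A n w (l - 1) * hahn_C n w l) * \<phi> (l - 1) +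
      (hahn_A n w l + hahn_C n w l - \<tau>) * \<phi> l + sqrt (hahn_A n w l * hahn_C n w (l + 1)) * \<phi> (l + 1)"
      using J1 J2 A1 C1 \<phi>0 by (intro add_mono mult_right_mono) auto
    finally show ?thesis using True by simp
  next
    case False
    hence "\<phi> l = 0" by (auto simp: \<phi>_def)
    moreover have "0 \<le> sqrt (hahn_A n w l * hahn_C n w (l + 1)) * \<phi> (l + 1)"
      using A0[of l] C0[of "l + 1"] lm \<phi>0 by (intro mult_nonneg_nonneg) auto
    moreover have "0 \<le> sqrt (hahn_A n w (l - 1) * hahn_C n w l) * \<phi> (l - 1)"
      using A0[of "l - 1"] C0[of l] lm \<phi>0 by (intro mult_nonneg_nonneg) auto
    ultimately show ?thesis by simp
  qed
  show ?thesis
    using dual_bound_johnson[OF wn mw \<phi>0 \<phi>out pos _ \<tau> sub] by simp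
qed


lemma hahn_alpha_nonneg: "0 \<le> s \<Longrightarrow> x < 1/2 \<Longrightarrow> 0 \<le> hahn_alpha s y x"
  unfolding hahn_alpha_def by (intro divide_nonneg_nonneg mult_nonneg_nonneg) auto

lemma hahn_gamma_nonneg: "0 \<le> s \<Longrightarrow> 0 \<le> x \<Longrightarrow> x < 1/2 \<Longrightarrow> 0 \<le> hahn_gamma s y x"
  unfolding hahn_gamma_def by (intro divide_nonneg_nonneg mult_nonneg_nonneg) auto

lemma hahn_limit_bounds:
  assumes "0 < \<eta>" "\<eta> \<le> 1" "0 \<le> a" "a \<le> 1/2" "0 \<le> b" "2 * b + \<eta> \<le> 1"
  shows "sqrt (hahn_alpha 0 a b) \<le> 1 / \<eta>" "sqrt (hahn_gamma 0 a b) \<le> 1 / \<eta>"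
proof -
  have d: "\<eta> * \<eta> \<le> (1 - 2 * b) * (1 - 2 * b)" using assms by (intro mult_mono) auto
  have "\<bar>a - b\<bar> \<le> 1" "\<bar>1 - a - b\<bar> \<le> 1" using assms by auto
  hence s: "(a - b)\<^sup>2 \<le> 1" "(1 - a - b)\<^sup>2 \<le> 1" by (simp_all add: abs_square_le_1)
  have e: "0 < \<eta> * \<eta>" using assms by simp
  have "(1 - b) * (a - b)\<^sup>2 \<le> 1 * 1" using assms s by (intro mult_mono) auto
  hence "hahn_alpha 0 a b \<le> 1 / (\<eta> * \<eta>)" unfolding hahn_alpha_def using assms d e by (intro frac_le) auto
  thus "sqrt (hahn_alpha 0 a b) \<le> 1 / \<eta>" using assms by (intro real_le_lsqrt) (auto simp: power2_eq_square)
  have "b * (1 - a - b)\<^sup>2 \<le> 1 * 1" using assms s by (intro mult_mono) auto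
  hence "hahn_gamma 0 a b \<le> 1 / (\<eta> * \<eta>)" unfolding hahn_gamma_def using assms d e by (intro frac_le) auto
  thus "sqrt (hahn_gamma 0 a b) \<le> 1 / \<eta>" using assms by (intro real_le_lsqrt) (auto simp: power2_eq_square)
qed

text \<open>\<open>p\<close> and \<open>q\<close> stand for the limits of the square roots of
  \<open>hahn_A / n\<close> and \<open>hahn_C / n\<close>, \<open>\<epsilon>\<close> for the error
  of approximation and \<open>c\<close> for the cosine. The left side is the limiting spectral edge
  less the losses from \<open>\<epsilon>\<close> and from \<open>c < 1\<close>.\<close>

lemma window_key:
  fixes n :: nat and p q \<epsilon> c B :: real
  assumes p: "0 \<le> p" "p \<le> B" and q: "0 \<le> q" "q \<le> B" and \<epsilon>: "0 \<le> \<epsilon>" and c: "0 \<le> c" "c \<le> 1"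
  defines "uA \<equiv> sqrt (real n) * max 0 (p - \<epsilon>)" and "uC \<equiv> sqrt (real n) * max 0 (q - \<epsilon>)"
  shows "real n * ((p + q)\<^sup>2 - 8 * \<epsilon> * B - 2 * (1 - c) * B\<^sup>2) \<le> uA\<^sup>2 + uC\<^sup>2 + 2 * c * (uA * uC)"
proof -
  define x y where "x = max 0 (p - \<epsilon>)" and "y = max 0 (q - \<epsilon>)"
  have xy: "0 \<le> x" "0 \<le> y" "p - \<epsilon> \<le> x" "q - \<epsilon> \<le> y" by (auto simp: x_def y_def)
  have "p * p - \<epsilon> * (p + p) \<le> x * x" "q * q - \<epsilon> * (q + q) \<le> y * y" "p * q - \<epsilon> * (p + q) \<le> x * y"
    by (rule mult_lower; use xy p q \<epsilon> in simp)+
  moreover have "\<epsilon> * (p + p) \<le> \<epsilon> * (2 * B)" "\<epsilon> * (q + q) \<le> \<epsilon> * (2 * B)" "\<epsilon> * (p + q) \<le> \<epsilon> * (2 * B)"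
    by (rule mult_left_mono; use p q \<epsilon> in simp)+
  ultimately have 1: "p * p - \<epsilon> * (2 * B) \<le> x * x" "q * q - \<epsilon> * (2 * B) \<le> y * y" and 2: "p * q - \<epsilon> * (2 * B) \<le> x * y"
    by linarith+
  have 3: "c * (p * q - \<epsilon> * (2 * B)) \<le> c * (x * y)" using 2 c by (intro mult_left_mono) auto
  have B: "0 \<le> \<epsilon> * (2 * B)" using \<epsilon> p by auto
  have 4: "c * (\<epsilon> * (2 * B)) \<le> 1 * (\<epsilon> * (2 * B))" using c B by (intro mult_right_mono) auto
  have 5: "(1 - c) * (p * q) \<le> (1 - c) * B\<^sup>2" unfolding power2_eq_square using c p q by (intro mult_left_mono mult_mono) auto
  have "(p + q)\<^sup>2 - 8 * \<epsilon> * B - 2 * (1 - c) * B\<^sup>2 \<le> x * x + y * y + 2 * c * (x * y)"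
  proof -
    have "(p + q)\<^sup>2 = p * p + q * q + 2 * (c * (p * q)) + 2 * ((1 - c) * (p * q))" by (simp add: power2_eq_square algebra_simps)
    moreover have "c * (p * q - \<epsilon> * (2 * B)) = c * (p * q) - c * (\<epsilon> * (2 * B))" by (simp add: algebra_simps)
    moreover have "8 * \<epsilon> * B = 4 * (\<epsilon> * (2 * B))" "2 * (1 - c) * B\<^sup>2 = 2 * ((1 - c) * B\<^sup>2)" "2 * c * (x * y) = 2 * (c * (x * y))" by simp_all
    ultimately show ?thesis using 1 3 4 5 by linarith
  qed
  hence "real n * ((p + q)\<^sup>2 - 8 * \<epsilon> * B - 2 * (1 - c) * B\<^sup>2) \<le> real n * (x * x + y * y + 2 * c * (x * y))"
    by (rule mult_left_mono) simp
  also have "\<dots> = uA\<^sup>2 + uC\<^sup>2 + 2 * c * (uA * uC)"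
  proof -
    have "sqrt (real n) * u * (sqrt (real n) * v) = (sqrt (real n) * sqrt (real n)) * (u * v)" for u v by (simp only: mult_ac)
    hence "sqrt (real n) * u * (sqrt (real n) * v) = real n * (u * v)" for u v by simp
    hence "uA * uA = real n * (x * x)" "uC * uC = real n * (y * y)" "uA * uC = real n * (x * y)"
      unfolding uA_def uC_def x_def y_def by blast+
    thus ?thesis unfolding power2_eq_square by (simp add: distrib_left)
  qed
  finally show ?thesis .
qed

text \<open>Strictly below, so that \<open>a \<le> 1/2\<close> gives
  \<open>2 * w < n\<close>.\<close>

lemma nat_below:
  assumes "0 < (x::real)"
  obtains w :: nat where "x - 1 \<le> real w" "real w < x"
proof (rule that[of "nat (\<lceil>x\<rceil> - 1)"])
  have "0 \<le> \<lceil>x\<rceil> - 1" using assms by simp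
  hence "real (nat (\<lceil>x\<rceil> - 1)) = of_int \<lceil>x\<rceil> - 1" by simp
  thus "x - 1 \<le> real (nat (\<lceil>x\<rceil> - 1))" "real (nat (\<lceil>x\<rceil> - 1)) < x" by linarith+
qed

lemma nat_floor:
  assumes "0 \<le> (x::real)"
  obtains m :: nat where "x - 1 < real m" "real m \<le> x"
proof (rule that[of "nat \<lfloor>x\<rfloor>"])
  have "real (nat \<lfloor>x\<rfloor>) = of_int \<lfloor>x\<rfloor>" using assms by simp
  thus "x - 1 < real (nat \<lfloor>x\<rfloor>)" "real (nat \<lfloor>x\<rfloor>) \<le> x" by linarith+
qed

text \<open>The window of degrees sits at c = b + \<eta>/2 instead of \<open>b\<close>, which lowers
  \<open>lp2_dist\<close> by at least \<eta>^2/2. Half of this gain is spent: \<eta>^2/16 on the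
  surplus 1 in \<open>key\<close>, \<eta>^2/8 on the approximation of the coefficients and
  \<eta>^2/16 on the finite length \<open>L\<close> of the window.\<close>

lemma dual_bound_lp2_raw:
  assumes \<eta>: "0 < \<eta>" "\<eta> \<le> 1/2"
  shows "eventually (\<lambda>n. \<forall>a b. 0 \<le> b \<longrightarrow> b + \<eta> \<le> a \<longrightarrow> a \<le> 1/2 \<longrightarrow>
    (\<exists>w m. 2 * w < n \<and> m < w \<and> a * real n - 1 \<le> real w \<and> real w < a * real n \<and> real m \<le> (b + \<eta> / 2) * real n \<and>
      dual_bound n (real n * lp2_dist a b)
        (2 ^ n / real (n choose w) * (real n * lp2_dist a b / 2) * (\<Sum>l\<le>m. real (n choose l))))) sequentially"
proof -
  define B where "B = 1 / \<eta>"
  \<comment> \<open>Makes \<open>8 * \<epsilon> * B\<close> equal to \<eta>^2/8.\<close>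
  define \<epsilon> where "\<epsilon> = \<eta> ^ 3 / 64"
  have \<epsilon>: "0 < \<epsilon>" using \<eta> by (simp add: \<epsilon>_def)
  \<comment> \<open>Keeps the window away from 1/2, where the coefficients are singular:
    \<open>c\<close> is at most 1/2 - \<eta>/2, and rounding adds at most \<eta>/4.\<close>
  define cc where "cc = 1/2 - \<eta> / 4"
  have cc: "cc < 1/2" using \<eta> by (simp add: cc_def)
  obtain d1 where d1: "0 < d1" "\<And>s y x s' y' x'. s \<in> {0..1} \<Longrightarrow> s' \<in> {0..1} \<Longrightarrow> y \<in> {0..1/2} \<Longrightarrow> y' \<in> {0..1/2} \<Longrightarrow> x \<in> {0..cc} \<Longrightarrow> x' \<in> {0..cc} \<Longrightarrow>
    \<bar>s - s'\<bar> < d1 \<Longrightarrow> \<bar>y - y'\<bar> < d1 \<Longrightarrow> \<bar>x - x'\<bar> < d1 \<Longrightarrow> \<bar>sqrt (hahn_alpha s y x) - sqrt (hahn_alpha s' y' x')\<bar> < \<epsilon>"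
    using uniform_modulus[OF compact_Icc compact_Icc compact_Icc continuous_on_hahn_alpha[OF cc] \<epsilon>] by blast
  obtain d2 where d2: "0 < d2" "\<And>s y x s' y' x'. s \<in> {0..1} \<Longrightarrow> s' \<in> {0..1} \<Longrightarrow> y \<in> {0..1/2} \<Longrightarrow> y' \<in> {0..1/2} \<Longrightarrow> x \<in> {0..cc} \<Longrightarrow> x' \<in> {0..cc} \<Longrightarrow>
    \<bar>s - s'\<bar> < d2 \<Longrightarrow> \<bar>y - y'\<bar> < d2 \<Longrightarrow> \<bar>x - x'\<bar> < d2 \<Longrightarrow> \<bar>sqrt (hahn_gamma s y x) - sqrt (hahn_gamma s' y' x')\<bar> < \<epsilon>"
    using uniform_modulus[OF compact_Icc compact_Icc compact_Icc continuous_on_hahn_gamma[OF cc] \<epsilon>] by blast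
  define d where "d = min d1 d2"
  have d: "0 < d" "d \<le> d1" "d \<le> d2" using d1(1) d2(1) by (auto simp: d_def)
  have "eventually (\<lambda>L::nat. 2 * (1 - cos (pi / (real L + 1))) * B\<^sup>2 \<le> \<eta>\<^sup>2 / 16) sequentially"
  proof -
    have "(\<lambda>L::nat. 2 * (1 - cos (pi / (real L + 1))) * B\<^sup>2) \<longlonglongrightarrow> 2 * (1 - cos 0) * B\<^sup>2"
      by (intro tendsto_intros) real_asymp
    hence "(\<lambda>L::nat. 2 * (1 - cos (pi / (real L + 1))) * B\<^sup>2) \<longlonglongrightarrow> 0" by simp
    hence "eventually (\<lambda>L::nat. 2 * (1 - cos (pi / (real L + 1))) * B\<^sup>2 < \<eta>\<^sup>2 / 16) sequentially"
      by (rule order_tendstoD) (use \<eta> in simp)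
    thus ?thesis by eventually_elim simp
  qed
  moreover have "eventually (\<lambda>L::nat. 1 \<le> L) sequentially" by (rule eventually_ge_at_top)
  ultimately obtain L :: nat where L: "2 * (1 - cos (pi / (real L + 1))) * B\<^sup>2 \<le> \<eta>\<^sup>2 / 16" "1 \<le> L"
    using eventually_happens[OF eventually_conj] by (metis (no_types, lifting) sequentially_bot)
  have ev: "eventually (\<lambda>n. (real L + 1) / real n < d) sequentially" "eventually (\<lambda>n. 1 / real n \<le> \<eta>\<^sup>2 / 16) sequentially"
    "eventually (\<lambda>n. real L + 2 \<le> \<eta> * real n / 2) sequentially" "eventually (\<lambda>n. 0 < n) sequentially"
    using d \<eta> by real_asymp+
  from ev show ?thesis
  proof eventually_elim
    case (elim n)
    show ?case
    proof (intro allI impI)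
      fix a b assume ab: "0 \<le> b" "b + \<eta> \<le> a" "a \<le> 1/2"
      define N where "N = real n"
      have N: "0 < N" "1 \<le> N" using elim by (auto simp: N_def)
      have N1: "(real L + 1) / N < d" "1 / N \<le> \<eta>\<^sup>2 / 16" "real L + 2 \<le> \<eta> * N / 2" using elim by (auto simp: N_def)
      have sm: "1 / N < d"
      proof -
        have "1 / N \<le> (real L + 1) / N" using N by (intro divide_right_mono) auto
        thus ?thesis using N1 by simp
      qed
      have \<eta>4: "\<eta>\<^sup>2 / 16 \<le> \<eta> / 4" using \<eta> by (simp add: power2_eq_square)
      obtain w where w: "a * N - 1 \<le> real w" "real w < a * N" using nat_below[of "a * N"] ab \<eta> N by auto
      define c where "c = b + \<eta> / 2"
      have c: "0 \<le> c" "c + \<eta> / 2 \<le> a" "c + \<eta> / 2 \<le> 1/2" "c < 1/2" "c \<le> a" using ab \<eta> by (auto simp: c_def)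
      obtain m where m: "c * N - 1 < real m" "real m \<le> c * N" using nat_floor[of "c * N"] c N by auto
      have aN: "a * N \<le> N / 2" using mult_right_mono[of a "1/2" N] ab N by simp
      have w2: "2 * real w < N" using aN w by linarith
      hence wn: "2 * w < n" by (simp add: N_def)
      have cN: "c * N + \<eta> * N / 2 \<le> a * N" using mult_right_mono[OF c(2), of N] N by (simp add: algebra_simps)
      have "real m < real w" using cN w m N1 by linarith
      hence mw: "m < w" by simp
      have "\<eta> * N / 2 \<le> c * N" using ab N by (simp add: c_def algebra_simps)
      hence "real L \<le> real m" using m N1 by linarith
      hence Lm: "L \<le> m" by simp
      define p q where "p = sqrt (hahn_alpha 0 a c)" and "q = sqrt (hahn_gamma 0 a c)"
      have pq: "0 \<le> p" "0 \<le> q" using c by (auto simp: p_def q_def intro!: hahn_alpha_nonneg hahn_gamma_nonneg)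
      have pqB: "p \<le> B" "q \<le> B" unfolding p_def q_def B_def using hahn_limit_bounds[of \<eta> a c] \<eta> ab c by auto
      define uA where "uA = sqrt (real n) * max 0 (p - \<epsilon>)"
      define uC where "uC = sqrt (real n) * max 0 (q - \<epsilon>)"
      define \<tau> where "\<tau> = real w - real n * lp2_dist a b / 2"
      have lp0: "0 \<le> lp2_dist a b" using ab \<eta> by (intro lp2_dist_nonneg) auto
      have sI: "1 / N \<in> {0..1}" "(0::real) \<in> {0..1}" using N by auto
      have yI: "real w / N \<in> {0..1/2}" "a \<in> {0..1/2}" using w2 N ab \<eta> by (auto simp: field_simps)
      have ydist: "\<bar>real w / N - a\<bar> < d"
      proof -
        have "\<bar>real w / N - a\<bar> = \<bar>real w - a * N\<bar> / N" using N by (simp add: field_simps abs_divide)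
        also have "\<dots> \<le> 1 / N" using w N by (intro divide_right_mono) auto
        finally show ?thesis using sm by simp
      qed
      have xI: "real l / N \<in> {0..cc}" and xdist: "\<bar>real l / N - c\<bar> < d" if l: "m - L \<le> l" "l \<le> m + 1" for l
      proof -
        have l': "real m - real L \<le> real l" "real l \<le> real m + 1" using l by linarith+
        have "real l \<le> c * N + 1" using l' m by linarith
        hence "real l / N \<le> (c * N + 1) / N" using N by (intro divide_right_mono) auto
        also have "\<dots> = c + 1 / N" using N by (simp add: field_simps)
        also have "\<dots> \<le> cc" using c N1 \<eta>4 by (simp add: cc_def)
        finally show "real l / N \<in> {0..cc}" using N by simp
        have "\<bar>real l / N - c\<bar> = \<bar>real l - c * N\<bar> / N" using N by (simp add: field_simps abs_divide)
        also have "\<dots> \<le> (real L + 1) / N" using l' m N by (intro divide_right_mono) auto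
        finally show "\<bar>real l / N - c\<bar> < d" using N1 by simp
      qed
      have cI: "c \<in> {0..cc}" using c \<eta> by (simp add: cc_def)
      have uA: "uA \<le> sqrt (hahn_A n w l)" if l: "m - L \<le> l" "l \<le> m" for l
      proof -
        have l1: "l \<le> m + 1" using l by simp
        have "\<bar>sqrt (hahn_alpha (1 / N) (real w / N) (real l / N)) - p\<bar> < \<epsilon>"
          unfolding p_def using sI yI xI[OF l(1) l1] cI ydist xdist[OF l(1) l1] sm d N by (intro d1(2)) auto
        moreover have "0 \<le> hahn_alpha (1 / N) (real w / N) (real l / N)"
        proof (rule hahn_alpha_nonneg)
          show "real l / N < 1/2" using xI[OF l(1) l1] cc unfolding atLeastAtMost_iff by linarith
        qed (use N in simp)
        ultimately have "max 0 (p - \<epsilon>) \<le> sqrt (hahn_alpha (1 / N) (real w / N) (real l / N))" by auto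
        thus ?thesis unfolding uA_def hahn_A_scaled[OF wn] real_sqrt_mult N_def by (intro mult_left_mono) auto
      qed
      have uC: "uC \<le> sqrt (hahn_C n w l)" if l: "m - L \<le> l" "l \<le> m + 1" for l
      proof -
        have "\<bar>sqrt (hahn_gamma (1 / N) (real w / N) (real l / N)) - q\<bar> < \<epsilon>"
          unfolding q_def using sI yI xI[OF l] cI ydist xdist[OF l] sm d N by (intro d2(2)) auto
        moreover have "0 \<le> hahn_gamma (1 / N) (real w / N) (real l / N)"
        proof (rule hahn_gamma_nonneg)
          show "real l / N < 1/2" using xI[OF l] cc unfolding atLeastAtMost_iff by linarith
        qed (use N in simp_all)
        ultimately have "max 0 (q - \<epsilon>) \<le> sqrt (hahn_gamma (1 / N) (real w / N) (real l / N))" by auto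
        thus ?thesis unfolding uC_def hahn_C_scaled[OF wn] real_sqrt_mult N_def by (intro mult_left_mono) auto
      qed
      define C where "C = cos (pi / (real L + 1))"
      have C: "0 \<le> C" "C \<le> 1"
      proof -
        have "pi / (real L + 1) \<le> pi / 2" using L(2) by (intro divide_left_mono) auto
        moreover have "0 \<le> pi / (real L + 1)" by simp
        ultimately show "0 \<le> C" unfolding C_def by (intro cos_ge_zero) (auto intro: order_trans[of _ 0])
      qed (simp add: C_def)
      have eB: "8 * \<epsilon> * B = \<eta>\<^sup>2 / 8" using \<eta> by (simp add: \<epsilon>_def B_def power2_eq_square power3_eq_cube)
      have gap: "\<eta>\<^sup>2 / 2 \<le> lp2_dist a b - lp2_dist a c"
      proof -
        have "\<eta>\<^sup>2 / 2 = (\<eta> / 2) * \<eta>" by (simp add: power2_eq_square)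
        also have "\<dots> \<le> (c - b) * (1 - b - c)" using ab c \<eta> by (intro mult_mono) (auto simp: c_def)
        also have "\<dots> \<le> lp2_dist a b - lp2_dist a c" using ab c \<eta> by (intro lp2_dist_gap) (auto simp: c_def)
        finally show ?thesis .
      qed
      have id: "(p + q)\<^sup>2 = a - lp2_dist a c / 2" unfolding p_def q_def using ab c by (intro hahn_limit_identity) auto
      have "\<tau> + 1 \<le> N * (a - lp2_dist a b / 2) + N * (\<eta>\<^sup>2 / 16)"
      proof -
        have "1 \<le> N * (\<eta>\<^sup>2 / 16)" using N1(2) N by (simp add: divide_le_eq mult.commute)
        thus ?thesis using w by (simp add: \<tau>_def N_def algebra_simps)
      qed
      also have "\<dots> = N * (a - lp2_dist a b / 2 + \<eta>\<^sup>2 / 16)" by (simp add: algebra_simps)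
      also have "\<dots> \<le> N * ((p + q)\<^sup>2 - 8 * \<epsilon> * B - 2 * (1 - C) * B\<^sup>2)"
        unfolding id eB using gap L(1) N by (intro mult_left_mono) (auto simp: C_def)
      also have "\<dots> \<le> uA\<^sup>2 + uC\<^sup>2 + 2 * C * (uA * uC)"
        unfolding uA_def uC_def N_def by (rule window_key) (use pq pqB \<epsilon> C in auto)
      finally have key: "\<tau> + 1 \<le> uA\<^sup>2 + uC\<^sup>2 + 2 * cos (pi / (real L + 1)) * (uA * uC)" by (simp add: C_def)
      have "dual_bound n (real n * lp2_dist a b) (2 ^ n / real (n choose w) * (real w - \<tau>) * (\<Sum>l\<le>m. real (n choose l)))"
        by (rule dual_bound_window[OF wn mw L(2) Lm _ _ _ _ uA uC key])
          (use lp0 in \<open>auto simp: \<tau>_def uA_def uC_def\<close>)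
      moreover have "real w - \<tau> = real n * lp2_dist a b / 2" by (simp add: \<tau>_def)
      ultimately show "\<exists>w m. 2 * w < n \<and> m < w \<and> a * real n - 1 \<le> real w \<and> real w < a * real n \<and> real m \<le> (b + \<eta> / 2) * real n \<and>
      dual_bound n (real n * lp2_dist a b)
        (2 ^ n / real (n choose w) * (real n * lp2_dist a b / 2) * (\<Sum>l\<le>m. real (n choose l)))"
        using wn mw w m by (intro exI[of _ w] exI[of _ m]) (simp add: N_def c_def)
    qed
  qed
qed

text \<open>If \<open>a\<close> and \<open>b\<close> differ by less than \<open>\<eta>\<close>,
  their entropies almost cancel and the trivial kernel suffices. Otherwise the bound just obtained
  applies; up to polynomial factors its value is \<open>2 ^ n\<close> times
  \<open>n choose m\<close> over \<open>n choose w\<close>.\<close>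

lemma dual_bound_lp2:
  assumes e: "0 < e"
  shows "eventually (\<lambda>n. \<forall>a b. 0 \<le> b \<longrightarrow> b \<le> a \<longrightarrow> a \<le> 1/2 \<longrightarrow>
    dual_bound n (real n * lp2_dist a b) (2 powr (real n * (1 - bin_entropy a + bin_entropy b + e)))) sequentially"
proof -
  obtain d where d: "0 < d" "\<And>x y. x \<in> {0..1} \<Longrightarrow> y \<in> {0..1} \<Longrightarrow> \<bar>x - y\<bar> < d \<Longrightarrow> \<bar>bin_entropy x - bin_entropy y\<bar> < e / 4"
    using bin_entropy_uniform[of "e / 4"] e by auto
  define \<eta> where "\<eta> = min (1/2) d"
  have \<eta>: "0 < \<eta>" "\<eta> \<le> 1/2" "\<eta> \<le> d" using d by (auto simp: \<eta>_def)
  have "eventually (\<lambda>n. 8 * (real n + 1) ^ 4 \<le> 2 powr (real n * (e / 2))) sequentially" using e by (intro poly_le_powr) simp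
  moreover have "eventually (\<lambda>n. 1 / real n < d) sequentially" using d by real_asymp
  moreover have "eventually (\<lambda>n::nat. 0 < n) sequentially" by (rule eventually_gt_at_top)
  ultimately show ?thesis using dual_bound_lp2_raw[OF \<eta>(1,2)]
  proof eventually_elim
    case (elim n)
    show ?case
    proof (intro allI impI)
      fix a b :: real assume ab: "0 \<le> b" "b \<le> a" "a \<le> 1/2"
      show "dual_bound n (real n * lp2_dist a b) (2 powr (real n * (1 - bin_entropy a + bin_entropy b + e)))"
      proof (cases "b + \<eta> \<le> a")
        case False
        have "\<bar>bin_entropy a - bin_entropy b\<bar> < e / 4" using ab False \<eta> by (intro d(2)) auto
        hence "bin_entropy a \<le> bin_entropy b + e" using e by linarith
        hence "real n * 1 \<le> real n * (1 - bin_entropy a + bin_entropy b + e)" by (intro mult_left_mono) auto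
        hence "2 powr real n \<le> 2 powr (real n * (1 - bin_entropy a + bin_entropy b + e))" by simp
        hence M: "2 ^ n \<le> 2 powr (real n * (1 - bin_entropy a + bin_entropy b + e))" by (simp add: powr_realpow)
        have "0 \<le> real n * lp2_dist a b" using lp2_dist_nonneg[OF ab] by simp
        thus ?thesis by (rule dual_bound_mono[OF dual_bound_trivial M])
      next
        case True
        define c where "c = b + \<eta> / 2"
        have c: "0 \<le> c" "c \<le> 1/2" using ab True \<eta> by (auto simp: c_def)
        obtain w m where wm: "2 * w < n" "m < w" "a * real n - 1 \<le> real w" "real w < a * real n" "real m \<le> c * real n"
          and D: "dual_bound n (real n * lp2_dist a b)
            (2 ^ n / real (n choose w) * (real n * lp2_dist a b / 2) * (\<Sum>l\<le>m. real (n choose l)))"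
          using elim(4) ab True unfolding c_def by blast
        have n: "0 < real n" using elim by simp
        have hw: "\<bar>bin_entropy (real w / real n) - bin_entropy a\<bar> < e / 4"
        proof (rule d(2))
          show "real w / real n \<in> {0..1}" using wm n by (simp add: field_simps)
          have "\<bar>real w / real n - a\<bar> = \<bar>real w - a * real n\<bar> / real n" using n by (simp add: field_simps abs_divide)
          also have "\<dots> \<le> 1 / real n" using wm n by (intro divide_right_mono) auto
          finally show "\<bar>real w / real n - a\<bar> < d" using elim by simp
        qed (use ab in auto)
        have hc: "\<bar>bin_entropy c - bin_entropy b\<bar> < e / 4"
          using ab c \<eta> by (intro d(2)) (auto simp: c_def)
        have S: "(\<Sum>l\<le>m. real (n choose l)) \<le> (real n + 1) * 2 powr (real n * bin_entropy c)"
        proof -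
          have "(\<Sum>l\<le>m. real (n choose l)) \<le> (\<Sum>l\<le>m. 2 powr (real n * bin_entropy c))"
          proof (rule sum_mono)
            fix l assume "l \<in> {..m}"
            hence l: "l \<le> n" "real l \<le> real m" using wm by auto
            have "real l \<le> c * real n" using l wm by linarith
            hence "real l / real n \<le> c" using n by (simp add: field_simps)
            hence "bin_entropy (real l / real n) \<le> bin_entropy c" using c by (intro bin_entropy_mono) auto
            hence "2 powr (real n * bin_entropy (real l / real n)) \<le> 2 powr (real n * bin_entropy c)" by (simp add: mult_left_mono)
            thus "real (n choose l) \<le> 2 powr (real n * bin_entropy c)"
              using binomial_entropy_bounds(1)[OF l(1)] elim by linarith
          qed
          also have "\<dots> = (real m + 1) * 2 powr (real n * bin_entropy c)" by simp
          also have "\<dots> \<le> (real n + 1) * 2 powr (real n * bin_entropy c)" using wm by (intro mult_right_mono) auto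
          finally show ?thesis .
        qed
        have Bw: "1 / real (n choose w) \<le> (real n + 1) * 2 powr (- (real n * bin_entropy (real w / real n)))"
        proof -
          have "2 powr (real n * bin_entropy (real w / real n)) \<le> (real n + 1) * real (n choose w)"
            using wm by (intro binomial_entropy_bounds(2)) auto
          moreover have "0 < real (n choose w)" using wm by simp
          ultimately show ?thesis by (simp add: powr_minus field_simps)
        qed
        have lp: "real n * lp2_dist a b / 2 \<le> real n + 1" "0 \<le> lp2_dist a b"
        proof -
          have "real n * lp2_dist a b \<le> real n * (1/2)" using lp2_dist_le[OF ab] by (intro mult_left_mono) auto
          thus "real n * lp2_dist a b / 2 \<le> real n + 1" by simp
        qed (rule lp2_dist_nonneg[OF ab])
        have "2 ^ n / real (n choose w) * (real n * lp2_dist a b / 2) * (\<Sum>l\<le>m. real (n choose l)) =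
            2 powr real n * (1 / real (n choose w)) * (real n * lp2_dist a b / 2) * (\<Sum>l\<le>m. real (n choose l))"
          by (simp add: powr_realpow)
        also have "\<dots> \<le> 2 powr real n * ((real n + 1) * 2 powr (- (real n * bin_entropy (real w / real n)))) * (real n + 1) *
            ((real n + 1) * 2 powr (real n * bin_entropy c))"
          using S Bw lp by (intro mult_mono mult_nonneg_nonneg sum_nonneg) auto
        also have "\<dots> = (real n + 1) ^ 3 * 2 powr (real n + - (real n * bin_entropy (real w / real n)) + real n * bin_entropy c)"
          unfolding powr_add by (simp add: power3_eq_cube)
        also have "\<dots> \<le> 2 powr (real n * (e / 2)) * 2 powr (real n * (1 - bin_entropy a + bin_entropy b + e / 2))"
        proof (rule mult_mono)
          have "(real n + 1) ^ 3 \<le> (real n + 1) ^ 4" by (rule power_increasing) auto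
          also have "\<dots> \<le> 8 * (real n + 1) ^ 4" by simp
          finally show "(real n + 1) ^ 3 \<le> 2 powr (real n * (e / 2))" using elim by linarith
          have "real n * (1 - bin_entropy (real w / real n) + bin_entropy c) \<le> real n * (1 - bin_entropy a + bin_entropy b + e / 2)"
            using hw hc by (intro mult_left_mono) linarith+
          thus "2 powr (real n + - (real n * bin_entropy (real w / real n)) + real n * bin_entropy c)
            \<le> 2 powr (real n * (1 - bin_entropy a + bin_entropy b + e / 2))" by (simp add: algebra_simps)
        qed auto
        also have "\<dots> = 2 powr (real n * (1 - bin_entropy a + bin_entropy b + e))"
          by (simp add: powr_add[symmetric] algebra_simps)
        finally show ?thesis by (rule dual_bound_mono[OF D])
      qed
    qed
  qed
qed

lemma R_LP2_nonneg: "0 \<le> \<beta> \<Longrightarrow> 0 \<le> R_LP2 \<beta>"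
proof -
  assume \<beta>: "0 \<le> \<beta>"
  show ?thesis
  proof (cases "1/2 \<le> \<beta>")
    case False
    have "0 \<le> Inf {1 - bin_entropy a + bin_entropy b | a b. 0 \<le> b \<and> b \<le> a \<and> a \<le> 1/2 \<and>
             2 * ((a * (1 - a) - b * (1 - b)) / (1 + 2 * sqrt (b * (1 - b)))) \<le> \<beta>}" (is "0 \<le> Inf ?S")
    proof (rule cInf_greatest)
      have "1 - bin_entropy 0 + bin_entropy 0 \<in> ?S" using \<beta> by (intro CollectI exI[of _ 0]) auto
      thus "?S \<noteq> {}" by blast
      fix x assume "x \<in> ?S"
      then obtain a b where ab: "x = 1 - bin_entropy a + bin_entropy b" "0 \<le> b" "b \<le> a" "a \<le> 1/2" by blast
      thus "0 \<le> x" using bin_entropy_le_1[of a] bin_entropy_nonneg[of b] by auto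
    qed
    thus ?thesis using False by (simp add: R_LP2_def)
  qed (simp add: R_LP2_def)
qed

text \<open>Below 1/2 this picks a near-minimizer of the infimum; from 1/2 on the pair
  \<open>a = 1/2\<close>, \<open>b = 0\<close> has distance 1/2 and rate 0.\<close>

lemma R_LP2_approx:
  assumes "0 \<le> \<beta>" "0 < e"
  obtains a b where "0 \<le> b" "b \<le> a" "a \<le> 1/2" "lp2_dist a b \<le> \<beta>" "1 - bin_entropy a + bin_entropy b \<le> R_LP2 \<beta> + e"
proof (cases "1/2 \<le> \<beta>")
  case True
  have "lp2_dist (1/2) 0 = 1/2" by (simp add: lp2_dist_def)
  thus ?thesis using True assms that[of 0 "1/2"] by (simp add: R_LP2_def)
next
  case False
  define S where "S = {1 - bin_entropy a + bin_entropy b | a b. 0 \<le> b \<and> b \<le> a \<and> a \<le> 1/2 \<and>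
             2 * ((a * (1 - a) - b * (1 - b)) / (1 + 2 * sqrt (b * (1 - b)))) \<le> \<beta>}"
  have "1 - bin_entropy 0 + bin_entropy 0 \<in> S" unfolding S_def using assms by (intro CollectI exI[of _ 0]) auto
  hence "S \<noteq> {}" by blast
  moreover have "Inf S < Inf S + e" using assms by simp
  ultimately obtain x where "x \<in> S" "x < Inf S + e" using cInf_lessD by blast
  then obtain a b where "0 \<le> b" "b \<le> a" "a \<le> 1/2" "lp2_dist a b \<le> \<beta>" "1 - bin_entropy a + bin_entropy b < Inf S + e"
    unfolding S_def lp2_dist_def by blast
  thus ?thesis using False that[of b a] by (simp add: R_LP2_def S_def)
qed

lemma dual_bound_R_LP2:
  assumes e: "0 < e"
  shows "eventually (\<lambda>n. \<forall>\<beta>\<ge>0. dual_bound n (\<beta> * real n) (2 powr (real n * (R_LP2 \<beta> + e)))) sequentially"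
proof -
  have e2: "0 < e / 2" using e by simp
  from dual_bound_lp2[OF e2] show ?thesis
  proof eventually_elim
    case (elim n)
    show ?case
    proof (intro allI impI)
      fix \<beta> :: real assume \<beta>: "0 \<le> \<beta>"
      show "dual_bound n (\<beta> * real n) (2 powr (real n * (R_LP2 \<beta> + e)))"
      proof (rule R_LP2_approx[OF \<beta> e2])
        fix a b assume ab: "0 \<le> b" "b \<le> a" "a \<le> 1/2" "lp2_dist a b \<le> \<beta>" "1 - bin_entropy a + bin_entropy b \<le> R_LP2 \<beta> + e / 2"
        have D: "dual_bound n (real n * lp2_dist a b) (2 powr (real n * (1 - bin_entropy a + bin_entropy b + e / 2)))"
          using elim[rule_format, OF ab(1,2,3)] .
        have "real n * (1 - bin_entropy a + bin_entropy b + e / 2) \<le> real n * (R_LP2 \<beta> + e)"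
          using ab(5) by (intro mult_left_mono) linarith+
        hence "2 powr (real n * (1 - bin_entropy a + bin_entropy b + e / 2)) \<le> 2 powr (real n * (R_LP2 \<beta> + e))" by simp
        from dual_bound_mono[OF D this] show ?thesis
        proof (rule dual_bound_mono_distance)
          show "real n * lp2_dist a b \<le> \<beta> * real n" using mult_right_mono[OF ab(4), of "real n"] by (simp add: mult.commute)
        qed
      qed
    qed
  qed
qed


section \<open>Exponents of the two primal solutions\<close>

lemma abs_sqrt_diff_le:
  assumes "0 \<le> a" "0 \<le> (b::real)"
  shows "\<bar>sqrt a - sqrt b\<bar> \<le> sqrt \<bar>a - b\<bar>"
proof (rule real_le_rsqrt)
  have "\<bar>sqrt a - sqrt b\<bar> \<le> sqrt a + sqrt b" using assms by (auto simp: abs_le_iff)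
  hence "\<bar>sqrt a - sqrt b\<bar> * \<bar>sqrt a - sqrt b\<bar> \<le> \<bar>sqrt a - sqrt b\<bar> * (sqrt a + sqrt b)" by (intro mult_left_mono) auto
  also have "\<dots> = \<bar>(sqrt a - sqrt b) * (sqrt a + sqrt b)\<bar>" using assms by (simp add: abs_mult)
  also have "(sqrt a - sqrt b) * (sqrt a + sqrt b) = a - b" using assms by (simp add: algebra_simps)
  finally show "\<bar>sqrt a - sqrt b\<bar>\<^sup>2 \<le> \<bar>a - b\<bar>" by (simp only: power2_eq_square)
qed

lemma even_above:
  obtains t :: nat where "even t" "d < t" "t \<le> d + 2"
  by (cases "even d") (use that[of "d + 2"] that[of "d + 1"] in auto)

text \<open>The last equation is symmetric in \<alpha> and \<open>r\<close>; it also says that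
  \<alpha> (1 - \<alpha>) = (1/2 - r)^2.\<close>

lemma sam_radius_bounds:
  assumes "0 \<le> \<alpha>" "\<alpha> \<le> 1/2"
  defines "r \<equiv> 1/2 - sqrt (\<alpha> * (1 - \<alpha>))"
  shows "0 \<le> r" "r \<le> 1/2 - \<alpha>" "r * (1 - r) = (1/2 - \<alpha>)\<^sup>2"
proof -
  have p: "0 \<le> \<alpha> * (1 - \<alpha>)" using assms by auto
  have "sqrt (\<alpha> * (1 - \<alpha>)) \<le> 1/2"
    by (rule real_le_lsqrt) (use mult_one_minus_mono[of \<alpha> "1/2"] assms in \<open>auto simp: power2_eq_square\<close>)
  thus "0 \<le> r" by (simp add: r_def)
  have "\<alpha> * \<alpha> \<le> \<alpha> * (1 - \<alpha>)" using assms by (intro mult_left_mono) auto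
  hence "\<alpha> \<le> sqrt (\<alpha> * (1 - \<alpha>))" by (intro real_le_rsqrt) (simp add: power2_eq_square)
  thus "r \<le> 1/2 - \<alpha>" by (simp add: r_def)
  have "r * (1 - r) = 1/4 - (sqrt (\<alpha> * (1 - \<alpha>)))\<^sup>2" by (simp add: r_def power2_eq_square algebra_simps)
  also have "\<dots> = 1/4 - \<alpha> * (1 - \<alpha>)" using p by simp
  finally show "r * (1 - r) = (1/2 - \<alpha>)\<^sup>2" by (simp add: power2_eq_square algebra_simps)
qed

lemma primal_bound_below_1:
  assumes "x \<le> 0"
  shows "primal_bound k d (2 powr (real k * x))"
proof (rule primal_bound_mono[OF primal_bound_1])
  have "real k * x \<le> 0" using assms by (simp add: mult_nonneg_nonpos)
  thus "2 powr (real k * x) \<le> 1" using powr_mono[of "real k * x" 0 2] by simp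
qed

text \<open>Take an even \<open>t\<close> just above \<open>d\<close> and the largest
  \<open>x0\<close> that \<open>primal_bound_samorodnitsky\<close> admits. Then
  \<open>x0 / k\<close> tends to \<open>r\<close>, and the value has exponent half of 1 + h(r) -
  h(\<alpha>). Close to \<alpha> = 1/2 the claimed rate is negative and the weight at distance 0
  alone suffices.\<close>

lemma primal_bound_sam1:
  assumes e: "0 < e"
  shows "eventually (\<lambda>k. \<forall>\<alpha> d. real d = \<alpha> * real k \<longrightarrow> 0 \<le> \<alpha> \<longrightarrow> \<alpha> < 1/2 \<longrightarrow>
    primal_bound k d (2 powr (real k * (1/2 * (1 - bin_entropy \<alpha> + R_LP1 \<alpha>) - e)))) sequentially"
proof -
  obtain \<eta> where \<eta>: "0 < \<eta>" "\<And>x y. x \<in> {0..1} \<Longrightarrow> y \<in> {0..1} \<Longrightarrow> \<bar>x - y\<bar> < \<eta> \<Longrightarrow> \<bar>bin_entropy x - bin_entropy y\<bar> < e / 2"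
    using bin_entropy_uniform[of "e / 2"] e by auto
  have ev: "eventually (\<lambda>k. 8 * (real k + 1) ^ 4 \<le> 2 powr (real k * (e / 2))) sequentially" using e by (intro poly_le_powr) simp
  have ev2: "eventually (\<lambda>k. 1 / real k + sqrt (3 / real k) < \<eta>) sequentially" "eventually (\<lambda>k. 2 / real k < \<eta>) sequentially"
    "eventually (\<lambda>k. 4 \<le> \<eta> * real k) sequentially" "eventually (\<lambda>k. 4 \<le> \<eta>\<^sup>2 * real k) sequentially" "eventually (\<lambda>k::nat. 0 < k) sequentially"
    using \<eta>(1) by real_asymp+
  from ev ev2 show ?thesis
  proof eventually_elim
    case (elim k)
    show ?case
    proof (intro allI impI)
      fix \<alpha> d assume d: "real d = \<alpha> * real k" and \<alpha>: "0 \<le> \<alpha>" "\<alpha> < 1/2"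
      define r where "r = 1/2 - sqrt (\<alpha> * (1 - \<alpha>))"
      have r: "0 \<le> r" "r \<le> 1/2 - \<alpha>" using sam_radius_bounds[of \<alpha>] \<alpha> by (auto simp: r_def)
      have R: "R_LP1 \<alpha> = bin_entropy r" by (simp add: R_LP1_def r_def)
      have k: "0 < real k" using elim by simp
      show "primal_bound k d (2 powr (real k * (1/2 * (1 - bin_entropy \<alpha> + R_LP1 \<alpha>) - e)))"
      proof (cases "1/2 - \<alpha> < \<eta>")
        case True
        have "\<bar>bin_entropy \<alpha> - bin_entropy (1/2)\<bar> < e / 2" using \<alpha> True by (intro \<eta>(2)) auto
        moreover have "\<bar>bin_entropy r - bin_entropy 0\<bar> < e / 2" using \<alpha> True r by (intro \<eta>(2)) auto
        ultimately have "- (bin_entropy \<alpha> - 1) < e / 2" "bin_entropy r < e / 2"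
          unfolding bin_entropy_half bin_entropy_0 diff_0_right abs_less_iff by blast+
        hence "1/2 * (1 - bin_entropy \<alpha> + R_LP1 \<alpha>) - e \<le> 0" using e unfolding R by simp
        thus ?thesis by (rule primal_bound_below_1)
      next
        case False
        obtain t where t: "even t" "d < t" "t \<le> d + 2" by (rule even_above)
        define K where "K = real k"
        have K: "0 < K" "real d = \<alpha> * K" using k d by (auto simp: K_def)
        have tK: "real t \<le> \<alpha> * K + 2" "\<alpha> * K < real t" using t K by linarith+
        have aK: "\<alpha> * K \<le> K / 2 - \<eta> * K" using mult_right_mono[of \<alpha> "1/2 - \<eta>" K] False K by (simp add: algebra_simps)
        have \<eta>K: "4 \<le> \<eta> * K" "4 \<le> \<eta>\<^sup>2 * K" using elim by (auto simp: K_def)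
        have half: "\<eta> * K / 2 \<le> K / 2 - real t" using tK aK \<eta>K by linarith
        hence t2: "2 * t \<le> k" using \<eta>K by (simp add: K_def)
        define X where "X = sqrt (real t * (K - real t + 1))"
        have Xnn: "0 \<le> real t * (K - real t + 1)" using half \<eta>K by (intro mult_nonneg_nonneg) auto
        have X: "0 \<le> X" "X\<^sup>2 = real t * (K - real t + 1)" using Xnn by (auto simp: X_def)
        have "X \<le> K / 2"
        proof -
          have "(\<eta> * K / 2) * (\<eta> * K / 2) \<le> (K / 2 - real t) * (K / 2 - real t)" using half \<eta>K by (intro mult_mono) auto
          moreover have "(\<eta> * K / 2) * (\<eta> * K / 2) = (\<eta>\<^sup>2 * K) * K / 4" by (simp add: power2_eq_square)
          moreover have "4 * K \<le> (\<eta>\<^sup>2 * K) * K" using \<eta>K K by (intro mult_right_mono) auto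
          ultimately have "K \<le> (K / 2 - real t) * (K / 2 - real t)" by linarith
          moreover have "real t \<le> K" using half \<eta>K K by linarith
          ultimately have "real t * (K - real t + 1) \<le> (K / 2)\<^sup>2" by (simp add: power2_eq_square algebra_simps)
          thus ?thesis unfolding X_def using K by (intro real_le_lsqrt) auto
        qed
        then obtain x0 where x0: "K / 2 - X - 1 < real x0" "real x0 \<le> K / 2 - X" using nat_floor[of "K / 2 - X"] by auto
        have "real x0 \<le> real k" using x0 X K by (simp add: K_def)
        hence x0k: "x0 \<le> k" by simp
        have P: "primal_bound k d (sqrt (2 ^ k * real (k choose x0) / real (k choose t)) / (4 * real k))"
          by (rule primal_bound_samorodnitsky[OF t(1,2) t2 x0k]) (use x0 in \<open>simp add: X_def K_def\<close>)
        have ht: "\<bar>bin_entropy (real t / K) - bin_entropy \<alpha>\<bar> < e / 2"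
        proof (rule \<eta>(2))
          show "real t / K \<in> {0..1}" using half \<eta>K K by (simp add: field_simps)
          have "\<bar>real t / K - \<alpha>\<bar> = \<bar>real t - \<alpha> * K\<bar> / K" using K by (simp add: field_simps abs_divide)
          also have "\<dots> \<le> 2 / K" using tK K by (intro divide_right_mono) auto
          finally show "\<bar>real t / K - \<alpha>\<bar> < \<eta>" using elim by (simp add: K_def)
        qed (use \<alpha> in auto)
        have hx: "\<bar>bin_entropy (real x0 / K) - bin_entropy r\<bar> < e / 2"
        proof (rule \<eta>(2))
          show "real x0 / K \<in> {0..1}" using x0k K by (simp add: field_simps K_def)
          \<comment> \<open>Replacing \<alpha> k by \<open>t\<close> changes the product under the
            root by O(k); after division by \<open>K\<^sup>2\<close> the root changes by the square
            root of 3/k at most.\<close>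
          have "X\<^sup>2 / K\<^sup>2 - \<alpha> * (1 - \<alpha>) = ((real t - \<alpha> * K) * (K - real t - \<alpha> * K) + real t) / K\<^sup>2"
            unfolding X(2) using K by (simp add: field_simps power2_eq_square)
          also have "\<bar>\<dots>\<bar> \<le> 3 * K / K\<^sup>2"
          proof -
            have t1: "real t \<le> K" using half \<eta>K K by linarith
            have aK2: "0 \<le> \<alpha> * K" "\<alpha> * K \<le> K / 2" using \<alpha> K aK \<eta>K by auto
            have "\<bar>real t - \<alpha> * K\<bar> * \<bar>K - real t - \<alpha> * K\<bar> \<le> 2 * K"
              using tK t1 aK2 by (intro mult_mono) (auto simp: abs_le_iff)
            hence "\<bar>(real t - \<alpha> * K) * (K - real t - \<alpha> * K) + real t\<bar> \<le> 3 * K" using t1 unfolding abs_mult[symmetric] by linarith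
            thus ?thesis using K by (simp add: abs_divide divide_right_mono)
          qed
          also have "3 * K / K\<^sup>2 = 3 / K" by (simp add: power2_eq_square)
          finally have "\<bar>X\<^sup>2 / K\<^sup>2 - \<alpha> * (1 - \<alpha>)\<bar> \<le> 3 / K" .
          hence "sqrt \<bar>X\<^sup>2 / K\<^sup>2 - \<alpha> * (1 - \<alpha>)\<bar> \<le> sqrt (3 / K)" by (rule real_sqrt_le_mono)
          moreover have "\<bar>sqrt (X\<^sup>2 / K\<^sup>2) - sqrt (\<alpha> * (1 - \<alpha>))\<bar> \<le> sqrt \<bar>X\<^sup>2 / K\<^sup>2 - \<alpha> * (1 - \<alpha>)\<bar>"
            using \<alpha> by (intro abs_sqrt_diff_le) auto
          moreover have "sqrt (X\<^sup>2 / K\<^sup>2) = X / K" using X(1) K(1) by (simp add: real_sqrt_divide)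
          ultimately have s: "\<bar>X / K - sqrt (\<alpha> * (1 - \<alpha>))\<bar> \<le> sqrt (3 / K)" by linarith
          have "\<bar>real x0 / K - (1/2 - X / K)\<bar> = \<bar>real x0 - (K / 2 - X)\<bar> / K" using K by (simp add: field_simps abs_divide)
          also have "\<dots> \<le> 1 / K" using x0 K by (intro divide_right_mono) auto
          finally have "\<bar>real x0 / K - r\<bar> \<le> 1 / K + sqrt (3 / K)" using s unfolding r_def by linarith
          thus "\<bar>real x0 / K - r\<bar> < \<eta>" using elim by (simp add: K_def)
        qed (use \<alpha> r in auto)
        have V: "2 powr (K * (1 + bin_entropy r - bin_entropy \<alpha> - e) / 2) / (4 * K * (K + 1)) \<le> sqrt (2 ^ k * real (k choose x0) / real (k choose t)) / (4 * real k)"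
        proof -
          have b1: "2 powr (K * bin_entropy (real x0 / K)) \<le> (K + 1) * real (k choose x0)"
            using binomial_entropy_bounds(2)[OF x0k] elim by (simp add: K_def)
          have b2: "real (k choose t) \<le> 2 powr (K * bin_entropy (real t / K))"
            using binomial_entropy_bounds(1)[of t k] t2 elim by (simp add: K_def)
          have ct: "0 < real (k choose t)" using t2 by simp
          have ineq: "1 + bin_entropy r - bin_entropy \<alpha> - e \<le> 1 + bin_entropy (real x0 / K) - bin_entropy (real t / K)"
            using hx ht by linarith
          have "2 powr (K * (1 + bin_entropy r - bin_entropy \<alpha> - e)) / (K + 1) \<le>
              2 powr (K * (1 + bin_entropy (real x0 / K) - bin_entropy (real t / K))) / (K + 1)"
            by (intro divide_right_mono powr_mono mult_left_mono ineq) (use K in auto)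
          also have "\<dots> = 2 powr K * (2 powr (K * bin_entropy (real x0 / K)) / (K + 1)) / 2 powr (K * bin_entropy (real t / K))"
          proof -
            have "2 powr (K * (1 + x - y)) = 2 powr K * 2 powr (K * x) / 2 powr (K * y)" for x y
              by (simp add: powr_add[symmetric] powr_diff[symmetric] algebra_simps)
            thus ?thesis by (simp add: mult.commute)
          qed
          also have "\<dots> \<le> 2 powr K * real (k choose x0) / real (k choose t)"
            using b1 b2 ct K by (intro frac_le mult_left_mono) (auto simp: divide_le_eq mult.commute)
          finally have "2 powr (K * (1 + bin_entropy r - bin_entropy \<alpha> - e)) / (K + 1) \<le> 2 ^ k * real (k choose x0) / real (k choose t)"
            by (simp add: K_def powr_realpow)
          hence "sqrt (2 powr (K * (1 + bin_entropy r - bin_entropy \<alpha> - e)) / (K + 1)) \<le> sqrt (2 ^ k * real (k choose x0) / real (k choose t))"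
            by (rule real_sqrt_le_mono)
          moreover have "sqrt (2 powr (K * (1 + bin_entropy r - bin_entropy \<alpha> - e)) / (K + 1)) =
              2 powr (K * (1 + bin_entropy r - bin_entropy \<alpha> - e) / 2) / sqrt (K + 1)"
            by (simp add: real_sqrt_divide powr_half_sqrt[symmetric] powr_powr)
          moreover have "2 powr (K * (1 + bin_entropy r - bin_entropy \<alpha> - e) / 2) / (K + 1) \<le> 2 powr (K * (1 + bin_entropy r - bin_entropy \<alpha> - e) / 2) / sqrt (K + 1)"
            using K by (intro divide_left_mono mult_pos_pos real_le_lsqrt) (auto simp: power2_eq_square)
          ultimately have "2 powr (K * (1 + bin_entropy r - bin_entropy \<alpha> - e) / 2) / (K + 1) \<le> sqrt (2 ^ k * real (k choose x0) / real (k choose t))"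
            by linarith
          hence "2 powr (K * (1 + bin_entropy r - bin_entropy \<alpha> - e) / 2) / (K + 1) / (4 * K) \<le> sqrt (2 ^ k * real (k choose x0) / real (k choose t)) / (4 * K)"
            using K by (intro divide_right_mono) auto
          thus ?thesis by (simp add: K_def mult.commute)
        qed
        have "2 powr (real k * (1/2 * (1 - bin_entropy \<alpha> + R_LP1 \<alpha>) - e)) =
            2 powr (K * (1 + bin_entropy r - bin_entropy \<alpha> - e) / 2) / 2 powr (K * (e / 2))"
        proof -
          have "real k * (1/2 * (1 - bin_entropy \<alpha> + bin_entropy r) - e) = K * (1 + bin_entropy r - bin_entropy \<alpha> - e) / 2 - K * (e / 2)"
            by (simp add: K_def field_simps)
          thus ?thesis unfolding R powr_diff[symmetric] by (simp only:)
        qed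
        also have "\<dots> \<le> 2 powr (K * (1 + bin_entropy r - bin_entropy \<alpha> - e) / 2) / (4 * K * (K + 1))"
        proof (rule divide_left_mono)
          have "4 * K * (K + 1) \<le> 4 * (K + 1) * (K + 1)" using K by (intro mult_mono) auto
          also have "\<dots> = 4 * (K + 1) ^ 2" by (simp add: power2_eq_square)
          also have "\<dots> \<le> 8 * (K + 1) ^ 4" using K by (intro mult_mono power_increasing) auto
          finally show "4 * K * (K + 1) \<le> 2 powr (K * (e / 2))" using elim by (simp add: K_def)
        qed (use K in auto)
        also note V
        finally show ?thesis by (rule primal_bound_mono[OF P])
      qed
    qed
  qed
qed

text \<open>The quadrature needs an even length, hence the detour through \<open>k' = k - 1\<close> for odd \<open>k\<close>.\<close>

lemma primal_bound_sam2:
  assumes e: "0 < e"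
  shows "eventually (\<lambda>k. \<forall>\<alpha> d. real d = \<alpha> * real k \<longrightarrow> 0 \<le> \<alpha> \<longrightarrow> \<alpha> < 1/2 \<longrightarrow> 1/2 - sqrt (\<alpha> * (1 - \<alpha>)) < 1/8 \<longrightarrow>
    (\<exists>k'\<le>k. primal_bound k' d (2 powr (real k * (1/2 * bin_entropy (1 - 2 * sqrt (\<alpha> * (1 - \<alpha>))) - e))))) sequentially"
proof -
  obtain \<eta> where \<eta>: "0 < \<eta>" "\<And>x y. x \<in> {0..1} \<Longrightarrow> y \<in> {0..1} \<Longrightarrow> \<bar>x - y\<bar> < \<eta> \<Longrightarrow> \<bar>bin_entropy x - bin_entropy y\<bar> < e / 2"
    using bin_entropy_uniform[of "e / 2"] e by auto
  define \<mu> where "\<mu> = \<eta>\<^sup>2 / 8"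
  have \<mu>: "0 < \<mu>" using \<eta> by (simp add: \<mu>_def)
  have "eventually (\<lambda>N. 10 \<le> \<eta> * real N \<and> 2 \<le> \<mu> * real N \<and> 36 * real N + 41616 \<le> 2 * \<mu> * (real N)\<^sup>2 \<and> 2 / real N < \<eta> / 2) sequentially"
    using \<eta>(1) \<mu> by (intro eventually_conj) real_asymp+
  then obtain N0 where N0: "\<And>N. N0 \<le> N \<Longrightarrow> 10 \<le> \<eta> * real N \<and> 2 \<le> \<mu> * real N \<and> 36 * real N + 41616 \<le> 2 * \<mu> * (real N)\<^sup>2 \<and> 2 / real N < \<eta> / 2"
    unfolding eventually_sequentially by blast
  have "eventually (\<lambda>k. 8 * (real k + 1) ^ 4 \<le> 2 powr (real k * (e / 2))) sequentially" using e by (intro poly_le_powr) simp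
  moreover have "eventually (\<lambda>k. N0 + 1 \<le> k) sequentially" by (rule eventually_ge_at_top)
  ultimately show ?thesis
  proof eventually_elim
    case (elim k)
    show ?case
    proof (intro allI impI)
      fix \<alpha> d assume d: "real d = \<alpha> * real k" and \<alpha>: "0 \<le> \<alpha>" "\<alpha> < 1/2" and r8: "1/2 - sqrt (\<alpha> * (1 - \<alpha>)) < 1/8"
      define r where "r = 1/2 - sqrt (\<alpha> * (1 - \<alpha>))"
      have r: "0 \<le> r" "r \<le> 1/2 - \<alpha>" "r * (1 - r) = (1/2 - \<alpha>)\<^sup>2" "r < 1/8"
        using sam_radius_bounds[of \<alpha>] \<alpha> r8 by (auto simp: r_def)
      have R: "1 - 2 * sqrt (\<alpha> * (1 - \<alpha>)) = 2 * r" by (simp add: r_def)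
      show "\<exists>k'\<le>k. primal_bound k' d (2 powr (real k * (1/2 * bin_entropy (1 - 2 * sqrt (\<alpha> * (1 - \<alpha>))) - e)))"
      proof (cases "2 * r < \<eta>")
        case True
        have "\<bar>bin_entropy (2 * r) - bin_entropy 0\<bar> < e / 2" using r True by (intro \<eta>(2)) auto
        hence "1/2 * bin_entropy (1 - 2 * sqrt (\<alpha> * (1 - \<alpha>))) - e \<le> 0" unfolding R using e by (simp add: abs_less_iff)
        thus ?thesis using primal_bound_below_1 by blast
      next
        case False
        define N where "N = 2 * (k div 2)"
        have Nk: "N \<le> k" "k \<le> N + 1" "N0 \<le> N" "even N" using elim by (auto simp: N_def)
        define M where "M = real N"
        define K where "K = real k"
        have MK: "M \<le> K" "K \<le> M + 1" using Nk by (auto simp: M_def K_def)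
        have M: "10 \<le> \<eta> * M" "2 \<le> \<mu> * M" "36 * M + 41616 \<le> 2 * \<mu> * M\<^sup>2" "2 / M < \<eta> / 2"
          using N0[OF Nk(3)] by (auto simp: M_def)
        have M0: "0 < M" using M(1) \<eta>(1) by (metis M_def mult_zero_right not_numeral_le_zero of_nat_0 of_nat_0_less_iff gr0I)
        \<comment> \<open>\<open>u * N\<close> is the length of the interval of nodes up to
          rounding, and u^2 = 4 r (1 - r). From r < 1/8 come 5 r <= u, which makes room for more
          than \<open>2 * m\<close> nodes, and 3 u <= 2, the range of
          \<open>entropy_quadratic\<close>.\<close>
        define u where "u = 1 - 2 * \<alpha>"
        have u0: "0 \<le> u" using \<alpha> by (simp add: u_def)
        have u2: "u\<^sup>2 = 4 * (r * (1 - r))" unfolding r(3) by (simp add: u_def power2_eq_square algebra_simps)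
        have r\<eta>: "\<eta> / 2 \<le> r" using False by simp
        have u5: "5 * r \<le> u"
        proof (rule power2_le_imp_le)
          have "r * (7 * r) \<le> r * (1 - r)" using r by (intro mult_left_mono) auto
          moreover have "0 \<le> r * r" "r * (7 * r) = 7 * (r * r)" "(5 * r)\<^sup>2 = 25 * (r * r)" by (simp_all add: power2_eq_square)
          ultimately show "(5 * r)\<^sup>2 \<le> u\<^sup>2" unfolding u2 by linarith
        qed (rule u0)
        have u3: "3 * u \<le> 2"
        proof (rule power2_le_imp_le)
          have "r * (1 - r) \<le> (1/8) * (1 - 1/8)" using r by (intro mult_one_minus_mono) auto
          thus "(3 * u)\<^sup>2 \<le> 2\<^sup>2" unfolding power_mult_distrib u2 by simp
        qed simp
        have \<mu>r: "2 * \<mu> \<le> r * r"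
        proof -
          have "(\<eta> / 2) * (\<eta> / 2) \<le> r * r" using r\<eta> \<eta>(1) by (intro mult_mono) auto
          thus ?thesis by (simp add: \<mu>_def power2_eq_square)
        qed
        have rr: "r * r \<le> r * (1/8)" using r by (intro mult_left_mono) auto
        obtain a where a: "even a" "d < a" "a \<le> d + 2" by (rule even_above)
        have dK: "real d = \<alpha> * K" using d by (simp add: K_def)
        have dM: "\<alpha> * M \<le> real d" "real d \<le> \<alpha> * M + 1/2"
        proof -
          show "\<alpha> * M \<le> real d" unfolding dK using MK \<alpha> by (intro mult_left_mono) auto
          have "\<alpha> * K \<le> \<alpha> * (M + 1)" using MK \<alpha> by (intro mult_left_mono) auto
          thus "real d \<le> \<alpha> * M + 1/2" unfolding dK using \<alpha> by (simp add: distrib_left)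
        qed
        have aM: "real d + 1 \<le> real a" "real a \<le> real d + 2" using a by linarith+
        have lo: "u * M - 5 \<le> M - 2 * real a" and hi: "M - 2 * real a \<le> u * M"
          using dM aM by (auto simp: u_def algebra_simps)
        \<comment> \<open>Staying below \<open>r * M\<close> by \<open>\<mu> * M\<close> creates the
          \<open>gap\<close> of the quadrature. Staying above (r - r^2) M, possible because 2 \<mu>
          <= r^2, keeps the degree large enough for the moment bound.\<close>
        define \<rho> where "\<rho> = (r - \<mu>) * M"
        have \<rho>0: "0 \<le> \<rho>" unfolding \<rho>_def using \<mu>r rr \<mu> r M0 by (intro mult_nonneg_nonneg) linarith+
        obtain m where m: "\<rho> - 1 < real m" "real m \<le> \<rho>" using nat_floor[OF \<rho>0] by auto
        have rM: "r * M \<le> M / 8" using r M0 by (simp add: field_simps)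
        have uM: "5 * (r * M) \<le> u * M" using mult_right_mono[OF u5, of M] M0 by (simp add: mult.assoc)
        have rM5: "5 \<le> r * M"
        proof -
          have "5 \<le> \<eta> / 2 * M" using M(1) by simp
          also have "\<dots> \<le> r * M" using r\<eta> M0 by (intro mult_right_mono) auto
          finally show ?thesis .
        qed
        have \<rho>: "\<rho> = r * M - \<mu> * M" by (simp add: \<rho>_def left_diff_distrib)
        have an: "2 * a + 4 * m \<le> N"
        proof -
          have "2 * real a + 4 * real m \<le> M" using lo m(2) \<rho> M(2) uM rM5 by linarith
          thus ?thesis unfolding M_def by linarith
        qed
        have mn: "8 * m + 15 \<le> N"
        proof -
          have "8 * real m + 15 \<le> M" using m(2) \<rho> M(2) rM by linarith
          thus ?thesis unfolding M_def by linarith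
        qed
        have sq_lo: "u\<^sup>2 * M\<^sup>2 - 10 * M \<le> (M - 2 * real a)\<^sup>2"
        proof -
          have uM5: "0 \<le> u * M - 5" using uM rM5 by linarith
          have "(u * M - 5) * (u * M - 5) \<le> (M - 2 * real a) * (M - 2 * real a)" using lo uM5 by (intro mult_mono) auto
          moreover have "(u * M - 5) * (u * M - 5) = u\<^sup>2 * M\<^sup>2 - 10 * (u * M) + 25" by (simp add: power2_eq_square algebra_simps)
          moreover have "u * M \<le> 1 * M" using u3 M0 by (intro mult_right_mono) auto
          ultimately show ?thesis unfolding power2_eq_square[of "M - 2 * real a"] by linarith
        qed
        have gap: "24 * real N + 41616 \<le> (real N - 2 * real a)\<^sup>2 - 4 * real x * (real N - real x) - 2 * real N" if x: "x \<le> m" for x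
        proof -
          have xm: "real x \<le> \<rho>" using x m(2) by linarith
          have "0 \<le> (\<rho> - real x) * (M - \<rho> - real x)" using xm rM \<rho> M(2) M0 by (intro mult_nonneg_nonneg) linarith+
          hence "real x * (M - real x) \<le> \<rho> * (M - \<rho>)" by (simp add: algebra_simps)
          also have "\<rho> * (M - \<rho>) = M\<^sup>2 * (r * (1 - r) - \<mu> * (1 - 2 * r) - \<mu> * \<mu>)"
            by (simp add: \<rho>_def power2_eq_square algebra_simps)
          also have "\<dots> \<le> M\<^sup>2 * (r * (1 - r) - \<mu> / 2)"
          proof (rule mult_left_mono)
            have "\<mu> * (1/2) \<le> \<mu> * (1 - 2 * r)" using \<mu> r by (intro mult_left_mono) auto
            moreover have "0 \<le> \<mu> * \<mu>" by simp
            ultimately show "r * (1 - r) - \<mu> * (1 - 2 * r) - \<mu> * \<mu> \<le> r * (1 - r) - \<mu> / 2" by linarith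
          qed simp
          finally have "4 * (real x * (M - real x)) \<le> 4 * (M\<^sup>2 * (r * (1 - r) - \<mu> / 2))" by linarith
          moreover have "4 * (M\<^sup>2 * (r * (1 - r) - \<mu> / 2)) = u\<^sup>2 * M\<^sup>2 - 2 * \<mu> * M\<^sup>2" unfolding u2 by (simp add: algebra_simps)
          moreover have "4 * real x * (M - real x) = 4 * (real x * (M - real x))" by simp
          ultimately have "24 * M + 41616 \<le> (M - 2 * real a)\<^sup>2 - 4 * real x * (M - real x) - 2 * M"
            using sq_lo M(3) by linarith
          thus ?thesis by (simp only: M_def)
        qed
        have ml: "(real N - 2 * real a)\<^sup>2 \<le> 4 * real N * real m"
        proof -
          have aN0: "0 \<le> M - 2 * real a" using lo uM rM5 by linarith
          have "(M - 2 * real a) * (M - 2 * real a) \<le> (u * M) * (u * M)" using hi aN0 by (intro mult_mono) auto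
          also have "\<dots> = u\<^sup>2 * (M * M)" by (simp add: power2_eq_square mult_ac)
          also have "\<dots> = 4 * M * (M * (r - r * r))" unfolding u2 by (simp add: algebra_simps)
          also have "\<dots> \<le> 4 * M * real m"
          proof (rule mult_left_mono)
            have "M * (2 * \<mu>) \<le> M * (r * r)" using \<mu>r M0 by (intro mult_left_mono) auto
            hence "M * (r - r * r) \<le> r * M - 2 * (\<mu> * M)" by (simp add: algebra_simps)
            thus "M * (r - r * r) \<le> real m" using m(1) \<rho> M(2) by linarith
          qed (use M0 in simp)
          finally show ?thesis by (simp only: M_def power2_eq_square)
        qed
        have ce: "3 * (real N - 2 * real a) \<le> 2 * real N"
        proof -
          have "(3 * u) * M \<le> 2 * M" using u3 M0 by (intro mult_right_mono) auto
          hence "3 * (u * M) \<le> 2 * M" by (simp only: mult.assoc)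
          moreover have "3 * (M - 2 * real a) \<le> 3 * (u * M)" using hi by simp
          ultimately have "3 * (M - 2 * real a) \<le> 2 * M" by linarith
          thus ?thesis by (simp only: M_def)
        qed
        have P: "primal_bound N d (sqrt (real (N choose (2 * m))) / (4 * (real N + 1)\<^sup>2))"
          by (rule primal_bound_quadrature[OF a(1) Nk(4) an mn gap a(2) ml ce])
        have h: "\<bar>bin_entropy (real (2 * m) / M) - bin_entropy (2 * r)\<bar> < e / 2"
        proof (rule \<eta>(2))
          have "real (2 * m) \<le> M" using mn by (simp add: M_def)
          thus "real (2 * m) / M \<in> {0..1}" using M0 by (simp add: field_simps)
          have "\<bar>real (2 * m) / M - 2 * r\<bar> = \<bar>2 * real m - 2 * (r * M)\<bar> / M" using M0 by (simp add: field_simps abs_divide)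
          also have "\<dots> \<le> (2 * (\<mu> * M) + 2) / M" using m \<rho> M(2) M0 by (intro divide_right_mono) (auto simp: abs_le_iff)
          also have "\<dots> = 2 * \<mu> + 2 / M" using M0 by (simp add: field_simps)
          also have "\<dots> < \<eta>"
          proof -
            have "\<eta> * \<eta> \<le> \<eta> * 1" using r\<eta> r \<eta>(1) by (intro mult_left_mono) auto
            hence "2 * \<mu> \<le> \<eta> / 2" using \<eta>(1) by (simp add: \<mu>_def power2_eq_square)
            thus ?thesis using M(4) by linarith
          qed
          finally show "\<bar>real (2 * m) / M - 2 * r\<bar> < \<eta>" .
        qed (use r in auto)
        define x where "x = bin_entropy (2 * r) - e / 2"
        have x1: "x \<le> 1" using bin_entropy_le_1[of "2 * r"] r e by (simp add: x_def)
        have V: "2 powr (K * x / 2) / (8 * (K + 1) ^ 3) \<le> sqrt (real (N choose (2 * m))) / (4 * (real N + 1)\<^sup>2)"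
        proof -
          have b: "2 powr (M * bin_entropy (real (2 * m) / M)) \<le> (M + 1) * real (N choose (2 * m))"
            using binomial_entropy_bounds(2)[of "2 * m" N] mn by (simp add: M_def)
          have "K * x - 1 \<le> M * x"
          proof (cases "N = k")
            case False
            hence "K = M + 1" using Nk by (simp add: K_def M_def)
            thus ?thesis using x1 by (simp add: distrib_right)
          qed (simp add: K_def M_def)
          also have "M * x \<le> M * bin_entropy (real (2 * m) / M)"
          proof (rule mult_left_mono)
            show "x \<le> bin_entropy (real (2 * m) / M)" using h unfolding x_def by linarith
          qed (use M0 in simp)
          finally have "2 powr (K * x - 1) \<le> 2 powr (M * bin_entropy (real (2 * m) / M))" by simp
          hence "2 powr (K * x - 1) \<le> (M + 1) * real (N choose (2 * m))" using b by linarith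
          hence "2 powr (K * x - 1) / (M + 1) \<le> real (N choose (2 * m))" using M0 by (simp add: divide_le_eq mult.commute)
          hence "sqrt (2 powr (K * x - 1) / (M + 1)) \<le> sqrt (real (N choose (2 * m)))" by (rule real_sqrt_le_mono)
          moreover have "sqrt (2 powr (K * x - 1) / (M + 1)) = 2 powr ((K * x - 1) / 2) / sqrt (M + 1)"
            by (simp add: real_sqrt_divide powr_half_sqrt[symmetric] powr_powr)
          moreover have "2 powr ((K * x - 1) / 2) / (K + 1) \<le> 2 powr ((K * x - 1) / 2) / sqrt (M + 1)"
          proof (rule divide_left_mono)
            have "sqrt (M + 1) \<le> M + 1" using M0 by (intro real_le_lsqrt) (auto simp: power2_eq_square)
            thus "sqrt (M + 1) \<le> K + 1" using MK by simp
          qed (use M0 MK in auto)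
          moreover have "2 powr (K * x / 2) / 2 \<le> 2 powr ((K * x - 1) / 2)"
          proof -
            have "2 powr (K * x / 2) / 2 = 2 powr (K * x / 2 - 1)" by (simp add: powr_diff)
            also have "\<dots> \<le> 2 powr ((K * x - 1) / 2)" by (intro powr_mono) (auto simp: diff_divide_distrib)
            finally show ?thesis .
          qed
          hence "2 powr (K * x / 2) / 2 / (K + 1) \<le> 2 powr ((K * x - 1) / 2) / (K + 1)" using M0 MK by (intro divide_right_mono) auto
          ultimately have s: "2 powr (K * x / 2) / 2 / (K + 1) \<le> sqrt (real (N choose (2 * m)))" by linarith
          have "2 powr (K * x / 2) / (8 * (K + 1) ^ 3) = 2 powr (K * x / 2) / 2 / (K + 1) / (4 * (K + 1)\<^sup>2)"
          proof -
            have "8 * y ^ 3 = 2 * y * (4 * y\<^sup>2)" for y :: real by (simp add: power2_eq_square power3_eq_cube)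
            thus ?thesis by (simp only: divide_divide_eq_left)
          qed
          also have "\<dots> \<le> sqrt (real (N choose (2 * m))) / (4 * (M + 1)\<^sup>2)"
            using s M0 MK by (intro frac_le mult_left_mono power_mono) auto
          finally show ?thesis by (simp only: M_def)
        qed
        have "2 powr (real k * (1/2 * bin_entropy (1 - 2 * sqrt (\<alpha> * (1 - \<alpha>))) - e)) \<le> 2 powr (K * x / 2 - K * (e / 2))"
        proof (rule powr_mono)
          have "K * x / 2 - K * (e / 2) = K * (1/2 * bin_entropy (2 * r) - e) + K * (e / 4)" by (simp add: x_def field_simps)
          moreover have "0 \<le> K * (e / 4)" using e MK M0 by simp
          ultimately show "real k * (1/2 * bin_entropy (1 - 2 * sqrt (\<alpha> * (1 - \<alpha>))) - e) \<le> K * x / 2 - K * (e / 2)"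
            unfolding R K_def by linarith
        qed simp
        also have "\<dots> = 2 powr (K * x / 2) / 2 powr (K * (e / 2))" by (simp add: powr_diff)
        also have "\<dots> \<le> 2 powr (K * x / 2) / (8 * (K + 1) ^ 3)"
        proof (rule divide_left_mono)
          have "8 * (K + 1) ^ 3 \<le> 8 * (K + 1) ^ 4" using MK M0 by (intro mult_left_mono power_increasing) auto
          thus "8 * (K + 1) ^ 3 \<le> 2 powr (K * (e / 2))" using elim(1) unfolding K_def by (rule order_trans)
        qed (use M0 MK in auto)
        also note V
        finally have "primal_bound N d (2 powr (real k * (1/2 * bin_entropy (1 - 2 * sqrt (\<alpha> * (1 - \<alpha>))) - e)))"
          by (rule primal_bound_mono[OF P])
        thus ?thesis using Nk(1) by blast
      qed
    qed
  qed
qed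

text \<open>The entropy of the distribution (r, r, 1 - 2 r), computed by the chain rule for two
  different groupings.\<close>

lemma bin_entropy_double:
  assumes "0 < r" "r < 1/2"
  shows "bin_entropy (2 * r) = bin_entropy r + (1 - r) * bin_entropy (r / (1 - r)) - 2 * r"
proof -
  have l: "log 2 (2 * r) = 1 + log 2 r" "log 2 (r / (1 - r)) = log 2 r - log 2 (1 - r)"
    "log 2 ((1 - 2 * r) / (1 - r)) = log 2 (1 - 2 * r) - log 2 (1 - r)"
    using assms by (simp_all add: log_mult log_divide)
  have c: "1 - r / (1 - r) = (1 - 2 * r) / (1 - r)" using assms by (simp add: field_simps)
  have "(1 - r) * bin_entropy (r / (1 - r)) = - r * (log 2 r - log 2 (1 - r)) - (1 - 2 * r) * (log 2 (1 - 2 * r) - log 2 (1 - r))"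
    unfolding bin_entropy_def c l using assms by (simp add: right_diff_distrib)
  thus ?thesis unfolding bin_entropy_def l by (simp add: algebra_simps)
qed

text \<open>The weight \<open>1/6\<close> in Gibbs' inequality is good enough for both entropies.\<close>

lemma R_LP1_dominates:
  assumes \<alpha>: "0 < \<alpha>" "\<alpha> < 1/2" and r8: "1/8 \<le> 1/2 - sqrt (\<alpha> * (1 - \<alpha>))"
  shows "bin_entropy (1 - 2 * sqrt (\<alpha> * (1 - \<alpha>))) \<le> 1 - bin_entropy \<alpha> + R_LP1 \<alpha>"
proof -
  define r where "r = 1/2 - sqrt (\<alpha> * (1 - \<alpha>))"
  define p q s where "p = log 2 (3::real)" and "q = log 2 (5::real)" and "s = log 2 (6::real)"
  have sp: "s = 1 + p" using log_mult[of 2 3 2] by (simp add: s_def p_def)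
  have pos: "0 < \<alpha> * (1 - \<alpha>)" using \<alpha> by simp
  have r: "1/8 \<le> r" "r < 1/2" using r8 pos by (auto simp: r_def)
  have "sqrt (\<alpha> * (1 - \<alpha>)) \<le> 3/8" using r8 by simp
  hence "(sqrt (\<alpha> * (1 - \<alpha>)))\<^sup>2 \<le> (3/8)\<^sup>2" using pos by (intro power_mono) auto
  hence a9: "\<alpha> * (1 - \<alpha>) \<le> 9/64" using pos by (simp add: power2_eq_square)
  \<comment> \<open>A simple fraction with (2/11) (9/11) above 9/64.\<close>
  have a2: "\<alpha> \<le> 2/11"
  proof (rule ccontr)
    assume "\<not> \<alpha> \<le> 2/11"
    hence "(2/11) * (1 - 2/11) \<le> \<alpha> * (1 - \<alpha>)" using \<alpha> by (intro mult_one_minus_mono) auto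
    thus False using a9 by simp
  qed
  have l: "log 2 (1 - 1/6) = q - s" "log 2 (1/6) = - s"
    using log_divide[where a = 2 and x = 5 and y = "6::real"] log_divide[where a = 2 and x = 1 and y = "6::real"] by (simp_all add: q_def s_def)
  have h1: "bin_entropy \<alpha> \<le> (s - q) + \<alpha> * q"
    using bin_entropy_gibbs[of \<alpha> "1/6"] \<alpha> unfolding l by (simp add: algebra_simps)
  have q0: "0 \<le> q" by (simp add: q_def)
  have "bin_entropy (r / (1 - r)) \<le> - (r / (1 - r)) * (- s) - (1 - r / (1 - r)) * (q - s)"
    using bin_entropy_gibbs[of "r / (1 - r)" "1/6"] r unfolding l by (simp add: field_simps)
  hence "(1 - r) * bin_entropy (r / (1 - r)) \<le> (1 - r) * (- (r / (1 - r)) * (- s) - (1 - r / (1 - r)) * (q - s))"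
    using r by (intro mult_left_mono) auto
  also have "\<dots> = r * s - (1 - 2 * r) * (q - s)"
  proof -
    have 1: "(1 - r) * (- y * (- s) - (1 - y) * (q - s)) = ((1 - r) * y) * s - ((1 - r) - (1 - r) * y) * (q - s)" for y
      by (simp add: algebra_simps)
    have 2: "(1 - r) * (r / (1 - r)) = r" using r by simp
    show ?thesis unfolding 1 2 by simp
  qed
  finally have "bin_entropy (2 * r) - bin_entropy r \<le> r * s - (1 - 2 * r) * (q - s) - 2 * r"
    using bin_entropy_double[of r] r by simp
  also have "\<dots> = (s - q) + r * (2 * q - s - 2)" by (simp add: algebra_simps)
  also have "\<dots> \<le> (s - q) + (1/2) * (2 * q - s - 2)"
  proof -
    \<comment> \<open>Makes the coefficient of \<open>r\<close> nonnegative, so that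
      \<open>r\<close> may be replaced by 1/2.\<close>
    have "log 2 (24::real) \<le> log 2 25" by simp
    moreover have "log 2 (24::real) = s + 2" using log_mult[of 2 6 4] log_pow_cancel[of 2 2] by (simp add: s_def)
    moreover have "log 2 (25::real) = 2 * q" using log_mult[of 2 5 5] by (simp add: q_def)
    ultimately have "0 \<le> 2 * q - s - 2" by simp
    thus ?thesis using r by (intro add_left_mono mult_right_mono) auto
  qed
  also have "\<dots> = s / 2 - 1" by (simp add: field_simps)
  finally have h2: "bin_entropy (2 * r) - bin_entropy r \<le> s / 2 - 1" .
  \<comment> \<open>Equivalent to 3^33 <= 2^11 * 5^18; after multiplication by 5^4 both sides are
    powers with exponent 11 up to that factor.\<close>
  have num: "(s - q) + (2/11) * q + (s / 2 - 1) \<le> 1"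
  proof -
    have "(27::real) ^ 11 * 5 ^ 4 \<le> 50 ^ 11" by simp
    hence "log 2 ((27::real) ^ 11 * 5 ^ 4) \<le> log 2 (50 ^ 11)" by (subst log_le_cancel_iff) auto
    moreover have "log 2 ((27::real) ^ 11 * 5 ^ 4) = log 2 (27 ^ 11) + log 2 (5 ^ 4)" by (rule log_mult_pos) auto
    moreover have "log 2 ((27::real) ^ 11) = 11 * log 2 27" "log 2 ((5::real) ^ 4) = 4 * q" "log 2 ((50::real) ^ 11) = 11 * log 2 50"
      unfolding q_def by (subst log_nat_power; simp)+
    ultimately have "11 * log 2 27 + 4 * q \<le> 11 * log 2 50" by (simp only:)
    moreover have "log 2 (27::real) = 3 * p" using log_nat_power[of 3 2 3] by (simp add: p_def)
    moreover have "log 2 (50::real) = 1 + 2 * q" using log_mult[of 2 2 25] log_nat_power[of 5 2 2] by (simp add: q_def)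
    ultimately have "33 * p \<le> 18 * q + 11" by simp
    thus ?thesis unfolding sp by (simp add: field_simps)
  qed
  have "\<alpha> * q \<le> (2/11) * q" using a2 q0 by (intro mult_right_mono) auto
  hence "bin_entropy (2 * r) \<le> 1 - bin_entropy \<alpha> + bin_entropy r" using h1 h2 num by linarith
  moreover have "1 - 2 * sqrt (\<alpha> * (1 - \<alpha>)) = 2 * r" by (simp add: r_def)
  moreover have "R_LP1 \<alpha> = bin_entropy r" by (simp only: R_LP1_def r_def)
  ultimately show ?thesis by (simp only:)
qed

text \<open>The quadrature is used only where the second term is the larger one, and there
  \<open>R_LP1_dominates\<close> provides the bound 1/8 that it requires. A length \<open>k'\<close>
  below \<open>k\<close> arises from it when \<open>k\<close> is odd.\<close>

lemma primal_bound_R_Sam: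
  assumes e: "0 < e"
  shows "eventually (\<lambda>k. \<forall>\<alpha> d. real d = \<alpha> * real k \<longrightarrow> 0 < \<alpha> \<longrightarrow>
    (\<exists>k'\<le>k. primal_bound k' d (2 powr (real k * (R_Sam \<alpha> - e))))) sequentially"
  using primal_bound_sam1[OF e] primal_bound_sam2[OF e]
proof eventually_elim
  case (elim k)
  show ?case
  proof (intro allI impI)
    fix \<alpha> d assume d: "real d = \<alpha> * real k" and \<alpha>: "0 < \<alpha>"
    show "\<exists>k'\<le>k. primal_bound k' d (2 powr (real k * (R_Sam \<alpha> - e)))"
    proof (cases "\<alpha> < 1/2")
      case False
      hence "R_Sam \<alpha> - e \<le> 0" using e by (simp add: R_Sam_def)
      thus ?thesis using primal_bound_below_1 by blast
    next
      case True
      have 1: "primal_bound k d (2 powr (real k * (1/2 * (1 - bin_entropy \<alpha> + R_LP1 \<alpha>) - e)))"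
        using elim(1) d \<alpha> True by (simp del: powr_le_cancel_iff)
      show ?thesis
      proof (cases "bin_entropy (1 - 2 * sqrt (\<alpha> * (1 - \<alpha>))) \<le> 1 - bin_entropy \<alpha> + R_LP1 \<alpha>")
        case le: True
        hence "R_Sam \<alpha> = 1/2 * (1 - bin_entropy \<alpha> + R_LP1 \<alpha>)" using True by (simp add: R_Sam_def max_def)
        hence "primal_bound k d (2 powr (real k * (R_Sam \<alpha> - e)))" using 1 by (simp only:)
        thus ?thesis by blast
      next
        case gt: False
        hence "1/2 - sqrt (\<alpha> * (1 - \<alpha>)) < 1/8" using R_LP1_dominates[OF \<alpha> True] by linarith
        hence "\<exists>k'\<le>k. primal_bound k' d (2 powr (real k * (1/2 * bin_entropy (1 - 2 * sqrt (\<alpha> * (1 - \<alpha>))) - e)))"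
          using elim(2)[rule_format, OF d _ True] \<alpha> by simp
        moreover have "R_Sam \<alpha> = 1/2 * bin_entropy (1 - 2 * sqrt (\<alpha> * (1 - \<alpha>)))" using gt True by (simp add: R_Sam_def max_def)
        ultimately show ?thesis by (simp only:)
      qed
    qed
  qed
qed


section \<open>Exponents of the anticode bound\<close>

lemma small_sets_entropy:
  assumes e: "0 < e"
  shows "eventually (\<lambda>k. \<forall>\<alpha> d. real d = \<alpha> * real k \<longrightarrow> 0 \<le> \<alpha> \<longrightarrow> \<alpha> \<le> 1 \<longrightarrow>
    2 * real (\<Sum>i\<le>(d + 1) div 2. k choose i) \<le> 2 powr (real k * (bin_entropy (\<alpha> / 2) + e))) sequentially"
proof -
  obtain \<eta> where \<eta>: "0 < \<eta>" "\<And>x y. x \<in> {0..1} \<Longrightarrow> y \<in> {0..1} \<Longrightarrow> \<bar>x - y\<bar> < \<eta> \<Longrightarrow> \<bar>bin_entropy x - bin_entropy y\<bar> < e / 2"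
    using bin_entropy_uniform[of "e / 2"] e by auto
  have "eventually (\<lambda>k. 8 * (real k + 1) ^ 4 \<le> 2 powr (real k * (e / 2))) sequentially" using e by (intro poly_le_powr) simp
  moreover have "eventually (\<lambda>k. 1 / real k < \<eta>) sequentially" using \<eta>(1) by real_asymp
  moreover have "eventually (\<lambda>k::nat. 0 < k) sequentially" by (rule eventually_gt_at_top)
  ultimately show ?thesis
  proof eventually_elim
    case (elim k)
    show ?case
    proof (intro allI impI)
      fix \<alpha> d assume d: "real d = \<alpha> * real k" and \<alpha>: "0 \<le> \<alpha>" "\<alpha> \<le> (1::real)"
      define K where "K = real k"
      have K: "0 < K" using elim by (simp add: K_def)
      have "real d \<le> real k" using d \<alpha> mult_right_mono[of \<alpha> 1 "real k"] by simp
      hence dk: "d \<le> k" by simp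
      define s where "s = (d + 1) div 2"
      have s: "s \<le> k" "2 * s \<le> d + 1" using dk elim by (auto simp: s_def)
      have h: "real (k choose i) \<le> 2 powr (K * (bin_entropy (\<alpha> / 2) + e / 2))" if i: "i \<le> s" for i
      proof -
        have "bin_entropy (real i / K) \<le> bin_entropy (\<alpha> / 2) + e / 2"
        proof (cases "real i / K \<le> \<alpha> / 2")
          case True
          hence "bin_entropy (real i / K) \<le> bin_entropy (\<alpha> / 2)" using \<alpha> K by (intro bin_entropy_mono) auto
          thus ?thesis using e by simp
        next
          case False
          have "2 * real i \<le> \<alpha> * K + 1" using i s d by (simp add: K_def)
          hence "(2 * real i - \<alpha> * K) / (2 * K) \<le> 1 / (2 * K)" using K by (intro divide_right_mono) auto
          moreover have "real i / K - \<alpha> / 2 = (2 * real i - \<alpha> * K) / (2 * K)" using K by (simp add: field_simps)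
          ultimately have "real i / K - \<alpha> / 2 \<le> 1 / (2 * K)" by (simp only:)
          also have "\<dots> \<le> 1 / K" using K by (intro divide_left_mono) auto
          finally have "real i / K - \<alpha> / 2 < \<eta>" using elim by (simp add: K_def)
          hence "\<bar>real i / K - \<alpha> / 2\<bar> < \<eta>" using False by simp
          hence "\<bar>bin_entropy (real i / K) - bin_entropy (\<alpha> / 2)\<bar> < e / 2"
            using \<alpha> i s K by (intro \<eta>(2)) (auto simp: K_def field_simps)
          thus ?thesis by linarith
        qed
        hence "2 powr (K * bin_entropy (real i / K)) \<le> 2 powr (K * (bin_entropy (\<alpha> / 2) + e / 2))"
          using K by (intro powr_mono mult_left_mono) auto
        thus ?thesis using binomial_entropy_bounds(1)[of i k] i s elim unfolding K_def by linarith
      qed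
      have "2 * real (\<Sum>i\<le>s. k choose i) = 2 * (\<Sum>i\<le>s. real (k choose i))" by simp
      also have "\<dots> \<le> 2 * (\<Sum>i\<le>s. 2 powr (K * (bin_entropy (\<alpha> / 2) + e / 2)))" using h by (intro mult_left_mono sum_mono) auto
      also have "\<dots> = (2 * (real s + 1)) * 2 powr (K * (bin_entropy (\<alpha> / 2) + e / 2))" by simp
      also have "\<dots> \<le> 2 powr (K * (e / 2)) * 2 powr (K * (bin_entropy (\<alpha> / 2) + e / 2))"
      proof (rule mult_right_mono)
        have "2 * (real s + 1) \<le> 8 * (K + 1) ^ 1" using s K by (simp add: K_def)
        also have "\<dots> \<le> 8 * (K + 1) ^ 4" using K by (intro mult_left_mono power_increasing) auto
        finally show "2 * (real s + 1) \<le> 2 powr (K * (e / 2))" using elim by (simp add: K_def)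
      qed simp
      also have "\<dots> = 2 powr (K * (bin_entropy (\<alpha> / 2) + e))" by (simp add: powr_add[symmetric] algebra_simps)
      finally show "2 * real (\<Sum>i\<le>(d + 1) div 2. k choose i) \<le> 2 powr (real k * (bin_entropy (\<alpha> / 2) + e))"
        by (simp only: s_def K_def)
    qed
  qed
qed

lemma binomial_floor_entropy:
  assumes e: "0 < e"
  shows "eventually (\<lambda>n. \<forall>\<beta>. 0 \<le> \<beta> \<longrightarrow> \<beta> \<le> 1 \<longrightarrow>
    2 powr (real n * (bin_entropy (\<beta> / 2) - e)) \<le> real (n choose nat \<lfloor>\<beta> * real n / 2\<rfloor>)) sequentially"
proof -
  obtain \<eta> where \<eta>: "0 < \<eta>" "\<And>x y. x \<in> {0..1} \<Longrightarrow> y \<in> {0..1} \<Longrightarrow> \<bar>x - y\<bar> < \<eta> \<Longrightarrow> \<bar>bin_entropy x - bin_entropy y\<bar> < e / 2"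
    using bin_entropy_uniform[of "e / 2"] e by auto
  have "eventually (\<lambda>k. 8 * (real k + 1) ^ 4 \<le> 2 powr (real k * (e / 2))) sequentially" using e by (intro poly_le_powr) simp
  moreover have "eventually (\<lambda>k. 1 / real k < \<eta>) sequentially" using \<eta>(1) by real_asymp
  moreover have "eventually (\<lambda>k::nat. 0 < k) sequentially" by (rule eventually_gt_at_top)
  ultimately show ?thesis
  proof eventually_elim
    case (elim n)
    show ?case
    proof (intro allI impI)
      fix \<beta> assume \<beta>: "0 \<le> \<beta>" "\<beta> \<le> (1::real)"
      define N where "N = real n"
      have N: "0 < N" using elim by (simp add: N_def)
      define \<rho> where "\<rho> = nat \<lfloor>\<beta> * real n / 2\<rfloor>"
      have "0 \<le> \<beta> * N / 2" using \<beta> N by simp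
      hence "real \<rho> = of_int \<lfloor>\<beta> * N / 2\<rfloor>" by (simp add: \<rho>_def N_def)
      hence \<rho>: "real \<rho> \<le> \<beta> * N / 2" "\<beta> * N / 2 - 1 < real \<rho>" by linarith+
      have bN: "\<beta> * N \<le> N" using \<beta> N mult_right_mono[of \<beta> 1 N] by simp
      have "real \<rho> \<le> real n" using \<rho> bN N unfolding N_def by linarith
      hence \<rho>n: "\<rho> \<le> n" by simp
      have "\<bar>real \<rho> / N - \<beta> / 2\<bar> = \<bar>real \<rho> - \<beta> * N / 2\<bar> / N" using N by (simp add: field_simps abs_divide)
      also have "\<dots> \<le> 1 / N" using \<rho> N by (intro divide_right_mono) auto
      finally have "\<bar>real \<rho> / N - \<beta> / 2\<bar> < \<eta>" using elim by (simp add: N_def)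
      hence "\<bar>bin_entropy (real \<rho> / N) - bin_entropy (\<beta> / 2)\<bar> < e / 2"
        using \<beta> \<rho>n N by (intro \<eta>(2)) (auto simp: N_def field_simps)
      hence h: "bin_entropy (\<beta> / 2) - e / 2 \<le> bin_entropy (real \<rho> / N)" by linarith
      have "2 powr (N * (bin_entropy (\<beta> / 2) - e)) = 2 powr (N * (bin_entropy (\<beta> / 2) - e / 2)) / 2 powr (N * (e / 2))"
        by (simp add: powr_diff[symmetric] algebra_simps)
      also have "\<dots> \<le> 2 powr (N * bin_entropy (real \<rho> / N)) / (N + 1)"
      proof (rule frac_le)
        show "2 powr (N * (bin_entropy (\<beta> / 2) - e / 2)) \<le> 2 powr (N * bin_entropy (real \<rho> / N))"
          using h N by (intro powr_mono mult_left_mono) auto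
        have "N + 1 \<le> 8 * (N + 1) ^ 1" using N by simp
        also have "\<dots> \<le> 8 * (N + 1) ^ 4" using N by (intro mult_left_mono power_increasing) auto
        finally show "N + 1 \<le> 2 powr (N * (e / 2))" using elim by (simp add: N_def)
      qed (use N in auto)
      also have "\<dots> \<le> real (n choose \<rho>)"
        using binomial_entropy_bounds(2)[OF \<rho>n] elim N by (simp add: N_def divide_le_eq mult.commute)
      finally show "2 powr (real n * (bin_entropy (\<beta> / 2) - e)) \<le> real (n choose nat \<lfloor>\<beta> * real n / 2\<rfloor>)"
        by (simp only: N_def \<rho>_def)
    qed
  qed
qed

section \<open>From bit vectors to their supports\<close>

definition supp :: "bit Matrix.vec \<Rightarrow> nat set" where
  "supp z = {i. i < dim_vec z \<and> vec_index z i \<noteq> 0}"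

lemma supp_subset: "z \<in> carrier_vec n \<Longrightarrow> supp z \<in> Pow {..<n}"
  by (auto simp: supp_def)

lemma hamming_weight_diff:
  assumes "u \<in> carrier_vec n" "v \<in> carrier_vec n"
  shows "hamming_weight (u - v) = card (sd (supp u) (supp v))"
proof -
  have "x - y \<noteq> 0 \<longleftrightarrow> (x \<noteq> 0) \<noteq> (y \<noteq> 0)" for x y :: bit
    by (cases x; cases y) auto
  hence "{i. i < dim_vec (u - v) \<and> vec_index (u - v) i \<noteq> 0} = sd (supp u) (supp v)"
    using assms by (auto simp: supp_def sd_def)
  thus ?thesis by (simp only: hamming_weight_def)
qed

lemma alpha_beta_map_sets:
  assumes "alpha_beta_map \<alpha> \<beta> k n f"
  obtains \<phi> where "\<phi> \<in> Pow {..<k} \<rightarrow> Pow {..<n}"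
    "\<And>x x'. x \<in> Pow {..<k} \<Longrightarrow> x' \<in> Pow {..<k} \<Longrightarrow>
      \<beta> * real n < real (card (sd (\<phi> x) (\<phi> x'))) \<or> real (card (sd x x')) \<le> \<alpha> * real k"
proof -
  define v where "v S = Matrix.vec k (\<lambda>i. if i \<in> S then 1 else 0 :: bit)" for S
  have v: "v S \<in> carrier_vec k" for S by (simp add: v_def)
  have sv: "supp (v S) = S" if "S \<in> Pow {..<k}" for S using that by (auto simp: supp_def v_def split: if_splits)
  have f: "f (v S) \<in> carrier_vec n" for S using assms v unfolding alpha_beta_map_def by (auto simp: Pi_def)
  show ?thesis
  proof (rule that[of "\<lambda>S. supp (f (v S))"])
    show "(\<lambda>S. supp (f (v S))) \<in> Pow {..<k} \<rightarrow> Pow {..<n}" using supp_subset[OF f] by auto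
    fix x x' assume x: "x \<in> Pow {..<k}" "x' \<in> Pow {..<k}"
    have "real (hamming_weight (f (v x) - f (v x'))) > \<beta> * real n \<or> real (hamming_weight (v x - v x')) \<le> \<alpha> * real k"
      using assms v unfolding alpha_beta_map_def by blast
    thus "\<beta> * real n < real (card (sd (supp (f (v x))) (supp (f (v x'))))) \<or> real (card (sd x x')) \<le> \<alpha> * real k"
      by (simp only: hamming_weight_diff[OF f f] hamming_weight_diff[OF v v] sv[OF x(1)] sv[OF x(2)])
  qed
qed


section \<open>Null sequences of errors\<close>

lemma R_Sam_le_1:
  assumes "0 < \<alpha>"
  shows "R_Sam \<alpha> \<le> 1"
proof (cases "\<alpha> < 1/2")
  case True
  define r where "r = 1/2 - sqrt (\<alpha> * (1 - \<alpha>))"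
  have r: "0 \<le> r" "r \<le> 1/2" using sam_radius_bounds[of \<alpha>] assms True by (auto simp: r_def)
  have "1 - bin_entropy \<alpha> + bin_entropy r \<le> 2"
    using bin_entropy_nonneg[of \<alpha>] bin_entropy_le_1[of r] assms True r by auto
  moreover have "bin_entropy (2 * r) \<le> 2" using bin_entropy_le_1[of "2 * r"] r by auto
  moreover have "2 * r = 1 - 2 * sqrt (\<alpha> * (1 - \<alpha>))" by (simp add: r_def)
  moreover have "R_LP1 \<alpha> = bin_entropy r" by (simp only: R_LP1_def r_def)
  moreover have "1/2 * max x y \<le> 1" if "x \<le> 2" "y \<le> 2" for x y :: real using that by auto
  ultimately show ?thesis using True unfolding R_Sam_def by (simp only: if_True)
qed (simp add: R_Sam_def)

lemma powr_2_mono_error: "e \<le> e' \<Longrightarrow> 2 powr (real n * (x + e)) \<le> 2 powr (real n * (x + e'))"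
  by (intro powr_mono mult_left_mono) auto

lemma powr_2_antimono_error: "e \<le> e' \<Longrightarrow> 2 powr (real n * (x - e')) \<le> 2 powr (real n * (x - e))"
  by (intro powr_mono mult_left_mono) auto

text \<open>The error 1 always works: as \<open>R_Sam\<close> is at most 1, the claimed value is
  then at most 1.\<close>

lemma R_Sam_error:
  "\<exists>\<delta>. \<delta> \<longlonglongrightarrow> 0 \<and> (\<forall>k. 0 \<le> \<delta> k \<and> (\<forall>\<alpha> d. real d = \<alpha> * real k \<longrightarrow> 0 < \<alpha> \<longrightarrow>
    (\<exists>k'\<le>k. primal_bound k' d (2 powr (real k * (R_Sam \<alpha> - \<delta> k))))))"
proof (rule null_sequence_exists[where C = 1])
  fix k e e'
  assume P: "\<forall>\<alpha> d. real d = \<alpha> * real k \<longrightarrow> 0 < \<alpha> \<longrightarrow> (\<exists>k'\<le>k. primal_bound k' d (2 powr (real k * (R_Sam \<alpha> - e))))"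
    and ee: "e \<le> (e'::real)"
  show "\<forall>\<alpha> d. real d = \<alpha> * real k \<longrightarrow> 0 < \<alpha> \<longrightarrow> (\<exists>k'\<le>k. primal_bound k' d (2 powr (real k * (R_Sam \<alpha> - e'))))"
  proof (intro allI impI)
    fix \<alpha> d assume "real d = \<alpha> * real k" "0 < \<alpha>"
    with P obtain k' where "k' \<le> k" "primal_bound k' d (2 powr (real k * (R_Sam \<alpha> - e)))" by blast
    thus "\<exists>k'\<le>k. primal_bound k' d (2 powr (real k * (R_Sam \<alpha> - e')))"
      using primal_bound_mono[OF _ powr_2_antimono_error[OF ee]] by blast
  qed
next
  fix k
  have "primal_bound k d (2 powr (real k * (R_Sam \<alpha> - 1)))" if "0 < \<alpha>" for \<alpha> d
    using R_Sam_le_1[OF that] by (intro primal_bound_below_1) simp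
  thus "\<forall>\<alpha> d. real d = \<alpha> * real k \<longrightarrow> 0 < \<alpha> \<longrightarrow> (\<exists>k'\<le>k. primal_bound k' d (2 powr (real k * (R_Sam \<alpha> - 1))))" by blast
qed (rule primal_bound_R_Sam)

lemma R_LP2_error:
  "\<exists>\<delta>. \<delta> \<longlonglongrightarrow> 0 \<and> (\<forall>n. 0 \<le> \<delta> n \<and> (\<forall>\<beta>\<ge>0. dual_bound n (\<beta> * real n) (2 powr (real n * (R_LP2 \<beta> + \<delta> n)))))"
proof (rule null_sequence_exists[where C = 1])
  fix n e e'
  assume P: "\<forall>\<beta>\<ge>0. dual_bound n (\<beta> * real n) (2 powr (real n * (R_LP2 \<beta> + e)))" and ee: "e \<le> (e'::real)"
  show "\<forall>\<beta>\<ge>0. dual_bound n (\<beta> * real n) (2 powr (real n * (R_LP2 \<beta> + e')))"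
    using P dual_bound_mono[OF _ powr_2_mono_error[OF ee]] by blast
next
  fix n :: nat
  show "\<forall>\<beta>\<ge>0. dual_bound n (\<beta> * real n) (2 powr (real n * (R_LP2 \<beta> + 1)))"
  proof (intro allI impI)
    fix \<beta> :: real assume \<beta>: "0 \<le> \<beta>"
    have "2 powr (real n * (0 + 1)) \<le> 2 powr (real n * (R_LP2 \<beta> + 1))"
      using R_LP2_nonneg[OF \<beta>] by (intro powr_mono mult_left_mono) auto
    hence "2 ^ n \<le> 2 powr (real n * (R_LP2 \<beta> + 1))" by (simp add: powr_realpow)
    thus "dual_bound n (\<beta> * real n) (2 powr (real n * (R_LP2 \<beta> + 1)))"
      using \<beta> by (intro dual_bound_mono[OF dual_bound_trivial]) auto
  qed
qed (rule dual_bound_R_LP2)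

text \<open>At \<open>k = 0\<close> the left side is 2 and the right side is 1, so this case is
  excluded. The fallback error is 2 because the left side can be as large as twice
  \<open>2 ^ k\<close>.\<close>

lemma small_sets_error:
  "\<exists>\<delta>. \<delta> \<longlonglongrightarrow> 0 \<and> (\<forall>k. 0 \<le> \<delta> k \<and> (0 < k \<longrightarrow> (\<forall>\<alpha> d. real d = \<alpha> * real k \<longrightarrow> 0 \<le> \<alpha> \<longrightarrow> \<alpha> \<le> 1 \<longrightarrow>
    2 * real (\<Sum>i\<le>(d + 1) div 2. k choose i) \<le> 2 powr (real k * (bin_entropy (\<alpha> / 2) + \<delta> k)))))"
proof (rule null_sequence_exists[where C = 2])
  fix k e e'
  assume P: "0 < k \<longrightarrow> (\<forall>\<alpha> d. real d = \<alpha> * real k \<longrightarrow> 0 \<le> \<alpha> \<longrightarrow> \<alpha> \<le> 1 \<longrightarrow>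
      2 * real (\<Sum>i\<le>(d + 1) div 2. k choose i) \<le> 2 powr (real k * (bin_entropy (\<alpha> / 2) + e)))" and ee: "e \<le> (e'::real)"
  show "0 < k \<longrightarrow> (\<forall>\<alpha> d. real d = \<alpha> * real k \<longrightarrow> 0 \<le> \<alpha> \<longrightarrow> \<alpha> \<le> 1 \<longrightarrow>
      2 * real (\<Sum>i\<le>(d + 1) div 2. k choose i) \<le> 2 powr (real k * (bin_entropy (\<alpha> / 2) + e')))"
    using P order_trans[OF _ powr_2_mono_error[OF ee]] by blast
next
  fix e :: real assume "0 < e"
  from small_sets_entropy[OF this]
  show "eventually (\<lambda>k. 0 < k \<longrightarrow> (\<forall>\<alpha> d. real d = \<alpha> * real k \<longrightarrow> 0 \<le> \<alpha> \<longrightarrow> \<alpha> \<le> 1 \<longrightarrow>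
      2 * real (\<Sum>i\<le>(d + 1) div 2. k choose i) \<le> 2 powr (real k * (bin_entropy (\<alpha> / 2) + e)))) sequentially"
    by (rule eventually_mono) (rule impI)
next
  fix k :: nat
  show "0 < k \<longrightarrow> (\<forall>\<alpha> d. real d = \<alpha> * real k \<longrightarrow> 0 \<le> \<alpha> \<longrightarrow> \<alpha> \<le> 1 \<longrightarrow>
      2 * real (\<Sum>i\<le>(d + 1) div 2. k choose i) \<le> 2 powr (real k * (bin_entropy (\<alpha> / 2) + 2)))"
  proof (intro impI allI)
    fix \<alpha> :: real and d assume k: "0 < k" and \<alpha>: "0 \<le> \<alpha>" "\<alpha> \<le> 1"
    have "(\<Sum>i\<le>(d + 1) div 2. k choose i) \<le> card (Pow {..<k})"
      unfolding card_Pow_le[symmetric] by (rule card_mono) auto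
    hence "real (\<Sum>i\<le>(d + 1) div 2. k choose i) \<le> real (card (Pow {..<k}))" by (rule of_nat_mono)
    hence "2 * real (\<Sum>i\<le>(d + 1) div 2. k choose i) \<le> 2 * 2 ^ k" by (simp add: card_Pow)
    also have "2 * 2 ^ k = 2 powr (real k + 1)" by (simp add: powr_add powr_realpow)
    also have "\<dots> \<le> 2 powr (real k * 2)" using k by (intro powr_mono) auto
    also have "\<dots> \<le> 2 powr (real k * (bin_entropy (\<alpha> / 2) + 2))"
      using bin_entropy_nonneg[of "\<alpha> / 2"] \<alpha> by (intro powr_mono mult_left_mono) auto
    finally show "2 * real (\<Sum>i\<le>(d + 1) div 2. k choose i) \<le> 2 powr (real k * (bin_entropy (\<alpha> / 2) + 2))" .
  qed
qed

lemma binomial_floor_error: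
  "\<exists>\<delta>. \<delta> \<longlonglongrightarrow> 0 \<and> (\<forall>n. 0 \<le> \<delta> n \<and> (\<forall>\<beta>. 0 \<le> \<beta> \<longrightarrow> \<beta> \<le> 1 \<longrightarrow>
    2 powr (real n * (bin_entropy (\<beta> / 2) - \<delta> n)) \<le> real (n choose nat \<lfloor>\<beta> * real n / 2\<rfloor>)))"
proof (rule null_sequence_exists[where C = 1])
  fix n e e'
  assume P: "\<forall>\<beta>. 0 \<le> \<beta> \<longrightarrow> \<beta> \<le> 1 \<longrightarrow> 2 powr (real n * (bin_entropy (\<beta> / 2) - e)) \<le> real (n choose nat \<lfloor>\<beta> * real n / 2\<rfloor>)"
    and ee: "e \<le> (e'::real)"
  show "\<forall>\<beta>. 0 \<le> \<beta> \<longrightarrow> \<beta> \<le> 1 \<longrightarrow> 2 powr (real n * (bin_entropy (\<beta> / 2) - e')) \<le> real (n choose nat \<lfloor>\<beta> * real n / 2\<rfloor>)"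
    using P order_trans[OF powr_2_antimono_error[OF ee]] by blast
next
  fix n :: nat
  show "\<forall>\<beta>. 0 \<le> \<beta> \<longrightarrow> \<beta> \<le> 1 \<longrightarrow> 2 powr (real n * (bin_entropy (\<beta> / 2) - 1)) \<le> real (n choose nat \<lfloor>\<beta> * real n / 2\<rfloor>)"
  proof (intro allI impI)
    fix \<beta> :: real assume \<beta>: "0 \<le> \<beta>" "\<beta> \<le> 1"
    have "real n * (bin_entropy (\<beta> / 2) - 1) \<le> 0" using bin_entropy_le_1[of "\<beta> / 2"] \<beta> by (intro mult_nonneg_nonpos) auto
    hence "2 powr (real n * (bin_entropy (\<beta> / 2) - 1)) \<le> 2 powr 0" by (intro powr_mono) auto
    moreover have "nat \<lfloor>\<beta> * real n / 2\<rfloor> \<le> n"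
    proof -
      have "\<beta> * real n \<le> real n" using \<beta> mult_right_mono[of \<beta> 1 "real n"] by simp
      hence "\<lfloor>\<beta> * real n / 2\<rfloor> \<le> int n" by linarith
      thus ?thesis by simp
    qed
    hence "1 \<le> real (n choose nat \<lfloor>\<beta> * real n / 2\<rfloor>)" by (simp add: Suc_le_eq)
    ultimately show "2 powr (real n * (bin_entropy (\<beta> / 2) - 1)) \<le> real (n choose nat \<lfloor>\<beta> * real n / 2\<rfloor>)" by simp
  qed
qed (rule binomial_floor_entropy)

theorem theorem1:
  fixes \<epsilon> :: real
  assumes "\<epsilon> > 0"
  shows "\<exists>\<delta> \<delta>' :: nat \<Rightarrow> real. \<delta> \<longlonglongrightarrow> 0 \<and> \<delta>' \<longlonglongrightarrow> 0 \<and>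
    (\<forall>(k::nat) (n::nat) (\<alpha>::real) (\<beta>::real).
       k > 0 \<longrightarrow> n > 0 \<longrightarrow> \<epsilon> \<le> \<alpha> \<longrightarrow> \<alpha> \<le> 1 \<longrightarrow> \<epsilon> \<le> \<beta> \<longrightarrow>
       (\<exists>f. alpha_beta_map \<alpha> \<beta> k n f) \<longrightarrow>
         real k * R_Sam \<alpha> + real k * \<delta> k \<le> real n * R_LP2 \<beta> + real n * \<delta>' n \<and>
         real k * (1 - bin_entropy (\<alpha> / 2)) + real k * \<delta> k
           \<le> real n * (1 - bin_entropy (\<beta> / 2)) + real n * \<delta>' n)"
proof -
  obtain \<delta>A where A: "\<delta>A \<longlonglongrightarrow> 0" "\<And>k. 0 \<le> \<delta>A k" "\<And>k \<alpha> d. real d = \<alpha> * real k \<Longrightarrow> 0 < \<alpha> \<Longrightarrow>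
      \<exists>k'\<le>k. primal_bound k' d (2 powr (real k * (R_Sam \<alpha> - \<delta>A k)))"
    using R_Sam_error by auto
  obtain \<delta>B where B: "\<delta>B \<longlonglongrightarrow> 0" "\<And>n. 0 \<le> \<delta>B n" "\<And>n \<beta>. 0 \<le> \<beta> \<Longrightarrow> dual_bound n (\<beta> * real n) (2 powr (real n * (R_LP2 \<beta> + \<delta>B n)))"
    using R_LP2_error by auto
  obtain \<delta>C where C: "\<delta>C \<longlonglongrightarrow> 0" "\<And>k. 0 \<le> \<delta>C k" "\<And>k \<alpha> d. 0 < k \<Longrightarrow> real d = \<alpha> * real k \<Longrightarrow> 0 \<le> \<alpha> \<Longrightarrow> \<alpha> \<le> 1 \<Longrightarrow>
      2 * real (\<Sum>i\<le>(d + 1) div 2. k choose i) \<le> 2 powr (real k * (bin_entropy (\<alpha> / 2) + \<delta>C k))"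
    using small_sets_error by blast
  obtain \<delta>E where E: "\<delta>E \<longlonglongrightarrow> 0" "\<And>n. 0 \<le> \<delta>E n" "\<And>n \<beta>. 0 \<le> \<beta> \<Longrightarrow> \<beta> \<le> 1 \<Longrightarrow>
      2 powr (real n * (bin_entropy (\<beta> / 2) - \<delta>E n)) \<le> real (n choose nat \<lfloor>\<beta> * real n / 2\<rfloor>)"
    using binomial_floor_error by auto
  \<comment> \<open>The losses on the source side lower the left-hand sides, those on the target
    side raise the right-hand sides; hence the opposite signs of the two sequences. Each covers both
    bounds at once.\<close>
  define \<delta> where "\<delta> k = - max (\<delta>A k) (\<delta>C k)" for k
  define \<delta>' where "\<delta>' n = max (\<delta>B n) (\<delta>E n)" for n
  have "\<delta> \<longlonglongrightarrow> - max 0 0" unfolding \<delta>_def by (intro tendsto_intros A C)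
  moreover have "\<delta>' \<longlonglongrightarrow> max 0 0" unfolding \<delta>'_def by (intro tendsto_intros B E)
  moreover have "real k * R_Sam \<alpha> + real k * \<delta> k \<le> real n * R_LP2 \<beta> + real n * \<delta>' n \<and>
      real k * (1 - bin_entropy (\<alpha> / 2)) + real k * \<delta> k \<le> real n * (1 - bin_entropy (\<beta> / 2)) + real n * \<delta>' n"
    if k: "0 < k" and n: "0 < n" and \<alpha>: "\<epsilon> \<le> \<alpha>" "\<alpha> \<le> 1" and \<beta>: "\<epsilon> \<le> \<beta>" and f: "alpha_beta_map \<alpha> \<beta> k n f" for k n \<alpha> \<beta> f
  proof -
    have pos: "0 < \<alpha>" "0 < \<beta>" using \<alpha> \<beta> assms by auto
    obtain \<phi> where \<phi>: "\<phi> \<in> Pow {..<k} \<rightarrow> Pow {..<n}"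
      and hom: "\<And>x x'. x \<in> Pow {..<k} \<Longrightarrow> x' \<in> Pow {..<k} \<Longrightarrow>
        \<beta> * real n < real (card (sd (\<phi> x) (\<phi> x'))) \<or> real (card (sd x x')) \<le> \<alpha> * real k"
      using alpha_beta_map_sets[OF f] by blast
    obtain d where d: "real d = \<alpha> * real k"
    proof -
      obtain z where "\<alpha> * real k = of_int z" using f unfolding alpha_beta_map_def by (auto elim: Ints_cases)
      moreover have "0 \<le> \<alpha> * real k" using pos by simp
      ultimately show ?thesis using that[of "nat z"] by simp
    qed
    have hom': "\<beta> * real n < real (card (sd (\<phi> x) (\<phi> x'))) \<or> card (sd x x') \<le> d"
      if "x \<in> Pow {..<k}" "x' \<in> Pow {..<k}" for x x' using hom[OF that] unfolding d[symmetric] of_nat_le_iff .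
    have \<delta>k: "real k * \<delta> k \<le> - (real k * \<delta>A k)" "real k * \<delta> k \<le> - (real k * \<delta>C k)" "real k * \<delta> k \<le> 0"
      using mult_left_mono[of "\<delta> k" "- \<delta>A k" "real k"] mult_left_mono[of "\<delta> k" "- \<delta>C k" "real k"] mult_left_mono[of "\<delta> k" 0 "real k"] A(2)[of k]
      by (auto simp: \<delta>_def)
    have \<delta>n: "real n * \<delta>B n \<le> real n * \<delta>' n" "real n * \<delta>E n \<le> real n * \<delta>' n" "0 \<le> real n * \<delta>' n"
      using B(2)[of n] by (auto simp: \<delta>'_def mult_left_mono)
    have "real k * (R_Sam \<alpha> - \<delta>A k) \<le> real n * (R_LP2 \<beta> + \<delta>B n)"
    proof -
      obtain k' where k': "k' \<le> k" "primal_bound k' d (2 powr (real k * (R_Sam \<alpha> - \<delta>A k)))" using A(3)[OF d pos(1)] by blast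
      \<comment> \<open>Subsets of \<open>{..<k'}\<close> are subsets of \<open>{..<k}\<close>, so
        the restriction of \<open>\<phi>\<close> satisfies the same distance condition and a primal
        solution of length \<open>k'\<close> can be used.\<close>
      have sub: "x \<in> Pow {..<k}" if "x \<in> Pow {..<k'}" for x using that k'(1) by auto
      have "2 powr (real k * (R_Sam \<alpha> - \<delta>A k)) \<le> 2 powr (real n * (R_LP2 \<beta> + \<delta>B n))"
      proof (rule primal_le_dual[OF k'(2) B(3)])
        show "\<phi> \<in> Pow {..<k'} \<rightarrow> Pow {..<n}" using \<phi> sub by blast
      qed (use pos hom' sub in auto)
      thus ?thesis by simp
    qed
    hence one: "real k * R_Sam \<alpha> + real k * \<delta> k \<le> real n * R_LP2 \<beta> + real n * \<delta>' n"
      using \<delta>k \<delta>n by (simp add: right_diff_distrib distrib_left)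
    have two: "real k * (1 - bin_entropy (\<alpha> / 2)) + real k * \<delta> k \<le> real n * (1 - bin_entropy (\<beta> / 2)) + real n * \<delta>' n"
    proof (cases "\<beta> \<le> 1")
      case True
      define \<rho> where "\<rho> = nat \<lfloor>\<beta> * real n / 2\<rfloor>"
      have "0 \<le> \<beta> * real n / 2" using pos by simp
      hence "real \<rho> = of_int \<lfloor>\<beta> * real n / 2\<rfloor>" by (simp add: \<rho>_def)
      hence \<rho>: "2 * real \<rho> \<le> \<beta> * real n" by linarith
      have "2 ^ k * 2 powr (real n * (bin_entropy (\<beta> / 2) - \<delta>E n)) \<le> 2 ^ k * real (n choose \<rho>)"
        unfolding \<rho>_def using pos True by (intro mult_left_mono E(3)) auto
      \<comment> \<open>\<open>(d + 1) div 2\<close> is the least \<open>e\<close> with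
        \<open>d \<le> 2 * e\<close>.\<close>
      also have "\<dots> \<le> 2 ^ n * (2 * real (\<Sum>i\<le>(d + 1) div 2. k choose i))"
        by (rule hom_anticode_bound[OF \<phi> hom' \<rho>]) auto
      also have "\<dots> \<le> 2 ^ n * 2 powr (real k * (bin_entropy (\<alpha> / 2) + \<delta>C k))"
        using C(3)[OF k d] pos \<alpha> by (intro mult_left_mono) auto
      finally have "2 ^ k * 2 powr (real n * (bin_entropy (\<beta> / 2) - \<delta>E n)) \<le> 2 ^ n * 2 powr (real k * (bin_entropy (\<alpha> / 2) + \<delta>C k))" .
      hence "2 powr (real k + real n * (bin_entropy (\<beta> / 2) - \<delta>E n)) \<le> 2 powr (real n + real k * (bin_entropy (\<alpha> / 2) + \<delta>C k))"
        by (simp add: powr_add powr_realpow)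
      hence "real k + real n * (bin_entropy (\<beta> / 2) - \<delta>E n) \<le> real n + real k * (bin_entropy (\<alpha> / 2) + \<delta>C k)" by simp
      thus ?thesis using \<delta>k(2) \<delta>n(2) by (simp add: algebra_simps)
    next
      case False
      \<comment> \<open>For \<beta> > 1 no two images are farther apart than
        \<open>\<beta> * n\<close>. The empty and the full set, at distance \<open>k\<close>, then
        force \<alpha> = 1, where the left-hand rate 1 - h(1/2) is 0.\<close>
      have "card (sd (\<phi> {}) (\<phi> {..<k})) \<le> n"
      proof -
        have "\<phi> {} \<in> Pow {..<n}" "\<phi> {..<k} \<in> Pow {..<n}" using \<phi> by auto
        hence "sd (\<phi> {}) (\<phi> {..<k}) \<in> Pow {..<n}" by (rule sd_in_Pow)
        thus ?thesis using card_mono[of "{..<n}" "sd (\<phi> {}) (\<phi> {..<k})"] by simp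
      qed
      moreover have "real n \<le> \<beta> * real n" using False mult_right_mono[of 1 \<beta> "real n"] by simp
      ultimately have "real k \<le> \<alpha> * real k" using hom[of "{}" "{..<k}"] by auto
      hence "\<alpha> = 1" using k \<alpha> by simp
      moreover have "bin_entropy (\<beta> / 2) \<le> 1"
        using bin_entropy_le_1[of "\<beta> / 2"] bin_entropy_le_1_ge_1[of "\<beta> / 2"] pos by (cases "\<beta> / 2 \<le> 1") auto
      hence "0 \<le> real n * (1 - bin_entropy (\<beta> / 2))" by simp
      ultimately show ?thesis using \<delta>k(3) \<delta>n(3) by simp
    qed
    show ?thesis using one two ..
  qed
  ultimately show ?thesis by (intro exI[of _ \<delta>] exI[of _ \<delta>']) auto
qed

end
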